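(* (i) Let $K/k$ be a Galois extension of fields with Galois group isomorphic to the alternating group $A_5$. Then the only type of Hopf Galois structures that occurs on $K/k$ is $A_5$, and the classical Galois structure realizes this type. (ii) Let $K/k$ be a Galois extension of fields with Galois group $S_5=A_5\rtimes C_2$. Then the types of Hopf Galois structures that occur on $K/k$ are exactly $S_5$ and $A_5\times C_2$. The classical Galois structure on $K/k$ is of type $S_5$. The type $A_5\times C_2$ is realized by the Hopf Galois structure on $K/k$ induced by an almost classical Hopf Galois structure on $K^{\langle\tau\rangle}/k$ (together with the unique Hopf Galois structure on the quadratic extension $K/K^{\langle\tau\rangle}$), where $\tau$ denotes a transposition in $S_5$.
   Context: $C_n$ denotes the cyclic group of order $n$. **Hopf Galois structures.** A Hopf Galois structure on a finite field extension $L/k$ is a pair $(\mathcal H,\mu)$, where $\mathcal H$ is a finite (finite-dimensional) cocommutative $k$-Hopf algebra and $\mu:\mathcal H\to \mathrm{End}_k(L)$ is a $k$-linear map that makes $L$ a left $\mathcal H$-module algebra and such that the induced map $L\otimes_k\mathcal H\to \mathrm{End}_k(L)$ is bijective. Such structures are considered up to isomorphism. **Greither–Pareigis correspondence and type.** Let $L/k$ be separable of degree $n$, let $\widetilde L$ be its Galois closure, $G=\mathrm{Gal}(\widetilde L/k)$, $G'=\mathrm{Gal}(\widetilde L/L)$, and let $\lambda:G\to \mathrm{Sym}(G/G')\cong S_n$ be the left action of $G$ on left cosets. Hopf Galois structures on $L/k$ are in bijection with regular subgroups $N$ of $\mathrm{Sym}(G/G')$ normalized by $\lambda(G)$. The Hopf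 algebra corresponding to $N$ is $\widetilde L[N]^G$ (where $G$ acts on $\widetilde L$ by $k$-automorphisms and on $N$ by conjugation via $\lambda$), acting on $L$ by $\left(\sum_{\eta\in N} c_\eta\eta\right)(x)=\sum_{\eta\in N} c_\eta\,\eta^{-1}(\bar 1)(x)$, where $\bar 1$ is the coset of the identity. The type of the Hopf Galois structure is the isomorphism class of $N$. A type $N$ "occurs" on $L/k$ if there is at least one Hopf Galois structure of that type on $L/k$. **Classical Galois structure.** If $L/k$ is Galois with group $G$ (so $G'=1$), the classical Galois structure is the one with $\mathcal H=k[G]$ acting in the natural way; it corresponds to $N=\rho(G)$, the group of right translations of $G$ in $\mathrm{Sym}(G)$. **Almost classical structures.** With $L/k$, $G$, $G'$, $\lambda$ as in the Greither–Pareigis correspondence, if $G'$ has a normal complement $M$ in $G$, then $\lambda(M)$ is regular in $\mathrm{Sym}(G/G')$, and its centralizer $N$ in $\mathrm{Sym}(G/G')$ is a regular subgroup isomorphic to $M$ and normalized by $\lambda(G)$. The corresponding Hopf Galois structure on $L/k$, of type $M$, is called almost classical. **Induced structures.** Let $K/k$ be Galois with group $G=H\rtimes G'$ ($H$ normal in $G$), and let $F=K^{G'}$. Suppose $F/k$ has a Hopf Galois structure given by a regular subgroup $N_1\subset \mathrm{Sym}(G/G')$ normalized by the left action of $G$ on $G/G'$, and that $K/F$ (which is Galois with group $G'$) has a Hopf Galois structure given by a regular subgroup $N_2\subset\mathrm{Sym}(G')$ normalized by the left translations of $G'$. Identify $G/G'\times G'$ with $G$ via $(hG',y)\mapsto hy$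 for $h\in H$, $y\in G'$. Then $N_1\times N_2$, acting componentwise, becomes a regular subgroup of $\mathrm{Sym}(G)$ normalized by $\lambda(G)$, and so gives a Hopf Galois structure of type $N_1\times N_2$ on $K/k$. It is called the Hopf Galois structure induced by the given structures on $F/k$ and $K/F$. *)

theory Defs
  imports
    "HOL-Algebra.Embedded_Algebras"
    "HOL-Algebra.Elementary_Groups"
    "HOL-Algebra.Left_Coset"
    "HOL-Algebra.Bij"
    "HOL-Algebra.Sym_Groups"
begin

section \<open>Tensors over a field\<close>

text \<open>
  An element of a tensor product \<open>M \<otimes> N\<close> over a field \<open>R\<close> is presented by a finite formal sum of
  pure tensors, i.e. a list of pairs.  Two lists present the same element iff every bilinear form
  takes the same value on both: the dual of \<open>M \<otimes> N\<close> is the space of bilinear forms, and over a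
  field the linear forms separate the points of a vector space.  Threefold tensors are handled in
  the same way.
\<close>

definition list_sum :: "('b, 'm) ring_scheme \<Rightarrow> ('c \<Rightarrow> 'b) \<Rightarrow> 'c list \<Rightarrow> 'b" where
  "list_sum A f xs = foldr (\<lambda>x s. f x \<oplus>\<^bsub>A\<^esub> s) xs \<zero>\<^bsub>A\<^esub>"

definition ring_as_module :: "('a, 'm) ring_scheme \<Rightarrow> ('a, 'a) module" where
  "ring_as_module R = \<lparr>carrier = carrier R, monoid.mult = monoid.mult R, one = one R,
     ring.zero = \<zero>\<^bsub>R\<^esub>, ring.add = ring.add R, smult = monoid.mult R\<rparr>"

definition linear_map ::
  "('a, 'm) ring_scheme \<Rightarrow> ('a, 'x, 'p) module_scheme \<Rightarrow> ('a, 'y, 'q) module_scheme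
     \<Rightarrow> ('x \<Rightarrow> 'y) \<Rightarrow> bool" where
  "linear_map R M N f \<longleftrightarrow>
     f \<in> carrier M \<rightarrow> carrier N \<and>
     (\<forall>x\<in>carrier M. \<forall>y\<in>carrier M. f (x \<oplus>\<^bsub>M\<^esub> y) = f x \<oplus>\<^bsub>N\<^esub> f y) \<and>
     (\<forall>c\<in>carrier R. \<forall>x\<in>carrier M. f (c \<odot>\<^bsub>M\<^esub> x) = c \<odot>\<^bsub>N\<^esub> f x)"

definition bilinear_form ::
  "('a, 'm) ring_scheme \<Rightarrow> ('a, 'x, 'p) module_scheme \<Rightarrow> ('a, 'y, 'q) module_scheme
     \<Rightarrow> ('x \<Rightarrow> 'y \<Rightarrow> 'a) \<Rightarrow> bool" where
  "bilinear_form R M N B \<longleftrightarrow>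
     (\<forall>x\<in>carrier M. linear_map R N (ring_as_module R) (B x)) \<and>
     (\<forall>y\<in>carrier N. linear_map R M (ring_as_module R) (\<lambda>x. B x y))"

definition trilinear_form ::
  "('a, 'm) ring_scheme \<Rightarrow> ('a, 'x, 'p) module_scheme \<Rightarrow> ('x \<Rightarrow> 'x \<Rightarrow> 'x \<Rightarrow> 'a) \<Rightarrow> bool" where
  "trilinear_form R M B \<longleftrightarrow>
     (\<forall>x\<in>carrier M. \<forall>y\<in>carrier M. linear_map R M (ring_as_module R) (\<lambda>z. B x y z)) \<and>
     (\<forall>x\<in>carrier M. \<forall>z\<in>carrier M. linear_map R M (ring_as_module R) (\<lambda>y. B x y z)) \<and>
     (\<forall>y\<in>carrier M. \<forall>z\<in>carrier M. linear_map R M (ring_as_module R) (\<lambda>x. B x y z))"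

definition tensor_eq ::
  "('a, 'm) ring_scheme \<Rightarrow> ('a, 'x, 'p) module_scheme \<Rightarrow> ('a, 'y, 'q) module_scheme
     \<Rightarrow> ('x \<times> 'y) list \<Rightarrow> ('x \<times> 'y) list \<Rightarrow> bool" where
  "tensor_eq R M N ss ts \<longleftrightarrow>
     (\<forall>B. bilinear_form R M N B \<longrightarrow>
        list_sum R (\<lambda>(x, y). B x y) ss = list_sum R (\<lambda>(x, y). B x y) ts)"

definition tensor3_eq ::
  "('a, 'm) ring_scheme \<Rightarrow> ('a, 'x, 'p) module_scheme
     \<Rightarrow> ('x \<times> 'x \<times> 'x) list \<Rightarrow> ('x \<times> 'x \<times> 'x) list \<Rightarrow> bool" where
  "tensor3_eq R M ss ts \<longleftrightarrow>
     (\<forall>B. trilinear_form R M B \<longrightarrow>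
        list_sum R (\<lambda>(x, y, z). B x y z) ss = list_sum R (\<lambda>(x, y, z). B x y z) ts)"

definition finite_dimensional ::
  "('a, 'm) ring_scheme \<Rightarrow> ('a, 'x, 'p) module_scheme \<Rightarrow> bool" where
  "finite_dimensional R M \<longleftrightarrow>
     (\<exists>B. finite B \<and> B \<subseteq> carrier M \<and>
        (\<forall>x\<in>carrier M. \<exists>c\<in>B \<rightarrow> carrier R. x = (\<Oplus>\<^bsub>M\<^esub>b\<in>B. c b \<odot>\<^bsub>M\<^esub> b)))"


section \<open>Cocommutative Hopf algebras\<close>

text \<open>
  \<open>comul H h\<close> is a list of pairs presenting the tensor \<open>\<Delta>(h) \<in> H \<otimes> H\<close> (so it lists the summands
  in Sweedler notation); conditions on \<open>\<Delta>\<close> are therefore stated up to equality of tensors.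
\<close>

record ('a, 'h) hopf = "('a, 'h) module" +
  comul :: "'h \<Rightarrow> ('h \<times> 'h) list"
  counit :: "'h \<Rightarrow> 'a"
  antipode :: "'h \<Rightarrow> 'h"

locale cocommutative_hopf_algebra = R: field R + module R H + H: ring H
  for R :: "('a, 'm) ring_scheme" and H :: "('a, 'h, 'z) hopf_scheme" +
  assumes smult_mult_left:
      "\<lbrakk>c \<in> carrier R; x \<in> carrier H; y \<in> carrier H\<rbrakk>
        \<Longrightarrow> (c \<odot>\<^bsub>H\<^esub> x) \<otimes>\<^bsub>H\<^esub> y = c \<odot>\<^bsub>H\<^esub> (x \<otimes>\<^bsub>H\<^esub> y)"
    and smult_mult_right:
      "\<lbrakk>c \<in> carrier R; x \<in> carrier H; y \<in> carrier H\<rbrakk>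
        \<Longrightarrow> x \<otimes>\<^bsub>H\<^esub> (c \<odot>\<^bsub>H\<^esub> y) = c \<odot>\<^bsub>H\<^esub> (x \<otimes>\<^bsub>H\<^esub> y)"
    and comul_closed:
      "x \<in> carrier H \<Longrightarrow> set (comul H x) \<subseteq> carrier H \<times> carrier H"
    and comul_add:
      "\<lbrakk>x \<in> carrier H; y \<in> carrier H\<rbrakk>
        \<Longrightarrow> tensor_eq R H H (comul H (x \<oplus>\<^bsub>H\<^esub> y)) (comul H x @ comul H y)"
    and comul_smult:
      "\<lbrakk>c \<in> carrier R; x \<in> carrier H\<rbrakk>
        \<Longrightarrow> tensor_eq R H H (comul H (c \<odot>\<^bsub>H\<^esub> x)) (map (\<lambda>(a, b). (c \<odot>\<^bsub>H\<^esub> a, b)) (comul H x))"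
    and comul_one:
      "tensor_eq R H H (comul H \<one>\<^bsub>H\<^esub>) [(\<one>\<^bsub>H\<^esub>, \<one>\<^bsub>H\<^esub>)]"
    and comul_mult:
      "\<lbrakk>x \<in> carrier H; y \<in> carrier H\<rbrakk>
        \<Longrightarrow> tensor_eq R H H (comul H (x \<otimes>\<^bsub>H\<^esub> y))
             [(a \<otimes>\<^bsub>H\<^esub> c, b \<otimes>\<^bsub>H\<^esub> d). (a, b) \<leftarrow> comul H x, (c, d) \<leftarrow> comul H y]"
    and coassoc:
      "x \<in> carrier H \<Longrightarrow> tensor3_eq R H
         [(a1, a2, b). (a, b) \<leftarrow> comul H x, (a1, a2) \<leftarrow> comul H a]
         [(a, b1, b2). (a, b) \<leftarrow> comul H x, (b1, b2) \<leftarrow> comul H b]"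
    and cocomm:
      "x \<in> carrier H \<Longrightarrow> tensor_eq R H H (map (\<lambda>(a, b). (b, a)) (comul H x)) (comul H x)"
    and counit_linear: "linear_map R H (ring_as_module R) (counit H)"
    and counit_hom: "counit H \<in> ring_hom H R"
    and counit_left:
      "x \<in> carrier H \<Longrightarrow> list_sum H (\<lambda>(a, b). counit H a \<odot>\<^bsub>H\<^esub> b) (comul H x) = x"
    and counit_right:
      "x \<in> carrier H \<Longrightarrow> list_sum H (\<lambda>(a, b). counit H b \<odot>\<^bsub>H\<^esub> a) (comul H x) = x"
    and antipode_linear: "linear_map R H H (antipode H)"
    and antipode_left:
      "x \<in> carrier H
        \<Longrightarrow> list_sum H (\<lambda>(a, b). antipode H a \<otimes>\<^bsub>H\<^esub> b) (comul H x) = counit H x \<odot>\<^bsub>H\<^esub> \<one>\<^bsub>H\<^esub>"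
    and antipode_right:
      "x \<in> carrier H
        \<Longrightarrow> list_sum H (\<lambda>(a, b). a \<otimes>\<^bsub>H\<^esub> antipode H b) (comul H x) = counit H x \<odot>\<^bsub>H\<^esub> \<one>\<^bsub>H\<^esub>"


section \<open>Field extensions and Hopf Galois structures\<close>

text \<open>All fields are subfields (given by their carriers) of one ambient field \<open>K\<close>.\<close>

definition finite_field_extension :: "('a, 'm) ring_scheme \<Rightarrow> 'a set \<Rightarrow> 'a set \<Rightarrow> bool" where
  "finite_field_extension K k L \<longleftrightarrow>
     field K \<and> subfield k K \<and> subfield L K \<and> k \<subseteq> L \<and> ring.finite_dimension K k L"

definition galois_group :: "('a, 'm) ring_scheme \<Rightarrow> 'a set \<Rightarrow> ('a \<Rightarrow> 'a) monoid" where
  "galois_group K k = (BijGroup (carrier K))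
     \<lparr>carrier := {\<sigma> \<in> Bij (carrier K). \<sigma> \<in> ring_hom K K \<and> (\<forall>x\<in>k. \<sigma> x = x)}\<rparr>"

definition fixed_field :: "('a, 'm) ring_scheme \<Rightarrow> ('a \<Rightarrow> 'a) set \<Rightarrow> 'a set" where
  "fixed_field K A = {x \<in> carrier K. \<forall>\<sigma>\<in>A. \<sigma> x = x}"

definition galois_extension :: "('a, 'm) ring_scheme \<Rightarrow> 'a set \<Rightarrow> bool" where
  "galois_extension K k \<longleftrightarrow>
     finite_field_extension K k (carrier K) \<and> fixed_field K (carrier (galois_group K k)) = k"

text \<open>
  A Hopf Galois structure on \<open>L/k\<close> is a pair \<open>(H, \<mu>)\<close>.  The last two conjuncts say that the map
  from \<open>L \<otimes> H\<close> to the \<open>k\<close>-linear endomorphisms of \<open>L\<close> sending \<open>x \<otimes> h\<close> to \<open>y \<mapsto> x \<cdot> \<mu>(h)(y)\<close>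
  is surjective and injective.
\<close>

definition hopf_galois_structure ::
  "('a, 'm) ring_scheme \<Rightarrow> 'a set \<Rightarrow> 'a set \<Rightarrow> ('a, 'h) hopf \<times> ('h \<Rightarrow> 'a \<Rightarrow> 'a) \<Rightarrow> bool" where
  "hopf_galois_structure K k L = (\<lambda>(H, \<mu>).
     let R = K\<lparr>carrier := k\<rparr>; LM = ring_as_module (K\<lparr>carrier := L\<rparr>);
         act = (\<lambda>ts y. list_sum K (\<lambda>(x, h). x \<otimes>\<^bsub>K\<^esub> \<mu> h y) ts)
     in
     finite_field_extension K k L \<and>
     cocommutative_hopf_algebra R H \<and> finite_dimensional R H \<and>
     (\<forall>h\<in>carrier H. linear_map R LM LM (\<mu> h)) \<and>
     (\<forall>h\<in>carrier H. \<forall>h'\<in>carrier H. \<forall>x\<in>L. \<mu> (h \<oplus>\<^bsub>H\<^esub> h') x = \<mu> h x \<oplus>\<^bsub>K\<^esub> \<mu> h' x) \<and>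
     (\<forall>c\<in>k. \<forall>h\<in>carrier H. \<forall>x\<in>L. \<mu> (c \<odot>\<^bsub>H\<^esub> h) x = c \<otimes>\<^bsub>K\<^esub> \<mu> h x) \<and>
     (\<forall>x\<in>L. \<mu> \<one>\<^bsub>H\<^esub> x = x) \<and>
     (\<forall>h\<in>carrier H. \<forall>h'\<in>carrier H. \<forall>x\<in>L. \<mu> (h \<otimes>\<^bsub>H\<^esub> h') x = \<mu> h (\<mu> h' x)) \<and>
     (\<forall>h\<in>carrier H. \<mu> h \<one>\<^bsub>K\<^esub> = counit H h) \<and>
     (\<forall>h\<in>carrier H. \<forall>x\<in>L. \<forall>y\<in>L.
        \<mu> h (x \<otimes>\<^bsub>K\<^esub> y) = list_sum K (\<lambda>(a, b). \<mu> a x \<otimes>\<^bsub>K\<^esub> \<mu> b y) (comul H h)) \<and>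
     (\<forall>\<phi>. linear_map R LM LM \<phi> \<longrightarrow>
        (\<exists>ts. set ts \<subseteq> L \<times> carrier H \<and> (\<forall>y\<in>L. \<phi> y = act ts y))) \<and>
     (\<forall>ss ts. set ss \<subseteq> L \<times> carrier H \<and> set ts \<subseteq> L \<times> carrier H \<and> (\<forall>y\<in>L. act ss y = act ts y)
        \<longrightarrow> tensor_eq R LM H ss ts))"

definition hopf_galois_isomorphic ::
  "('a, 'm) ring_scheme \<Rightarrow> 'a set \<Rightarrow> 'a set \<Rightarrow> ('a, 'h) hopf \<times> ('h \<Rightarrow> 'a \<Rightarrow> 'a)
     \<Rightarrow> ('a, 'i) hopf \<times> ('i \<Rightarrow> 'a \<Rightarrow> 'a) \<Rightarrow> bool" where
  "hopf_galois_isomorphic K k L = (\<lambda>(H, \<mu>) (H', \<mu>').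
     let R = K\<lparr>carrier := k\<rparr> in
     \<exists>\<phi>. bij_betw \<phi> (carrier H) (carrier H') \<and> linear_map R H H' \<phi> \<and> \<phi> \<in> ring_hom H H' \<and>
       (\<forall>h\<in>carrier H. tensor_eq R H' H' (map (map_prod \<phi> \<phi>) (comul H h)) (comul H' (\<phi> h))) \<and>
       (\<forall>h\<in>carrier H. counit H' (\<phi> h) = counit H h) \<and>
       (\<forall>h\<in>carrier H. \<forall>x\<in>L. \<mu>' (\<phi> h) x = \<mu> h x))"


section \<open>Group algebras and the classical structure\<close>

definition group_element :: "('a, 'm) ring_scheme \<Rightarrow> ('g, 'n) monoid_scheme \<Rightarrow> 'g \<Rightarrow> 'g \<Rightarrow> 'a" where
  "group_element R G g = (\<lambda>x\<in>carrier G. if x = g then \<one>\<^bsub>R\<^esub> else \<zero>\<^bsub>R\<^esub>)"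

definition group_hopf_algebra ::
  "('a, 'm) ring_scheme \<Rightarrow> ('g, 'n) monoid_scheme \<Rightarrow> ('a, 'g \<Rightarrow> 'a) hopf" where
  "group_hopf_algebra R G =
    \<lparr>carrier = carrier G \<rightarrow>\<^sub>E carrier R,
     monoid.mult = (\<lambda>a b. \<lambda>g\<in>carrier G. \<Oplus>\<^bsub>R\<^esub>h\<in>carrier G. a h \<otimes>\<^bsub>R\<^esub> b (inv\<^bsub>G\<^esub> h \<otimes>\<^bsub>G\<^esub> g)),
     one = group_element R G \<one>\<^bsub>G\<^esub>,
     ring.zero = (\<lambda>g\<in>carrier G. \<zero>\<^bsub>R\<^esub>),
     ring.add = (\<lambda>a b. \<lambda>g\<in>carrier G. a g \<oplus>\<^bsub>R\<^esub> b g),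
     smult = (\<lambda>s a. \<lambda>g\<in>carrier G. s \<otimes>\<^bsub>R\<^esub> a g),
     comul = (\<lambda>a. map (\<lambda>g. (\<lambda>x\<in>carrier G. a g \<otimes>\<^bsub>R\<^esub> group_element R G g x, group_element R G g))
        (SOME gs. set gs = carrier G \<and> distinct gs)),
     counit = (\<lambda>a. \<Oplus>\<^bsub>R\<^esub>g\<in>carrier G. a g),
     antipode = (\<lambda>a. \<lambda>g\<in>carrier G. a (inv\<^bsub>G\<^esub> g))\<rparr>"

definition classical_structure ::
  "('a, 'm) ring_scheme \<Rightarrow> 'a set
     \<Rightarrow> ('a, ('a \<Rightarrow> 'a) \<Rightarrow> 'a) hopf \<times> ((('a \<Rightarrow> 'a) \<Rightarrow> 'a) \<Rightarrow> 'a \<Rightarrow> 'a)" where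
  "classical_structure K k =
     (group_hopf_algebra (K\<lparr>carrier := k\<rparr>) (galois_group K k),
      \<lambda>c x. \<Oplus>\<^bsub>K\<^esub>\<sigma>\<in>carrier (galois_group K k). c \<sigma> \<otimes>\<^bsub>K\<^esub> \<sigma> x)"


section \<open>The Greither--Pareigis correspondence\<close>

text \<open>
  Here \<open>G\<close> acts transitively on \<open>X\<close> through \<open>act\<close>.  The two instances used are \<open>X = G/G'\<close>, and,
  for \<open>G' = 1\<close>, \<open>X = G\<close>; in both cases \<open>act\<close> is left translation, and the base point \<open>x0\<close> is the
  coset of the identity.  The field \<open>L\<close> is the fixed field of the stabiliser of \<open>x0\<close>.
\<close>

definition left_translation :: "('g, 'n) monoid_scheme \<Rightarrow> 'g \<Rightarrow> 'g \<Rightarrow> 'g" where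
  "left_translation G g = (\<lambda>x\<in>carrier G. g \<otimes>\<^bsub>G\<^esub> x)"

definition coset_translation ::
  "('g, 'n) monoid_scheme \<Rightarrow> 'g set \<Rightarrow> 'g \<Rightarrow> 'g set \<Rightarrow> 'g set" where
  "coset_translation G G' g = (\<lambda>C\<in>lcosets\<^bsub>G\<^esub> G'. g <#\<^bsub>G\<^esub> C)"

abbreviation perm_subgroup :: "'x set \<Rightarrow> ('x \<Rightarrow> 'x) set \<Rightarrow> ('x \<Rightarrow> 'x) monoid" where
  "perm_subgroup X N \<equiv> (BijGroup X)\<lparr>carrier := N\<rparr>"

definition regular_subgroup :: "'x set \<Rightarrow> ('x \<Rightarrow> 'x) set \<Rightarrow> bool" where
  "regular_subgroup X N \<longleftrightarrow>
     subgroup N (BijGroup X) \<and> (\<forall>x\<in>X. \<forall>y\<in>X. \<exists>!\<eta>. \<eta> \<in> N \<and> \<eta> x = y)"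

definition perm_conj :: "'x set \<Rightarrow> ('x \<Rightarrow> 'x) \<Rightarrow> ('x \<Rightarrow> 'x) \<Rightarrow> 'x \<Rightarrow> 'x" where
  "perm_conj X \<pi> \<eta> = \<pi> \<otimes>\<^bsub>BijGroup X\<^esub> \<eta> \<otimes>\<^bsub>BijGroup X\<^esub> inv\<^bsub>BijGroup X\<^esub> \<pi>"

definition gp_subgroup ::
  "('g, 'n) monoid_scheme \<Rightarrow> 'x set \<Rightarrow> ('g \<Rightarrow> 'x \<Rightarrow> 'x) \<Rightarrow> ('x \<Rightarrow> 'x) set \<Rightarrow> bool" where
  "gp_subgroup G X act N \<longleftrightarrow>
     regular_subgroup X N \<and> (\<forall>g\<in>carrier G. \<forall>\<eta>\<in>N. perm_conj X (act g) \<eta> \<in> N)"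

text \<open>
  The fixed ring \<open>K[N]\<^sup>G\<close>.  Its comultiplication is the restriction of the one of \<open>K[N]\<close>: since the
  natural map \<open>K[N]\<^sup>G \<otimes>\<^sub>k K[N]\<^sup>G \<rightarrow> K[N] \<otimes>\<^sub>K K[N]\<close> is injective, the condition below on the
  coefficients at \<open>\<eta> \<otimes> \<zeta>\<close> determines the tensor presented by the chosen list.
\<close>

definition gp_hopf_algebra ::
  "('a, 'm) ring_scheme \<Rightarrow> ('a \<Rightarrow> 'a) monoid \<Rightarrow> 'x set \<Rightarrow> (('a \<Rightarrow> 'a) \<Rightarrow> 'x \<Rightarrow> 'x)
     \<Rightarrow> ('x \<Rightarrow> 'x) set \<Rightarrow> ('a, ('x \<Rightarrow> 'x) \<Rightarrow> 'a) hopf" where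
  "gp_hopf_algebra K G X act N =
     (let A = {c \<in> N \<rightarrow>\<^sub>E carrier K.
                 \<forall>g\<in>carrier G. \<forall>\<eta>\<in>N. c (perm_conj X (act g) \<eta>) = g (c \<eta>)}
      in (group_hopf_algebra K (perm_subgroup X N))
        \<lparr>carrier := A,
         comul := (\<lambda>c. SOME ts. set ts \<subseteq> A \<times> A \<and>
           (\<forall>\<eta>\<in>N. \<forall>\<zeta>\<in>N. list_sum K (\<lambda>(a, b). a \<eta> \<otimes>\<^bsub>K\<^esub> b \<zeta>) ts
              = (if \<eta> = \<zeta> then c \<eta> else \<zero>\<^bsub>K\<^esub>)))\<rparr>)"

definition gp_action ::
  "('a, 'm) ring_scheme \<Rightarrow> ('a \<Rightarrow> 'a) monoid \<Rightarrow> 'x set \<Rightarrow> (('a \<Rightarrow> 'a) \<Rightarrow> 'x \<Rightarrow> 'x) \<Rightarrow> 'x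
     \<Rightarrow> ('x \<Rightarrow> 'x) set \<Rightarrow> (('x \<Rightarrow> 'x) \<Rightarrow> 'a) \<Rightarrow> 'a \<Rightarrow> 'a" where
  "gp_action K G X act x0 N c x =
     (\<Oplus>\<^bsub>K\<^esub>\<eta>\<in>N. c \<eta> \<otimes>\<^bsub>K\<^esub> (SOME g. g \<in> carrier G \<and> act g x0 = (inv\<^bsub>BijGroup X\<^esub> \<eta>) x0) x)"

text \<open>The structure on \<open>K/k\<close> given by \<open>N \<subseteq> Sym(G)\<close>.\<close>

definition gp_structure ::
  "('a, 'm) ring_scheme \<Rightarrow> 'a set \<Rightarrow> (('a \<Rightarrow> 'a) \<Rightarrow> 'a \<Rightarrow> 'a) set
     \<Rightarrow> ('a, (('a \<Rightarrow> 'a) \<Rightarrow> 'a \<Rightarrow> 'a) \<Rightarrow> 'a) hopf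
        \<times> (((('a \<Rightarrow> 'a) \<Rightarrow> 'a \<Rightarrow> 'a) \<Rightarrow> 'a) \<Rightarrow> 'a \<Rightarrow> 'a)" where
  "gp_structure K k N =
     (let G = galois_group K k in
      (gp_hopf_algebra K G (carrier G) (left_translation G) N,
       gp_action K G (carrier G) (left_translation G) \<one>\<^bsub>G\<^esub> N))"

text \<open>
  The structure on \<open>K\<^bsup>G'\<^esup>/k\<close> given by \<open>N \<subseteq> Sym(G/G')\<close>.  When \<open>K\<close> is the Galois closure of
  \<open>K\<^bsup>G'\<^esup>\<close>, i.e. when \<open>G'\<close> contains no nontrivial normal subgroup of \<open>G\<close>, this is the
  Greither--Pareigis setting.
\<close>

definition gp_coset_structure ::
  "('a, 'm) ring_scheme \<Rightarrow> 'a set \<Rightarrow> ('a \<Rightarrow> 'a) set \<Rightarrow> (('a \<Rightarrow> 'a) set \<Rightarrow> ('a \<Rightarrow> 'a) set) set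
     \<Rightarrow> ('a, (('a \<Rightarrow> 'a) set \<Rightarrow> ('a \<Rightarrow> 'a) set) \<Rightarrow> 'a) hopf
        \<times> (((('a \<Rightarrow> 'a) set \<Rightarrow> ('a \<Rightarrow> 'a) set) \<Rightarrow> 'a) \<Rightarrow> 'a \<Rightarrow> 'a)" where
  "gp_coset_structure K k G' N =
     (let G = galois_group K k in
      (gp_hopf_algebra K G (lcosets\<^bsub>G\<^esub> G') (coset_translation G G') N,
       gp_action K G (lcosets\<^bsub>G\<^esub> G') (coset_translation G G') G' N))"

definition has_type ::
  "('a, 'm) ring_scheme \<Rightarrow> 'a set \<Rightarrow> ('a, 'h) hopf \<times> ('h \<Rightarrow> 'a \<Rightarrow> 'a)
     \<Rightarrow> ('t, 'n) monoid_scheme \<Rightarrow> bool" where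
  "has_type K k S T \<longleftrightarrow>
     (let G = galois_group K k in
      \<exists>N. gp_subgroup G (carrier G) (left_translation G) N \<and>
          hopf_galois_isomorphic K k (carrier K) S (gp_structure K k N) \<and>
          perm_subgroup (carrier G) N \<cong> T)"

text \<open>
  The type of the elements of the Hopf algebra has to be fixed under the existential quantifier.
  Nothing is lost: a structure that has a type is isomorphic to some \<open>gp_structure K k N\<close>.
\<close>

definition type_occurs ::
  "('a, 'm) ring_scheme \<Rightarrow> 'a set \<Rightarrow> ('t, 'n) monoid_scheme \<Rightarrow> bool" where
  "type_occurs K k T \<longleftrightarrow>
     (\<exists>S :: ('a, (('a \<Rightarrow> 'a) \<Rightarrow> 'a \<Rightarrow> 'a) \<Rightarrow> 'a) hopf
              \<times> (((('a \<Rightarrow> 'a) \<Rightarrow> 'a \<Rightarrow> 'a) \<Rightarrow> 'a) \<Rightarrow> 'a \<Rightarrow> 'a).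
        hopf_galois_structure K k (carrier K) S \<and> has_type K k S T)"


section \<open>Almost classical and induced structures\<close>

definition normal_complement :: "('g, 'n) monoid_scheme \<Rightarrow> 'g set \<Rightarrow> 'g set \<Rightarrow> bool" where
  "normal_complement G G' M \<longleftrightarrow>
     subgroup G' G \<and> M \<lhd> G \<and> M \<inter> G' = {\<one>\<^bsub>G\<^esub>} \<and> M <#>\<^bsub>G\<^esub> G' = carrier G"

definition almost_classical_subgroup ::
  "('g, 'n) monoid_scheme \<Rightarrow> 'g set \<Rightarrow> 'g set \<Rightarrow> ('g set \<Rightarrow> 'g set) set" where
  "almost_classical_subgroup G G' M =
     {\<eta> \<in> Bij (lcosets\<^bsub>G\<^esub> G'). \<forall>m\<in>M.
        \<eta> \<otimes>\<^bsub>BijGroup (lcosets\<^bsub>G\<^esub> G')\<^esub> coset_translation G G' m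
          = coset_translation G G' m \<otimes>\<^bsub>BijGroup (lcosets\<^bsub>G\<^esub> G')\<^esub> \<eta>}"

text \<open>The identification \<open>(h G', y) \<mapsto> h y\<close> of \<open>G/G' \<times> G'\<close> with \<open>G\<close>, where \<open>h \<in> M\<close>, \<open>y \<in> G'\<close>.\<close>

definition coset_pair :: "('g, 'n) monoid_scheme \<Rightarrow> 'g set \<Rightarrow> 'g set \<times> 'g \<Rightarrow> 'g" where
  "coset_pair G M = (\<lambda>(C, y). (THE h. h \<in> M \<and> h \<in> C) \<otimes>\<^bsub>G\<^esub> y)"

definition induced_subgroup ::
  "('g, 'n) monoid_scheme \<Rightarrow> 'g set \<Rightarrow> 'g set \<Rightarrow> ('g set \<Rightarrow> 'g set) set \<Rightarrow> ('g \<Rightarrow> 'g) set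
     \<Rightarrow> ('g \<Rightarrow> 'g) set" where
  "induced_subgroup G M G' N1 N2 =
     {\<lambda>g\<in>carrier G.
        coset_pair G M (map_prod \<eta>1 \<eta>2 (inv_into ((lcosets\<^bsub>G\<^esub> G') \<times> G') (coset_pair G M) g))
      | \<eta>1 \<eta>2. \<eta>1 \<in> N1 \<and> \<eta>2 \<in> N2}"

end

theory Submission
 imports Defs "HOL-Algebra.Group_Action" "HOL-Algebra.Sylow"
begin

text \<open>
 Transported to \<open>G\<close> by evaluation at \<open>1\<close>, a regular subgroup \<open>N\<close> of \<open>Sym(G)\<close> normalised by the left
 translations becomes a second group structure on the set \<open>G\<close> for which \<open>a \<circ> (x y) = (a \<circ> x) a\<^sup>-\<^sup>1 (a \<circ> y)\<close>, where
 \<open>\<circ>\<close> is the multiplication of the Galois group: a skew brace. Hence \<open>lam a x = a\<^sup>-\<^sup>1 (a \<circ> x)\<close> is an action of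
 \<open>(G, \<circ>)\<close> on \<open>N\<close> by automorphisms, and characteristic subgroups of \<open>N\<close> are also subgroups of \<open>(G, \<circ>)\<close>.
 Let \<open>A\<close> be the copy of \<open>A\<^sub>5\<close> in \<open>(G, \<circ>)\<close>. Being perfect, it lies in every subgroup of small index and acts
 trivially on small sets; applied to the kernels of the maps from \<open>N\<close> to the prime parts of its abelianisation,
 this shows that \<open>N\<close> is perfect or that \<open>|N| = 120\<close> and \<open>N' = A\<close> as sets.

 If \<open>N\<close> is perfect, the six Sylow 5-subgroups of \<open>N\<close> show that \<open>A\<close> acts on \<open>N\<close> by inner automorphisms. For
 \<open>|N| = 60\<close> this gives \<open>N \<cong> G\<close>. For \<open>|N| = 120\<close> it is impossible: an element \<open>a\<close> of order 3 in \<open>A\<close> acts by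
 \<open>a \<circ> x = l x n\<^sup>-\<^sup>1\<close> with \<open>l\<close> and \<open>n\<close> of order 3; as \<open>a\<close> is conjugate to its inverse in \<open>A\<close>, so is \<open>n\<close> in \<open>N\<close>
 up to the centre, and Sylow's theorem makes \<open>l\<close> and \<open>n\<close> conjugate, so that \<open>a\<close> has a fixed point. If \<open>N' = A\<close>,
 then \<open>A\<close> is a sub-brace, so \<open>N'\<close> is isomorphic to \<open>A\<^sub>5\<close> and has index 2 in \<open>N\<close>.

 On the field side, a separability system \<open>\<Sum>\<^sub>i \<sigma>(x\<^sub>i) \<tau>(y\<^sub>i) = \<delta>\<close> makes descent explicit: it expresses every linear map in
 terms of the automorphisms and recovers the coefficients. For a quadratic extension the coefficients of a Hopf algebra
 action lie in the base field, which gives uniqueness.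
\<close>

section \<open>Perfect groups of order 60 and 120\<close>

text \<open>No classification of groups of order 60 or 120 enters. The recurring lever is that a
  perfect group acts trivially on at most four points, the symmetric groups of degree at most four
  being soluble. Inner actions come from a pigeonhole count: pairs formed by an element of
  \<open>N\<close> and an element of \<open>A\<close> permute the six Sylow 5-subgroups in at most
  720 ways, and there are too many pairs to be told apart up to a kernel of order at most four. At
  order 120 an inner action alone is no contradiction, since a perfect group of that order may have
  a centre; hence the passage to elements of order 3, where the central correction vanishes, and to
  a fixed point, which left translation by \<open>a\<close> cannot have.

  Tensors are compared through bilinear forms, so on the field side all forms have to be known: the
  separability system writes each form on the fixed ring as the restriction of a form on
  \<open>K[N]\<close> with explicit coefficients. Equality of tensors becomes equality of
  coefficients, and no basis of a fixed ring has to be chosen. The same mechanism yields Artin's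
  theorem on fixed fields, which identifies the group of the quadratic step.\<close>

definition perfect :: "('a, 'b) monoid_scheme => bool" where
 "perfect G \<longleftrightarrow> group G \<and> derived G (carrier G) = carrier G"

text \<open>A bare function on a set, with no extensionality: the same \<open>act\<close> then
  serves for subgroups of \<open>G\<close> and for invariant subsets of \<open>E\<close>.
  \<open>acts_on_group_action\<close> restricts it when orbits and stabilisers are wanted.\<close>

definition acts_on :: "('a, 'b) monoid_scheme => 'x set => ('a => 'x => 'x) => bool" where
 "acts_on G E act \<longleftrightarrow> group G \<and> (\<forall>g\<in>carrier G. \<forall>x\<in>E. act g x\<in>E) \<and> (\<forall>x\<in>E. act \<one>\<^bsub>G\<^esub> x = x) \<and>
  (\<forall>g\<in>carrier G. \<forall>h\<in>carrier G. \<forall>x\<in>E. act (g\<otimes>\<^bsub>G\<^esub> h) x = act g (act h x))"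

section \<open>Actions of perfect groups on at most four points\<close>

lemma acts_on_bij:
 fixes G (structure)
 assumes "acts_on G E act" "g\<in>carrier G"
 shows "bij_betw (act g) E E"
proof -
 interpret group G using assms by (simp add: acts_on_def)
 show ?thesis
 proof (rule bij_betwI[where g="act (inv g)"])
  show "act (inv g) (act g x) = x" if "x\<in>E" for x
   using assms that l_inv[OF assms(2)] inv_closed[OF assms(2)] unfolding acts_on_def by metis
  show "act g (act (inv g) x) = x" if "x\<in>E" for x
   using assms that r_inv[OF assms(2)] inv_closed[OF assms(2)] unfolding acts_on_def by metis
 qed (use assms(1) inv_closed[OF assms(2)] assms(2) in \<open>simp_all add: acts_on_def\<close>)
qed

lemma acts_on_group_action:
 fixes G (structure)
 assumes "acts_on G E act"
 shows "group_action G E (\<lambda>g. restrict (act g) E)"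
proof -
 interpret group G using assms by (simp add: acts_on_def)
 have "restrict (act g) E\<in>Bij E" if "g\<in>carrier G" for g
  using acts_on_bij[OF assms that] by (simp add: Bij_def)
 thus ?thesis
  using assms
  by (intro group_action.intro group_hom.intro group_hom_axioms.intro homI group_BijGroup)
   (auto simp: BijGroup_def acts_on_def compose_def fun_eq_iff)
qed

lemma acts_on_kernel:
 fixes G (structure)
 assumes "acts_on G E act"
 shows "{g\<in>carrier G. \<forall>x\<in>E. act g x = x} \<lhd> G"
proof -
 interpret h: group_hom G "BijGroup E" "\<lambda>g. restrict (act g) E"
  using acts_on_group_action[OF assms] by (simp add: group_action_def)
 have "kernel G (BijGroup E) (\<lambda>g. restrict (act g) E) = {g\<in>carrier G. \<forall>x\<in>E. act g x = x}"
  by (auto simp: kernel_def BijGroup_def restrict_def fun_eq_iff)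
 thus ?thesis using h.normal_kernel by simp
qed

text \<open>The image of a derived subgroup is the derived subgroup of the image, which is trivial
  in a commutative group.\<close>

lemma perfect_hom_comm:
 assumes "perfect G" "comm_group H" "f\<in>hom G H" "g\<in>carrier G"
 shows "f g = \<one>\<^bsub>H\<^esub>"
proof -
 interpret group_hom G H f
  using assms by (auto simp: perfect_def group_hom_def group_hom_axioms_def comm_group_def)
 have "derived H (f ` carrier G) = {\<one>\<^bsub>H\<^esub>}"
  using comm_group.derived_eq_singleton[OF assms(2)] img_is_subgroup subgroup.subset by blast
 hence "f ` carrier G = {\<one>\<^bsub>H\<^esub>}"
  using derived_img[of "carrier G"] assms(1) by (simp add: perfect_def)
 thus ?thesis using assms(4) by auto
qed

lemma perfect_hom_sym_group:
 assumes "perfect G" "f\<in>hom G (sym_group n)" "g\<in>carrier G"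
 shows "f g\<in>carrier (alt_group n)"
proof -
 have "comm_group sign_img"
  using sign_img_is_group by (auto intro!: group.group_comm_groupI simp: sign_img_def)
 hence "(sign \<circ> f) g = \<one>\<^bsub>sign_img\<^esub>"
  using assms sign_is_hom by (intro perfect_hom_comm[of G]) (blast intro: Group.hom_compose)+
 thus ?thesis
  using assms by (auto simp: alt_group_is_sign_kernel kernel_def hom_def)
qed

text \<open>By cancellation neither product of two distinct nontrivial elements \<open>x\<close>,
  \<open>y\<close> equals \<open>x\<close> or \<open>y\<close>; with only three elements in the
  group both products are the unit.\<close>

lemma small_comm_group:
 fixes G (structure)
 assumes "group G" "card (carrier G) \<le> 3" "finite (carrier G)"
 shows "comm_group G"
proof (rule group.group_comm_groupI[OF assms(1)])
 interpret group G by fact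
 fix x y assume xy: "x\<in>carrier G" "y\<in>carrier G"
 show "x\<otimes>y = y\<otimes>x"
 proof (cases "x = \<one> \<or> y = \<one> \<or> x = y")
  case False
  hence "card {\<one>, x, y} = 3" by auto
  hence "carrier G = {\<one>, x, y}"
   using card_seteq[of "carrier G" "{\<one>, x, y}"] assms xy by simp
  moreover have "x\<otimes>y ~= x" "x\<otimes>y ~= y" "y\<otimes>x ~= x" "y\<otimes>x ~= y"
   using xy False by (simp_all add: r_cancel_one l_cancel_one)
  ultimately have "x\<otimes>y = \<one>" "y\<otimes>x = \<one>"
   using m_closed[OF xy] m_closed[OF xy(2,1)] by auto
  thus ?thesis by simp
 qed (use xy in auto)
qed

text \<open>The action gives a homomorphism into a symmetric group. Its sign is trivial by
  perfectness, and the alternating groups of degree two and three are commutative, so the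
  homomorphism itself is trivial.\<close>

lemma perfect_acts_on_le3:
 assumes "perfect G" "acts_on G E act" "finite E" "card E \<le> 3" "g\<in>carrier G" "x\<in>E"
 shows "act g x = x"
proof -
 define n where "n = card E"
 obtain e where e: "bij_betw e {1..n} E"
  using ex_bij_betw_nat_finite_1[OF assms(3)] n_def by auto
 \<comment> \<open>Elements of \<open>sym_group n\<close> are functions on all natural numbers, so
   the transported action is extended by the identity outside \<open>{1..n}\<close>.\<close>
 define f where "f = (\<lambda>g i. if i\<in>{1..n} then inv_into {1..n} e (act g (e i)) else i)"
 have eE: "e i\<in>E" if "i\<in>{1..n}" for i using e that by (auto simp: bij_betw_def)
 have ie: "inv_into {1..n} e (e i) = i" if "i\<in>{1..n}" for i
  using e that by (simp add: bij_betw_def)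
 have ei: "e (inv_into {1..n} e x) = x" "inv_into {1..n} e x\<in>{1..n}" if "x\<in>E" for x
  using e that by (auto simp: bij_betw_def f_inv_into_f inv_into_into)
 have fperm: "f g permutes {1..n}" if "g\<in>carrier G" for g
 proof -
  have "bij_betw (inv_into {1..n} e \<circ> act g \<circ> e) {1..n} {1..n}"
   using bij_betw_trans[OF bij_betw_trans[OF e acts_on_bij[OF assms(2) that]] bij_betw_inv_into[OF e]]
   by (simp add: comp_assoc)
  hence "bij_betw (f g) {1..n} {1..n}"
   by (subst bij_betw_cong[where g="inv_into {1..n} e \<circ> act g \<circ> e"]) (simp_all add: f_def)
  thus ?thesis by (rule bij_imp_permutes) (simp add: f_def del: atLeastAtMost_iff)
 qed
 have fhom: "f\<in>hom G (sym_group n)"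
 proof (rule homI)
  show "f (g\<otimes>\<^bsub>G\<^esub> h) = f g\<otimes>\<^bsub>sym_group n\<^esub> f h" if "g\<in>carrier G" "h\<in>carrier G" for g h
  proof
   fix i
   have "act h (e i)\<in>E" if "i\<in>{1..n}"
    using assms(2) eE[OF that] \<open>h\<in>carrier G\<close> by (simp add: acts_on_def)
   thus "f (g\<otimes>\<^bsub>G\<^esub> h) i = (f g\<otimes>\<^bsub>sym_group n\<^esub> f h) i"
    using assms(2) that eE[of i] ei
    by (auto simp: f_def sym_group_mult acts_on_def simp del: atLeastAtMost_iff)
  qed
 qed (use fperm in \<open>simp add: sym_group_carrier\<close>)
 have fid: "f g = id"
 proof (cases "n \<ge> 2")
  case True
  define H where "H = alt_group n"
  have H: "group H" by (simp add: H_def alt_group_is_group)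
  have "2 * card (carrier H) = fact n" unfolding H_def using alt_group_card_carrier True by blast
  moreover have "n = 2 \<or> n = 3" using True assms(4) n_def by linarith
  ultimately have card: "order H = 1 \<or> order H = 3"
   by (auto simp: fact_numeral eval_nat_numeral order_def)
  have "comm_group H" using card by (intro small_comm_group[OF H]) (auto simp: order_def intro: card_ge_0_finite)
  moreover have "f\<in>hom G H"
   using perfect_hom_sym_group[OF assms(1) fhom] fhom
   by (auto simp: hom_def H_def alt_group_mult sym_group_mult)
  ultimately have "f g = \<one>\<^bsub>H\<^esub>" by (rule perfect_hom_comm[OF assms(1) _ _ assms(5)])
  thus ?thesis by (simp add: H_def alt_group_one)
 next
  case False
  hence "n = 0 \<or> n = 1" by linarith
  thus ?thesis using fperm[OF assms(5)] by auto
 qed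
 have "act g x = e (inv_into {1..n} e (act g x))"
  using ei assms by (simp add: acts_on_def)
 also have "inv_into {1..n} e (act g x) = f g (inv_into {1..n} e x)"
  using ei[OF assms(6)] by (simp add: f_def del: atLeastAtMost_iff)
 also have "... = inv_into {1..n} e x" using fid by simp
 finally show ?thesis using ei assms(6) by simp
qed

text \<open>If \<open>p x\<close> and \<open>q x\<close> differ, then \<open>x\<close>,
  \<open>p x\<close>, \<open>q x\<close> are three of the four points, and both
  \<open>p (q x)\<close> and \<open>q (p x)\<close> can only be the fourth.\<close>

lemma fixpoint_free_involutions_commute:
 assumes "card E = 4" "!!x. x\<in>E ==> p x\<in>E \<and> p (p x) = x \<and> p x ~= x"
  "!!x. x\<in>E ==> q x\<in>E \<and> q (q x) = x \<and> q x ~= x" "x\<in>E"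
 shows "p (q x) = q (p x)"
proof (cases "p x = q x")
 case True
 thus ?thesis using assms by metis
next
 case False
 have fin: "finite E" using assms(1) card.infinite by fastforce
 have "card {x, p x, q x} = 3" using False assms(2)[OF assms(4)] assms(3)[OF assms(4)] by (auto simp: card_insert_if)
 hence "card (E - {x, p x, q x}) = 1"
  using assms fin by (subst card_Diff_subset) auto
 then obtain w where w: "E - {x, p x, q x} = {w}" by (auto simp: card_1_singleton_iff)
 have P: "p x\<in>E" "p (p x) = x" "p x ~= x" and Q: "q x\<in>E" "q (q x) = x" "q x ~= x"
  using assms(2,3)[OF assms(4)] by auto
 have "p (q x)\<in>E" "p (p (q x)) = q x" "p (q x) ~= q x" "q (p x)\<in>E" "q (q (p x)) = p x" "q (p x) ~= p x"
  using assms(2)[OF Q(1)] assms(3)[OF P(1)] by auto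
 hence "p (q x)\<in>E - {x, p x, q x}" "q (p x)\<in>E - {x, p x, q x}"
  using P Q False by (metis Diff_iff empty_iff insert_iff)+
 thus ?thesis using w by auto
qed

text \<open>The partitions of a four-element set into two pairs. Permuting them is the map of the
  symmetric group of degree four onto that of degree three, with the Klein four-group as
  kernel.\<close>

definition pairings :: "'a set => 'a set set set" where
 "pairings E = {{A, E - A} | A. A \<subseteq> E \<and> card A = 2}"

lemma card_pairings:
 assumes "card E = 4" shows "finite (pairings E)" "card (pairings E) \<le> 3"
proof -
 have fin: "finite E" using assms card.infinite by fastforce
 obtain a where a: "a\<in>E" using assms by fastforce
 have "pairings E \<subseteq> (\<lambda>b. {{a, b}, E - {a, b}}) ` (E - {a})"
 proof
  fix P assume "P\<in>pairings E"
  then obtain A where A: "A \<subseteq> E" "card A = 2" "P = {A, E - A}" by (auto simp: pairings_def)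
  have c: "card (E - A) = 2" using A assms fin by (subst card_Diff_subset) (auto intro: finite_subset)
  define C where "C = (if a\<in>A then A else E - A)"
  have C: "a\<in>C" "card C = 2" "C \<subseteq> E" "P = {C, E - C}"
   using a A c by (auto simp: C_def)
  have "card (C - {a}) = 1" using C by simp
  then obtain b where "C - {a} = {b}" by (auto simp: card_1_singleton_iff)
  hence "C = {a, b}" "b\<in>E - {a}" using C by auto
  thus "P\<in>(\<lambda>b. {{a, b}, E - {a, b}}) ` (E - {a})" using C by auto
 qed
 moreover have "card (E - {a}) = 3" using a assms by simp
 moreover have "finite ((\<lambda>b. {{a, b}, E - {a, b}}) ` (E - {a}))" using fin by simp
 ultimately show "finite (pairings E)" "card (pairings E) \<le> 3"
  using card_image_le[of "E - {a}" "\<lambda>b. {{a, b}, E - {a, b}}"] fin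
  by (auto intro: finite_subset) (meson card_mono finite_Diff finite_imageI le_trans)
qed

text \<open>The pair \<open>{a, b}\<close> goes to itself or to its complement, and
  \<open>p a\<close> decides which.\<close>

lemma pairing_preserving_involution:
 assumes "card E = 4" "bij_betw p E E" "!!P. P\<in>pairings E ==> image p ` P = P"
  "a\<in>E" "b\<in>E" "a ~= b" "p a\<in>{a, b}"
 shows "p b\<in>{a, b}"
proof -
 have fin: "finite E" using assms card.infinite by fastforce
 have "{{a, b}, E - {a, b}}\<in>pairings E"
  using assms(4-6) unfolding pairings_def by (intro CollectI exI[of _ "{a, b}"]) auto
 hence "image p ` {{a, b}, E - {a, b}} = {{a, b}, E - {a, b}}" by (rule assms(3))
 hence "p ` {a, b}\<in>{{a, b}, E - {a, b}}" by (metis image_eqI insertI1)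
 hence "p ` {a, b} = {a, b}" using assms(7) by auto
 thus ?thesis by auto
qed

text \<open>There are at most three pairings, so \<open>G\<close> fixes each of them. Hence
  \<open>G\<close> acts through the Klein four-group, which is commutative, and perfectness applies
  a second time.\<close>

lemma perfect_acts_on_card4:
 fixes G (structure)
 assumes "perfect G" "acts_on G E act" "card E = 4" "g\<in>carrier G" "x\<in>E"
 shows "act g x = x"
proof -
 interpret group G using assms by (simp add: perfect_def)
 have fin: "finite E" using assms card.infinite by fastforce
 have bij: "bij_betw (act g) E E" if "g\<in>carrier G" for g by (rule acts_on_bij[OF assms(2) that])
 have inj: "act g x = act g y \<longleftrightarrow> x = y" if "g\<in>carrier G" "x\<in>E" "y\<in>E" for g x y
  using bij[OF that(1)] that by (auto simp: bij_betw_def inj_on_def)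
 have img: "act g ` A \<subseteq> E" if "g\<in>carrier G" "A \<subseteq> E" for g A
  using assms(2) that by (auto simp: acts_on_def)
 define act2 where "act2 = (\<lambda>g. image (image (act g)))"
 have "acts_on G (pairings E) act2"
  unfolding acts_on_def
 proof (intro conjI ballI)
  fix g P assume g: "g\<in>carrier G" and "P\<in>pairings E"
  then obtain A where A: "A \<subseteq> E" "card A = 2" "P = {A, E - A}" by (auto simp: pairings_def)
  have "act g ` (E - A) = E - act g ` A"
   using bij[OF g] A by (simp add: bij_betw_def inj_on_image_set_diff[where C=E])
  moreover have "card (act g ` A) = 2"
   using bij[OF g] A by (metis bij_betw_def card_image inj_on_subset)
  ultimately show "act2 g P\<in>pairings E" using img[OF g A(1)] A by (auto simp: act2_def pairings_def)
 next
  fix P assume "P\<in>pairings E"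
  hence P: "\<forall>A\<in>P. A \<subseteq> E" by (auto simp: pairings_def)
  have "act \<one> y = id y" if "y\<in>E" for y using assms(2) that by (simp add: acts_on_def)
  hence "act \<one> ` A = id ` A" if "A\<in>P" for A
   using P that by (intro image_cong) auto
  thus "act2 \<one> P = P"
   using image_cong[OF refl, of P "image (act \<one>)" id] by (simp add: act2_def)
  fix g h assume "g\<in>carrier G" "h\<in>carrier G"
  hence "act (g\<otimes>h) y = act g (act h y)" if "y\<in>E" for y
   using assms(2) that by (simp add: acts_on_def)
  hence "act (g\<otimes>h) ` A = act g ` act h ` A" if "A\<in>P" for A
   unfolding image_image using P that by (intro image_cong) auto
  thus "act2 (g\<otimes>h) P = act2 g (act2 h P)"
   using image_cong[OF refl, of P "image (act (g\<otimes>h))" "image (act g) \<circ> image (act h)"]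
   by (simp add: act2_def image_comp)
 qed (use is_group in auto)
 hence triv: "act2 g P = P" if "g\<in>carrier G" "P\<in>pairings E" for g P
  by (rule perfect_acts_on_le3[OF assms(1) _ card_pairings[OF assms(3)] that])
 have pres: "act g b\<in>{a, b}" if "g\<in>carrier G" "a\<in>E" "b\<in>E" "a ~= b" "act g a\<in>{a,b}" for g a b
  using pairing_preserving_involution[OF assms(3) bij[OF that(1)]] triv that by (simp add: act2_def)
 \<comment> \<open>A permutation that preserves every pairing and fixes one point fixes all of them;
   otherwise it is an involution without fixed points.\<close>
 have cases: "(\<forall>x\<in>E. act g x = x) \<or> (\<forall>x\<in>E. act g x\<in>E \<and> act g (act g x) = x \<and> act g x ~= x)"
  if g: "g\<in>carrier G" for g
 proof (cases "\<exists>x\<in>E. act g x = x")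
  case True
  then obtain x where x: "x\<in>E" "act g x = x" by blast
  have "act g y = y" if "y\<in>E" for y
  proof (cases "y = x")
   case False
   hence "act g y\<in>{x, y}" using pres[of g x y] g x that by auto
   thus ?thesis using inj[OF g that x(1)] x False by auto
  qed (use x in auto)
  thus ?thesis by blast
 next
  case False
  have "act g (act g x) = x" if "x\<in>E" for x
  proof -
   have "act g x\<in>E" "act g x ~= x" using that img[OF g, of E] False by auto
   thus ?thesis using pres[of g x "act g x"] g that False by auto
  qed
  thus ?thesis using False img[OF g, of E] by auto
 qed
 have comm: "act g (act h x) = act h (act g x)" if "g\<in>carrier G" "h\<in>carrier G" "x\<in>E" for g h x
  using cases[OF that(1)] cases[OF that(2)] that
   fixpoint_free_involutions_commute[OF assms(3), of "act g" "act h" x] by auto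
 interpret A: group_action G E "\<lambda>g. restrict (act g) E"
  using acts_on_group_action assms(2) by blast
 let ?f = "\<lambda>g. restrict (act g) E"
 interpret h: group_hom G "BijGroup E" ?f by (rule A.group_hom)
 define H where "H = BijGroup E \<lparr>carrier := ?f ` carrier G\<rparr>"
 have sH: "subgroup (?f ` carrier G) (BijGroup E)" by (rule h.img_is_subgroup)
 have gH: "group H"
  unfolding H_def by (rule subgroup.subgroup_is_group[OF sH group_BijGroup])
 have "comm_group H"
 proof (rule group.group_comm_groupI[OF gH])
  fix x y assume "x\<in>carrier H" "y\<in>carrier H"
  then obtain g h where gh: "x = ?f g" "y = ?f h" "g\<in>carrier G" "h\<in>carrier G" by (auto simp: H_def)
  have "?f g\<in>Bij E" "?f h\<in>Bij E" using gh A.bij_prop0 by auto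
  thus "x\<otimes>\<^bsub>H\<^esub> y = y\<otimes>\<^bsub>H\<^esub> x"
   using comm[OF gh(3,4)] img[OF gh(3), of E] img[OF gh(4), of E] unfolding gh(1,2)
   by (auto simp: H_def BijGroup_def compose_def fun_eq_iff image_subset_iff)
 qed
 moreover have "?f\<in>hom G H" using h.homh by (auto simp: hom_def H_def)
 ultimately have "?f g = \<one>\<^bsub>H\<^esub>" by (rule perfect_hom_comm[OF assms(1) _ _ assms(4)])
 hence "?f g x = x" using assms(5) by (simp add: H_def BijGroup_def)
 thus ?thesis using assms(5) by simp
qed

lemma perfect_acts_on_le4:
 assumes "perfect G" "acts_on G E act" "finite E" "card E \<le> 4" "g\<in>carrier G" "x\<in>E"
 shows "act g x = x"
 using perfect_acts_on_le3[OF assms(1-3)] perfect_acts_on_card4[OF assms(1,2)] assms(4-6)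
 by (cases "card E = 4") auto

text \<open>\<open>A\<close> acts on the cosets of \<open>H\<close>, of which there are at most
  four, so it fixes the coset \<open>H\<close> itself.\<close>

lemma perfect_subset_small_index:
 fixes G (structure)
 assumes "group G" "subgroup A G" "perfect (G\<lparr>carrier := A\<rparr>)" "subgroup H G" "finite (carrier G)"
  "card (carrier G) \<le> 4 * card H"
 shows "A \<subseteq> H"
proof -
 interpret group G by fact
 interpret A: subgroup A G by fact
 interpret H: subgroup H G by fact
 let ?E = "rcosets H"
 \<comment> \<open>Inversion turns right multiplication of right cosets into a left action.\<close>
 define act where "act = (\<lambda>a C. C #> inv a)"
 have sub: "C \<subseteq> carrier G" if "C\<in>?E" for C using that rcosets_part_G[OF assms(4)] by auto
 have "acts_on (G\<lparr>carrier := A\<rparr>) ?E act"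
  unfolding acts_on_def
 proof (intro conjI ballI)
  show "group (G\<lparr>carrier := A\<rparr>)" using A.subgroup_is_group[OF assms(1)] .
  fix C assume C: "C\<in>?E"
  show "act \<one>\<^bsub>G\<lparr>carrier := A\<rparr>\<^esub> C = C" using sub[OF C] by (simp add: act_def)
  fix g assume g: "g\<in>carrier (G\<lparr>carrier := A\<rparr>)"
  obtain x where x: "x\<in>carrier G" "C = H #> x" using C by (auto simp: RCOSETS_def)
  thus "act g C\<in>?E" using g
   by (auto simp: act_def RCOSETS_def coset_mult_assoc[OF H.subset] A.mem_carrier)
  fix h assume h: "h\<in>carrier (G\<lparr>carrier := A\<rparr>)"
  show "act (g\<otimes>\<^bsub>G\<lparr>carrier := A\<rparr>\<^esub> h) C = act g (act h C)"
   using g h sub[OF C] by (simp add: act_def coset_mult_assoc inv_mult_group A.mem_carrier)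
 qed
 moreover have c: "card ?E * card H = card (carrier G)"
  using lagrange[OF assms(4)] by (simp add: order_def)
 moreover have "card H > 0" using assms(5) H.subset H.one_closed by (metis card_gt_0_iff empty_iff finite_subset)
 ultimately have "card ?E \<le> 4"
  using assms(6) by (metis mult_le_cancel2)
 moreover have "finite ?E" using assms(5) rcosets_part_G[OF assms(4)] by (metis finite_UnionD)
 moreover have "H\<in>?E" using coset_join2[OF one_closed assms(4) H.one_closed] by (auto simp: RCOSETS_def intro!: bexI[of _ \<one>])
 ultimately have "act a H = H" if "a\<in>A" for a
  using perfect_acts_on_le4[OF assms(3) \<open>acts_on _ _ _\<close>] that by simp
 hence "H #> inv a = H" if "a\<in>A" for a using that by (simp add: act_def)
 thus ?thesis
  by (metis A.mem_carrier H.m_inv_closed assms(1,4) coset_join1 inv_closed inv_inv subsetI subgroup.subset group.coset_join1)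
qed

text \<open>Every orbit has one element or \<open>order P\<close> many, and the orbits of the first
  kind are the fixed points.\<close>

lemma prime_order_fixed_points:
 fixes P (structure)
 assumes "acts_on P E act" "finite E" "prime (order P)"
 shows "card E mod order P = card {x\<in>E. \<forall>g\<in>carrier P. act g x = x} mod order P"
proof -
 let ?p = "order P" and ?F = "{x\<in>E. \<forall>g\<in>carrier P. act g x = x}"
 let ?a = "\<lambda>g. restrict (act g) E"
 interpret A: group_action P E ?a using assms(1) by (rule acts_on_group_action)
 interpret group P using assms(1) by (simp add: acts_on_def)
 let ?f = "\<lambda>x. if x\<in>?F then 0 else 1::nat"
 have dvd: "?p dvd (\<Sum>x\<in>orb. ?f x)" if orb: "orb\<in>orbits P E ?a" for orb
 proof -
  obtain x where x: "x\<in>E" "orb = orbit P ?a x" using orb by (auto simp: orbits_def)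
  have card: "card orb * card (stabilizer P ?a x) = ?p"
   using A.orbit_stabilizer_theorem[OF x(1)] x by simp
  have orb': "orb = {act g x | g. g\<in>carrier P}" using x by (auto simp: orbit_def)
  show ?thesis
  proof (cases "x\<in>?F")
   case True
   hence "orb = {x}" using orb' by (auto intro!: exI[of _ \<one>])
   thus ?thesis using True by simp
  next
   case False
   have "y \<notin> ?F" if y: "y\<in>orb" for y
   proof
    assume "y\<in>?F"
    moreover have "x\<in>orbit P ?a y"
     using A.orbit_sym[of x y] x y \<open>y\<in>?F\<close> by auto
    ultimately have "x = y" by (auto simp: orbit_def)
    thus False using False \<open>y\<in>?F\<close> by simp
   qed
   hence "(\<Sum>x\<in>orb. ?f x) = (\<Sum>x\<in>orb. 1)" by (intro sum.cong refl if_not_P)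
   hence sum: "(\<Sum>x\<in>orb. ?f x) = card orb" by simp
   have "card orb ~= 1"
   proof
    assume "card orb = 1"
    moreover have "x\<in>orb" using A.orbit_refl[OF x(1)] x(2) by simp
    ultimately have "orb = {x}" by (auto simp: card_1_singleton_iff)
    thus False using False x(1) orb' by blast
   qed
   moreover have "card orb dvd ?p" using card by (metis dvd_triv_left)
   ultimately have "card orb = ?p" using assms(3) by (metis prime_nat_iff)
   thus ?thesis using sum by simp
  qed
 qed
 have "(\<Sum>x\<in>E. ?f x) = (\<Sum>x\<in>E - ?F. 1)"
  using assms(2) by (intro sum.mono_neutral_cong_right) auto
 hence "card (E - ?F) = (\<Sum>x\<in>E. ?f x)" by simp
 also have "... = (\<Sum>orb\<in>orbits P E ?a. \<Sum>x\<in>orb. ?f x)" using A.disjoint_sum[OF assms(2), of ?f] by simp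
 finally have "?p dvd card (E - ?F)" using dvd by (auto intro: dvd_sum)
 then obtain k where "card (E - ?F) = ?p * k" by (rule dvdE)
 moreover have "card E = card (E - ?F) + card ?F"
  using card_Diff_subset[of ?F E] card_mono[OF assms(2), of ?F] finite_subset[OF _ assms(2), of ?F]
  by (simp add: subset_iff)
 ultimately show ?thesis by simp
qed

section \<open>Conjugation and Sylow theory for a prime dividing the order once\<close>

definition conj_set :: "('a, 'b) monoid_scheme => 'a => 'a set => 'a set" where
 "conj_set G g H = (\<lambda>x. g\<otimes>\<^bsub>G\<^esub> x\<otimes>\<^bsub>G\<^esub> inv\<^bsub>G\<^esub> g) ` H"

text \<open>When \<open>p\<close> divides the group order exactly once, these are the Sylow
  \<open>p\<close>-subgroups.\<close>

definition psubs :: "('a, 'b) monoid_scheme => nat => 'a set set" where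
 "psubs G p = {H. subgroup H G \<and> card H = p}"

definition nzer :: "('a, 'b) monoid_scheme => 'a set => 'a set" where
 "nzer G H = {g\<in>carrier G. conj_set G g H = H}"

context group
begin

abbreviation "cG \<equiv> carrier G"

lemma conj_elt_mult:
 "g\<in>cG ==> h\<in>cG ==> x\<in>cG ==>
  (g\<otimes>h)\<otimes>x\<otimes>inv (g\<otimes>h) = g\<otimes>(h\<otimes>x\<otimes>inv h)\<otimes>inv g"
 by (simp add: inv_mult_group m_assoc)

lemma conj_elt_inv_cancel:
 "g\<in>cG ==> x\<in>cG ==> inv g\<otimes>(g\<otimes>x\<otimes>inv g)\<otimes>g = x"
 "g\<in>cG ==> x\<in>cG ==> g\<otimes>(inv g\<otimes>x\<otimes>g)\<otimes>inv g = x"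
 by (simp_all add: m_assoc inv_solve_left) (simp_all flip: m_assoc)

lemma conj_elt_hom:
 "g\<in>cG ==> x\<in>cG ==> y\<in>cG ==>
  g\<otimes>(x\<otimes>y)\<otimes>inv g = (g\<otimes>x\<otimes>inv g)\<otimes>(g\<otimes>y\<otimes>inv g)"
 by (simp add: m_assoc) (simp flip: m_assoc)

lemma conj_group_hom: "g\<in>cG ==> group_hom G G (\<lambda>x. g\<otimes>x\<otimes>inv g)"
 by (intro group_hom.intro is_group group_hom_axioms.intro homI) (simp_all add: conj_elt_hom)

lemma conj_elt_inj: "g\<in>cG ==> inj_on (\<lambda>x. g\<otimes>x\<otimes>inv g) cG"
 by (rule inj_onI) (metis conj_elt_inv_cancel(1))

lemma conj_set_mult:
 "g\<in>cG ==> h\<in>cG ==> H \<subseteq> cG ==>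
  conj_set G (g\<otimes>h) H = conj_set G g (conj_set G h H)"
 unfolding conj_set_def image_image by (intro image_cong refl) (auto simp: conj_elt_mult)

lemma conj_set_one: "H \<subseteq> cG ==> conj_set G \<one> H = H"
 unfolding conj_set_def by (force intro!: image_eqI)

lemma conj_set_psubs:
 assumes "g\<in>cG" "H\<in>psubs G p"
 shows "conj_set G g H\<in>psubs G p"
 using assms group_hom.subgroup_img_is_subgroup[OF conj_group_hom[OF assms(1)], of H]
  inj_on_subset[OF conj_elt_inj[OF assms(1)] subgroup.subset]
 by (auto simp: psubs_def conj_set_def card_image)

lemma acts_on_psubs: "acts_on G (psubs G p) (conj_set G)"
 using conj_set_psubs conj_set_mult conj_set_one
 by (auto simp: acts_on_def psubs_def subgroup.subset)

lemma acts_on_subgroup: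
 assumes "acts_on G E act" "subgroup H G" "E' \<subseteq> E" "!!g x. g\<in>H ==> x\<in>E' ==> act g x\<in>E'"
 shows "acts_on (G\<lparr>carrier := H\<rparr>) E' act"
 using assms subgroup.subset[OF assms(2)] subgroup.subgroup_is_group[OF assms(2) is_group]
 by (auto simp: acts_on_def subset_iff)

lemma finite_psubs: "finite cG ==> finite (psubs G p)"
 by (rule finite_subset[of _ "Pow cG"]) (auto simp: psubs_def dest: subgroup.subset)

lemma card_set_mult_disjoint:
 assumes "subgroup P G" "subgroup Q G" "P \<inter> Q \<subseteq> {\<one>}"
 shows "card (P <#> Q) = card P * card Q"
proof -
 have "inj_on (\<lambda>(x, y). x\<otimes>y) (P\<times>Q)"
 proof (rule inj_onI, clarify)
  fix x y x' y' assume *: "x\<in>P" "y\<in>Q" "x'\<in>P" "y'\<in>Q" "x\<otimes>y = x'\<otimes>y'"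
  hence c: "x\<in>cG" "y\<in>cG" "x'\<in>cG" "y'\<in>cG"
   using assms subgroup.mem_carrier by metis+
  have "inv x'\<otimes>x = y'\<otimes>inv y"
  proof -
   have "x'\<otimes>(inv x'\<otimes>x)\<otimes>y = x'\<otimes>(y'\<otimes>inv y)\<otimes>y"
    using c *(5) by (simp add: m_assoc) (simp add: m_assoc[symmetric])
   thus ?thesis using c by simp
  qed
  moreover have "inv x'\<otimes>x\<in>P" "y'\<otimes>inv y\<in>Q"
   using * assms subgroup.m_closed subgroup.m_inv_closed by metis+
  ultimately have "inv x'\<otimes>x = \<one>" "y'\<otimes>inv y = \<one>" using assms(3) by auto
  thus "x = x' \<and> y = y'" using c by (auto simp: inv_solve_left' inv_solve_right')
 qed
 moreover have "P <#> Q = (\<lambda>(x, y). x\<otimes>y) ` (P\<times>Q)" by (auto simp: set_mult_def)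
 ultimately show ?thesis by (simp add: card_image card_cartesian_product)
qed

lemma set_mult_normalised:
 assumes "subgroup P G" "subgroup Q G" "P \<subseteq> nzer G Q"
 shows "subgroup (P <#> Q) G"
proof -
 have P: "P \<subseteq> cG" and Q: "Q \<subseteq> cG" using assms subgroup.subset by auto
 have img: "(\<lambda>y. x\<otimes>y\<otimes>inv x) ` Q = Q" if "x\<in>P" for x
  using assms(3) that by (auto simp: nzer_def conj_set_def)
 have conj: "x\<otimes>y\<otimes>inv x\<in>Q" if "x\<in>P" "y\<in>Q" for x y using img[OF that(1)] that(2) by blast
 have c: "x\<in>cG" if "x\<in>P \<or> x\<in>Q" for x using that P Q by blast
 show ?thesis
 proof (rule subgroupI)
  show "P <#> Q \<subseteq> cG" using P Q by (rule set_mult_closed)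
  show "P <#> Q ~= {}" using assms(1,2) subgroup.one_closed by (auto simp: set_mult_def)
 next
  fix z assume "z\<in>P <#> Q"
  then obtain x y where z: "z = x\<otimes>y" "x\<in>P" "y\<in>Q" by (auto simp: set_mult_def)
  hence "inv z = inv x\<otimes>(x\<otimes>inv y\<otimes>inv x)"
   by (simp add: inv_mult_group c m_assoc[symmetric])
  thus "inv z\<in>P <#> Q"
   using z conj[OF z(2), of "inv y"] assms(1,2) subgroup.m_inv_closed
   unfolding set_mult_def by fastforce
  fix z' assume "z'\<in>P <#> Q"
  then obtain x' y' where z': "z' = x'\<otimes>y'" "x'\<in>P" "y'\<in>Q" by (auto simp: set_mult_def)
  have i: "inv x'\<in>P" by (rule subgroup.m_inv_closed[OF assms(1) z'(2)])
  have "inv x'\<otimes>y\<otimes>x'\<in>Q" using conj[OF i z(3)] z' c by simp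
  moreover have "z\<otimes>z' = (x\<otimes>x')\<otimes>((inv x'\<otimes>y\<otimes>x')\<otimes>y')"
   using z z' c by (simp add: m_assoc) (simp add: m_assoc[symmetric])
  moreover have "x\<otimes>x'\<in>P" by (rule subgroup.m_closed[OF assms(1) z(2) z'(2)])
  ultimately show "z\<otimes>z'\<in>P <#> Q"
   using z'(3) assms(2) subgroup.m_closed unfolding set_mult_def by fastforce
 qed
qed

lemma card_subgroup_dvd:
 assumes "subgroup H G" "subgroup K G" "H \<subseteq> K"
 shows "card H dvd card K"
 using group.lagrange[OF subgroup.subgroup_is_group[OF assms(2) is_group] subgroup_incl[OF assms]]
 by (simp add: order_def) (metis dvd_triv_right)

lemma prime_card_Int:
 assumes "P\<in>psubs G p" "Q\<in>psubs G p" "prime (p :: nat)" "P ~= Q"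
 shows "P \<inter> Q = {\<one>}"
proof -
 have s: "subgroup P G" "subgroup Q G" "card P = p" "card Q = p" using assms by (auto simp: psubs_def)
 have fin: "finite P" "finite Q" using s prime_gt_0_nat[OF assms(3)] by (auto intro: card_ge_0_finite)
 have "card (P \<inter> Q) dvd p"
  using card_subgroup_dvd[OF subgroups_Inter_pair[OF s(1,2)] s(1)] s(3) by simp
 hence "card (P \<inter> Q) = 1 \<or> card (P \<inter> Q) = p" using assms(3) s by (simp add: prime_nat_iff)
 moreover have "card (P \<inter> Q) ~= p"
  using s fin assms(4) by (metis card_subset_eq inf_le1 inf_le2)
 ultimately have "card (P \<inter> Q) = 1" by simp
 moreover have "\<one>\<in>P \<inter> Q" using s subgroup.one_closed by blast
 ultimately show ?thesis by (metis card_1_singletonE singletonD)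
qed

text \<open>Otherwise \<open>P\<close> and \<open>Q\<close> meet trivially, and
  \<open>P <#> Q\<close> is a subgroup of order \<open>p ^ 2\<close>.\<close>

lemma normalised_prime_subgroups_eq:
 assumes "P\<in>psubs G p" "Q\<in>psubs G p" "prime p" "\<not> p ^ 2 dvd order G" "P \<subseteq> nzer G Q"
 shows "P = Q"
proof (rule ccontr)
 assume "P ~= Q"
 have s: "subgroup P G" "subgroup Q G" "card P = p" "card Q = p" using assms by (auto simp: psubs_def)
 have "card (P <#> Q) = p ^ 2"
  using card_set_mult_disjoint[OF s(1,2)] prime_card_Int[OF assms(1-3) \<open>P ~= Q\<close>] s
  by (simp add: power2_eq_square)
 thus False
  using card_subgroup_dvd[OF set_mult_normalised[OF s(1,2) assms(5)] subgroup_self] assms(4)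
  by (simp add: order_def subgroup.subset[OF set_mult_normalised[OF s(1,2) assms(5)]])
qed

lemma subgroup_nzer:
 assumes "H \<subseteq> cG" shows "subgroup (nzer G H) G"
proof (rule subgroupI)
 show "nzer G H ~= {}" using conj_set_one[OF assms] by (auto simp: nzer_def)
 show "inv a\<in>nzer G H" if "a\<in>nzer G H" for a
  using that conj_set_mult[of "inv a" a H] assms conj_set_one[OF assms] by (auto simp: nzer_def)
qed (use assms conj_set_mult in \<open>auto simp: nzer_def\<close>)

lemma subset_nzer_self:
 assumes "subgroup P G" shows "P \<subseteq> nzer G P"
proof
 fix g assume g: "g\<in>P"
 interpret P: subgroup P G by fact
 have "conj_set G g P \<subseteq> P" using g by (auto simp: conj_set_def)
 moreover have "P \<subseteq> conj_set G g P"
 proof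
  fix x assume x: "x\<in>P"
  have "x = g\<otimes>(inv g\<otimes>x\<otimes>g)\<otimes>inv g" using conj_elt_inv_cancel(2)[of g x] g x by simp
  moreover have "inv g\<otimes>x\<otimes>g\<in>P" using g x by simp
  ultimately show "x\<in>conj_set G g P" unfolding conj_set_def by blast
 qed
 ultimately show "g\<in>nzer G P" using g by (auto simp: nzer_def)
qed

text \<open>Fixed points are counted modulo \<open>p\<close>: a subgroup of order \<open>p\<close>
  acts by conjugation on families of such subgroups, and it normalises no other one.\<close>

lemma sylow_prime:
 assumes fin: "finite cG" and p: "prime p" "p dvd order G" "\<not> p ^ 2 dvd order G"
 shows "card (psubs G p) mod p = 1" "psubs G p ~= {}"
  and "!!P Q. P\<in>psubs G p ==> Q\<in>psubs G p ==> \<exists>g\<in>cG. Q = conj_set G g P"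
  and "!!P. P\<in>psubs G p ==> card (psubs G p) * card (nzer G P) = order G \<and> p dvd card (nzer G P)"
proof -
 show ne: "psubs G p ~= {}"
  using sylow_thm[of p G 1] p(1,2) fin is_group by (auto simp: psubs_def elim!: dvdE)
 \<comment> \<open>On a family \<open>E\<close> stable under conjugation by \<open>P\<close>, the
   only possible fixed point is \<open>P\<close> itself.\<close>
 have fixed: "card E mod p = (if P\<in>E then 1 else 0)"
  if P: "P\<in>psubs G p" and E: "E \<subseteq> psubs G p" "!!g H. g\<in>P ==> H\<in>E ==> conj_set G g H\<in>E" for P E
 proof -
  have s: "subgroup P G" "card P = p" using P by (auto simp: psubs_def)
  have "acts_on (G\<lparr>carrier := P\<rparr>) E (conj_set G)"
   by (rule acts_on_subgroup[OF acts_on_psubs s(1) E])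
  moreover have "finite E" using finite_psubs[OF fin] E(1) finite_subset by blast
  ultimately have "card E mod p = card {H\<in>E. \<forall>g\<in>P. conj_set G g H = H} mod p"
   using prime_order_fixed_points[of "G\<lparr>carrier := P\<rparr>" E "conj_set G"] p(1) s by (simp add: order_def)
  also have "{H\<in>E. \<forall>g\<in>P. conj_set G g H = H} = (if P\<in>E then {P} else {})"
  proof -
   have "H = P" if "H\<in>E" "\<forall>g\<in>P. conj_set G g H = H" for H
    using normalised_prime_subgroups_eq[OF P _ p(1,3), of H] that E(1) subgroup.subset[OF s(1)]
    by (auto simp: nzer_def)
   moreover have "conj_set G g P = P" if "g\<in>P" for g
    using subset_nzer_self[OF s(1)] that by (auto simp: nzer_def)
   ultimately have "{H\<in>E. \<forall>g\<in>P. conj_set G g H = H} = {H\<in>E. H = P}" by blast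
   thus ?thesis by auto
  qed
  finally show ?thesis using prime_gt_1_nat[OF p(1)] by auto
 qed
 obtain P0 where "P0\<in>psubs G p" using ne by blast
 thus "card (psubs G p) mod p = 1"
  using fixed[of P0 "psubs G p"] conj_set_psubs[of _ _ p] by (auto simp: psubs_def subgroup.mem_carrier)
 have conj: "\<exists>g\<in>cG. Q = conj_set G g P" if P: "P\<in>psubs G p" and Q: "Q\<in>psubs G p" for P Q
 proof (rule ccontr)
  assume no: "\<not> ?thesis"
  \<comment> \<open>Counted through \<open>P\<close>, the conjugates of \<open>P\<close> number 1
    modulo \<open>p\<close>; if \<open>Q\<close> is not among them, counting through
    \<open>Q\<close> gives 0.\<close>
  define E where "E = {conj_set G g P | g. g\<in>cG}"
  have sub: "P \<subseteq> cG" "Q \<subseteq> cG" using P Q by (auto simp: psubs_def subgroup.subset dest: subgroup.subset)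
  have "conj_set G g H\<in>E" if "g\<in>cG" "H\<in>E" for g H
  proof -
   obtain h where "h\<in>cG" "H = conj_set G h P" using \<open>H\<in>E\<close> by (auto simp: E_def)
   hence "conj_set G g H = conj_set G (g\<otimes>h) P" "g\<otimes>h\<in>cG"
    using that sub conj_set_mult by auto
   thus ?thesis by (auto simp: E_def)
  qed
  moreover have "E \<subseteq> psubs G p" using P conj_set_psubs by (auto simp: E_def)
  ultimately have "card E mod p = (if P\<in>E then 1 else 0)" "card E mod p = (if Q\<in>E then 1 else 0)"
   using fixed[OF P, of E] fixed[OF Q, of E] sub by blast+
  moreover have "P\<in>E" using conj_set_one[OF sub(1)] unfolding E_def by force
  moreover have "Q \<notin> E" using no by (auto simp: E_def)
  ultimately show False by simp
 qed
 show "\<exists>g\<in>cG. Q = conj_set G g P" if "P\<in>psubs G p" "Q\<in>psubs G p" for P Q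
  using conj that by blast
 show "card (psubs G p) * card (nzer G P) = order G \<and> p dvd card (nzer G P)" if P: "P\<in>psubs G p" for P
 proof
  have s: "subgroup P G" "card P = p" using P by (auto simp: psubs_def)
  let ?a = "\<lambda>g. restrict (conj_set G g) (psubs G p)"
  interpret A: group_action G "psubs G p" ?a by (rule acts_on_group_action[OF acts_on_psubs])
  have "orbit G ?a P = psubs G p"
   using P conj[OF P] conj_set_psubs[OF _ P] by (auto simp: orbit_def)
  moreover have "stabilizer G ?a P = nzer G P" using P by (auto simp: stabilizer_def nzer_def)
  ultimately show "card (psubs G p) * card (nzer G P) = order G"
   using A.orbit_stabilizer_theorem[OF P] by simp
  show "p dvd card (nzer G P)"
   using card_subgroup_dvd[OF s(1) subgroup_nzer subset_nzer_self[OF s(1)]] s subgroup.subset by auto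
 qed
qed

lemma normal_conj_set: "J \<lhd> G ==> H \<subseteq> J ==> g\<in>cG ==> conj_set G g H \<subseteq> J"
 by (auto simp: conj_set_def normal_inv_iff subset_iff)

text \<open>Conjugation permutes the at most four nontrivial elements of \<open>J\<close>.\<close>

lemma perfect_conj_trivial:
 assumes "perfect G" "J \<lhd> G" "finite J" "card J \<le> 5" "g\<in>cG" "x\<in>J"
 shows "g\<otimes>x = x\<otimes>g"
proof (cases "x = \<one>")
 case False
 have J: "J \<subseteq> cG" "\<one>\<in>J" using assms(2) by (auto simp: normal_inv_iff subgroup.subset subgroup.one_closed dest: subgroup.subset)
 have "acts_on G (J - {\<one>}) (\<lambda>g x. g\<otimes>x\<otimes>inv g)"
  unfolding acts_on_def
 proof (intro conjI ballI is_group)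
  fix g x assume gx: "g\<in>cG" "x\<in>J - {\<one>}"
  hence "g\<otimes>x\<otimes>inv g\<in>J" using assms(2) by (auto simp: normal_inv_iff)
  moreover have "g\<otimes>x\<otimes>inv g ~= \<one>"
   using conj_elt_inv_cancel(1)[of g x] gx J by auto
  ultimately show "g\<otimes>x\<otimes>inv g\<in>J - {\<one>}" by simp
 qed (use J conj_elt_mult in \<open>auto simp: subset_iff\<close>)
 moreover have "card (J - {\<one>}) \<le> 4" using assms(4) J by simp
 ultimately have "g\<otimes>x\<otimes>inv g = x"
  using perfect_acts_on_le4[OF assms(1), of "J - {\<one>}"] assms(3,5,6) False by auto
 thus ?thesis using assms(5,6) J by (metis inv_closed inv_solve_right m_closed subsetD)
qed (use assms(5) in simp)

end

section \<open>Sylow 5-subgroups and automorphisms of perfect groups of order 60 and 120\<close>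

definition centreless :: "('a, 'b) monoid_scheme => bool" where
 "centreless H \<longleftrightarrow> (\<forall>z\<in>carrier H. (\<forall>x\<in>carrier H. x\<otimes>\<^bsub>H\<^esub> z = z\<otimes>\<^bsub>H\<^esub> x) \<longrightarrow> z = \<one>\<^bsub>H\<^esub>)"

context group
begin

text \<open>The number is 1 modulo 5 and divides 12 or 24, which leaves 1 and 6. A single Sylow
  5-subgroup would be normal, and its product with a Sylow 2-subgroup would be a subgroup of index
  three, which a perfect group does not have.\<close>

lemma psubs5_perfect:
 assumes "perfect G" "order G = 60 \<or> order G = 120"
 shows "card (psubs G 5) = 6"
proof -
 have fin: "finite cG" using assms(2) by (auto simp: order_def intro: card_ge_0_finite)
 have p: "prime (5::nat)" by (simp add: prime_nat_numeral_eq)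
 note S = sylow_prime[OF fin p]
 have dvd: "5 dvd order G" "\<not> 5 ^ 2 dvd order G" using assms(2) by auto
 obtain P where P: "P\<in>psubs G 5" using S(2)[OF dvd] by blast
 hence s: "subgroup P G" "card P = 5" by (auto simp: psubs_def)
 obtain w where w: "card (nzer G P) = 5 * w" using S(4)[OF dvd P] by (auto elim: dvdE)
 have n: "card (psubs G 5) * w = 12 \<or> card (psubs G 5) * w = 24" using S(4)[OF dvd P] w assms(2) by (auto simp: mult.commute)
 have "w ~= 0" using n by (intro notI) simp
 hence "card (psubs G 5) \<le> card (psubs G 5) * w" by simp
 hence "card (psubs G 5) \<le> 24" using n by linarith
 hence "card (psubs G 5) = 1 \<or> card (psubs G 5) = 6 \<or> card (psubs G 5) = 11
   \<or> card (psubs G 5) = 16 \<or> card (psubs G 5) = 21"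
  using S(1)[OF dvd] by presburger
 hence "card (psubs G 5) = 1 \<or> card (psubs G 5) = 6"
  using n by (elim disjE) (simp_all, presburger+)
 moreover have "card (psubs G 5) ~= 1"
 proof
  assume "card (psubs G 5) = 1"
  hence "card (nzer G P) = order G" using S(4)[OF dvd P] by simp
  hence nz: "nzer G P = cG"
   using card_subset_eq[OF fin, of "nzer G P"] by (auto simp: order_def nzer_def)
  \<comment> \<open>Both orders have the shape \<open>2 ^ a * 15\<close>, so one argument with a
    Sylow 2-subgroup covers them.\<close>
  have "order G = 2 ^ 2 * 15 \<or> order G = 2 ^ 3 * 15" using assms(2) by auto
  then obtain a where a: "order G = 2 ^ a * 15" by blast
  obtain Q where Q: "subgroup Q G" "card Q = 2 ^ a"
   using sylow_thm[OF two_is_prime_nat is_group a fin] by blast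
  have "card (P \<inter> Q) dvd 5" "card (P \<inter> Q) dvd 2 ^ a"
   using card_subgroup_dvd[OF subgroups_Inter_pair[OF s(1) Q(1)] s(1)]
    card_subgroup_dvd[OF subgroups_Inter_pair[OF s(1) Q(1)] Q(1)] s Q by auto
  moreover have "coprime (5::nat) (2 ^ a)" by (simp add: coprime_power_right_iff)
  ultimately have "card (P \<inter> Q) = 1" by (metis coprime_common_divisor_nat)
  moreover have "\<one>\<in>P \<inter> Q" using s(1) Q(1) by (simp add: subgroup.one_closed)
  ultimately have "Q \<inter> P \<subseteq> {\<one>}" by (metis Int_commute card_1_singletonE order_refl singletonD)
  hence c: "card (Q <#> P) = 5 * 2 ^ a" using card_set_mult_disjoint[OF Q(1) s(1)] s Q by simp
  have QP: "subgroup (Q <#> P) G" using set_mult_normalised[OF Q(1) s(1)] nz subgroup.subset[OF Q(1)] by simp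
  have "cG \<subseteq> Q <#> P"
   using perfect_subset_small_index[OF is_group subgroup_self _ QP fin] assms(1) a c by (simp add: order_def)
  hence "order G = 5 * 2 ^ a" using subgroup.subset[OF QP] c by (simp add: order_def subset_antisym)
  thus False using a by simp
 qed
 ultimately show ?thesis by blast
qed

text \<open>The kernel of the conjugation action on the Sylow 5-subgroups. For perfect groups of
  order 60 or 120 it turns out to be central: it is trivial in the alternating group and has order
  two in SL(2,5).\<close>

definition sylow5_kernel :: "'a set" where
 "sylow5_kernel = {z\<in>cG. \<forall>P\<in>psubs G 5. conj_set G z P = P}"

lemma psubs_subset: "P\<in>psubs G p ==> P \<subseteq> cG"
 by (simp add: psubs_def subgroup.subset)

lemma sylow5_kernel_normal: "sylow5_kernel \<lhd> G"
 unfolding normal_inv_iff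
proof (intro conjI ballI subgroupI)
 show "sylow5_kernel ~= {}" using conj_set_one psubs_subset by (auto simp: sylow5_kernel_def)
 fix a assume a: "a\<in>sylow5_kernel"
 have "conj_set G (inv a) P = P" if P: "P\<in>psubs G 5" for P
  using conj_set_mult[of "inv a" a P] conj_set_one[OF psubs_subset[OF P]] psubs_subset[OF P] a P
  by (simp add: sylow5_kernel_def)
 thus "inv a\<in>sylow5_kernel" using a by (simp add: sylow5_kernel_def)
 fix x assume x: "x\<in>cG"
 have "conj_set G (x\<otimes>a\<otimes>inv x) P = P" if P: "P\<in>psubs G 5" for P
 proof -
  have i: "conj_set G (inv x) P\<in>psubs G 5" using conj_set_psubs[OF _ P] x by simp
  have "conj_set G (x\<otimes>a\<otimes>inv x) P = conj_set G x (conj_set G a (conj_set G (inv x) P))"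
   using a x P psubs_subset[OF P] psubs_subset[OF i] by (simp add: conj_set_mult sylow5_kernel_def)
  also have "... = conj_set G x (conj_set G (inv x) P)" using a i by (simp add: sylow5_kernel_def)
  also have "... = P" using conj_set_mult[of x "inv x" P] x psubs_subset[OF P] conj_set_one by simp
  finally show ?thesis .
 qed
 thus "x\<otimes>a\<otimes>inv x\<in>sylow5_kernel" using a x by (simp add: sylow5_kernel_def)
qed (use conj_set_mult psubs_subset in \<open>auto simp: sylow5_kernel_def\<close>)

text \<open>A Sylow 5-subgroup inside the kernel would normalise all the others. So 5 does not
  divide its order; as it lies in a normaliser of order 10 or 20, its order divides 4.\<close>

lemma card_sylow5_kernel:
 assumes "perfect G" "order G = 60 \<or> order G = 120"
 shows "card sylow5_kernel \<le> 4"
proof -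
 have fin: "finite cG" using assms(2) by (auto simp: order_def intro: card_ge_0_finite)
 have p: "prime (5::nat)" by (simp add: prime_nat_numeral_eq)
 have dvd: "5 dvd order G" "\<not> 5 ^ 2 dvd order G" using assms(2) by auto
 note S = sylow_prime[OF fin p dvd]
 have Z: "subgroup sylow5_kernel G" using sylow5_kernel_normal by (simp add: normal_inv_iff)
 have finZ: "finite sylow5_kernel" using fin subgroup.subset[OF Z] finite_subset by blast
 have nz: "sylow5_kernel \<subseteq> nzer G P" if "P\<in>psubs G 5" for P
  using that by (auto simp: sylow5_kernel_def nzer_def)
 have "\<not> 5 dvd card sylow5_kernel"
 proof
  assume "5 dvd card sylow5_kernel"
  then obtain m where m: "card sylow5_kernel = 5 * m" by (rule dvdE)
  have gZ: "group (G\<lparr>carrier := sylow5_kernel\<rparr>)" by (rule subgroup.subgroup_is_group[OF Z is_group])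
  obtain P where P: "subgroup P (G\<lparr>carrier := sylow5_kernel\<rparr>)" "card P = 5"
   using sylow_thm[OF p gZ, of 1 m] m finZ by (auto simp: order_def)
  have P': "P\<in>psubs G 5" "P \<subseteq> sylow5_kernel"
   using incl_subgroup[OF Z P(1)] P subgroup.subset[OF P(1)] by (auto simp: psubs_def)
  have "\<not> psubs G 5 \<subseteq> {P}"
   using psubs5_perfect[OF assms] card_mono[of "{P}" "psubs G 5"] by auto
  then obtain Q where Q: "Q\<in>psubs G 5" "Q ~= P" by blast
  thus False
   using normalised_prime_subgroups_eq[OF P'(1) Q(1) p dvd(2)] P'(2) nz[OF Q(1)] by auto
 qed
 moreover obtain P where P: "P\<in>psubs G 5" using S(2) by blast
 have "card (nzer G P) = 10 \<or> card (nzer G P) = 20"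
  using S(4)[OF P] psubs5_perfect[OF assms] assms(2) by auto
 moreover have "card sylow5_kernel dvd card (nzer G P)"
  using card_subgroup_dvd[OF Z subgroup_nzer nz[OF P]] psubs_subset[OF P] by simp
 ultimately have "card sylow5_kernel dvd 4 * 5" "\<not> 5 dvd card sylow5_kernel" by (auto elim: dvd_trans)
 hence "card sylow5_kernel dvd 4"
  using prime_imp_coprime[OF p] by (metis coprime_commute coprime_dvd_mult_left_iff)
 thus ?thesis by (rule dvd_imp_le) simp
qed

text \<open>\<open>q x\<close> and \<open>x\<close> permute the Sylow 5-subgroups in the same way,
  so they differ by an element of \<open>sylow5_kernel\<close>. That kernel is central, which makes
  the difference a homomorphism into a commutative group, trivial by perfectness.\<close>

lemma perfect_auto_fixing_sylow5:
 assumes "perfect G" "order G = 60 \<or> order G = 120" "q\<in>hom G G"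
  "!!P. P\<in>psubs G 5 ==> q ` P = P" "x\<in>cG"
 shows "q x = x"
proof -
 interpret k: group_hom G G q using assms(3) by (intro group_hom.intro group_hom_axioms.intro is_group)
 have fin: "finite cG" using assms(2) by (auto simp: order_def intro: card_ge_0_finite)
 have Z: "subgroup sylow5_kernel G" using sylow5_kernel_normal by (simp add: normal_inv_iff)
 have finZ: "finite sylow5_kernel" using fin subgroup.subset[OF Z] finite_subset by blast
 let ?H = "G\<lparr>carrier := sylow5_kernel\<rparr>"
 let ?z = "\<lambda>x. q x\<otimes>inv x"
 have central: "g\<otimes>z = z\<otimes>g" if "z\<in>sylow5_kernel" "g\<in>cG" for g z
  using perfect_conj_trivial[OF assms(1) sylow5_kernel_normal finZ _ that(2,1)] card_sylow5_kernel[OF assms(1,2)]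
  by simp
 have mem: "?z x\<in>sylow5_kernel" if x: "x\<in>cG" for x
 proof -
  have "conj_set G (?z x) P = P" if P: "P\<in>psubs G 5" for P
  proof -
   let ?Q = "conj_set G (inv x) P"
   have Q: "?Q\<in>psubs G 5" using conj_set_psubs[OF _ P] x by simp
   have "conj_set G (?z x) P = conj_set G (q x) ?Q"
    using x psubs_subset[OF P] by (simp add: conj_set_mult)
   also have "... = conj_set G (q x) (q ` ?Q)" using assms(4)[OF Q] by simp
   also have "... = q ` conj_set G x ?Q"
    unfolding conj_set_def[of G "q x"] conj_set_def[of G x] image_image
    using x psubs_subset[OF Q] by (intro image_cong refl) (auto simp: subset_iff)
   also have "conj_set G x ?Q = P"
    using conj_set_mult[of x "inv x" P] x psubs_subset[OF P] conj_set_one by simp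
   finally show ?thesis using assms(4)[OF P] by simp
  qed
  thus ?thesis using x by (simp add: sylow5_kernel_def)
 qed
 have "comm_group ?H"
  using subgroup.subgroup_is_group[OF Z is_group] central subgroup.mem_carrier[OF Z]
  by (intro group.group_comm_groupI) auto
 moreover have "?z\<in>hom G ?H"
 proof (rule homI)
  fix x y assume xy: "x\<in>cG" "y\<in>cG"
  have "?z (x\<otimes>y) = q x\<otimes>?z y\<otimes>inv x" using xy by (simp add: inv_mult_group m_assoc)
  also have "... = ?z x\<otimes>?z y"
   using central[OF mem[OF xy(2)], of "inv x"] xy by (simp add: m_assoc)
  finally show "?z (x\<otimes>y) = ?z x\<otimes>\<^bsub>?H\<^esub> ?z y" by simp
 qed (use mem in simp)
 ultimately have "?z x = \<one>\<^bsub>?H\<^esub>" by (rule perfect_hom_comm[OF assms(1) _ _ assms(5)])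
 thus ?thesis using assms(5) by (simp add: inv_solve_right')
qed

lemma conj_auto_image: "conj_set G n (f ` P) = (\<lambda>x. n\<otimes>f x\<otimes>inv n) ` P"
 by (simp add: conj_set_def image_image)

lemma auto_image_psubs:
 assumes "f\<in>hom G G" "inj_on f cG" "P\<in>psubs G p"
 shows "f ` P\<in>psubs G p"
 using assms group_hom.subgroup_img_is_subgroup[of G G f P] inj_on_subset[of f "cG" P]
 by (auto simp: psubs_def card_image subgroup.subset group_hom_def group_hom_axioms_def is_group)

text \<open>A pair \<open>(n, a)\<close> permutes the six Sylow 5-subgroups by \<open>lam a\<close>
  followed by conjugation with \<open>n\<close>. If no nontrivial \<open>a\<close> acted as an inner
  automorphism, at most four pairs would give the same permutation; so there would be at most 4
  times 720, that is 2880 pairs, against at least 3600.\<close>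

lemma exists_inner_action:
 assumes "perfect G" "order G = 60 \<or> order G = 120" "order A = 60"
  and act: "acts_on A cG lam" and hom: "!!a. a\<in>carrier A ==> lam a\<in>hom G G"
 shows "\<exists>a\<in>carrier A. a ~= \<one>\<^bsub>A\<^esub> \<and> (\<exists>n\<in>cG. \<forall>x\<in>cG. lam a x = n\<otimes>x\<otimes>inv n)"
proof (rule ccontr)
 assume no: "\<not> ?thesis"
 interpret A: group A using act by (simp add: acts_on_def)
 have fin: "finite cG" using assms(2) by (auto simp: order_def intro: card_ge_0_finite)
 have finA: "finite (carrier A)" using assms(3) by (auto simp: order_def intro: card_ge_0_finite)
 have Z: "subgroup sylow5_kernel G" using sylow5_kernel_normal by (simp add: normal_inv_iff)
 have finZ: "finite sylow5_kernel" using fin subgroup.subset[OF Z] finite_subset by blast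
 let ?S = "psubs G 5"
 have finS: "finite ?S" by (rule finite_psubs[OF fin])
 have lc: "lam a x\<in>cG" if "a\<in>carrier A" "x\<in>cG" for a x
  using act that by (simp add: acts_on_def)
 have lm: "lam (a\<otimes>\<^bsub>A\<^esub> b) x = lam a (lam b x)" if "a\<in>carrier A" "b\<in>carrier A" "x\<in>cG" for a b x
  using act that by (simp add: acts_on_def)
 have l1: "lam \<one>\<^bsub>A\<^esub> x = x" if "x\<in>cG" for x using act that by (simp add: acts_on_def)
 have lmult: "lam a (x\<otimes>y) = lam a x\<otimes>lam a y" if "a\<in>carrier A" "x\<in>cG" "y\<in>cG" for a x y
  using hom[OF that(1)] that by (simp add: hom_def)
 have inj: "inj_on (lam a) cG" if "a\<in>carrier A" for a
  using acts_on_bij[OF act that] by (simp add: bij_betw_def)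
 define F where "F = (\<lambda>(n, a) P. if P\<in>?S then conj_set G n (lam a ` P) else P)"
 have FS: "conj_set G n (lam a ` P)\<in>?S" if "n\<in>cG" "a\<in>carrier A" "P\<in>?S" for n a P
  using conj_set_psubs[OF that(1) auto_image_psubs[OF hom inj]] that by blast
 have Fperm: "F (n, a) permutes ?S" if na: "n\<in>cG" "a\<in>carrier A" for n a
 proof (rule bij_imp_permutes)
  have "inj_on (F (n, a)) ?S"
  proof (rule inj_onI)
   fix P Q assume PQ: "P\<in>?S" "Q\<in>?S" "F (n, a) P = F (n, a) Q"
   hence "conj_set G n (lam a ` P) = conj_set G n (lam a ` Q)" by (simp add: F_def)
   moreover have "inj_on (\<lambda>x. n\<otimes>x\<otimes>inv n) cG" using conj_elt_inj na by simp
   moreover have "lam a ` P \<subseteq> cG" "lam a ` Q \<subseteq> cG"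
    using lc na PQ psubs_subset by blast+
   ultimately have "lam a ` P = lam a ` Q" using inj_on_image_eq_iff by (metis conj_set_def)
   thus "P = Q"
    using inj_on_image_eq_iff[OF inj[OF na(2)] psubs_subset[OF PQ(1)] psubs_subset[OF PQ(2)]] by simp
  qed
  moreover have "F (n, a) ` ?S \<subseteq> ?S" using FS na by (auto simp: F_def)
  ultimately show "bij_betw (F (n, a)) ?S ?S" using finS by (simp add: bij_betw_def endo_inj_surj)
 qed (simp add: F_def)
 have fiber: "card {y\<in>cG\<times>carrier A. F y = f} \<le> 4" if f: "f\<in>F ` (cG\<times>carrier A)" for f
 proof -
  obtain n0 a0 where 0: "n0\<in>cG" "a0\<in>carrier A" "f = F (n0, a0)" using f by auto
  have "{y\<in>cG\<times>carrier A. F y = f} \<subseteq> (\<lambda>z. (n0\<otimes>z, a0)) ` sylow5_kernel"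
  proof
   fix y assume "y\<in>{y\<in>cG\<times>carrier A. F y = f}"
   then obtain n a where y: "y = (n, a)" and na: "n\<in>cG" "a\<in>carrier A" "F (n, a) = f" by auto
   let ?b = "inv\<^bsub>A\<^esub> a0"
   let ?m = "inv n0\<otimes>n"
   have m: "?m\<in>cG" using 0 na by simp
   have b: "?b\<in>carrier A" using 0 by simp
   \<comment> \<open>For two pairs with the same permutation, \<open>q\<close> applies
     \<open>lam a\<close>, the quotient of the two conjugations and the inverse of
     \<open>lam a0\<close>. It fixes every Sylow 5-subgroup, hence is the identity, and
     \<open>?c\<close> acts as conjugation by \<open>?m\<close>.\<close>
   define q where "q = (\<lambda>x. lam ?b (?m\<otimes>lam a x\<otimes>inv ?m))"
   have "q\<in>hom G G"
    unfolding q_def using b m lc na lmult conj_elt_hom[OF m] by (intro homI) auto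
   moreover have "q ` P = P" if P: "P\<in>?S" for P
   proof -
    have l: "lam a ` P \<subseteq> cG" "lam a0 ` P \<subseteq> cG" using lc na 0 psubs_subset[OF P] by blast+
    have e: "conj_set G n (lam a ` P) = conj_set G n0 (lam a0 ` P)"
     using fun_cong[OF na(3)[unfolded 0(3)], of P] P by (simp add: F_def)
    have "conj_set G ?m (lam a ` P) = conj_set G (inv n0) (conj_set G n0 (lam a0 ` P))"
     using e conj_set_mult[of "inv n0" n "lam a ` P"] 0 na l by simp
    also have "... = lam a0 ` P"
     using conj_set_mult[of "inv n0" n0 "lam a0 ` P"] 0 l conj_set_one by simp
    finally have "(\<lambda>x. ?m\<otimes>lam a x\<otimes>inv ?m) ` P = lam a0 ` P" by (simp add: conj_auto_image)
    hence "q ` P = lam ?b ` lam a0 ` P" unfolding q_def by (metis image_image)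
    also have "... = id ` P"
     unfolding image_image using lm[OF b 0(2)] l1 0 psubs_subset[OF P]
     by (intro image_cong refl) (simp flip: lm add: subset_iff)
    finally show ?thesis by simp
   qed
   ultimately have k: "q x = x" if "x\<in>cG" for x
    using perfect_auto_fixing_sylow5[OF assms(1,2)] that by blast
   let ?c = "a0\<otimes>\<^bsub>A\<^esub> inv\<^bsub>A\<^esub> a"
   have inner: "lam ?c y = ?m\<otimes>y\<otimes>inv ?m" if y: "y\<in>cG" for y
   proof -
    let ?x = "lam (inv\<^bsub>A\<^esub> a) y"
    have x: "?x\<in>cG" "lam a ?x = y" using lc na y lm[of a "inv\<^bsub>A\<^esub> a" y] l1 by simp_all
    have "lam ?c y = lam a0 ?x" using lm[OF 0(2), of "inv\<^bsub>A\<^esub> a" y] na y by simp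
    also have "... = lam a0 (q ?x)" using k[OF x(1)] by simp
    also have "... = lam a0 (lam ?b (?m\<otimes>y\<otimes>inv ?m))" using x by (simp add: q_def)
    also have "... = ?m\<otimes>y\<otimes>inv ?m"
     using lm[of a0 ?b "?m\<otimes>y\<otimes>inv ?m"] 0 m y l1 by simp
    finally show ?thesis .
   qed
   have "?c\<in>carrier A" using 0 na by simp
   hence c1: "?c = \<one>\<^bsub>A\<^esub>" using no m inner by blast
   moreover have "a0 = ?c\<otimes>\<^bsub>A\<^esub> a" using 0 na by (simp add: A.m_assoc)
   ultimately have a: "a = a0" using na by simp
   have "?m\<otimes>y\<otimes>inv ?m = y" if "y\<in>cG" for y
    using inner[OF that] l1[OF that] c1 by simp
   hence "conj_set G ?m P = P" if "P\<in>?S" for P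
    unfolding conj_set_def using psubs_subset[OF that]
    by (subst image_cong[OF refl, where g=id]) (auto simp: subset_iff)
   hence "?m\<in>sylow5_kernel" using m by (simp add: sylow5_kernel_def)
   moreover have "n = n0\<otimes>?m" using 0 na by (simp add: m_assoc[symmetric])
   ultimately show "y\<in>(\<lambda>z. (n0\<otimes>z, a0)) ` sylow5_kernel" using a y by blast
  qed
  hence "card {y\<in>cG\<times>carrier A. F y = f} \<le> card sylow5_kernel"
   using finZ by (meson card_image_le card_mono finite_imageI le_trans)
  thus ?thesis using card_sylow5_kernel[OF assms(1,2)] by simp
 qed
 let ?I = "F ` (cG\<times>carrier A)"
 have "?I \<subseteq> {p. p permutes ?S}" using Fperm by auto
 hence "card ?I \<le> fact 6"
  using card_mono[OF finite_permutations[OF finS]] card_permutations[OF psubs5_perfect[OF assms(1,2)] finS] by metis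
 have "cG\<times>carrier A = (\<Union>f\<in>?I. {y\<in>cG\<times>carrier A. F y = f})" by auto
 hence "card (cG\<times>carrier A) \<le> (\<Sum>f\<in>?I. card {y\<in>cG\<times>carrier A. F y = f})"
  using card_UN_le[of ?I "\<lambda>f. {y\<in>cG\<times>carrier A. F y = f}"] fin finA by simp
 also have "... \<le> (\<Sum>f\<in>?I. 4)" using fiber by (intro sum_mono)
 also have "... \<le> 4 * fact 6" using \<open>card ?I \<le> fact 6\<close> by simp
 also have "... = 2880" by (simp add: fact_numeral)
 finally have "order G * 60 \<le> 2880" using assms(3) by (simp add: card_cartesian_product order_def)
 thus False using assms(2) by auto
qed

text \<open>A Sylow \<open>p\<close>-subgroup inside \<open>J\<close> brings all its conjugates with
  it; they meet pairwise in the unit and contribute \<open>p - 1\<close> elements each.\<close>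

lemma card_normal_ge:
 assumes "J \<lhd> G" "finite cG" "prime p" "p dvd order G" "\<not> p ^ 2 dvd order G" "p dvd card J"
 shows "1 + card (psubs G p) * (p - 1) \<le> card J"
proof -
 have J: "subgroup J G" using assms(1) by (simp add: normal_inv_iff)
 have finJ: "finite J" using assms(2) subgroup.subset[OF J] finite_subset by blast
 obtain m where m: "card J = p * m" using assms(6) by (rule dvdE)
 obtain P where P: "subgroup P (G\<lparr>carrier := J\<rparr>)" "card P = p"
  using sylow_thm[OF assms(3) subgroup.subgroup_is_group[OF J is_group], of 1 m] m finJ by (auto simp: order_def)
 have P': "P\<in>psubs G p" "P \<subseteq> J"
  using incl_subgroup[OF J P(1)] P subgroup.subset[OF P(1)] by (auto simp: psubs_def)
 let ?U = "\<Union>Q\<in>psubs G p. Q - {\<one>}"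
 have "Q \<subseteq> J" if "Q\<in>psubs G p" for Q
  using sylow_prime(3)[OF assms(2-5) P'(1) that] normal_conj_set[OF assms(1) P'(2)] by auto
 hence "insert \<one> ?U \<subseteq> J" using subgroup.one_closed[OF J] by auto
 hence "card (insert \<one> ?U) \<le> card J" using finJ card_mono by blast
 moreover have "card (insert \<one> ?U) = 1 + card ?U"
  using \<open>insert \<one> ?U \<subseteq> J\<close> finJ by (subst card_insert_disjoint) (auto intro: finite_subset)
 moreover have "card ?U = (\<Sum>Q\<in>psubs G p. card (Q - {\<one>}))"
 proof (rule card_UN_disjoint)
  show "\<forall>Q\<in>psubs G p. finite (Q - {\<one>})" by (auto intro: finite_subset[OF psubs_subset assms(2)])
  show "\<forall>i\<in>psubs G p. \<forall>j\<in>psubs G p. i ~= j \<longrightarrow> (i - {\<one>}) \<inter> (j - {\<one>}) = {}"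
   using prime_card_Int[OF _ _ assms(3)] by blast
 qed (rule finite_psubs[OF assms(2)])
 moreover have "(\<Sum>Q\<in>psubs G p. card (Q - {\<one>})) = (\<Sum>Q\<in>psubs G p. p - 1)"
  by (intro sum.cong refl) (auto simp: psubs_def subgroup.one_closed)
 ultimately show ?thesis by simp
qed

text \<open>A normal subgroup with at least 15 elements has index at most four and is everything;
  one with at most five elements is central, hence trivial. The prime divisors of the order of
  \<open>J\<close> lead to one of these: six Sylow 5-subgroups give 25 elements, seven Sylow
  3-subgroups give 15, and without the primes 5 and 3 the order divides 4.\<close>

lemma perfect60_simple:
 assumes "perfect G" "order G = 60" "centreless G" "J \<lhd> G" "J ~= {\<one>}"
 shows "J = cG"
proof -
 have fin: "finite cG" using assms(2) by (auto simp: order_def intro: card_ge_0_finite)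
 have J: "subgroup J G" using assms(4) by (simp add: normal_inv_iff)
 have finJ: "finite J" using fin subgroup.subset[OF J] finite_subset by blast
 have large: "J = cG" if "card J \<ge> 15"
  using perfect_subset_small_index[OF is_group subgroup_self _ J fin] assms(1,2) that subgroup.subset[OF J]
  by (auto simp: order_def)
 have trivial: "K = {\<one>}" if K: "K \<lhd> G" "card K \<le> 5" for K
 proof -
  have sK: "subgroup K G" using K by (simp add: normal_inv_iff)
  have "finite K" using fin subgroup.subset[OF sK] finite_subset by blast
  hence "x = \<one>" if x: "x\<in>K" for x
   using perfect_conj_trivial[OF assms(1) K(1) _ K(2) _ x] assms(3)[unfolded centreless_def, rule_format, OF subgroup.mem_carrier[OF sK x]]
   by simp
  thus ?thesis using subgroup.one_closed[OF sK] by blast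
 qed
 consider "5 dvd card J" | "3 dvd card J" | "\<not> 5 dvd card J" "\<not> 3 dvd card J" by blast
 thus ?thesis
 proof cases
  case 1
  thus ?thesis
   using card_normal_ge[OF assms(4) fin, of 5] assms(2) psubs5_perfect[OF assms(1)] large
   by (simp add: prime_nat_numeral_eq)
 next
  case 2
  have p: "prime (3::nat)" "3 dvd order G" "\<not> 3 ^ 2 dvd order G" using assms(2) by (simp_all add: prime_nat_numeral_eq)
  note S = sylow_prime[OF fin p]
  have ge: "1 + card (psubs G 3) * 2 \<le> card J" using card_normal_ge[OF assms(4) fin p 2] by simp
  show ?thesis
  proof (cases "card (psubs G 3) \<ge> 7")
   \<comment> \<open>Fewer than seven Sylow 3-subgroups means at most four. All of them are then
     fixed by \<open>G\<close>, so one of them is normal of order three, which is too small.\<close>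
   case False
   hence "card (psubs G 3) \<le> 4" using S(1) by presburger
   hence fixed: "conj_set G g P = P" if "g\<in>cG" "P\<in>psubs G 3" for g P
    using perfect_acts_on_le4[OF assms(1) acts_on_psubs finite_psubs[OF fin]] that by blast
   obtain P where P: "P\<in>psubs G 3" using S(2) by blast
   have "P \<lhd> G" using P fixed[OF _ P] by (auto simp: normal_inv_iff psubs_def conj_set_def)
   hence "P = {\<one>}" using trivial P by (simp add: psubs_def)
   thus ?thesis using P by (simp add: psubs_def)
  qed (use ge large in simp)
 next
  case 3
  have "card J dvd 4 * (3 * 5)" using card_subgroup_dvd[OF J subgroup_self] subgroup.subset[OF J] assms(2) by (simp add: order_def)
  moreover have "coprime (card J) 3" "coprime (card J) 5"
   using 3 prime_imp_coprime[of 3 "card J"] prime_imp_coprime[of 5 "card J"]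
   by (simp_all add: prime_nat_numeral_eq coprime_commute)
  ultimately have "card J dvd 4" by (metis coprime_dvd_mult_left_iff coprime_mult_right_iff)
  hence "card J \<le> 4" by (rule dvd_imp_le) simp
  thus ?thesis using trivial[OF assms(4)] assms(5) by simp
 qed
qed

text \<open>The elements acting by inner automorphisms form a normal subgroup of \<open>A\<close>,
  because \<open>lam b\<close> turns conjugation by \<open>n\<close> into conjugation by
  \<open>lam b n\<close>. It is nontrivial by \<open>exists_inner_action\<close>, and
  \<open>A\<close> is simple.\<close>

lemma action_inner:
 assumes "perfect G" "order G = 60 \<or> order G = 120"
  and A: "perfect A" "order A = 60" "centreless A"
  and act: "acts_on A cG lam" and hom: "!!a. a\<in>carrier A ==> lam a\<in>hom G G"
  and "a\<in>carrier A"
 shows "\<exists>n\<in>cG. \<forall>x\<in>cG. lam a x = n\<otimes>x\<otimes>inv n"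
proof -
 interpret A: group A using act by (simp add: acts_on_def)
 define J where "J = {a\<in>carrier A. \<exists>n\<in>cG. \<forall>x\<in>cG. lam a x = n\<otimes>x\<otimes>inv n}"
 have lc: "lam a x\<in>cG" if "a\<in>carrier A" "x\<in>cG" for a x
  using act that by (simp add: acts_on_def)
 have lm: "lam (a\<otimes>\<^bsub>A\<^esub> b) x = lam a (lam b x)" if "a\<in>carrier A" "b\<in>carrier A" "x\<in>cG" for a b x
  using act that by (simp add: acts_on_def)
 have l1: "lam \<one>\<^bsub>A\<^esub> x = x" if "x\<in>cG" for x using act that by (simp add: acts_on_def)
 have gh: "group_hom G G (lam a)" if "a\<in>carrier A" for a
  using hom[OF that] by (intro group_hom.intro is_group group_hom_axioms.intro)
 have conj: "lam a (n\<otimes>x\<otimes>inv n) = lam a n\<otimes>lam a x\<otimes>inv (lam a n)"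
  if "a\<in>carrier A" "n\<in>cG" "x\<in>cG" for a n x
 proof -
  interpret l: group_hom G G "lam a" by (rule gh[OF that(1)])
  show ?thesis using that by simp
 qed
 have "subgroup J A"
 proof (rule A.subgroupI)
  show "J ~= {}" using l1 A.one_closed by (auto simp: J_def intro!: exI[of _ "\<one>\<^bsub>A\<^esub>"] bexI[of _ "\<one>"])
 next
  fix a assume "a\<in>J"
  then obtain n where a: "a\<in>carrier A" and n: "n\<in>cG" "!!x. x\<in>cG ==> lam a x = n\<otimes>x\<otimes>inv n"
   by (auto simp: J_def)
  have "lam (inv\<^bsub>A\<^esub> a) x = inv n\<otimes>x\<otimes>inv (inv n)" if x: "x\<in>cG" for x
  proof -
   have "n\<otimes>lam (inv\<^bsub>A\<^esub> a) x\<otimes>inv n = x"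
    using n(2)[OF lc[of "inv\<^bsub>A\<^esub> a" x]] lm[of a "inv\<^bsub>A\<^esub> a" x] l1 a x by simp
   thus ?thesis using conj_elt_inv_cancel(1)[OF n(1) lc[of "inv\<^bsub>A\<^esub> a" x]] a x n(1) by simp
  qed
  thus "inv\<^bsub>A\<^esub> a\<in>J" using a n(1) by (auto simp: J_def intro!: bexI[of _ "inv n"])
  fix b assume "b\<in>J"
  then obtain m where b: "b\<in>carrier A" and m: "m\<in>cG" "!!x. x\<in>cG ==> lam b x = m\<otimes>x\<otimes>inv m"
   by (auto simp: J_def)
  have "lam (a\<otimes>\<^bsub>A\<^esub> b) x = (n\<otimes>m)\<otimes>x\<otimes>inv (n\<otimes>m)" if "x\<in>cG" for x
   using lm[OF a b that] n m that conj_elt_mult[OF n(1) m(1) that] by simp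
  thus "a\<otimes>\<^bsub>A\<^esub> b\<in>J" using a b n(1) m(1) by (auto simp: J_def intro!: bexI[of _ "n\<otimes>m"])
 qed (auto simp: J_def)
 moreover have "b\<otimes>\<^bsub>A\<^esub> a\<otimes>\<^bsub>A\<^esub> inv\<^bsub>A\<^esub> b\<in>J" if b: "b\<in>carrier A" and aJ: "a\<in>J" for a b
 proof -
  obtain n where a: "a\<in>carrier A" and n: "n\<in>cG" "!!x. x\<in>cG ==> lam a x = n\<otimes>x\<otimes>inv n"
   using aJ by (auto simp: J_def)
  have "lam (b\<otimes>\<^bsub>A\<^esub> a\<otimes>\<^bsub>A\<^esub> inv\<^bsub>A\<^esub> b) x = lam b n\<otimes>x\<otimes>inv (lam b n)" if x: "x\<in>cG" for x
  proof -
   have "lam (b\<otimes>\<^bsub>A\<^esub> a\<otimes>\<^bsub>A\<^esub> inv\<^bsub>A\<^esub> b) x = lam b (lam a (lam (inv\<^bsub>A\<^esub> b) x))"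
    using a b x lc by (simp add: lm)
   also have "... = lam b n\<otimes>lam b (lam (inv\<^bsub>A\<^esub> b) x)\<otimes>inv (lam b n)"
    using n lc[of "inv\<^bsub>A\<^esub> b" x] b x conj by simp
   also have "lam b (lam (inv\<^bsub>A\<^esub> b) x) = x" using lm[of b "inv\<^bsub>A\<^esub> b" x] b x l1 by simp
   finally show ?thesis .
  qed
  thus ?thesis using a b lc[OF b n(1)] by (auto simp: J_def intro!: bexI[of _ "lam b n"])
 qed
 ultimately have "J \<lhd> A" by (simp add: A.normal_inv_iff)
 moreover have "J ~= {\<one>\<^bsub>A\<^esub>}"
  using exists_inner_action[OF assms(1,2) A(2) act hom] by (auto simp: J_def)
 ultimately have "J = carrier A" using A.perfect60_simple[OF A] by blast
 thus ?thesis using assms(8) by (auto simp: J_def)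
qed

end

section \<open>Index two and the prime parts of the abelianisation\<close>

context group
begin

lemma subgroup_nat_pow_closed: "subgroup H G ==> x\<in>H ==> x [^] (n::nat)\<in>H"
 by (induction n) (auto simp: subgroup.one_closed subgroup.m_closed)

text \<open>Otherwise the cosets of the unit, of \<open>x\<close> and of its square would be three
  different ones.\<close>

lemma square_in_index_2_subgroup:
 assumes "subgroup A G" "order G = 2 * card A" "x\<in>cG" "card A > 0"
 shows "x\<otimes>x\<in>A"
proof (rule ccontr)
 have c2: "card (rcosets A) = 2" using lagrange[OF assms(1)] assms(2,4) by simp
 have fc: "finite (rcosets A)" using c2 by (metis card.infinite zero_neq_numeral)
 have x: "x\<in>cG" by fact
 assume n: "x\<otimes>x \<notin> A"
 hence n1: "x \<notin> A" using subgroup.m_closed[OF assms(1)] by blast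
 have ne: "A #> y ~= A #> z" if "y\<otimes>inv z \<notin> A" "y\<in>cG" "z\<in>cG" for y z
  using that rcos_self[OF that(2) assms(1)] subgroup.rcos_module_imp[OF assms(1) is_group that(3), of y] by auto
 have "x\<otimes>inv (x\<otimes>x) \<notin> A"
  using n1 x subgroup.m_inv_closed[OF assms(1), of "inv x"] by (auto simp: inv_mult_group m_assoc[symmetric])
 hence "card {A #> \<one>, A #> x, A #> (x\<otimes>x)} = 3"
  using ne[of x "\<one>"] ne[of "x\<otimes>x" "\<one>"] ne[of x "x\<otimes>x"] n n1 x by auto
 moreover have "{A #> \<one>, A #> x, A #> (x\<otimes>x)} \<subseteq> rcosets A"
  using x by (auto simp: RCOSETS_def)
 ultimately have "3 \<le> card (rcosets A)" using card_mono[OF fc] by metis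
 thus False using c2 by simp
qed

lemma card_hom_image: "group_hom G Q f ==> card (f ` cG) * card (kernel G Q f) = order G"
proof -
 assume "group_hom G Q f"
 then interpret f: group_hom G Q f .
 let ?J = "Q\<lparr>carrier := f ` cG\<rparr>"
 interpret J: group ?J by (rule subgroup.subgroup_is_group[OF f.img_is_subgroup f.H.is_group])
 interpret f': group_hom G ?J f
  by (intro group_hom.intro is_group J.is_group group_hom_axioms.intro homI) auto
 have "kernel G ?J f = kernel G Q f" by (simp add: kernel_def)
 hence "G Mod kernel G Q f \<cong> ?J" using f'.FactGroup_iso by simp
 hence "card (rcosets (kernel G Q f)) = card (f ` cG)"
  using iso_same_card by (fastforce simp: FactGroup_def)
 thus ?thesis using lagrange[OF f.subgroup_kernel] by simp
qed

text \<open>A prime dividing both the order and \<open>j\<close> would give an element of that prime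
  order, and its order would also divide \<open>p ^ k\<close>.\<close>

lemma card_exponent_prime_power:
 assumes "finite cG" "order G dvd p ^ k * j" "prime p" "coprime p j"
  "!!y. y\<in>cG ==> y [^] (p ^ k) = \<one>"
 shows "order G dvd p ^ k"
proof -
 have "coprime (order G) j"
 proof (rule ccontr)
  assume "\<not> coprime (order G) j"
  hence "gcd (order G) j ~= 1" by (simp add: coprime_iff_gcd_eq_1)
  then obtain r where r: "prime r" "r dvd gcd (order G) j" using prime_factor_nat by blast
  then obtain m where m: "order G = r * m" by (auto elim: dvdE)
  obtain H where H: "subgroup H G" "card H = r"
   using sylow_thm[OF r(1) is_group, of 1 m] m assms(1) by auto
  have "H ~= {\<one>}" using H r(1) by auto
  then obtain y where y: "y\<in>H" "y ~= \<one>" using subgroup.one_closed[OF H(1)] by blast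
  have yG: "y\<in>cG" using subgroup.mem_carrier[OF H(1) y(1)] .
  interpret H: group "G\<lparr>carrier := H\<rparr>" by (rule subgroup.subgroup_is_group[OF H(1) is_group])
  have "y [^] r = \<one>" using H.pow_order_eq_1[of y] y H(2) by (simp add: order_def nat_pow_def)
  hence d: "ord y dvd r" "ord y dvd p ^ k" using pow_eq_id[OF yG] assms(5)[OF yG] by auto
  have "r ~= p" using assms(3,4) r by (metis coprime_common_divisor_nat dvd_refl gcd_nat.boundedE not_prime_1)
  hence "coprime r (p ^ k)" using primes_coprime_nat[OF r(1) assms(3)] by simp
  hence "ord y = 1" using d by (metis coprime_common_divisor_nat)
  thus False using ord_eq_1[OF yG] y(2) by simp
 qed
 thus ?thesis using assms(2) by (simp add: coprime_dvd_mult_left_iff)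
qed

text \<open>For a prime power \<open>p ^ k\<close> exactly dividing the order, with cofactor \<open>j\<close>, the map
 \<open>x \<mapsto> x ^ j\<close> into the abelianisation has its \<open>p\<close>-part as image.\<close>

lemma abelianisation_prime_part:
 assumes fin: "finite cG" and o: "order G = p ^ k * j" and p: "prime p" "coprime p j"
 shows "\<exists>(Q :: 'a set monoid) f. comm_group Q \<and> group_hom G Q f \<and>
  kernel G Q f = {x\<in>cG. x [^] j\<in>derived G cG} \<and> card (f ` cG) dvd p ^ k"
proof -
 define Q where "Q = G Mod derived G cG"
 interpret Q: comm_group Q unfolding Q_def by (rule derived_quot_is_comm_group)
 define q where "q = (\<lambda>x. derived G cG #> x)"
 have q: "q\<in>hom G Q" unfolding q_def Q_def by (rule normal.r_coset_hom_Mod[OF derived_self_is_normal])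
 interpret q: group_hom G Q q using q by (intro group_hom.intro is_group Q.is_group group_hom_axioms.intro)
 have sD: "subgroup (derived G cG) G" using derived_self_is_normal by (simp add: normal_inv_iff)
 have q1: "q x = \<one>\<^bsub>Q\<^esub> \<longleftrightarrow> x\<in>derived G cG" if "x\<in>cG" for x
  using coset_join1[OF _ that sD] coset_join2[OF that sD] by (auto simp: q_def Q_def)
 \<comment> \<open>Raising to the power \<open>j\<close> kills the part of the abelianisation prime
   to \<open>p\<close>; what remains has exponent dividing \<open>p ^ k\<close>.\<close>
 define f where "f = (\<lambda>x. q x [^]\<^bsub>Q\<^esub> j)"
 interpret f: group_hom G Q f
  unfolding f_def
  by (intro group_hom.intro is_group Q.is_group group_hom_axioms.intro homI) (simp_all add: Q.nat_pow_distrib)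
 have f: "f x = q (x [^] j)" if "x\<in>cG" for x using that by (simp add: f_def q.hom_nat_pow)
 have "kernel G Q f = {x\<in>cG. x [^] j\<in>derived G cG}"
  unfolding kernel_def using f q1[OF nat_pow_closed] by blast
 moreover have "card (f ` cG) dvd p ^ k"
 proof -
  let ?J = "Q\<lparr>carrier := f ` cG\<rparr>"
  interpret J: group ?J by (rule subgroup.subgroup_is_group[OF f.img_is_subgroup Q.is_group])
  have "y [^]\<^bsub>?J\<^esub> (p ^ k) = \<one>\<^bsub>?J\<^esub>" if y: "y\<in>carrier ?J" for y
  proof -
   obtain x where x: "x\<in>cG" "y = f x" using y by auto
   have "f x [^]\<^bsub>Q\<^esub> (p ^ k) = q (x [^] order G)"
    using x o by (simp add: f_def Q.nat_pow_pow q.hom_nat_pow mult.commute)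
   also have "... = \<one>\<^bsub>Q\<^esub>" using x pow_order_eq_1 by simp
   finally show ?thesis using x by (simp add: nat_pow_def)
  qed
  moreover have "order ?J dvd p ^ k * j"
   using card_hom_image[OF f.group_hom_axioms] o by (metis dvd_triv_left order_def partial_object.select_convs(1) partial_object.surjective partial_object.update_convs(1))
  ultimately have "order ?J dvd p ^ k" using J.card_exponent_prime_power[OF _ _ p] fin by simp
  thus ?thesis by (simp add: order_def)
 qed
 ultimately show ?thesis using Q.comm_group_axioms f.group_hom_axioms by (intro exI[of _ Q] exI[of _ f] conjI)
qed

end

section \<open>Skew braces\<close>

locale skew_brace = N: group N + G: group G
 for N :: "('a, 'b) monoid_scheme" (structure) and G :: "('a, 'c) monoid_scheme" +
 assumes carrier_eq: "carrier G = carrier N"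
  and one_eq: "\<one>\<^bsub>G\<^esub> = \<one>"
  and brace: "[|a\<in>carrier N; b\<in>carrier N; c\<in>carrier N|]
   ==> a\<otimes>\<^bsub>G\<^esub> (b\<otimes>c) = (a\<otimes>\<^bsub>G\<^esub> b)\<otimes>inv a\<otimes>(a\<otimes>\<^bsub>G\<^esub> c)"
begin

abbreviation G_mult (infixl "\<bullet>" 70) where "x\<bullet>y \<equiv> x\<otimes>\<^bsub>G\<^esub> y"
abbreviation G_inv ("iG _" [81] 80) where "iG x \<equiv> inv\<^bsub>G\<^esub> x"
abbreviation "cN \<equiv> carrier N"
abbreviation "cG \<equiv> carrier G"

definition lam :: "'a => 'a => 'a" where
 "lam a b = inv a\<otimes>(a\<bullet>b)"

lemma G_closed [simp]: "a\<in>cN ==> b\<in>cN ==> a\<bullet>b\<in>cN"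
 using G.m_closed by (simp add: carrier_eq)

lemma G_inv_closed [simp]: "a\<in>cN ==> iG a\<in>cN"
 using G.inv_closed by (simp add: carrier_eq)

lemma lam_closed [simp]: "a\<in>cN ==> b\<in>cN ==> lam a b\<in>cN"
 by (simp add: lam_def)

lemma G_mult: "a\<in>cN ==> b\<in>cN ==> a\<bullet>b = a\<otimes>lam a b"
 by (simp add: lam_def N.m_assoc[symmetric])

lemma lam_mult:
 "a\<in>cN ==> b\<in>cN ==> c\<in>cN ==> lam a (b\<otimes>c) = lam a b\<otimes>lam a c"
 by (simp add: lam_def brace N.m_assoc)

lemma lam_hom: "a\<in>cN ==> group_hom N N (lam a)"
 by (intro group_hom.intro N.is_group group_hom_axioms.intro homI) (simp_all add: lam_mult)

lemma lam_comp:
 assumes "a\<in>cN" "b\<in>cN" "c\<in>cN"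
 shows "lam (a\<bullet>b) c = lam a (lam b c)"
proof -
 interpret l: group_hom N N "lam a" by (rule lam_hom[OF assms(1)])
 have "lam a (lam b c) = inv (lam a b)\<otimes>lam a (b\<bullet>c)"
  unfolding lam_def[of b] using assms by simp
 also have "... = inv (a\<bullet>b)\<otimes>(a\<otimes>(inv a\<otimes>(a\<bullet>(b\<bullet>c))))"
  unfolding lam_def using assms by (simp add: N.inv_mult_group N.m_assoc)
 also have "... = inv (a\<bullet>b)\<otimes>(a\<bullet>(b\<bullet>c))"
  using assms by (simp add: N.m_assoc[symmetric])
 finally show ?thesis using assms by (simp add: lam_def G.m_assoc carrier_eq)
qed

lemma lam_one: "b\<in>cN ==> lam \<one> b = b"
 using G.l_one[of b] by (simp add: lam_def one_eq carrier_eq)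

lemma lam_acts: "acts_on G cN lam"
 by (simp add: acts_on_def G.is_group carrier_eq one_eq lam_one lam_comp)

lemma lam_acts_subgroup: "subgroup A G ==> acts_on (G\<lparr>carrier := A\<rparr>) cN lam"
 using G.acts_on_subgroup[OF lam_acts, of A "cN"] subgroup.subset[of A G]
 by (simp add: carrier_eq subset_iff)

text \<open>Closure comes from \<open>G_mult\<close>. For the inverse, \<open>lam a\<close> sends
  the \<open>G\<close>-inverse of \<open>a\<close> to its \<open>N\<close>-inverse, so
  \<open>lam\<close> at the \<open>G\<close>-inverse sends the \<open>N\<close>-inverse
  back.\<close>

lemma invariant_subgroup:
 assumes "subgroup E N" "!!a e. a\<in>cN ==> e\<in>E ==> lam a e\<in>E"
 shows "subgroup E G"
proof (rule G.subgroupI)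
 show "E \<subseteq> cG" using subgroup.subset[OF assms(1)] by (simp add: carrier_eq)
 show "E ~= {}" using subgroup.one_closed[OF assms(1)] by auto
 fix a assume a: "a\<in>E"
 hence aN: "a\<in>cN" using subgroup.mem_carrier[OF assms(1)] by simp
 let ?x = "iG a"
 have "a\<otimes>lam a ?x = \<one>" using G_mult[OF aN, of ?x] aN by (simp add: carrier_eq one_eq)
 hence "lam a ?x = inv a" using aN by (metis G_inv_closed N.inv_equality N.inv_inv N.inv_comm lam_closed)
 hence "lam ?x (inv a) = ?x"
  using lam_comp[of ?x a ?x] aN lam_one[of ?x] by (simp add: carrier_eq one_eq)
 thus "?x\<in>E" using assms(2)[of ?x "inv a"] aN subgroup.m_inv_closed[OF assms(1) a] by simp
 fix b assume b: "b\<in>E"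
 hence "b\<in>cN" using subgroup.mem_carrier[OF assms(1)] by simp
 thus "a\<bullet>b\<in>E"
  using G_mult[OF aN] subgroup.m_closed[OF assms(1) a assms(2)[OF aN b]] by simp
qed

lemma lam_bij: "a\<in>cN ==> bij_betw (lam a) cN cN"
 using acts_on_bij[OF lam_acts] by (simp add: carrier_eq)

text \<open>This is the \<open>lam\<close> action of the opposite brace, in which the multiplication
  of \<open>N\<close> is reversed. Its kernel consists of the \<open>a\<close> with
  \<open>a \<bullet> x = x \<otimes> a\<close> for all \<open>x\<close>, the mirror image of the
  kernel of \<open>lam\<close>.\<close>

lemma op_acts: "acts_on G cN (\<lambda>a x. (a\<bullet>x)\<otimes>inv a)"
proof -
 have "(a\<bullet>b\<bullet>x)\<otimes>inv (a\<bullet>b) = (a\<bullet>((b\<bullet>x)\<otimes>inv b))\<otimes>inv a"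
  if c: "a\<in>cN" "b\<in>cN" "x\<in>cN" for a b x
 proof -
  have "a = a\<bullet>(b\<otimes>inv b)" using c G.r_one[of a] by (simp add: carrier_eq one_eq)
  also have "... = (a\<bullet>b)\<otimes>(inv a\<otimes>(a\<bullet>inv b))" using brace[of a b "inv b"] c by (simp add: N.m_assoc)
  finally have "inv (a\<bullet>b)\<otimes>a = inv a\<otimes>(a\<bullet>inv b)"
   using c N.inv_solve_left'[of "inv a\<otimes>(a\<bullet>inv b)" "a\<bullet>b" a] by simp
  hence "a\<bullet>((b\<bullet>x)\<otimes>inv b) = (a\<bullet>(b\<bullet>x))\<otimes>(inv (a\<bullet>b)\<otimes>a)"
   using brace[of a "b\<bullet>x" "inv b"] c by (simp add: N.m_assoc)
  thus ?thesis using c G.m_assoc[of a b x] by (simp add: N.m_assoc carrier_eq)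
 qed
 moreover have "\<one>\<bullet>x = x" if "x\<in>cN" for x using G.l_one[of x] that by (simp add: carrier_eq one_eq)
 ultimately show ?thesis using G.is_group by (auto simp: acts_on_def carrier_eq one_eq)
qed

lemma lam_derived:
 assumes "a\<in>cN" "x\<in>derived N cN"
 shows "lam a x\<in>derived N cN"
proof -
 interpret l: group_hom N N "lam a" by (rule lam_hom[OF assms(1)])
 have "lam a ` cN = cN" using lam_bij[OF assms(1)] by (simp add: bij_betw_def)
 thus ?thesis using l.derived_img[of "cN"] assms(2) by auto
qed

text \<open>\<open>E\<close> is described by powers and the derived subgroup, so every automorphism
  of \<open>N\<close> preserves it. It is therefore a subgroup for both multiplications, and its
  index can be exploited in \<open>G\<close>.\<close>

lemma abelian_quotient_prime_part:
 assumes "finite cN" "order N = p ^ k * j" "prime p" "coprime p j"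
 defines "E \<equiv> {x\<in>cN. x [^] j\<in>derived N cN}"
 shows "\<exists>(Q :: 'a set monoid) f. comm_group Q \<and> group_hom N Q f \<and> E = kernel N Q f \<and>
  subgroup E G \<and> (\<forall>a\<in>cN. \<forall>e\<in>E. lam a e\<in>E) \<and>
  card (f ` cN) dvd p ^ k \<and> card (f ` cN) * card E = order N"
proof -
 obtain Q :: "'a set monoid" and f where Q: "comm_group Q" "group_hom N Q f" "E = kernel N Q f" "card (f ` cN) dvd p ^ k"
  using N.abelianisation_prime_part[OF assms(1-4)] unfolding E_def by auto
 interpret f: group_hom N Q f by (rule Q(2))
 have lE: "lam a e\<in>E" if "a\<in>cN" "e\<in>E" for a e
 proof -
  interpret l: group_hom N N "lam a" by (rule lam_hom[OF that(1)])
  show ?thesis using that lam_derived[OF that(1), of "e [^] j"] by (simp add: E_def l.hom_nat_pow)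
 qed
 have "subgroup E N" unfolding Q(3) by (rule f.subgroup_kernel)
 moreover have "card (f ` cN) * card E = order N"
  using N.card_hom_image[OF Q(2)] by (simp add: Q(3))
 moreover have "subgroup E G" by (rule invariant_subgroup[OF \<open>subgroup E N\<close> lE])
 ultimately have "comm_group Q \<and> group_hom N Q f \<and> E = kernel N Q f \<and>
  subgroup E G \<and> (\<forall>a\<in>cN. \<forall>e\<in>E. lam a e\<in>E) \<and>
  card (f ` cN) dvd p ^ k \<and> card (f ` cN) * card E = order N"
  by (intro conjI ballI Q lE)
 thus ?thesis by (intro exI)
qed

end

section \<open>Braces whose second group contains a perfect subgroup of order 60\<close>

locale alternating_brace = skew_brace N G for N (structure) and G +
 fixes A
 assumes A: "subgroup A G" "perfect (G\<lparr>carrier := A\<rparr>)" "order (G\<lparr>carrier := A\<rparr>) = 60"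
   "centreless (G\<lparr>carrier := A\<rparr>)"
  and order: "order N = 60 \<or> order N = 120"
begin

lemma fin: "finite cN"
 using order by (auto simp: order_def intro: card_ge_0_finite)

lemma card_A: "card A = 60" using A(3) by (simp add: order_def)

lemma A_subset: "A \<subseteq> cN" using subgroup.subset[OF A(1)] by (simp add: carrier_eq)

lemma A_subset_small_index:
 assumes "subgroup E G" "order N \<le> 4 * card E" shows "A \<subseteq> E"
 using perfect_subset_small_index[OF G.is_group A(1,2) assms(1)] fin assms(2)
 by (simp add: carrier_eq order_def)

lemma card_ge_A: "subgroup E G ==> A \<subseteq> E ==> 60 \<le> card E"
 using card_mono[of E A] card_A finite_subset[OF subgroup.subset fin[folded carrier_eq]] by simp

text \<open>Index five is out of reach of the small-index argument. Instead, a quotient of order 5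
  has four nontrivial elements, on which \<open>A\<close> acts trivially. Then \<open>f\<close> is a
  homomorphism on \<open>A\<close> for \<open>\<bullet>\<close> as well, so \<open>A\<close> lies in
  the kernel \<open>E\<close>, which would have at most 24 elements.\<close>

lemma index_not5:
 assumes "order N = 5 * j" "\<not> 5 dvd j" defines "E \<equiv> {x\<in>cN. x [^] j\<in>derived N cN}"
 shows "E = cN"
proof -
 have p: "prime (5::nat)" by (simp add: prime_nat_numeral_eq)
 have c: "coprime 5 j" using p assms(2) by (simp add: prime_imp_coprime)
 have o: "order N = 5 ^ 1 * j" using assms(1) by simp
 obtain Q :: "'a set monoid" and f where E: "comm_group Q" "group_hom N Q f" "E = kernel N Q f"
  "subgroup E G" and lE: "\<forall>a\<in>cN. \<forall>e\<in>E. lam a e\<in>E"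
  and cE: "card (f ` cN) dvd 5 ^ 1" "card (f ` cN) * card E = order N"
  using abelian_quotient_prime_part[OF fin o p c, folded E_def] by blast
 interpret Q: comm_group Q by (rule E(1))
 interpret f: group_hom N Q f by (rule E(2))
 note ker = E(3)
 define i where "i = card (f ` cN)"
 have i: "i dvd 5" "i * card E = order N" "card (f ` cN) = i" using cE by (simp_all add: i_def)
 have "i ~= 5"
 proof
  assume i5: "i = 5"
  \<comment> \<open>\<open>lam\<close> descends to the image of \<open>f\<close> because it
    preserves the kernel; this makes \<open>act\<close> independent of the chosen preimage.\<close>
  have f_lam: "f (lam a x) = f (lam a y)"
   if "a\<in>cN" "x\<in>cN" "y\<in>cN" "f x = f y" for a x y
  proof -
   have "x\<otimes>inv y\<in>E" unfolding ker kernel_def using that f.hom_closed[OF that(3)] by (simp add: Q.r_inv)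
   hence "lam a (x\<otimes>inv y)\<in>E" by (rule lE[rule_format, OF that(1)])
   moreover interpret l: group_hom N N "lam a" by (rule lam_hom[OF that(1)])
   have "lam a (x\<otimes>inv y) = lam a x\<otimes>inv (lam a y)" using that by simp
   ultimately have "f (lam a x)\<otimes>\<^bsub>Q\<^esub> inv\<^bsub>Q\<^esub> f (lam a y) = \<one>\<^bsub>Q\<^esub>"
    unfolding ker kernel_def using that by (simp)
   thus ?thesis using f.hom_closed[of "lam a x"] f.hom_closed[of "lam a y"] that
    by (simp add: Q.inv_solve_right')
  qed
  define act where "act = (\<lambda>a y. f (lam a (SOME x. x\<in>cN \<and> f x = y)))"
  have act: "act a (f x) = f (lam a x)" if "a\<in>cN" "x\<in>cN" for a x
  proof -
   have "(SOME z. z\<in>cN \<and> f z = f x)\<in>cN \<and> f (SOME z. z\<in>cN \<and> f z = f x) = f x"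
    by (rule someI[of _ x]) (use that in simp)
   thus ?thesis unfolding act_def using f_lam that by blast
  qed
  let ?I = "f ` cN - {\<one>\<^bsub>Q\<^esub>}"
  have "acts_on (G\<lparr>carrier := A\<rparr>) ?I act"
   unfolding acts_on_def
  proof (intro conjI ballI)
   show "group (G\<lparr>carrier := A\<rparr>)" using A(2) by (simp add: perfect_def)
   fix y assume "y\<in>?I"
   then obtain x where x: "x\<in>cN" "y = f x" "f x ~= \<one>\<^bsub>Q\<^esub>" by blast
   show "act \<one>\<^bsub>G\<lparr>carrier := A\<rparr>\<^esub> y = y" using x act lam_one by (simp add: one_eq)
   fix a assume "a\<in>carrier (G\<lparr>carrier := A\<rparr>)"
   hence a: "a\<in>cN" using A_subset by auto
   have "act a y ~= \<one>\<^bsub>Q\<^esub>"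
   proof
    assume "act a y = \<one>\<^bsub>Q\<^esub>"
    hence "lam a x\<in>E" using act[OF a x(1)] x a by (simp add: ker kernel_def)
    hence "lam (iG a) (lam a x)\<in>E" using lE a by simp
    hence "x\<in>E" using lam_comp[of "iG a" a x] a x lam_one by (simp add: carrier_eq one_eq)
    thus False using x by (simp add: ker kernel_def)
   qed
   thus "act a y\<in>?I" using act[OF a x(1)] x a by auto
   fix b assume "b\<in>carrier (G\<lparr>carrier := A\<rparr>)"
   hence b: "b\<in>cN" using A_subset by auto
   show "act (a\<otimes>\<^bsub>G\<lparr>carrier := A\<rparr>\<^esub> b) y = act a (act b y)"
    using x a b act lam_comp by simp
  qed
  moreover have "card ?I \<le> 4" using i(3) i5 f.hom_one N.one_closed
   by (subst card_Diff_singleton) (auto intro!: rev_image_eqI[of \<one>] )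
  moreover have "finite ?I" using fin by simp
  ultimately have "act a y = y" if "a\<in>A" "y\<in>?I" for a y
   using perfect_acts_on_le4[OF A(2), where act=act] that by simp
  hence "f (lam a x) = f x" if "a\<in>A" "x\<in>cN" for a x
   using act[of a x] that A_subset by (cases "f x = \<one>\<^bsub>Q\<^esub>") (use f_lam[of a x \<one>] group_hom.hom_one[OF lam_hom] f.hom_one in auto)
  \<comment> \<open>\<open>a \<bullet> b\<close> is the \<open>N\<close>-product of \<open>a\<close>
    and \<open>lam a b\<close>, and \<open>f\<close> no longer sees \<open>lam a\<close>.\<close>
  hence "f\<in>hom (G\<lparr>carrier := A\<rparr>) Q"
   using A_subset G_mult f.hom_closed f.hom_mult by (intro homI) (auto simp: subset_iff)
  hence "f a = \<one>\<^bsub>Q\<^esub>" if "a\<in>A" for a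
   using perfect_hom_comm[OF A(2) Q.comm_group_axioms] that by simp
  hence "A \<subseteq> E" using A_subset by (auto simp: ker kernel_def)
  hence "60 \<le> card E" using card_ge_A E(4) by blast
  thus False using i i5 order by auto
 qed
 moreover have "i = 1 \<or> i = 5" using i(1) p by (simp add: prime_nat_iff)
 ultimately have "card E = card cN" using i by (simp add: order_def)
 thus ?thesis using card_subset_eq[OF fin, of E] by (auto simp: E_def)
qed

text \<open>Index three is within reach of the small-index argument, which puts \<open>A\<close>
  into \<open>E\<close>; but a third of 60 or 120 is less than 60.\<close>

lemma index_not3:
 assumes "order N = 3 * j" "\<not> 3 dvd j" defines "E \<equiv> {x\<in>cN. x [^] j\<in>derived N cN}"
 shows "E = cN"
proof -
 have p: "prime (3::nat)" by (simp add: prime_nat_numeral_eq)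
 have c: "coprime 3 j" using p assms(2) by (simp add: prime_imp_coprime)
 have o: "order N = 3 ^ 1 * j" using assms(1) by simp
 obtain Q :: "'a set monoid" and f where E: "comm_group Q" "group_hom N Q f" "E = kernel N Q f"
  "subgroup E G" and lE: "\<forall>a\<in>cN. \<forall>e\<in>E. lam a e\<in>E"
  and cE: "card (f ` cN) dvd 3 ^ 1" "card (f ` cN) * card E = order N"
  using abelian_quotient_prime_part[OF fin o p c, folded E_def] by blast
 note sE = E(4)
 define i where "i = card (f ` cN)"
 have i: "i dvd 3" "i * card E = order N" using cE by (simp_all add: i_def)
 hence i13: "i = 1 \<or> i = 3" using p by (simp add: prime_nat_iff)
 hence "A \<subseteq> E" using A_subset_small_index[OF sE] i by auto
 hence "60 \<le> card E" using card_ge_A sE by blast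
 hence "card E = card cN" using i13 i order by (auto simp: order_def)
 thus ?thesis using card_subset_eq[OF fin, of E] by (auto simp: E_def)
qed

text \<open>Only index 8 escapes the small-index argument. Then \<open>E\<close> has order 15; being
  of odd order it lies in \<open>A\<close>, where its index is four, and the argument applies inside
  \<open>A\<close>.\<close>

lemma index_2:
 assumes "order N = 2 ^ k * 15" defines "E \<equiv> {x\<in>cN. x [^] (15::nat)\<in>derived N cN}"
 shows "A \<subseteq> E"
proof -
 have c: "coprime 2 (15::nat)" by simp
 obtain Q :: "'a set monoid" and f where E: "comm_group Q" "group_hom N Q f" "E = kernel N Q f"
  "subgroup E G" and lE: "\<forall>a\<in>cN. \<forall>e\<in>E. lam a e\<in>E"
  and cE: "card (f ` cN) dvd 2 ^ k" "card (f ` cN) * card E = order N"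
  using abelian_quotient_prime_part[OF fin assms(1) two_is_prime_nat c, folded E_def] by blast
 note sE = E(4)
 define i where "i = card (f ` cN)"
 have i: "i dvd 2 ^ k" "i * card E = order N" using cE by (simp_all add: i_def)
 have k: "k = 2 \<or> k = 3"
  using order assms(1) power_inject_exp[of "2::nat" k 2] power_inject_exp[of "2::nat" k 3] by auto
 obtain m where m: "m \<le> k" "i = 2 ^ m" using i(1) by (auto simp: divides_primepow_nat[OF two_is_prime_nat])
 hence "i \<le> 4 \<or> i = 8 \<and> k = 3" using k power_increasing[of m 2 "2::nat"] by (auto simp: le_Suc_eq numeral_eq_Suc)
 thus ?thesis
 proof
  assume "i \<le> 4"
  thus ?thesis using A_subset_small_index[OF sE] i(2) by (metis mult_le_mono1)
 next
  assume i8: "i = 8 \<and> k = 3"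
  hence cE: "card E = 15" using i assms(1) by simp
  have "E \<subseteq> A"
  proof
   fix e assume e: "e\<in>E"
   have eG: "e\<in>cG" using subgroup.mem_carrier[OF sE e] .
   have sq: "x\<bullet>x\<in>A" if x: "x\<in>cG" for x
    using G.square_in_index_2_subgroup[OF A(1) _ x] card_A assms(1) i8 by (simp add: order_def carrier_eq)
   interpret E: group "G\<lparr>carrier := E\<rparr>" by (rule subgroup.subgroup_is_group[OF sE G.is_group])
   have "e [^]\<^bsub>G\<^esub> (15::nat) = \<one>\<^bsub>G\<^esub>" using E.pow_order_eq_1[of e] e cE by (simp add: order_def nat_pow_def)
   \<comment> \<open>Since 16 is 15 plus 1, \<open>e\<close> is the square of its eighth power, and
     squares lie in the subgroup \<open>A\<close> of index two.\<close>
   hence "e [^]\<^bsub>G\<^esub> Suc 15 = e" using eG by (simp only: G.nat_pow_Suc G.l_one)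
   moreover have "Suc 15 = 8 + 8" by simp
   ultimately have "e = e [^]\<^bsub>G\<^esub> (8 + 8::nat)" by metis
   hence "e = e [^]\<^bsub>G\<^esub> (8::nat)\<bullet>e [^]\<^bsub>G\<^esub> (8::nat)" using G.nat_pow_mult[OF eG] by metis
   thus "e\<in>A" using sq[of "e [^]\<^bsub>G\<^esub> (8::nat)"] eG by simp
  qed
  have "A \<subseteq> E"
  proof -
   let ?A = "G\<lparr>carrier := A\<rparr>"
   have gA: "group ?A" using A(2) by (simp add: perfect_def)
   have "carrier ?A \<subseteq> E"
    using perfect_subset_small_index[OF gA group.subgroup_self[OF gA], of E] A(2)
     G.subgroup_incl[OF sE A(1) \<open>E \<subseteq> A\<close>] card_A cE finite_subset[OF A_subset fin] by simp
   thus ?thesis by simp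
  qed
  thus ?thesis .
 qed
qed

text \<open>With the 5-part and the 3-part of the abelianisation trivial, the derived subgroup
  equals the group \<open>E\<close> of \<open>index_2\<close>, which contains \<open>A\<close>. Its
  order is then a divisor of 60 or 120 that is at least 60.\<close>

lemma derived_cases: "derived N cN = cN \<or> order N = 120 \<and> derived N cN = A"
proof -
 let ?D = "derived N cN"
 have sD: "subgroup ?D N" by (rule N.derived_is_subgroup) simp
 obtain k :: nat where k: "order N = 2 ^ k * 15" "2 ^ k * (2 ^ (4 - k)) = (16 :: nat)" "k = 2 \<or> k = 3"
  using order that[of 2] that[of 3] by auto
 let ?q = "2 ^ k :: nat"
 have e5: "x [^] (3 * ?q)\<in>?D" if "x\<in>cN" for x
  using index_not5[of "3 * ?q"] k that by auto
 have e3: "x [^] (5 * ?q)\<in>?D" if "x\<in>cN" for x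
  using index_not3[of "5 * ?q"] k that by auto
 have eq: "x [^] ?q\<in>?D" if x: "x\<in>cN" for x
 proof -
  \<comment> \<open>The exponents \<open>3 * ?q\<close> and \<open>5 * ?q\<close> combine to
    \<open>?q\<close> because 1 = 3 + 3 - 5.\<close>
  have "x [^] ?q\<otimes>x [^] (5 * ?q) = x [^] (3 * ?q)\<otimes>x [^] (3 * ?q)"
   using x by (simp add: N.nat_pow_mult)
  hence "x [^] ?q = x [^] (3 * ?q)\<otimes>x [^] (3 * ?q)\<otimes>inv (x [^] (5 * ?q))"
   using x by (simp add: N.inv_solve_right)
  thus ?thesis using e3[OF x] e5[OF x] sD by (simp add: subgroup.m_closed subgroup.m_inv_closed)
 qed
 have DE: "?D = {x\<in>cN. x [^] (15::nat)\<in>?D}"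
 proof
  show "?D \<subseteq> {x\<in>cN. x [^] (15::nat)\<in>?D}"
   using subgroup.subset[OF sD] N.subgroup_nat_pow_closed[OF sD] by auto
  show "{x\<in>cN. x [^] (15::nat)\<in>?D} \<subseteq> ?D"
  proof safe
   fix x assume x: "x\<in>cN" "x [^] (15::nat)\<in>?D"
   \<comment> \<open>16 is a multiple of \<open>?q\<close>, and 1 = 16 - 15.\<close>
   have "x\<otimes>x [^] (15::nat) = x [^] (1 + 15 :: nat)" using x(1) N.nat_pow_mult[of x 1 15] by simp
   also have "... = (x [^] ?q) [^] (2 ^ (4 - k) :: nat)" using x(1) k(2) by (simp add: N.nat_pow_pow)
   finally have "x = (x [^] ?q) [^] (2 ^ (4 - k) :: nat)\<otimes>inv (x [^] (15::nat))"
    using x(1) by (simp add: N.inv_solve_right)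
   thus "x\<in>?D"
    using eq[OF x(1)] x(2) sD by (metis subgroup.m_closed subgroup.m_inv_closed N.subgroup_nat_pow_closed)
  qed
 qed
 hence AD: "A \<subseteq> ?D" using index_2[OF k(1)] by simp
 have finD: "finite ?D" using fin subgroup.subset[OF sD] finite_subset by blast
 have "card ?D dvd order N" using N.card_subgroup_dvd[OF sD N.subgroup_self] subgroup.subset[OF sD] by (simp add: order_def)
 moreover have "60 \<le> card ?D" using card_mono[OF finD AD] card_A by simp
 ultimately have "card ?D = order N \<or> order N = 120 \<and> card ?D = 60"
 proof -
  assume "card ?D dvd order N" "60 \<le> card ?D"
  then obtain m where "order N = card ?D * m" by (auto elim: dvdE)
  moreover have "m = 0 \<or> m = 1 \<or> m = 2 \<or> m \<ge> 3" by linarith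
  moreover have "60 * 3 \<le> card ?D * m" if "m \<ge> 3" using mult_le_mono[OF \<open>60 \<le> card ?D\<close> that] .
  ultimately show ?thesis using order \<open>60 \<le> card ?D\<close> by auto
 qed
 thus ?thesis
 proof
  assume "card ?D = order N"
  hence "?D = cN" using card_subset_eq[OF fin subgroup.subset[OF sD]] by (simp add: order_def)
  thus ?thesis by simp
 next
  assume "order N = 120 \<and> card ?D = 60"
  thus ?thesis using card_subset_eq[OF finD AD] card_A by simp
 qed
qed

lemma A_simple: "J \<lhd> G\<lparr>carrier := A\<rparr> ==> a\<in>J ==> a ~= \<one>\<^bsub>G\<^esub> ==> J = A"
 using group.perfect60_simple[OF _ A(2-4), of J] A(2) by (auto simp: perfect_def)

lemma lam_inner:
 assumes "derived N cN = cN" "a\<in>A"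
 shows "\<exists>n\<in>cN. \<forall>x\<in>cN. lam a x = n\<otimes>x\<otimes>inv n"
proof -
 have "perfect N" using assms(1) by (simp add: perfect_def N.is_group)
 moreover have "lam b\<in>hom N N" if "b\<in>carrier (G\<lparr>carrier := A\<rparr>)" for b
  using lam_hom[of b] that A_subset by (auto simp: group_hom_def group_hom_axioms_def)
 ultimately show ?thesis
  using N.action_inner[OF _ order A(2-4) lam_acts_subgroup[OF A(1)], of a] assms(2) by simp
qed

lemma lam_kernel_normal: "{a\<in>A. \<forall>x\<in>cN. lam a x = x} \<lhd> G\<lparr>carrier := A\<rparr>"
 using acts_on_kernel[OF lam_acts_subgroup[OF A(1)]] by simp

text \<open>A perfect group has no subgroup of index two.\<close>

lemma not_subgroup_A: "order N = 120 ==> derived N cN = cN ==> \<not> subgroup A N"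
proof
 assume o: "order N = 120" and D: "derived N cN = cN" and s: "subgroup A N"
 have "perfect (N\<lparr>carrier := cN\<rparr>)" using D by (simp add: perfect_def N.is_group)
 hence "cN \<subseteq> A"
  using perfect_subset_small_index[OF N.is_group N.subgroup_self _ s fin] o card_A by (simp add: order_def)
 hence "cN = A" using A_subset by simp
 thus False using o card_A by (simp add: order_def)
qed

lemma subgroup_N_I:
 assumes "!!a b. a\<in>A ==> b\<in>A ==> a\<otimes>b\<in>A"
 shows "subgroup A N"
proof (rule N.subgroupI)
 show "A \<subseteq> cN" by (rule A_subset)
 show "A ~= {}" using card_A by auto
 fix a assume a: "a\<in>A"
 have "a [^] (Suc n)\<in>A" for n :: nat by (induction n) (use a A_subset assms in auto)
 hence "a [^] (order N - 1)\<in>A" using order by (cases "order N - 1") auto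
 moreover have "a [^] (order N - 1)\<otimes>a = \<one>"
 proof -
  have "Suc (order N - 1) = order N" using order by auto
  thus ?thesis using N.pow_order_eq_1[of a] a A_subset N.nat_pow_Suc[of a "order N - 1"] by auto
 qed
 hence "inv a = a [^] (order N - 1)" using a A_subset by (intro N.inv_equality) auto
 ultimately show "inv a\<in>A" by simp
qed (rule assms)

text \<open>By simplicity of \<open>A\<close> the action \<open>lam\<close> is trivial or faithful.
  If it is trivial, the two multiplications coincide. If it is faithful, sending \<open>a\<close> to
  an element of \<open>N\<close> that induces \<open>lam a\<close> is injective, hence bijective by
  finiteness, and it is a homomorphism because the centre of \<open>N\<close> turns out to be
  trivial.\<close>

lemma iso_of_perfect_60:
 assumes "derived N cN = cN" "order N = 60"
 shows "G \<cong> N"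
proof -
 have AG: "A = cN" using card_subset_eq[OF fin A_subset] card_A assms(2) by (simp add: order_def)
 let ?J = "{a\<in>A. \<forall>x\<in>cN. lam a x = x}"
 show ?thesis
 proof (cases "?J = {\<one>}")
  case False
  then obtain a where "a\<in>?J" "a ~= \<one>" using lam_one AG by (auto)
  hence "?J = A" using A_simple[OF lam_kernel_normal] by (simp add: one_eq)
  hence "a\<bullet>b = a\<otimes>b" if "a\<in>cN" "b\<in>cN" for a b
   using G_mult that AG by auto
  hence "(\<lambda>x. x)\<in>iso G N" by (auto simp: iso_def hom_def carrier_eq bij_betw_def)
  thus ?thesis by (rule is_isoI)
 next
  case True
  have "\<exists>n. n\<in>cN \<and> (\<forall>x\<in>cN. lam a x = n\<otimes>x\<otimes>inv n)" if "a\<in>cN" for a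
   using lam_inner[OF assms(1)] that AG by blast
  then obtain f where f: "!!a. a\<in>cN ==> f a\<in>cN"
   "!!a x. a\<in>cN ==> x\<in>cN ==> lam a x = f a\<otimes>x\<otimes>inv (f a)" by metis
  have inj: "inj_on f cN"
  proof (rule inj_onI)
   fix a b assume ab: "a\<in>cN" "b\<in>cN" "f a = f b"
   let ?b = "iG b"
   have "lam (a\<bullet>?b) x = x" if "x\<in>cN" for x
   proof -
    have "lam a y = lam b y" if "y\<in>cN" for y
     using f(2)[OF ab(1) that] f(2)[OF ab(2) that] ab(3) by simp
    hence "lam (a\<bullet>?b) x = lam b (lam ?b x)" using lam_comp[of a ?b x] ab that by simp
    also have "... = x" using lam_comp[of b ?b x] ab that lam_one by (simp add: carrier_eq one_eq)
    finally show ?thesis .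
   qed
   hence "a\<bullet>?b\<in>?J" using AG ab by simp
   hence "a\<bullet>?b = \<one>\<^bsub>G\<^esub>" using True by (simp add: one_eq)
   thus "a = b" using ab G.inv_equality[of a ?b] by (simp add: carrier_eq)
  qed
  have surj: "f ` cN = cN" using endo_inj_surj[OF fin _ inj] f(1) by blast
  have centre: "z = \<one>" if z: "z\<in>cN" "!!x. x\<in>cN ==> z\<otimes>x = x\<otimes>z" for z
  proof -
   \<comment> \<open>As \<open>lam\<close> is faithful, every central element is the value of
     \<open>f\<close> at the unit. The unit is itself central, so there is no other central
     element.\<close>
   have "\<exists>a. a\<in>cN \<and> f a = y \<and> a = \<one>" if y: "y\<in>cN" "!!x. x\<in>cN ==> y\<otimes>x = x\<otimes>y" for y
   proof -
    have "y\<in>f ` cN" using surj y(1) by simp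
    then obtain a where a: "a\<in>cN" "f a = y" by (elim imageE) simp
    have "lam a x = x" if "x\<in>cN" for x
     using f(2)[OF a(1) that] y(2)[OF that] a(2) y(1) that by (simp add: N.m_assoc)
    hence "a\<in>?J" using a AG by simp
    thus ?thesis using True a by auto
   qed
   thus ?thesis using z by (metis N.one_closed N.l_one N.r_one)
  qed
  have "f (a\<bullet>b) = f a\<otimes>f b" if ab: "a\<in>cN" "b\<in>cN" for a b
  proof -
   \<comment> \<open>\<open>f (a \<bullet> b)\<close> and the product of \<open>f a\<close> and
     \<open>f b\<close> induce the same automorphism, so \<open>?z\<close> is central.\<close>
   let ?z = "inv (f (a\<bullet>b))\<otimes>(f a\<otimes>f b)"
   have c: "f (a\<bullet>b)\<in>cN" "f a\<in>cN" "f b\<in>cN" using f(1) ab by simp_all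
   have "?z\<otimes>x\<otimes>inv ?z = x" if x: "x\<in>cN" for x
   proof -
    have "(f a\<otimes>f b)\<otimes>x\<otimes>inv (f a\<otimes>f b) = lam a (lam b x)"
     using ab f c x N.conj_elt_mult by simp
    also have "... = f (a\<bullet>b)\<otimes>x\<otimes>inv (f (a\<bullet>b))" using lam_comp f(2) ab x by simp
    finally have "?z\<otimes>x\<otimes>inv ?z = inv (f (a\<bullet>b))\<otimes>(f (a\<bullet>b)\<otimes>x\<otimes>inv (f (a\<bullet>b)))\<otimes>inv (inv (f (a\<bullet>b)))"
     using N.conj_elt_mult[of "inv (f (a\<bullet>b))" "f a\<otimes>f b" x] c x by simp
    thus ?thesis using N.conj_elt_inv_cancel(1)[OF c(1) x] c by simp
   qed
   hence "?z\<otimes>x = x\<otimes>?z" if "x\<in>cN" for x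
    using c that by (metis N.inv_solve_right' N.m_closed N.inv_closed)
   hence "?z = \<one>" using centre[of ?z] c by simp
   thus ?thesis using c by (metis N.inv_equality N.inv_inv N.inv_closed N.m_closed N.inv_comm)
  qed
  hence "f\<in>iso G N" using inj surj f(1) by (auto simp: iso_def hom_def bij_betw_def carrier_eq)
  thus ?thesis by (rule is_isoI)
 qed
qed

lemma perfect_60_not_120:
 assumes D: "derived N cN = cN" and o: "order N = 120"
  and ab: "a\<in>A" "b\<in>A" "a ~= \<one>" "a\<bullet>a\<bullet>a = \<one>" "b\<bullet>a\<bullet>iG b = iG a"
 shows False
proof -
 have not: "\<not> subgroup A N" by (rule not_subgroup_A[OF o D])
 have AN: "x\<in>cN" if "x\<in>A" for x using that A_subset by blast
 have c: "a\<in>cN" "b\<in>cN" using ab AN by simp_all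
 let ?J = "{a\<in>A. \<forall>x\<in>cN. lam a x = x}"
 have Amult: "a\<bullet>b\<in>A" if "a\<in>A" "b\<in>A" for a b using subgroup.m_closed[OF A(1) that] .
 \<comment> \<open>If \<open>a\<close> acted trivially, so would all of \<open>A\<close> by
   simplicity; the two multiplications would agree on \<open>A\<close> and make it a subgroup of
   \<open>N\<close> of index two.\<close>
 have faithful: "a \<notin> ?J"
 proof
  assume "a\<in>?J"
  hence "?J = A" using A_simple[OF lam_kernel_normal] ab by (simp add: one_eq)
  hence triv: "lam x y = y" if "x\<in>A" "y\<in>cN" for x y using that by blast
  have "x\<otimes>y\<in>A" if "x\<in>A" "y\<in>A" for x y
   using Amult[OF that] G_mult[of x y] triv[of x y] that AN by simp
  thus False using subgroup_N_I not by blast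
 qed
 let ?R = "{a\<in>A. \<forall>x\<in>cN. a\<bullet>x = x\<otimes>a}"
 \<comment> \<open>The same argument for the opposite brace: here the multiplications would agree on
   \<open>A\<close> up to the order of the factors. This will exclude that \<open>l\<close> is the
   unit.\<close>
 have unopposed: "a \<notin> ?R"
 proof
  assume aR: "a\<in>?R"
  have eq: "(r\<bullet>x)\<otimes>inv r = x \<longleftrightarrow> r\<bullet>x = x\<otimes>r" if "r\<in>cN" "x\<in>cN" for r x
   using that N.inv_solve_right'[of x "r\<bullet>x" r] by auto
  have eq2: "?R = {r\<in>A. \<forall>x\<in>cN. (r\<bullet>x)\<otimes>inv r = x}" using eq AN by auto
  have "acts_on (G\<lparr>carrier := A\<rparr>) cN (\<lambda>r x. (r\<bullet>x)\<otimes>inv r)"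
   by (rule G.acts_on_subgroup[OF op_acts A(1)]) (use AN op_acts in \<open>auto simp: acts_on_def carrier_eq\<close>)
  hence "?R \<lhd> G\<lparr>carrier := A\<rparr>" unfolding eq2 using acts_on_kernel by fastforce
  hence "?R = A" using A_simple[OF _ aR] ab by (simp add: one_eq)
  hence opp: "x\<bullet>y = y\<otimes>x" if "x\<in>A" "y\<in>cN" for x y using that by blast
  have "x\<otimes>y\<in>A" if "x\<in>A" "y\<in>A" for x y
   using Amult[OF that(2,1)] opp[of y x] that AN by simp
  thus False using subgroup_N_I not by blast
 qed
 obtain n0 where n0: "n0\<in>cN" "!!x. x\<in>cN ==> lam a x = n0\<otimes>x\<otimes>inv n0"
  using lam_inner[OF D ab(1)] by blast
 have inner_pow: "(n0 [^] k)\<otimes>x\<otimes>inv (n0 [^] k) = (lam a ^^ k) x" if "x\<in>cN" for x and k :: nat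
 proof (induction k)
  case (Suc k)
  have "n0 [^] Suc k = n0\<otimes>n0 [^] k" using n0 N.nat_pow_Suc2 by simp
  hence "(n0 [^] Suc k)\<otimes>x\<otimes>inv (n0 [^] Suc k) = n0\<otimes>(n0 [^] k\<otimes>x\<otimes>inv (n0 [^] k))\<otimes>inv n0"
   using N.conj_elt_mult[of n0 "n0 [^] k" x] n0 that by simp
  thus ?case using Suc n0 that by (metis N.inv_closed N.m_closed N.nat_pow_closed comp_apply funpow.simps(2))
 qed (use that in simp)
 have lam3: "lam a (lam a (lam a x)) = x" if "x\<in>cN" for x
  using lam_comp[of "a\<bullet>a" a x] lam_comp[of a a "lam a x"] c ab(4) lam_one that by simp
 have lam39: "(lam a ^^ (3 * k)) x = x" if "x\<in>cN" for x and k
  by (induction k) (use lam3[OF that] in \<open>simp_all add: numeral_3_eq_3\<close>)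
 \<comment> \<open>40 is 1 modulo 3, so \<open>n\<close> induces the same automorphism
   \<open>lam a\<close> as \<open>n0\<close>; and 3 times 40 is the order of \<open>N\<close>, so
   the cube of \<open>n\<close> is the unit.\<close>
 define n where "n = n0 [^] (40::nat)"
 have n: "n\<in>cN" "n\<otimes>n\<otimes>n = \<one>"
 proof -
  show "n\<in>cN" using n0 by (simp add: n_def)
  have "n\<otimes>n\<otimes>n = n0 [^] (40 + 40 + 40 :: nat)" unfolding n_def using n0 by (simp only: N.nat_pow_mult)
  thus "n\<otimes>n\<otimes>n = \<one>" using N.pow_order_eq_1[OF n0(1)] o by simp
 qed
 have lam_n: "lam a x = n\<otimes>x\<otimes>inv n" if x: "x\<in>cN" for x
 proof -
  have "(lam a ^^ 40) x = lam a ((lam a ^^ (3 * 13)) x)" using funpow.simps(2)[of 39 "lam a"] by simp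
  thus ?thesis unfolding n_def using inner_pow[OF x, of 40] lam39[OF x, of 13] by simp
 qed
 define l where "l = a\<otimes>n"
 have l: "l\<in>cN" using c n by (simp add: l_def)
 have G_l: "a\<bullet>x = l\<otimes>x\<otimes>inv n" if "x\<in>cN" for x
  using G_mult[OF c(1) that] lam_n[OF that] c n that by (simp add: l_def N.m_assoc)
 \<comment> \<open>By \<open>G_l\<close> the \<open>G\<close>-cube of \<open>a\<close> is the cube
   of \<open>l\<close> times the inverse cube of \<open>n\<close>, so \<open>l\<close> has cube one
   like \<open>n\<close>.\<close>
 have "a\<bullet>(a\<bullet>a) = \<one>" using ab(4) c G.m_assoc by (simp add: carrier_eq)
 moreover have "a = l\<otimes>inv n" using l_def c n by (simp add: N.m_assoc)
 ultimately have "l\<otimes>(l\<otimes>(l\<otimes>inv n)\<otimes>inv n)\<otimes>inv n = \<one>" using G_l c l n by simp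
 hence "(l\<otimes>l\<otimes>l)\<otimes>(inv n\<otimes>inv n\<otimes>inv n) = \<one>" using l n by (simp add: N.m_assoc)
 moreover have "inv n\<otimes>inv n\<otimes>inv n = \<one>"
  using n N.inv_mult_group[of "n\<otimes>n" n] N.inv_mult_group[of n n] by (simp add: N.m_assoc)
 ultimately have l3: "l\<otimes>l\<otimes>l = \<one>" using l by simp
 have l1: "l ~= \<one>"
 proof
  assume "l = \<one>"
  hence "a\<bullet>x = x\<otimes>a" if "x\<in>cN" for x
   using G_l[OF that] \<open>a = l\<otimes>inv n\<close> that n by simp
  thus False using unopposed ab(1) by simp
 qed
 have not_central: "\<exists>x\<in>cN. n\<otimes>x ~= x\<otimes>n"
 proof (rule ccontr)
  assume "\<not> ?thesis"
  hence "lam a x = x" if "x\<in>cN" for x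
   using lam_n[OF that] that n by (metis N.inv_solve_right' N.m_closed)
  thus False using faithful ab(1) by simp
 qed
 hence n1: "n ~= \<one>" by auto
 have p: "prime (3::nat)" "3 dvd order N" "\<not> 3 ^ 2 dvd order N" using o by (simp_all add: prime_nat_numeral_eq)
 note S3 = N.sylow_prime(3)[OF fin p]
 have cyc: "{\<one>, x, x\<otimes>x}\<in>psubs N 3" if x: "x\<in>cN" "x ~= \<one>" "x\<otimes>x\<otimes>x = \<one>" for x
 proof -
  have d: "x\<otimes>x ~= \<one>" "x\<otimes>x ~= x" using x by (auto simp: N.l_cancel_one)
  have i: "inv x = x\<otimes>x" "inv (x\<otimes>x) = x" using x by (auto intro: N.inv_equality simp: N.m_assoc)
  have "subgroup {\<one>, x, x\<otimes>x} N"
   by (rule N.subgroupI) (use x i in \<open>auto simp: N.m_assoc\<close>)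
  thus ?thesis using d x by (auto simp: psubs_def)
 qed
 \<comment> \<open>Sylow's theorem compares only the subgroups of order three, not their generators;
   hence the two alternatives.\<close>
 have conj_cyc: "\<exists>y\<in>cN. n = y\<otimes>z\<otimes>inv y \<or> n\<otimes>n = y\<otimes>z\<otimes>inv y"
  if z: "z\<in>cN" "z ~= \<one>" "z\<otimes>z\<otimes>z = \<one>" for z
 proof -
  obtain y where y: "y\<in>cN" "{\<one>, n, n\<otimes>n} = conj_set N y {\<one>, z, z\<otimes>z}"
   using S3[OF cyc[OF z] cyc[OF n(1) n1 n(2)]] by blast
  hence "y\<otimes>z\<otimes>inv y\<in>{\<one>, n, n\<otimes>n}" by (auto simp: conj_set_def)
  moreover have "y\<otimes>z\<otimes>inv y ~= \<one>" using N.conj_elt_inv_cancel(1)[OF y(1) z(1)] z(2) y(1) by auto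
  ultimately have "y\<otimes>z\<otimes>inv y = n \<or> y\<otimes>z\<otimes>inv y = n\<otimes>n" by blast
  thus ?thesis using y(1) by metis
 qed
 have nn: "n\<otimes>n = inv n" using n by (metis N.inv_equality N.m_closed)
 obtain m where m: "m\<in>cN" "!!x. x\<in>cN ==> lam b x = m\<otimes>x\<otimes>inv m"
  using lam_inner[OF D ab(2)] by blast
 \<comment> \<open>The failure of \<open>m\<close> to invert \<open>n\<close>. Since
   \<open>b\<close> inverts \<open>a\<close>, conjugation by \<open>z\<close> is
   \<open>lam a\<close> composed with its inverse, so \<open>z\<close> is central.\<close>
 define z where "z = n\<otimes>(m\<otimes>n\<otimes>inv m)"
 have zN: "z\<in>cN" using n m by (simp add: z_def)
 have z_central: "z\<otimes>x = x\<otimes>z" if x: "x\<in>cN" for x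
 proof -
  let ?b = "iG b"
  have bb: "lam b (lam ?b x) = x" if "x\<in>cN" for x
   using lam_comp[of b ?b x] c that lam_one by (simp add: carrier_eq one_eq)
  have aa: "lam a (lam (iG a) x) = x" if "x\<in>cN" for x
   using lam_comp[of a "iG a" x] c that lam_one by (simp add: carrier_eq one_eq)
  have "(m\<otimes>n\<otimes>inv m)\<otimes>x\<otimes>inv (m\<otimes>n\<otimes>inv m) = lam (iG a) x" if x: "x\<in>cN" for x
  proof -
   have y: "lam ?b x\<in>cN" using x c by simp
   have "lam (iG a) x = lam b (lam a (lam ?b x))"
    using lam_comp[of "b\<bullet>a" ?b x] lam_comp[of b a "lam ?b x"] c x ab(5) by simp
   also have "... = m\<otimes>(n\<otimes>lam ?b x\<otimes>inv n)\<otimes>inv m" using lam_n[OF y] m y n c by simp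
   also have "... = m\<otimes>(n\<otimes>(inv m\<otimes>x\<otimes>m)\<otimes>inv n)\<otimes>inv m"
    using bb[OF x] m(2)[OF y] N.conj_elt_inv_cancel(1)[OF m(1) y] by simp
   finally show ?thesis using m n x by (simp add: N.inv_mult_group N.m_assoc)
  qed
  hence "z\<otimes>x\<otimes>inv z = lam a (lam (iG a) x)"
   using N.conj_elt_mult[of n "m\<otimes>n\<otimes>inv m" x] lam_n[of "lam (iG a) x"] n m x c by (simp add: z_def)
  hence "z\<otimes>x\<otimes>inv z = x" using aa x by simp
  thus ?thesis using zN x by (metis N.inv_solve_right' N.m_closed)
 qed
 have mnm: "m\<otimes>n\<otimes>inv m = inv n\<otimes>z" using n m by (simp add: z_def N.m_assoc[symmetric])
 have z3: "z\<otimes>z\<otimes>z = \<one>"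
 proof -
  have "(m\<otimes>n\<otimes>inv m)\<otimes>(m\<otimes>n\<otimes>inv m)\<otimes>(m\<otimes>n\<otimes>inv m) = m\<otimes>(n\<otimes>n\<otimes>n)\<otimes>inv m"
   using m(1) n(1) by (metis N.conj_elt_hom N.m_closed)
  hence "(inv n\<otimes>z)\<otimes>(inv n\<otimes>z)\<otimes>(inv n\<otimes>z) = \<one>" using n m mnm by simp
  moreover have "(inv n\<otimes>z)\<otimes>(inv n\<otimes>z)\<otimes>(inv n\<otimes>z) = (inv n\<otimes>inv n\<otimes>inv n)\<otimes>(z\<otimes>z\<otimes>z)"
  proof -
   have zn: "z\<otimes>inv n = inv n\<otimes>z" using z_central[of "inv n"] n by simp
   have zx: "z\<otimes>(inv n\<otimes>w) = inv n\<otimes>(z\<otimes>w)" if "w\<in>cN" for w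
    using zn n zN that by (metis N.inv_closed N.m_assoc)
   show ?thesis using n zN by (simp add: N.m_assoc zx zn)
  qed
  ultimately show ?thesis using \<open>inv n\<otimes>inv n\<otimes>inv n = \<one>\<close> zN by simp
 qed
 \<comment> \<open>A nontrivial central \<open>z\<close> with cube one would be conjugate, hence
   equal, to \<open>n\<close> or its inverse, and \<open>n\<close> would be central.\<close>
 have "z = \<one>"
 proof (rule ccontr)
  assume "z ~= \<one>"
  then obtain y where y: "y\<in>cN" "n = y\<otimes>z\<otimes>inv y \<or> n\<otimes>n = y\<otimes>z\<otimes>inv y"
   using conj_cyc[OF zN _ z3] by blast
  have "y\<otimes>z\<otimes>inv y = z" using z_central[OF y(1)] y(1) zN by (simp add: N.m_assoc flip: z_central)
  hence "n = z \<or> inv n = z" using y(2) nn by auto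
  hence "n = z \<or> n = inv z" using n by auto
  moreover have "inv z\<otimes>x = x\<otimes>inv z" if "x\<in>cN" for x
   using z_central[OF that] that zN by (metis N.inv_closed N.inv_solve_left' N.inv_solve_right N.m_assoc N.m_closed)
  ultimately show False using not_central z_central by metis
 qed
 hence n_inv: "m\<otimes>n\<otimes>inv m = inv n" using mnm n by simp
 obtain y where y: "y\<in>cN" "n = y\<otimes>l\<otimes>inv y \<or> n\<otimes>n = y\<otimes>l\<otimes>inv y"
  using conj_cyc[OF l l1 l3] by blast
 \<comment> \<open>Conjugation by \<open>m\<close> exchanges \<open>n\<close> and its square, which
   removes the second alternative.\<close>
 have "\<exists>w\<in>cN. n = w\<otimes>l\<otimes>inv w"
  using y(2)
 proof
  assume "n\<otimes>n = y\<otimes>l\<otimes>inv y"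
  hence "m\<otimes>n\<otimes>inv m = y\<otimes>l\<otimes>inv y" using n_inv nn by simp
  hence "n = inv m\<otimes>(y\<otimes>l\<otimes>inv y)\<otimes>inv (inv m)"
   using N.conj_elt_inv_cancel(1)[OF m(1) n(1)] m by simp
  also have "... = (inv m\<otimes>y)\<otimes>l\<otimes>inv (inv m\<otimes>y)" using N.conj_elt_mult[of "inv m" y l] m y(1) l by simp
  finally show ?thesis using m y(1) by (intro bexI[of _ "inv m\<otimes>y"]) auto
 qed (use y(1) in blast)
 then obtain w where w: "w\<in>cN" "n = w\<otimes>l\<otimes>inv w" by blast
 \<comment> \<open>The inverse of \<open>w\<close> is fixed by left translation with
   \<open>a\<close> in \<open>G\<close>.\<close>
 have "a\<bullet>inv w = l\<otimes>inv w\<otimes>inv n" using G_l w by simp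
 also have "... = inv w\<otimes>n\<otimes>inv n" using w l by (simp add: N.m_assoc[symmetric])
 finally have "a\<bullet>inv w = inv w" using w n by (simp add: N.m_assoc)
 hence "a = \<one>\<^bsub>G\<^esub>" using w c G.r_cancel_one[of "inv w" a] by (simp add: carrier_eq)
 thus False using ab(3) by (simp add: one_eq)
qed

end

section \<open>Alternating and symmetric groups of degree five\<close>

lemma alt5_perfect: "perfect (alt_group 5)"
 by (simp add: perfect_def alt_group_is_group derived_alt_group_const)

lemma alt5_order: "order (alt_group 5) = 60"
 using alt_group_card_carrier[of 5] by (simp add: order_def fact_numeral)

lemma three_cycle_alt:
 assumes "i\<in>{1..n}" "j\<in>{1..n}" "k\<in>{1..n}" "i ~= j" "j ~= k"
 shows "transpose i j \<circ> transpose j k\<in>carrier (alt_group n)"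
 using assms by (auto simp: alt_group_carrier evenperm_comp permutation_swap_id evenperm_swap
   intro!: permutes_compose permutes_swap_id)

text \<open>A 3-cycle through \<open>p i\<close> that avoids \<open>i\<close> cannot commute with
  \<open>p\<close>: it would have to fix \<open>p i\<close>.\<close>

lemma alt5_centreless: "centreless (alt_group 5)"
 unfolding centreless_def alt_group_mult alt_group_one
proof (intro ballI impI)
 fix p assume p: "p\<in>carrier (alt_group 5)" and c: "\<forall>q\<in>carrier (alt_group 5). q \<circ> p = p \<circ> q"
 show "p = id"
 proof (rule ccontr)
  assume "p ~= id"
  have perm: "p permutes {1..5}" using p by (simp add: alt_group_carrier)
  obtain i where i: "p i ~= i" using \<open>p ~= id\<close> by (auto simp: fun_eq_iff)
  hence i5: "i\<in>{1..5}" using perm by (metis permutes_not_in)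
  have j5: "p i\<in>{1..5}" using permutes_in_image[OF perm] i5 by simp
  have "card ({1..5} - {i, p i}) = 3" using i i5 j5 by (subst card_Diff_subset) auto
  then obtain k l m where kl: "{1..5} - {i, p i} = {k, l, m}" "k ~= l" by (auto simp: card_3_iff)
  have "k\<in>{1..5} - {i, p i}" "l\<in>{1..5} - {i, p i}" unfolding kl(1) by simp_all
  hence kl5: "k\<in>{1..5}" "l\<in>{1..5}" "k ~= i" "k ~= p i" "l ~= i" "l ~= p i" by simp_all
  let ?q = "transpose (p i) k \<circ> transpose k l"
  have "?q\<in>carrier (alt_group 5)" using kl5 kl(2) j5 by (intro three_cycle_alt) auto
  hence "?q (p i) = p (?q i)" using c by (metis comp_apply)
  thus False using kl5 kl(2) i by (simp add: transpose_def split: if_splits)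
 qed
qed

text \<open>Transposing two points of a 3-cycle inverts it; the transposition of 4 and 5 serves to
  make \<open>b\<close> even.\<close>

lemma alt5_real_element:
 obtains a b where "a\<in>carrier (alt_group 5)" "b\<in>carrier (alt_group 5)" "a ~= id"
  "a \<circ> a \<circ> a = id" "b \<circ> a = a \<circ> a \<circ> b"
proof
 let ?a = "transpose 1 2 \<circ> transpose 2 (3::nat)" and ?b = "transpose 1 2 \<circ> transpose 4 (5::nat)"
 show "?a\<in>carrier (alt_group 5)" by (rule three_cycle_alt) auto
 show "?b\<in>carrier (alt_group 5)"
  by (auto simp: alt_group_carrier evenperm_comp permutation_swap_id evenperm_swap
   intro!: permutes_compose permutes_swap_id)
 show "?a ~= id" by (auto simp: fun_eq_iff transpose_def intro!: exI[of _ 1])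
 show "?a \<circ> ?a \<circ> ?a = id" by (auto simp: fun_eq_iff transpose_def)
 show "?b \<circ> ?a = ?a \<circ> ?a \<circ> ?b" by (auto simp: fun_eq_iff transpose_def)
qed

section \<open>Recovering the five points from the involutions of the alternating group\<close>

definition inv5 :: "(nat => nat) set" where
 "inv5 = {p\<in>carrier (alt_group 5). p \<circ> p = id \<and> p ~= id}"

definition fx :: "(nat => nat) => nat" where
 "fx p = (THE i. i\<in>{1..5} \<and> p i = i)"

text \<open>An even involution of five points is a product of two disjoint transpositions and leaves
  one point over.\<close>

lemma inv5_fixed_point:
 assumes "p\<in>inv5"
 shows "\<exists>!i. i\<in>{1..5} \<and> p i = i"
proof -
 have p: "p permutes {1..5}" "evenperm p" "p ~= id" and pp: "p (p x) = x" for x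
  using assms by (auto simp: inv5_def alt_group_carrier fun_eq_iff)
 obtain a where a: "p a ~= a" using p(3) by (auto simp: fun_eq_iff)
 define b where "b = p a"
 have ab: "a ~= b" "p a = b" "p b = a" using a pp by (auto simp: b_def)
 have ab5: "a\<in>{1..5}" "b\<in>{1..5}" using p(1) ab by (metis permutes_not_in)+
 have "card ({1..5} - {a, b}) = 3" using ab ab5 by (subst card_Diff_subset) auto
 then obtain c d e where cde: "{1..5} - {a, b} = {c, d, e}" "c ~= d" "d ~= e" "c ~= e" by (auto simp: card_3_iff)
 have S: "{1..5} = {a, b, c, d, e}" using cde(1) ab5 by blast
 have ne: "c ~= a" "c ~= b" "d ~= a" "d ~= b" "e ~= a" "e ~= b" using cde(1) by auto
 have inj: "p x = p y \<longleftrightarrow> x = y" for x y by (metis pp)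
 have cl: "p x\<in>{c, d, e}" if "x\<in>{c, d, e}" for x
 proof -
  have "x\<in>{1..5}" using that unfolding S by blast
  hence "p x\<in>{a, b, c, d, e}" using permutes_in_image[OF p(1), of x] unfolding S by simp
  moreover have "p x ~= a" "p x ~= b" using that ne pp ab by (metis empty_iff insert_iff)+
  ultimately show ?thesis by blast
 qed
 \<comment> \<open>Otherwise \<open>p\<close> would be a single transposition, which is odd.\<close>
 have odd: "\<not> (p c = c \<and> p d = d \<and> p e = e)"
 proof
  assume *: "p c = c \<and> p d = d \<and> p e = e"
  have "p x = transpose a b x" for x
  proof (cases "x\<in>{1..5}")
   case True
   hence "x\<in>{a, b, c, d, e}" unfolding S .
   thus ?thesis using * ab ne by (elim insertE) (simp_all add: transpose_def)
  next
   case False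
   thus ?thesis using p(1) ab5 by (metis permutes_not_in transpose_apply_other)
  qed
  hence "p = transpose a b" by blast
  thus False using p(2) ab(1) by (simp add: evenperm_swap)
 qed
 consider "p c = c" | "p c = d" | "p c = e" using cl[of c] by blast
 thus ?thesis
 proof cases
  case 1
  hence "p d ~= c" "p e ~= c" using inj[of d c] inj[of e c] cde(2,4) by simp_all
  hence "p d = d \<or> p d = e" "p e = d \<or> p e = e" using cl[of d] cl[of e] by blast+
  moreover have "p d = p e \<longleftrightarrow> d = e" by (rule inj)
  ultimately have "p d = e" "p e = d" using odd 1 cde(3) by metis+
  thus ?thesis unfolding S using 1 ab cde(2-4) by (intro ex1I[of _ c]) auto
 next
  case 2
  hence "p d = c" using pp[of c] by simp
  moreover have "p e ~= c" "p e ~= d" using inj[of e c] inj[of e d] cde(3,4) 2 calculation by auto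
  ultimately have "p d = c" "p e = e" using cl[of e] by blast+
  thus ?thesis unfolding S using 2 ab cde(2-4) by (intro ex1I[of _ e]) auto
 next
  case 3
  hence "p e = c" using pp[of c] by simp
  moreover have "p d ~= c" "p d ~= e" using inj[of d c] inj[of e d] cde(2,3) 3 calculation by auto
  ultimately have "p e = c" "p d = d" using cl[of d] by blast+
  thus ?thesis unfolding S using 3 ab cde(2-4) by (intro ex1I[of _ d]) auto
 qed
qed

lemma fx_props:
 assumes "p\<in>inv5"
 shows "fx p\<in>{1..5}" "p (fx p) = fx p" "!!i. i\<in>{1..5} ==> p i = i ==> i = fx p"
 using theI'[OF inv5_fixed_point[OF assms]] inv5_fixed_point[OF assms] unfolding fx_def by auto

text \<open>This makes the points visible in the abstract group, as the classes of involutions under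
  commutation. Commuting permutations preserve each other's fixed points; conversely,
  fixed-point-free involutions of the four remaining points commute.\<close>

lemma inv5_commute_iff:
 assumes "p\<in>inv5" "q\<in>inv5"
 shows "p \<circ> q = q \<circ> p \<longleftrightarrow> fx p = fx q"
proof
 have pq: "p permutes {1..5}" "q permutes {1..5}" using assms by (simp_all add: inv5_def alt_group_carrier)
 show "fx p = fx q" if "p \<circ> q = q \<circ> p"
 proof -
  have "p (q (fx p)) = q (fx p)" using that fx_props(2)[OF assms(1)] by (metis comp_apply)
  moreover have "q (fx p)\<in>{1..5}" using permutes_in_image[OF pq(2)] fx_props(1)[OF assms(1)] by simp
  ultimately have "q (fx p) = fx p" using fx_props(3)[OF assms(1), of "q (fx p)"] by simp
  thus ?thesis using fx_props(3)[OF assms(2), of "fx p"] fx_props(1)[OF assms(1)] by simp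
 qed
 assume eq: "fx p = fx q"
 let ?E = "{1..5} - {fx p}"
 have E: "card ?E = 4" using fx_props(1)[OF assms(1)] by simp
 have fpf: "r x\<in>?E \<and> r (r x) = x \<and> r x ~= x" if r: "r\<in>inv5" "fx r = fx p" and x: "x\<in>?E" for r x
 proof -
  have "r permutes {1..5}" using r by (simp add: inv5_def alt_group_carrier)
  hence "r x\<in>{1..5}" using x permutes_in_image by fastforce
  moreover have rr: "r (r x) = x" using r(1) by (auto simp: inv5_def fun_eq_iff)
  moreover have "r x ~= x" using fx_props(3)[OF r(1), of x] r(2) x by auto
  moreover have "r x ~= fx p" using rr fx_props(2)[OF r(1)] r(2) x by auto
  ultimately show ?thesis by simp
 qed
 have "p (q x) = q (p x)" for x
 proof -
  consider "x\<in>?E" | "x = fx p" | "x \<notin> {1..5}" by blast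
  thus ?thesis
  proof cases
   case 1
   show ?thesis
    by (rule fixpoint_free_involutions_commute[OF E _ _ 1]) (use fpf assms eq in auto)
  next
   case 2
   thus ?thesis using fx_props(2)[OF assms(1)] fx_props(2)[OF assms(2)] eq by simp
  next
   case 3
   thus ?thesis using pq by (simp add: permutes_not_in)
  qed
 qed
 thus "p \<circ> q = q \<circ> p" by auto
qed

lemma inv5_exists: "i\<in>{1..5} ==> \<exists>p\<in>inv5. fx p = i"
proof -
 assume i: "i\<in>{1..5::nat}"
 hence "card ({1..5} - {i}) = 4" by simp
 hence "card ({1..5} - {i}) = Suc 3" by simp
 from card_eq_SucD[OF this] obtain a B where a: "a \<notin> B" "{1..5} - {i} = insert a B" "card B = 3" by blast
 then obtain b c d where b: "B = {b, c, d}" "b ~= c" "c ~= d" "b ~= d" by (auto simp: card_3_iff)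
 have m: "a\<in>{1..5}" "b\<in>{1..5}" "c\<in>{1..5}" "d\<in>{1..5}" "a ~= i" "b ~= i" "c ~= i" "d ~= i"
 proof -
  have "x\<in>{1..5} - {i}" if "x\<in>{a, b, c, d}" for x using that unfolding a(2) b(1) .
  from this[of a] this[of b] this[of c] this[of d]
  show "a\<in>{1..5}" "b\<in>{1..5}" "c\<in>{1..5}" "d\<in>{1..5}" "a ~= i" "b ~= i" "c ~= i" "d ~= i" by simp_all
 qed
 let ?p = "transpose a b \<circ> transpose c d"
 have "?p permutes {1..5}" using m by (intro permutes_compose permutes_swap_id)
 moreover have "evenperm ?p" using a(1) b by (auto simp: evenperm_comp permutation_swap_id evenperm_swap)
 moreover have d: "a ~= b" "a ~= c" "a ~= d" "b ~= c" "b ~= d" "c ~= d" using a(1) b(2-4) unfolding b(1) by simp_all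
 have "?p (?p x) = x" for x
 proof -
  consider "x = a" | "x = b" | "x = c" | "x = d" | "x ~= a" "x ~= b" "x ~= c" "x ~= d" by blast
  thus ?thesis by cases (use d in \<open>auto simp: transpose_def\<close>)
 qed
 hence "?p \<circ> ?p = id" by auto
 moreover have "?p a ~= id a" using d by (simp add: transpose_def)
 hence "?p ~= id" by metis
 ultimately have p: "?p\<in>inv5" by (simp add: inv5_def alt_group_carrier)
 moreover have "?p i = i" using m by (simp add: transpose_def)
 hence "fx ?p = i" using fx_props(3)[OF p i] by simp
 ultimately show ?thesis by blast
qed

text \<open>\<open>M\<close> and \<open>c\<close> commute elementwise and exhaust \<open>N\<close>
  by order. This serves both to recognise \<open>N\<close> and to compute the type of the induced
  structure.\<close>

lemma iso_alt5_times_C2: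
 fixes N (structure)
 assumes "group N" "group H" "subgroup M N" "f\<in>iso H (N\<lparr>carrier := M\<rparr>)" "order N = 2 * card M" "card M > 0"
  "c\<in>carrier N" "c \<notin> M" "c\<otimes>c = \<one>" "!!m. m\<in>M ==> c\<otimes>m = m\<otimes>c"
 shows "H \<times>\<times> integer_mod_group 2 \<cong> N"
proof -
 interpret group N by fact
 let ?F = "\<lambda>(p, i::int). f p\<otimes>(if i = 0 then \<one> else c)"
 have M: "M \<subseteq> carrier N" using assms(3) by (rule subgroup.subset)
 have Z2: "carrier (integer_mod_group 2) = {0, 1}" by (auto simp: carrier_integer_mod_group)
 have f: "f p\<in>M" "f p\<in>carrier N" if "p\<in>carrier H" for p
  using assms(4) that M by (auto simp: iso_def hom_def)
 have fm: "f (p\<otimes>\<^bsub>H\<^esub> q) = f p\<otimes>f q" if "p\<in>carrier H" "q\<in>carrier H" for p q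
  using assms(4) that by (auto simp: iso_def hom_def)
 have fb: "bij_betw f (carrier H) M" using assms(4) by (simp add: iso_def)
 have swap: "c\<otimes>(f q\<otimes>w) = f q\<otimes>(c\<otimes>w)" if "q\<in>carrier H" "w\<in>carrier N" for q w
  using assms(10)[OF f(1)[OF that(1)]] that f(2)[OF that(1)] assms(7) by (metis m_assoc)
 have "?F\<in>hom (H \<times>\<times> integer_mod_group 2) N"
 proof (rule homI, clarify)
  fix x y assume "x\<in>carrier (H \<times>\<times> integer_mod_group 2)" "y\<in>carrier (H \<times>\<times> integer_mod_group 2)"
  then obtain p i q j where "x = (p, i)" "y = (q, j)" "p\<in>carrier H" "q\<in>carrier H" "i = 0 \<or> i = 1" "j = 0 \<or> j = 1"
   by (auto simp: Z2)
  thus "?F (x\<otimes>\<^bsub>H \<times>\<times> integer_mod_group 2\<^esub> y) = ?F x\<otimes>?F y"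
   using f fm assms(7,9) swap[of q \<one>] assms(10)[OF f(1)] swap[of q c] by (auto simp: m_assoc)
 qed (use f assms(7) in \<open>auto simp: Z2\<close>)
 moreover have "bij_betw ?F (carrier (H \<times>\<times> integer_mod_group 2)) (carrier N)"
 proof -
  have inj: "inj_on ?F (carrier (H \<times>\<times> integer_mod_group 2))"
  proof (rule inj_onI)
   fix x y assume "x\<in>carrier (H \<times>\<times> integer_mod_group 2)" "y\<in>carrier (H \<times>\<times> integer_mod_group 2)" and e: "?F x = ?F y"
   then obtain p i q j where xy: "x = (p, i)" "y = (q, j)" "p\<in>carrier H" "q\<in>carrier H" "i = 0 \<or> i = 1" "j = 0 \<or> j = 1"
    by (auto simp: Z2)
   have no: "f r\<otimes>c ~= f s" if "r\<in>carrier H" "s\<in>carrier H" for r s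
   proof
    assume "f r\<otimes>c = f s"
    hence "c = inv (f r)\<otimes>f s" using f[OF that(1)] f[OF that(2)] assms(7) by (metis inv_solve_left)
    thus False using assms(3,8) f[OF that(1)] f[OF that(2)] by (simp add: subgroup.m_closed subgroup.m_inv_closed)
   qed
   have "f p = f q ==> p = q" using fb xy by (auto simp: bij_betw_def inj_on_def)
   thus "x = y" using e xy f(2)[OF xy(3)] f(2)[OF xy(4)] assms(7) no[OF xy(3,4)] no[OF xy(4,3)] by auto
  qed
  have fin: "finite (carrier N)" using assms(5,6) by (intro card_ge_0_finite) (simp add: order_def)
  have "card (carrier (H \<times>\<times> integer_mod_group 2)) = card (carrier N)"
   using bij_betw_same_card[OF fb] assms(5) by (simp add: card_cartesian_product Z2 order_def)
  moreover have "?F ` carrier (H \<times>\<times> integer_mod_group 2) \<subseteq> carrier N"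
   using f assms(7) by (auto simp: Z2)
  ultimately have "?F ` carrier (H \<times>\<times> integer_mod_group 2) = carrier N"
   using card_subset_eq[OF fin] card_image[OF inj] by metis
  thus ?thesis using inj by (simp add: bij_betw_def)
 qed
 ultimately show ?thesis by (auto simp: is_iso_def iso_def)
qed

text \<open>Conjugation by \<open>N\<close> permutes the involutions of \<open>M\<close> and
  respects commutation, hence permutes five points; on \<open>M\<close> this recovers the given
  isomorphism. If the resulting map \<open>g\<close> to the symmetric group is injective, it is
  bijective by order. Otherwise a nontrivial element of its kernel centralises \<open>M\<close>,
  lies outside \<open>M\<close> and has square one, which splits off a factor of order two.\<close>

lemma alt5_index_2_recognition:
 fixes N (structure)
 assumes "group N" "order N = 120" "M \<lhd> N" "alt_group 5 \<cong> N\<lparr>carrier := M\<rparr>"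
 shows "N \<cong> sym_group 5 \<or> N \<cong> alt_group 5 \<times>\<times> integer_mod_group 2"
proof -
 interpret group N by fact
 have sM: "subgroup M N" and nM: "!!n m. n\<in>carrier N ==> m\<in>M ==> n\<otimes>m\<otimes>inv n\<in>M"
  using assms(3) by (auto simp: normal_inv_iff)
 have M: "M \<subseteq> carrier N" using sM by (rule subgroup.subset)
 obtain f where f: "f\<in>iso (alt_group 5) (N\<lparr>carrier := M\<rparr>)" using assms(4) by (auto simp: is_iso_def)
 let ?A = "carrier (alt_group 5)"
 have fb: "bij_betw f ?A M" using f by (simp add: iso_def)
 have fM: "f p\<in>M" if "p\<in>?A" for p using fb that by (auto simp: bij_betw_def)
 have fN: "f p\<in>carrier N" if "p\<in>?A" for p using fM M that by blast
 have fm: "f (p \<circ> q) = f p\<otimes>f q" if "p\<in>?A" "q\<in>?A" for p q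
  using f that by (auto simp: iso_def hom_def alt_group_mult)
 have finj: "p = q" if "f p = f q" "p\<in>?A" "q\<in>?A" for p q
  using fb that by (auto simp: bij_betw_def inj_on_def)
 interpret alt: group "alt_group 5" by (rule alt_group_is_group)
 have comp: "p \<circ> q\<in>?A" if "p\<in>?A" "q\<in>?A" for p q using alt.m_closed[OF that] by (simp add: alt_group_mult)
 have idA: "id\<in>?A" using alt.one_closed by (simp add: alt_group_one)
 have f1: "f id = \<one>"
  using fm[OF idA idA] fN[OF idA] by (simp add: r_cancel_one')
 define u where "u = (\<lambda>n p. inv_into ?A f (n\<otimes>f p\<otimes>inv n))"
 have fu: "f (u n p) = n\<otimes>f p\<otimes>inv n" and uA: "u n p\<in>?A" if "n\<in>carrier N" "p\<in>?A" for n p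
 proof -
  have "n\<otimes>f p\<otimes>inv n\<in>f ` ?A" using nM[OF that(1) fM[OF that(2)]] fb by (simp add: bij_betw_def)
  thus "f (u n p) = n\<otimes>f p\<otimes>inv n" "u n p\<in>?A"
   unfolding u_def by (rule f_inv_into_f, rule inv_into_into)
 qed
 have u_mult: "u n (p \<circ> q) = u n p \<circ> u n q" if "n\<in>carrier N" "p\<in>?A" "q\<in>?A" for n p q
  by (rule finj) (use that fu uA comp fm fN conj_elt_hom in simp_all)
 have u_comp: "u (n\<otimes>m) p = u n (u m p)" if "n\<in>carrier N" "m\<in>carrier N" "p\<in>?A" for n m p
  by (rule finj) (use that fu uA fN conj_elt_mult in simp_all)
 have u_one: "u \<one> p = p" if "p\<in>?A" for p
  by (rule finj) (use that fu uA fN in simp_all)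
 have u_inv5: "u n p\<in>inv5" if "n\<in>carrier N" "p\<in>inv5" for n p
 proof -
  have p: "p\<in>?A" "p \<circ> p = id" "p ~= id" using that by (auto simp: inv5_def)
  have "u n id = id" by (rule finj) (use that(1) idA fu uA f1 in simp_all)
  hence "u n p \<circ> u n p = id" using u_mult[OF that(1) p(1,1)] p(2) by simp
  moreover have "u n p ~= id"
  proof
   assume "u n p = id"
   hence "u (inv n) id = p" using u_comp[of "inv n" n p] that p u_one by simp
   moreover have "u (inv n) id = id" by (rule finj) (use that(1) idA fu uA f1 in simp_all)
   ultimately show False using p by simp
  qed
  ultimately show ?thesis using uA that p by (simp add: inv5_def)
 qed
 obtain s where s: "!!i. i\<in>{1..5} ==> s i\<in>inv5" "!!i. i\<in>{1..5} ==> fx (s i) = i"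
  using inv5_exists by metis
 \<comment> \<open>\<open>s i\<close> is an arbitrary involution fixing \<open>i\<close>;
   \<open>fx_u\<close> shows that the choice does not matter.\<close>
 define g where "g = (\<lambda>n i. if i\<in>{1..5} then fx (u n (s i)) else i)"
 have inv5A: "p\<in>?A" if "p\<in>inv5" for p using that by (simp add: inv5_def)
 have fx_u: "fx (u n p) = g n (fx p)" if "n\<in>carrier N" "p\<in>inv5" for n p
 proof -
  have i: "fx p\<in>{1..5}" using fx_props(1)[OF that(2)] .
  have "p \<circ> s (fx p) = s (fx p) \<circ> p" using inv5_commute_iff[OF that(2) s(1)[OF i]] s(2)[OF i] by simp
  hence "u n p \<circ> u n (s (fx p)) = u n (s (fx p)) \<circ> u n p"
   using u_mult[OF that(1)] inv5A that(2) s(1)[OF i] by metis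
  hence "fx (u n p) = fx (u n (s (fx p)))" using inv5_commute_iff u_inv5 that s(1)[OF i] by blast
  thus ?thesis using i by (simp only: g_def if_True)
 qed
 have g_cl: "g n i\<in>{1..5}" if "n\<in>carrier N" "i\<in>{1..5}" for n i
  using fx_props(1)[OF u_inv5[OF that(1) s(1)[OF that(2)]]] that(2) by (simp only: g_def if_True)
 have g_comp: "g (n\<otimes>m) = g n \<circ> g m" if "n\<in>carrier N" "m\<in>carrier N" for n m
 proof
  fix i
  show "g (n\<otimes>m) i = (g n \<circ> g m) i"
  proof (cases "i\<in>{1..5}")
   case True
   have "g (n\<otimes>m) i = fx (u n (u m (s i)))" using True u_comp[OF that inv5A[OF s(1)[OF True]]] by (simp only: g_def if_True)
   also have "... = g n (fx (u m (s i)))" by (rule fx_u[OF that(1) u_inv5[OF that(2) s(1)[OF True]]])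
   also have "... = g n (g m i)" using True by (simp only: g_def if_True)
   finally show ?thesis by simp
  next
   case False
   thus ?thesis by (simp add: g_def del: atLeastAtMost_iff)
  qed
 qed
 have g_one: "g \<one> = id"
 proof
  show "g \<one> i = id i" for i
   by (cases "i\<in>{1..5}") (use u_one inv5A s in \<open>simp_all add: g_def del: atLeastAtMost_iff\<close>)
 qed
 have g_perm: "g n permutes {1..5}" if n: "n\<in>carrier N" for n
 proof (rule bij_imp_permutes)
  have "g n (g (inv n) x) = x" "g (inv n) (g n x) = x" for x
   using g_comp[of n "inv n"] g_comp[of "inv n" n] n g_one by (simp_all add: fun_eq_iff)
  thus "bij_betw (g n) {1..5} {1..5}"
   using g_cl n by (intro bij_betwI[where g="g (inv n)"]) (auto simp del: atLeastAtMost_iff)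
 qed (simp add: g_def del: atLeastAtMost_iff)
 have g_hom: "g\<in>hom N (sym_group 5)"
  using g_perm g_comp by (auto simp: hom_def sym_group_carrier sym_group_mult)
 have g_f: "g (f t) = t" if t: "t\<in>?A" for t
 proof
  fix i
  have perm: "t permutes {1..5}" using t by (simp add: alt_group_carrier)
  show "g (f t) i = t i"
  proof (cases "i\<in>{1..5}")
   case True
   let ?q = "u (f t) (s i)"
   have q: "?q\<in>inv5" by (rule u_inv5[OF fN[OF t] s(1)[OF True]])
   \<comment> \<open>\<open>?q\<close> is the conjugate of \<open>s i\<close> by \<open>t\<close>,
     so the point it fixes is \<open>t i\<close>.\<close>
   have "f (?q \<circ> t) = f (t \<circ> s i)"
    using fm[OF inv5A[OF q] t] fm[OF t inv5A[OF s(1)[OF True]]] fu[OF fN[OF t] inv5A[OF s(1)[OF True]]]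
     fN[OF t] fN[OF inv5A[OF s(1)[OF True]]] by (simp add: m_assoc)
   hence "?q \<circ> t = t \<circ> s i" by (rule finj) (use comp inv5A q s(1)[OF True] t in simp_all)
   hence "?q (t i) = t (s i i)" by (metis comp_apply)
   also have "s i i = i" using fx_props(2)[OF s(1)[OF True]] s(2)[OF True] by simp
   finally have "t i = fx ?q" using fx_props(3)[OF q, of "t i"] True permutes_in_image[OF perm] by simp
   thus ?thesis using True by (simp only: g_def if_True)
  next
   case False
   thus ?thesis using permutes_not_in[OF perm False] by (simp add: g_def del: atLeastAtMost_iff)
  qed
 qed
 interpret g: group_hom N "sym_group 5" g
  using g_hom by (intro group_hom.intro is_group sym_group_is_group group_hom_axioms.intro)
 have cM: "card M = 60" using bij_betw_same_card[OF fb] alt5_order by (simp add: order_def)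
 show ?thesis
 proof (cases "inj_on g (carrier N)")
  case True
  have "card (g ` carrier N) = card (carrier (sym_group 5))"
   using card_image[OF True] assms(2) sym_group_card_carrier[of 5] by (simp add: order_def fact_numeral)
  moreover have "finite (carrier (sym_group 5))"
   using sym_group_card_carrier[of 5] by (intro card_ge_0_finite) simp
  ultimately have "g ` carrier N = carrier (sym_group 5)"
   using g.hom_closed by (intro card_subset_eq) auto
  hence "g\<in>iso N (sym_group 5)" using g_hom True by (simp add: iso_def bij_betw_def)
  thus ?thesis using is_isoI by blast
 next
  case False
  hence "kernel N (sym_group 5) g ~= {\<one>}" using g.inj_iff_trivial_ker by simp
  moreover have "\<one>\<in>kernel N (sym_group 5) g" by (simp add: kernel_def)
  ultimately obtain c where "c\<in>kernel N (sym_group 5) g" "c ~= \<one>" by blast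
  hence c: "c\<in>carrier N" "c ~= \<one>" "g c = id" by (simp_all add: kernel_def sym_group_one)
  have comm: "c\<otimes>m = m\<otimes>c" if mM: "m\<in>M" for m
  proof -
   obtain t where t: "t\<in>?A" "m = f t" using fb mM by (auto simp: bij_betw_def)
   \<comment> \<open>\<open>u c t\<close> and \<open>t\<close> have the same image under
     \<open>g\<close>, which is faithful on \<open>M\<close>; hence \<open>c\<close> centralises
     \<open>M\<close>.\<close>
   have "g (f (u c t)) = g (f t)"
    using fu[OF c(1) t(1)] g_comp c fN[OF t(1)] g_comp[of c "inv c"] g_one by (simp add: sym_group_mult)
   hence "u c t = t" using g_f t(1) uA[OF c(1) t(1)] by simp
   hence "c\<otimes>m\<otimes>inv c = m" using fu[OF c(1) t(1)] t(2) by simp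
   thus ?thesis using c(1) mM M by (metis inv_solve_right' m_closed subsetD)
  qed
  have notM: "x = \<one>" if xM: "x\<in>M" "g x = id" for x
  proof -
   obtain t where t: "t\<in>?A" "x = f t" using fb xM by (auto simp: bij_betw_def)
   thus ?thesis using g_f xM(2) f1 by simp
  qed
  hence "c \<notin> M" using c by blast
  \<comment> \<open>The square lies in \<open>M\<close> because \<open>M\<close> has index two, and
    in the kernel of \<open>g\<close>, which meets \<open>M\<close> trivially.\<close>
  moreover have "c\<otimes>c = \<one>"
  proof (rule notM)
   show "c\<otimes>c\<in>M" using square_in_index_2_subgroup[OF sM _ c(1)] assms(2) cM by simp
   show "g (c\<otimes>c) = id" using g_comp c by (simp add: sym_group_mult)
  qed
  ultimately have "alt_group 5 \<times>\<times> integer_mod_group 2 \<cong> N"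
   using iso_alt5_times_C2[OF assms(1) alt_group_is_group sM f] assms(2) cM c(1) comm by simp
  moreover have "group (alt_group 5 \<times>\<times> integer_mod_group 2)" by (intro DirProd_group alt_group_is_group) simp
  ultimately show ?thesis using group.iso_sym by blast
 qed
qed

lemma perfect_iso:
 assumes "perfect H" "group G" "f\<in>iso H G"
 shows "perfect G"
proof -
 interpret p: group_hom H G f
  using assms by (auto simp: perfect_def iso_def group_hom_def group_hom_axioms_def)
 have "f ` carrier H = carrier G" using assms(3) by (simp add: iso_def bij_betw_def)
 thus ?thesis using p.derived_img[of "carrier H"] assms(1,2) by (simp add: perfect_def)
qed

lemma centreless_iso:
 assumes "centreless H" "group H" "group G" "f\<in>iso H G"
 shows "centreless G"
 unfolding centreless_def
proof (intro ballI impI)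
 interpret p: group_hom H G f using assms by (auto simp: iso_def group_hom_def group_hom_axioms_def)
 have b: "bij_betw f (carrier H) (carrier G)" using assms(4) by (simp add: iso_def)
 fix z assume z: "z\<in>carrier G" "\<forall>x\<in>carrier G. x\<otimes>\<^bsub>G\<^esub> z = z\<otimes>\<^bsub>G\<^esub> x"
 obtain w where w: "w\<in>carrier H" "z = f w" using b z(1) by (auto simp: bij_betw_def)
 have "x\<otimes>\<^bsub>H\<^esub> w = w\<otimes>\<^bsub>H\<^esub> x" if x: "x\<in>carrier H" for x
 proof -
  have "f (x\<otimes>\<^bsub>H\<^esub> w) = f (w\<otimes>\<^bsub>H\<^esub> x)" using z(2) x w by simp
  moreover have "x\<otimes>\<^bsub>H\<^esub> w\<in>carrier H" "w\<otimes>\<^bsub>H\<^esub> x\<in>carrier H" using x w(1) by simp_all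
  ultimately show ?thesis using b by (auto simp: bij_betw_def inj_on_def)
 qed
 hence "w = \<one>\<^bsub>H\<^esub>" using assms(1) w(1) by (simp add: centreless_def)
 thus "z = \<one>\<^bsub>G\<^esub>" using w by simp
qed

text \<open>Of the alternating group, only perfectness, the order and the trivial centre are passed
  to the locale; the pair of \<open>alt5_real_element\<close> is supplied separately where order 120
  is treated.\<close>

lemma (in skew_brace) alternating_brace_I:
 assumes "subgroup A G" "alt_group 5 \<cong> G\<lparr>carrier := A\<rparr>" "order N = 60 \<or> order N = 120"
 shows "alternating_brace N G A"
proof -
 have gA: "group (G\<lparr>carrier := A\<rparr>)" by (rule subgroup.subgroup_is_group[OF assms(1) G.is_group])
 obtain f where f: "f\<in>iso (alt_group 5) (G\<lparr>carrier := A\<rparr>)" using assms(2) by (auto simp: is_iso_def)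
 have "order (G\<lparr>carrier := A\<rparr>) = 60" using iso_same_card[OF assms(2)] alt5_order by (simp add: order_def)
 thus ?thesis
  using perfect_iso[OF alt5_perfect gA f] centreless_iso[OF alt5_centreless alt_group_is_group gA f] assms(1,3)
  by (intro alternating_brace.intro alternating_brace_axioms.intro skew_brace_axioms) simp_all
qed

lemma skew_brace_alt5:
 assumes "skew_brace N G" "alt_group 5 \<cong> G"
 shows "G \<cong> N"
proof -
 interpret skew_brace N G by fact
 have "order N = 60" using iso_same_card[OF assms(2)] alt5_order by (simp add: order_def carrier_eq)
 then interpret alternating_brace N G "carrier G"
  using alternating_brace_I[OF G.subgroup_self] assms(2) by simp
 show ?thesis using iso_of_perfect_60 derived_cases \<open>order N = 60\<close> by auto
qed

lemma (in skew_brace) sub_brace: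
 assumes "subgroup A N" "subgroup A G"
 shows "skew_brace (N\<lparr>carrier := A\<rparr>) (G\<lparr>carrier := A\<rparr>)"
proof -
 have "A \<subseteq> carrier N" using subgroup.subset[OF assms(1)] .
 thus ?thesis
  using brace N.m_inv_consistent[OF assms(1)]
  by (intro skew_brace.intro skew_brace_axioms.intro subgroup.subgroup_is_group[OF assms(1) N.is_group]
   subgroup.subgroup_is_group[OF assms(2) G.is_group]) (auto simp: one_eq subset_iff)
qed

lemma skew_brace_sym5:
 assumes "skew_brace N G" "sym_group 5 \<cong> G"
 shows "N \<cong> sym_group 5 \<or> N \<cong> alt_group 5 \<times>\<times> integer_mod_group 2"
proof -
 interpret skew_brace N G by fact
 obtain f where f: "f\<in>iso (sym_group 5) G" using assms(2) by (auto simp: is_iso_def)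
 interpret p: group_hom "sym_group 5" G f
  using f sym_group_is_group by (auto simp: iso_def group_hom_def group_hom_axioms_def)
 let ?Alt = "carrier (alt_group 5)"
 define A where "A = f ` ?Alt"
 have sA: "subgroup A G" unfolding A_def by (rule p.subgroup_img_is_subgroup[OF alt_group_is_subgroup])
 have sub: "?Alt \<subseteq> carrier (sym_group 5)" by (rule subgroup.subset[OF alt_group_is_subgroup])
 have inj: "inj_on f (carrier (sym_group 5))" using f by (simp add: iso_def bij_betw_def)
 have fm: "f (p \<circ> q) = f p\<otimes>\<^bsub>G\<^esub> f q" if "p\<in>?Alt" "q\<in>?Alt" for p q
  using p.hom_mult[of p q] that sub by (auto simp: sym_group_mult)
 have "f\<in>iso (alt_group 5) (G\<lparr>carrier := A\<rparr>)"
  using fm inj_on_subset[OF inj sub] by (auto simp: iso_def hom_def A_def bij_betw_def alt_group_mult)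
 hence isoA: "alt_group 5 \<cong> G\<lparr>carrier := A\<rparr>" by (rule is_isoI)
 have o: "order N = 120"
  using iso_same_card[OF assms(2)] sym_group_card_carrier[of 5] by (simp add: order_def carrier_eq fact_numeral)
 interpret alternating_brace N G A using alternating_brace_I[OF sA isoA] o by simp
 have "derived N (carrier N) ~= carrier N"
 proof
  assume D: "derived N (carrier N) = carrier N"
  obtain a b where ab: "a\<in>?Alt" "b\<in>?Alt" "a ~= id" "a \<circ> a \<circ> a = id" "b \<circ> a = a \<circ> a \<circ> b"
   by (rule alt5_real_element)
  have comp: "p \<circ> q\<in>?Alt" if "p\<in>?Alt" "q\<in>?Alt" for p q
   using group.is_monoid[OF alt_group_is_group] monoid.m_closed that by (metis alt_group_mult)
  have idA: "id\<in>?Alt" "f id = \<one>\<^bsub>G\<^esub>"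
   using subgroup.one_closed[OF alt_group_is_subgroup, of 5] p.hom_one by (simp_all add: sym_group_one)
  have a: "f a\<in>A" "f b\<in>A" using ab by (simp_all add: A_def)
  have G: "f a\<in>carrier G" "f b\<in>carrier G" using a subgroup.mem_carrier[OF sA] by simp_all
  have a3: "f a\<otimes>\<^bsub>G\<^esub> f a\<otimes>\<^bsub>G\<^esub> f a = \<one>\<^bsub>G\<^esub>"
   using fm[OF comp[OF ab(1,1)] ab(1)] fm[OF ab(1,1)] ab(4) idA by simp
  hence inv: "inv\<^bsub>G\<^esub> (f a) = f a\<otimes>\<^bsub>G\<^esub> f a" using G.inv_equality G by simp
  have "f b\<otimes>\<^bsub>G\<^esub> f a = f a\<otimes>\<^bsub>G\<^esub> f a\<otimes>\<^bsub>G\<^esub> f b"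
   using fm[OF ab(2,1)] fm[OF comp[OF ab(1,1)] ab(2)] fm[OF ab(1,1)] ab(5) by simp
  hence "f b\<otimes>\<^bsub>G\<^esub> f a\<otimes>\<^bsub>G\<^esub> inv\<^bsub>G\<^esub> (f b) = inv\<^bsub>G\<^esub> (f a)" using inv G by (simp add: G.m_assoc)
  moreover have "f a ~= \<one>\<^bsub>G\<^esub>"
   using inj_onD[OF inj, of a id] sub ab(1,3) idA by auto
  ultimately show False using perfect_60_not_120[OF D o a] a3 by (simp add: one_eq)
 qed
 hence DA: "derived N (carrier N) = A" using derived_cases by blast
 have nA: "A \<lhd> N" using N.derived_self_is_normal by (simp add: DA)
 hence sAN: "subgroup A N" by (simp add: N.normal_inv_iff)
 have "G\<lparr>carrier := A\<rparr> \<cong> N\<lparr>carrier := A\<rparr>" by (rule skew_brace_alt5[OF sub_brace[OF sAN sA] isoA])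
 hence "alt_group 5 \<cong> N\<lparr>carrier := A\<rparr>" by (rule iso_trans[OF isoA])
 thus ?thesis by (rule alt5_index_2_recognition[OF N.is_group o nA])
qed

section \<open>Regular permutation groups as skew braces\<close>

lemma carrier_BijGroup: "carrier (BijGroup X) = Bij X"
 by (simp add: BijGroup_def)

lemma BijGroup_mult_apply:
 "f\<in>Bij X ==> g\<in>Bij X ==> x\<in>X ==> (f\<otimes>\<^bsub>BijGroup X\<^esub> g) x = f (g x)"
 by (simp add: BijGroup_def compose_def)

lemma BijGroup_inv_apply:
 assumes "f\<in>Bij X" "x\<in>X"
 shows "(inv\<^bsub>BijGroup X\<^esub> f) x\<in>X" "f ((inv\<^bsub>BijGroup X\<^esub> f) x) = x" "(inv\<^bsub>BijGroup X\<^esub> f) (f x) = x"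
proof -
 have "f ` X = X" "inj_on f X" using assms(1) by (auto simp: Bij_def bij_betw_def)
 thus "(inv\<^bsub>BijGroup X\<^esub> f) x\<in>X" "f ((inv\<^bsub>BijGroup X\<^esub> f) x) = x" "(inv\<^bsub>BijGroup X\<^esub> f) (f x) = x"
  using assms by (auto simp: inv_BijGroup f_inv_into_f inv_into_into inj_on_def image_iff inv_f_f)
qed

lemma Bij_closed: "f\<in>Bij X ==> x\<in>X ==> f x\<in>X"
 by (auto simp: Bij_def bij_betw_def)

lemma Bij_ext: "f\<in>Bij X ==> g\<in>Bij X ==> (!!x. x\<in>X ==> f x = g x) ==> f = g"
 by (rule extensionalityI[of f X]) (auto simp: Bij_def)

lemma left_translation_Bij: "group G ==> g\<in>carrier G ==> left_translation G g\<in>Bij (carrier G)"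
proof -
 assume "group G" and g: "g\<in>carrier G"
 then interpret group G by simp
 have "bij_betw (\<lambda>x. g\<otimes>\<^bsub>G\<^esub> x) (carrier G) (carrier G)"
  using g by (intro bij_betwI[where g="\<lambda>x. inv\<^bsub>G\<^esub> g\<otimes>\<^bsub>G\<^esub> x"]) (auto simp: m_assoc[symmetric])
 thus ?thesis by (simp add: left_translation_def Bij_def)
qed

lemma perm_conj_Bij: "p\<in>Bij X ==> w\<in>Bij X ==> perm_conj X p w\<in>Bij X"
 using group.is_monoid[OF group_BijGroup, of X] group.inv_closed[OF group_BijGroup, of p X]
  monoid.m_closed[of "BijGroup X"]
 by (simp add: perm_conj_def BijGroup_def)

lemma perm_conj_apply:
 assumes "p\<in>Bij X" "w\<in>Bij X" "x\<in>X"
 shows "perm_conj X p w (p x) = p (w x)"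
proof -
 have i: "inv\<^bsub>BijGroup X\<^esub> p\<in>Bij X"
  using group.inv_closed[OF group_BijGroup, of p X] assms(1) by (simp add: carrier_BijGroup)
 have c: "p\<otimes>\<^bsub>BijGroup X\<^esub> w\<in>Bij X"
  using monoid.m_closed[OF group.is_monoid[OF group_BijGroup], of p X w] assms by (simp add: carrier_BijGroup)
 show ?thesis
  unfolding perm_conj_def
  using BijGroup_mult_apply[OF c i Bij_closed[OF assms(1,3)]] BijGroup_inv_apply(3)[OF assms(1,3)]
   BijGroup_mult_apply[OF assms(1,2,3)] by simp
qed

lemma regular_subgroup_Bij: "regular_subgroup X N ==> w\<in>N ==> w\<in>Bij X"
 using subgroup.mem_carrier by (fastforce simp: regular_subgroup_def BijGroup_def)

text \<open>Regularity gives for each \<open>x\<close> a unique \<open>u x\<close> in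
  \<open>N\<close> that moves the unit to \<open>x\<close>; the new product of \<open>x\<close> and
  \<open>y\<close> is \<open>u x y\<close>. The brace law then expresses that left translations
  normalise \<open>N\<close>.\<close>

lemma gp_skew_brace:
 fixes G :: "('g, 'n) monoid_scheme"
 assumes "group G" "gp_subgroup G (carrier G) (left_translation G) N"
 shows "\<exists>N' :: 'g monoid. skew_brace N' G \<and> perm_subgroup (carrier G) N \<cong> N'"
proof -
 let ?X = "carrier G" and ?P = "perm_subgroup (carrier G) N"
 interpret G: group G by fact
 have reg: "regular_subgroup ?X N" and nrm: "!!g w. g\<in>?X ==> w\<in>N ==> perm_conj ?X (left_translation G g) w\<in>N"
  using assms(2) by (auto simp: gp_subgroup_def)
 have sN: "subgroup N (BijGroup ?X)" using reg by (simp add: regular_subgroup_def)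
 interpret P: group ?P by (rule subgroup.subgroup_is_group[OF sN group_BijGroup])
 have NB: "w\<in>Bij ?X" if "w\<in>N" for w using regular_subgroup_Bij[OF reg that] .
 let ?h = "\<lambda>w. w \<one>\<^bsub>G\<^esub>"
 have ex1: "\<exists>!w. w\<in>N \<and> w x = y" if "x\<in>?X" "y\<in>?X" for x y
  using reg that by (simp add: regular_subgroup_def)
 define u where "u = (\<lambda>x. THE w. w\<in>N \<and> w \<one>\<^bsub>G\<^esub> = x)"
 have u: "u x\<in>N" "u x \<one>\<^bsub>G\<^esub> = x" if "x\<in>?X" for x
  using theI'[OF ex1[OF G.one_closed that]] by (simp_all add: u_def)
 have u_eq: "w = u x" if "w\<in>N" "w \<one>\<^bsub>G\<^esub> = x" "x\<in>?X" for w x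
  using ex1[OF G.one_closed that(3)] u[OF that(3)] that by auto
 have mult: "(w\<otimes>\<^bsub>?P\<^esub> v) x = w (v x)" if "w\<in>N" "v\<in>N" "x\<in>?X" for w v x
  using BijGroup_mult_apply[OF NB[OF that(1)] NB[OF that(2)] that(3)] by simp
 define N' where "N' = \<lparr>carrier = ?X, monoid.mult = (\<lambda>x y. u x y), one = \<one>\<^bsub>G\<^esub>\<rparr>"
 have h_hom: "?h\<in>hom ?P N'"
 proof (rule homI)
  fix w assume "w\<in>carrier ?P"
  hence w: "w\<in>N" by simp
  thus "?h w\<in>carrier N'" using Bij_closed[OF NB] by (simp add: N'_def)
  fix v assume "v\<in>carrier ?P"
  hence v: "v\<in>N" by simp
  have "u (?h w) = w" using u_eq[OF w refl Bij_closed[OF NB[OF w]]] by simp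
  thus "?h (w\<otimes>\<^bsub>?P\<^esub> v) = ?h w\<otimes>\<^bsub>N'\<^esub> ?h v" using mult[OF w v G.one_closed] by (simp add: N'_def)
 qed
 moreover have "bij_betw ?h (carrier ?P) (carrier N')"
  using u u_eq Bij_closed[OF NB G.one_closed]
  by (intro bij_betwI[where g=u]) (auto simp: N'_def)
 ultimately have h: "?h\<in>iso ?P N'" by (simp add: iso_def)
 have one: "?h \<one>\<^bsub>?P\<^esub> = \<one>\<^bsub>N'\<^esub>" by (simp add: BijGroup_def N'_def)
 hence "N'\<lparr>one := ?h \<one>\<^bsub>?P\<^esub>\<rparr> = N'" by (simp add: N'_def)
 hence gN': "group N'" using P.iso_imp_img_group[OF h] by simp
 then interpret N': group N' .
 have "skew_brace N' G"
 proof (intro skew_brace.intro skew_brace_axioms.intro gN' assms(1))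
  fix a b c assume "a\<in>carrier N'" "b\<in>carrier N'" "c\<in>carrier N'"
  hence abc: "a\<in>?X" "b\<in>?X" "c\<in>?X" by (simp_all add: N'_def)
  let ?l = "left_translation G a"
  have l: "?l\<in>Bij ?X" by (rule left_translation_Bij[OF assms(1) abc(1)])
  have lx: "?l x = a\<otimes>\<^bsub>G\<^esub> x" if "x\<in>?X" for x using that by (simp add: left_translation_def)
  let ?c = "perm_conj ?X ?l (u b)"
  have cN: "?c\<in>N" by (rule nrm[OF abc(1) u(1)[OF abc(2)]])
  have capp: "?c (a\<otimes>\<^bsub>G\<^esub> x) = a\<otimes>\<^bsub>G\<^esub> (u b x)" if "x\<in>?X" for x
   using perm_conj_apply[OF l NB[OF u(1)[OF abc(2)]] that] lx[OF that] lx[OF Bij_closed[OF NB[OF u(1)[OF abc(2)]] that]] by simp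
  let ?d = "?c \<one>\<^bsub>G\<^esub>"
  have d: "?d\<in>carrier N'" using Bij_closed[OF NB[OF cN]] by (simp add: N'_def)
  have ud: "u ?d = ?c" using u_eq[OF cN refl] d by (simp add: N'_def)
  have "?d\<otimes>\<^bsub>N'\<^esub> a = a\<otimes>\<^bsub>G\<^esub> b"
   using capp[OF G.one_closed] ud u(2)[OF abc(2)] abc by (simp add: N'_def)
  hence "?d = (a\<otimes>\<^bsub>G\<^esub> b)\<otimes>\<^bsub>N'\<^esub> inv\<^bsub>N'\<^esub> a"
   using N'.inv_solve_right[of ?d "a\<otimes>\<^bsub>G\<^esub> b" a] d abc by (simp add: N'_def)
  moreover have "a\<otimes>\<^bsub>G\<^esub> (b\<otimes>\<^bsub>N'\<^esub> c) = ?d\<otimes>\<^bsub>N'\<^esub> (a\<otimes>\<^bsub>G\<^esub> c)"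
   using capp[OF abc(3)] ud by (simp add: N'_def)
  ultimately show "a\<otimes>\<^bsub>G\<^esub> (b\<otimes>\<^bsub>N'\<^esub> c) = a\<otimes>\<^bsub>G\<^esub> b\<otimes>\<^bsub>N'\<^esub> inv\<^bsub>N'\<^esub> a\<otimes>\<^bsub>N'\<^esub> (a\<otimes>\<^bsub>G\<^esub> c)" by simp
 qed (simp_all add: N'_def)
 thus ?thesis using is_isoI[OF h] by blast
qed

lemma group_perm_subgroup: "regular_subgroup X N ==> group (perm_subgroup X N)"
 using subgroup.subgroup_is_group[OF _ group_BijGroup] by (auto simp: regular_subgroup_def)

lemma gp_subgroup_alt5:
 fixes G :: "('a, 'n) monoid_scheme"
 assumes "group G" "G \<cong> alt_group 5" "gp_subgroup G (carrier G) (left_translation G) N"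
 shows "perm_subgroup (carrier G) N \<cong> alt_group 5"
proof -
 obtain N' :: "'a monoid" where N': "skew_brace N' G" "perm_subgroup (carrier G) N \<cong> N'"
  using gp_skew_brace[OF assms(1,3)] by blast
 have gN': "group N'" using N'(1) by (simp add: skew_brace_def)
 have "alt_group 5 \<cong> G" using group.iso_sym[OF assms(1,2)] .
 hence "N' \<cong> G" using group.iso_sym[OF assms(1) skew_brace_alt5[OF N'(1)]] by simp
 thus ?thesis using N'(2) iso_trans[OF iso_trans[OF N'(2)]] assms(2) by blast
qed

lemma gp_subgroup_sym5:
 fixes G :: "('a, 'n) monoid_scheme"
 assumes "group G" "G \<cong> sym_group 5" "gp_subgroup G (carrier G) (left_translation G) N"
 shows "perm_subgroup (carrier G) N \<cong> sym_group 5 \<or>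
  perm_subgroup (carrier G) N \<cong> alt_group 5 \<times>\<times> integer_mod_group 2"
proof -
 obtain N' :: "'a monoid" where N': "skew_brace N' G" "perm_subgroup (carrier G) N \<cong> N'"
  using gp_skew_brace[OF assms(1,3)] by blast
 have "sym_group 5 \<cong> G" using group.iso_sym[OF assms(1,2)] .
 from skew_brace_sym5[OF N'(1) this] show ?thesis
 proof
  assume "N' \<cong> sym_group 5"
  thus ?thesis using iso_trans[OF N'(2)] by blast
 next
  assume "N' \<cong> alt_group 5 \<times>\<times> integer_mod_group 2"
  thus ?thesis using iso_trans[OF N'(2)] by blast
 qed
qed

section \<open>Finite groups of field automorphisms\<close>

context abelian_monoid
begin

lemma finsum_swap:
 assumes "finite A" "finite B" "!!x y. x\<in>A ==> y\<in>B ==> f x y\<in>carrier G"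
 shows "(\<Oplus>x\<in>A. \<Oplus>y\<in>B. f x y) = (\<Oplus>y\<in>B. \<Oplus>x\<in>A. f x y)"
 using assms(1,3)
proof (induction A)
 case empty
 thus ?case by simp
next
 case (insert a A)
 hence "(\<Oplus>y\<in>B. \<Oplus>x\<in>insert a A. f x y) = (\<Oplus>y\<in>B. f a y\<oplus>(\<Oplus>x\<in>A. f x y))"
  by (intro finsum_cong') (auto simp: Pi_def)
 also have "... = (\<Oplus>y\<in>B. f a y)\<oplus>(\<Oplus>y\<in>B. \<Oplus>x\<in>A. f x y)"
  using insert by (intro finsum_addf) (auto simp: Pi_def)
 finally show ?case using insert by (simp add: Pi_def)
qed

lemma finsum_cartesian:
 assumes "finite A" "finite B" "!!x y. x\<in>A ==> y\<in>B ==> f (x, y)\<in>carrier G"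
 shows "(\<Oplus>p\<in>A\<times>B. f p) = (\<Oplus>x\<in>A. \<Oplus>y\<in>B. f (x, y))"
 using assms(1,3)
proof (induction A)
 case empty
 thus ?case by simp
next
 case (insert a A)
 have "insert a A\<times>B = (Pair a ` B) \<union> (A\<times>B)" by auto
 hence "(\<Oplus>p\<in>insert a A\<times>B. f p) = (\<Oplus>p\<in>Pair a ` B. f p)\<oplus>(\<Oplus>p\<in>A\<times>B. f p)"
  using insert assms(2) by (simp add: finsum_Un_disjoint Pi_def disjoint_iff image_iff)
 also have "(\<Oplus>p\<in>Pair a ` B. f p) = (\<Oplus>y\<in>B. f (a, y))"
  using insert by (intro finsum_reindex) (auto simp: inj_on_def)
 finally show ?case using insert by (simp add: Pi_def)
qed

lemma finsum_delta:
 assumes "finite A" "a\<in>A" "f a\<in>carrier G"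
 shows "(\<Oplus>x\<in>A. if x = a then f x else \<zero>) = f a"
proof -
 have "(\<Oplus>x\<in>A. if x = a then f x else \<zero>) = (\<Oplus>x\<in>A. if a = x then f x else \<zero>)"
  using assms by (intro finsum_cong') auto
 also have "... = f a"
 proof -
  have "A = insert a (A - {a})" using assms(2) by blast
  hence "(\<Oplus>x\<in>A. if a = x then f x else \<zero>) = (\<Oplus>x\<in>insert a (A - {a}). if a = x then f x else \<zero>)" by simp
  also have "... = f a\<oplus>(\<Oplus>x\<in>A - {a}. if a = x then f x else \<zero>)"
   using assms by (subst finsum_insert) auto
  also have "(\<Oplus>x\<in>A - {a}. if a = x then f x else \<zero>) = \<zero>" by (rule add.finprod_one_eqI) auto
  finally show ?thesis using assms(3) by simp
 qed
 finally show ?thesis .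
qed

lemma finsum_bij:
 assumes "bij_betw h A B" "!!y. y\<in>B ==> f y\<in>carrier G"
 shows "(\<Oplus>y\<in>B. f y) = (\<Oplus>x\<in>A. f (h x))"
proof -
 have "h ` A = B" "inj_on h A" using assms(1) by (auto simp: bij_betw_def)
 thus ?thesis using finsum_reindex[of f h A] assms(2) by auto
qed

lemma finsum_group:
 assumes "finite A" "finite B" "!!x. x\<in>A ==> h x\<in>B" "!!x. x\<in>A ==> f x\<in>carrier G"
 shows "(\<Oplus>x\<in>A. f x) = (\<Oplus>y\<in>B. \<Oplus>x\<in>A. if h x = y then f x else \<zero>)"
proof -
 have "(\<Oplus>y\<in>B. \<Oplus>x\<in>A. if h x = y then f x else \<zero>) = (\<Oplus>x\<in>A. \<Oplus>y\<in>B. if h x = y then f x else \<zero>)"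
  using assms by (intro finsum_swap) auto
 also have "... = (\<Oplus>x\<in>A. f x)"
 proof (rule finsum_cong')
  fix x assume x: "x\<in>A"
  have "(\<Oplus>y\<in>B. if h x = y then f x else \<zero>) = (\<Oplus>y\<in>B. if y = h x then f x else \<zero>)"
   using assms(4)[OF x] by (intro finsum_cong') auto
  also have "... = f x" using finsum_delta[of B "h x" "\<lambda>_. f x"] assms x by simp
  finally show "(\<Oplus>y\<in>B. if h x = y then f x else \<zero>) = f x" .
 qed (use assms in auto)
 finally show ?thesis by simp
qed

lemma finsum_concat:
 fixes n m :: nat
 assumes "!!i. i < n ==> f i\<in>carrier G" "!!i. i < m ==> g i\<in>carrier G"
 shows "(\<Oplus>i\<in>{..<n + m}. if i < n then f i else g (i - n)) = (\<Oplus>i\<in>{..<n}. f i)\<oplus>(\<Oplus>i\<in>{..<m}. g i)"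
proof -
 let ?h = "\<lambda>i. if i < n then f i else g (i - n)"
 have "{..<n + m} = {..<n} \<union> {n..<n + m}" by auto
 moreover have "{..<n} \<inter> {n..<n + m} = {}" by auto
 moreover have "?h\<in>{..<n} \<rightarrow> carrier G" "?h\<in>{n..<n + m} \<rightarrow> carrier G" using assms by auto
 ultimately have "(\<Oplus>i\<in>{..<n + m}. ?h i) = (\<Oplus>i\<in>{..<n}. ?h i)\<oplus>(\<Oplus>i\<in>{n..<n + m}. ?h i)"
  by (simp only: finsum_Un_disjoint finite_lessThan finite_atLeastLessThan)
 also have "(\<Oplus>i\<in>{..<n}. ?h i) = (\<Oplus>i\<in>{..<n}. f i)" using assms by (intro finsum_cong') auto
 also have "(\<Oplus>i\<in>{n..<n + m}. ?h i) = (\<Oplus>i\<in>{..<m}. ?h (i + n))"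
  using assms by (intro finsum_bij bij_betwI[where g="\<lambda>i. i - n"]) auto
 also have "... = (\<Oplus>i\<in>{..<m}. g i)" using assms by (intro finsum_cong') auto
 finally show ?thesis .
qed

end

context ring
begin

lemma ls_nil [simp]: "list_sum R f [] = \<zero>" by (simp add: list_sum_def)
lemma ls_cons [simp]: "list_sum R f (x # xs) = f x\<oplus>list_sum R f xs" by (simp add: list_sum_def)

lemma ls_closed [simp]: "(!!x. x\<in>set xs ==> f x\<in>carrier R) ==> list_sum R f xs\<in>carrier R"
 by (induction xs) auto

lemma ls_cong: "(!!x. x\<in>set xs ==> f x = g x) ==> list_sum R f xs = list_sum R g xs"
 by (induction xs) auto

lemma ls_map [simp]: "list_sum R f (map g xs) = list_sum R (\<lambda>x. f (g x)) xs"
 by (induction xs) auto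

lemma ls_append:
 "(!!x. x\<in>set xs \<union> set ys ==> f x\<in>carrier R) ==> list_sum R f (xs @ ys) = list_sum R f xs\<oplus>list_sum R f ys"
 by (induction xs) (auto simp: a_assoc)

lemma ls_concat_map:
 "(!!x y. x\<in>set xs ==> y\<in>set (g x) ==> f y\<in>carrier R) ==>
  list_sum R f (concat (map g xs)) = list_sum R (\<lambda>x. list_sum R f (g x)) xs"
proof (induction xs)
 case (Cons x xs)
 have "list_sum R f (concat (map g (x # xs))) = list_sum R f (g x)\<oplus>list_sum R f (concat (map g xs))"
  using Cons.prems by (simp, intro ls_append) auto
 moreover have "list_sum R f (concat (map g xs)) = list_sum R (\<lambda>x. list_sum R f (g x)) xs"
  by (rule Cons.IH) (use Cons.prems in auto)
 ultimately show ?case by simp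
qed simp

lemma ls_ldistr:
 "(!!x. x\<in>set xs ==> f x\<in>carrier R) ==> a\<in>carrier R ==> list_sum R f xs\<otimes>a = list_sum R (\<lambda>x. f x\<otimes>a) xs"
 by (induction xs) (auto simp: l_distr)

lemma ls_rdistr:
 "(!!x. x\<in>set xs ==> f x\<in>carrier R) ==> a\<in>carrier R ==> a\<otimes>list_sum R f xs = list_sum R (\<lambda>x. a\<otimes>f x) xs"
 by (induction xs) (auto simp: r_distr)

lemma ls_finsum:
 "finite A ==> (!!x y. x\<in>set xs ==> y\<in>A ==> f x y\<in>carrier R) ==>
  list_sum R (\<lambda>x. \<Oplus>y\<in>A. f x y) xs = (\<Oplus>y\<in>A. list_sum R (\<lambda>x. f x y) xs)"
 by (induction xs) (simp_all add: finsum_addf Pi_def)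

lemma ls_distinct:
 "distinct xs ==> (!!x. x\<in>set xs ==> f x\<in>carrier R) ==> list_sum R f xs = (\<Oplus>x\<in>set xs. f x)"
 by (induction xs) (simp_all add: Pi_def)

end

lemma ring_hom_finsum:
 assumes "ring R" "ring S" "h\<in>ring_hom R S" "finite A" "!!x. x\<in>A ==> f x\<in>carrier R"
 shows "h (finsum R f A) = finsum S (\<lambda>x. h (f x)) A"
proof -
 interpret R: ring R by fact
 interpret S: ring S by fact
 show ?thesis
  using assms(4,5)
 proof (induction A)
  case empty
  thus ?case using ring_hom_zero[OF assms(3,1,2)] by simp
 next
  case (insert x A)
  thus ?case
   using ring_hom_add[OF assms(3)] ring_hom_closed[OF assms(3)] by (simp add: Pi_def)
 qed
qed

lemma ring_hom_ls:
 assumes "ring R" "ring S" "h\<in>ring_hom R S" "!!x. x\<in>set xs ==> f x\<in>carrier R"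
 shows "h (list_sum R f xs) = list_sum S (\<lambda>x. h (f x)) xs"
proof -
 interpret R: ring R by fact
 interpret S: ring S by fact
 show ?thesis
  using assms(4) ring_hom_zero[OF assms(3,1,2)] ring_hom_add[OF assms(3)] by (induction xs) auto
qed

section \<open>The separability system and the trace\<close>

context field
begin

text \<open>For one more automorphism \<open>u\<close>, choose \<open>z\<close> with
  \<open>u z ~= z\<close> and multiply the sum belonging to \<open>t\<close> by the quotient of
  \<open>t z - u z\<close> by \<open>z - u z\<close>. This factor is 1 for the identity and 0 for
  \<open>u\<close>, and it keeps the zeros already obtained.\<close>

lemma separating_coordinates:
 assumes "finite S" "!!t. t\<in>S ==> t\<in>ring_hom R R" "!!t. t\<in>S ==> \<exists>z\<in>carrier R. t z ~= z"
 shows "\<exists>(n::nat) x y. (\<forall>i. x i\<in>carrier R \<and> y i\<in>carrier R) \<and> (\<Oplus>i\<in>{..<n}. x i\<otimes>y i) = \<one> \<and>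
  (\<forall>t\<in>S. (\<Oplus>i\<in>{..<n}. x i\<otimes>t (y i)) = \<zero>)"
 using assms
proof (induction S)
 case empty
 show ?case by (intro exI[of _ 1] exI[of _ "\<lambda>_. \<one>"]) (simp add: lessThan_Suc)
next
 case (insert u S)
 have ex: "\<exists>(n::nat) x y. (\<forall>i. x i\<in>carrier R \<and> y i\<in>carrier R) \<and> (\<Oplus>i\<in>{..<n}. x i\<otimes>y i) = \<one> \<and>
   (\<forall>t\<in>S. (\<Oplus>i\<in>{..<n}. x i\<otimes>t (y i)) = \<zero>)"
  by (rule insert.IH) (use insert.prems in auto)
 then obtain n :: nat and x y where xy0: "\<forall>i. x i\<in>carrier R \<and> y i\<in>carrier R"
  and one: "(\<Oplus>i\<in>{..<n}. x i\<otimes>y i) = \<one>" and zero0: "\<forall>t\<in>S. (\<Oplus>i\<in>{..<n}. x i\<otimes>t (y i)) = \<zero>"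
  by blast
 have xy: "x i\<in>carrier R" "y i\<in>carrier R" for i using xy0 by simp_all
 have zero: "(\<Oplus>i\<in>{..<n}. x i\<otimes>t (y i)) = \<zero>" if "t\<in>S" for t using zero0 that by blast
 obtain z where z: "z\<in>carrier R" "u z ~= z" using insert.prems(2) by blast
 have u: "u\<in>ring_hom R R" using insert.prems(1) by blast
 have uz: "u z\<in>carrier R" using ring_hom_closed[OF u z(1)] .
 define d where "d = inv (z\<ominus>u z)"
 have nz: "z\<ominus>u z ~= \<zero>" using z uz by (metis r_right_minus_eq)
 hence d: "d\<in>carrier R" "d\<otimes>(z\<ominus>u z) = \<one>"
  using z uz field_Units by (auto simp: d_def)
 \<comment> \<open>The two halves of the new family carry the terms \<open>- u z\<close> and
   \<open>t z\<close> of the factor; \<open>d\<close> is the inverse of its denominator.\<close>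
 define x' where "x' = (\<lambda>i. if i < n then\<ominus>(d\<otimes>u z)\<otimes>x i else d\<otimes>x (i - n))"
 define y' where "y' = (\<lambda>i. if i < n then y i else y (i - n)\<otimes>z)"
 have cl: "x' i\<in>carrier R" "y' i\<in>carrier R" for i using xy d z uz by (auto simp: x'_def y'_def)
 have sum: "(\<Oplus>i\<in>{..<n + n}. x' i\<otimes>t (y' i)) = (\<Oplus>i\<in>{..<n}. x i\<otimes>t (y i))\<otimes>(d\<otimes>(t z\<ominus>u z))"
  if t: "t\<in>ring_hom R R" for t
 proof -
  have tc: "t w\<in>carrier R" if "w\<in>carrier R" for w using ring_hom_closed[OF t that] .
  let ?s = "\<lambda>i. x i\<otimes>t (y i)"
  have "(\<Oplus>i\<in>{..<n + n}. x' i\<otimes>t (y' i)) =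
    (\<Oplus>i\<in>{..<n + n}. if i < n then\<ominus>(d\<otimes>u z)\<otimes>?s i else (d\<otimes>t z)\<otimes>?s (i - n))"
  proof (rule finsum_cong')
   fix i
   show "x' i\<otimes>t (y' i) = (if i < n then\<ominus>(d\<otimes>u z)\<otimes>?s i else (d\<otimes>t z)\<otimes>?s (i - n))"
    using xy d z uz tc ring_hom_mult[OF t] by (simp add: x'_def y'_def m_ac l_minus r_minus)
  qed (use xy d z uz tc in auto)
  also have "... = (\<Oplus>i\<in>{..<n}.\<ominus>(d\<otimes>u z)\<otimes>?s i)\<oplus>(\<Oplus>i\<in>{..<n}. (d\<otimes>t z)\<otimes>?s i)"
   using xy d z uz tc by (intro finsum_concat) auto
  also have "... =\<ominus>(d\<otimes>u z)\<otimes>(\<Oplus>i\<in>{..<n}. ?s i)\<oplus>(d\<otimes>t z)\<otimes>(\<Oplus>i\<in>{..<n}. ?s i)"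
   using xy d z uz tc by (simp add: finsum_rdistr Pi_def)
  also have "... = (\<Oplus>i\<in>{..<n}. ?s i)\<otimes>(d\<otimes>(t z\<ominus>u z))"
  proof -
   have "(\<Oplus>i\<in>{..<n}. ?s i)\<in>carrier R" using xy tc by (intro finsum_closed) auto
   thus ?thesis using d(1) z(1) uz tc[OF z(1)]
    by (simp add: a_minus_def l_distr r_distr m_ac l_minus r_minus a_ac)
  qed
  finally show ?thesis .
 qed
 have "(\<Oplus>i\<in>{..<n + n}. x' i\<otimes>y' i) = \<one>"
  using sum[of "\<lambda>w. w"] one d by (simp add: ring_hom_def)
 moreover have "(\<Oplus>i\<in>{..<n + n}. x' i\<otimes>t (y' i)) = \<zero>" if "t\<in>insert u S" for t
 proof (cases "t = u")
  case True
  have "(\<Oplus>i\<in>{..<n}. x i\<otimes>u (y i))\<in>carrier R" using xy ring_hom_closed[OF u] by (intro finsum_closed) auto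
  thus ?thesis using sum[OF u] True d uz by (simp add: a_minus_def r_neg)
 next
  case False
  hence "t\<in>S" "t\<in>ring_hom R R" using that insert.prems(1) by auto
  thus ?thesis using sum zero d z uz ring_hom_closed[of t R R z] by simp
 qed
 ultimately show ?case using cl by (intro exI[of _ "n + n"] exI[of _ x'] exI[of _ y']) simp
qed

end

text \<open>A finite group of automorphisms rather than the Galois group of a given extension: it is
  instantiated with the full Galois group, with the stabiliser of an intermediate field and with the
  group generated by a transposition.\<close>

locale field_auts = field K for K (structure) +
 fixes \<Gamma> :: "('a => 'a) set"
 assumes sub: "subgroup \<Gamma> (BijGroup (carrier K))"
  and hom: "\<sigma>\<in>\<Gamma> ==> \<sigma>\<in>ring_hom K K"
  and fin: "finite \<Gamma>"
begin

definition "GG = (BijGroup (carrier K))\<lparr>carrier := \<Gamma>\<rparr>"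
abbreviation GG_mult (infixl "\<star>" 70) where "x\<star>y \<equiv> x\<otimes>\<^bsub>GG\<^esub> y"
abbreviation GG_inv ("iG _" [81] 80) where "iG x \<equiv> inv\<^bsub>GG\<^esub> x"
abbreviation "cK \<equiv> carrier K"
abbreviation "idG \<equiv> \<one>\<^bsub>GG\<^esub>"

lemma carrier_GG [simp]: "carrier GG = \<Gamma>" by (simp add: GG_def)

sublocale GG: group GG unfolding GG_def by (rule subgroup.subgroup_is_group[OF sub group_BijGroup])

lemma G_Bij: "t\<in>\<Gamma> ==> t\<in>Bij cK"
 using subgroup.mem_carrier[OF sub] by (simp add: carrier_BijGroup)

lemma G_mult_closed [simp]: "t\<in>\<Gamma> ==> u\<in>\<Gamma> ==> t\<star>u\<in>\<Gamma>" using GG.m_closed by simp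
lemma G_inv_closed [simp]: "t\<in>\<Gamma> ==> iG t\<in>\<Gamma>" using GG.inv_closed by simp
lemma G_one_closed [simp]: "idG\<in>\<Gamma>" using GG.one_closed by simp

lemma aut_closed [simp]: "t\<in>\<Gamma> ==> x\<in>cK ==> t x\<in>cK" using ring_hom_closed[OF hom] .
lemma aut_add: "t\<in>\<Gamma> ==> x\<in>cK ==> y\<in>cK ==> t (x\<oplus>y) = t x\<oplus>t y" using ring_hom_add[OF hom] .
lemma aut_mult: "t\<in>\<Gamma> ==> x\<in>cK ==> y\<in>cK ==> t (x\<otimes>y) = t x\<otimes>t y" using ring_hom_mult[OF hom] .
lemma aut_one [simp]: "t\<in>\<Gamma> ==> t \<one> = \<one>" using ring_hom_one[OF hom] .
lemma aut_zero [simp]: "t\<in>\<Gamma> ==> t \<zero> = \<zero>" using ring_hom_zero[OF hom] is_ring by blast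
lemma aut_finsum: "t\<in>\<Gamma> ==> finite A ==> (!!x. x\<in>A ==> f x\<in>cK) ==> t (\<Oplus>x\<in>A. f x) = (\<Oplus>x\<in>A. t (f x))"
 using ring_hom_finsum[OF is_ring is_ring hom] by blast
lemma aut_ls: "t\<in>\<Gamma> ==> (!!x. x\<in>set xs ==> f x\<in>cK) ==> t (list_sum K f xs) = list_sum K (\<lambda>x. t (f x)) xs"
 using ring_hom_ls[OF is_ring is_ring hom] by blast

lemma aut_comp: "t\<in>\<Gamma> ==> u\<in>\<Gamma> ==> x\<in>cK ==> (t\<star>u) x = t (u x)"
 using BijGroup_mult_apply[OF G_Bij G_Bij] by (simp add: GG_def)
lemma aut_id [simp]: "x\<in>cK ==> idG x = x" by (simp add: BijGroup_def GG_def)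
lemma aut_inv1 [simp]: "t\<in>\<Gamma> ==> x\<in>cK ==> (iG t) (t x) = x"
 using aut_comp[of "iG t" t x] GG.l_inv[of t] by simp
lemma aut_inv2 [simp]: "t\<in>\<Gamma> ==> x\<in>cK ==> t ((iG t) x) = x"
 using aut_comp[of t "iG t" x] GG.r_inv[of t] by simp

lemma aut_eqI: "t\<in>\<Gamma> ==> u\<in>\<Gamma> ==> (!!x. x\<in>cK ==> t x = u x) ==> t = u"
 using Bij_ext[OF G_Bij G_Bij] .

lemma left_mult_bij: "t\<in>\<Gamma> ==> bij_betw (\<lambda>u. t\<star>u) \<Gamma> \<Gamma>"
 using GG.m_assoc[of "iG t" t] GG.m_assoc[of t "iG t"] GG.l_inv[of t] GG.r_inv[of t] GG.l_one
 by (intro bij_betwI[where g="\<lambda>u. iG t\<star>u"]) auto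

definition tr :: "'a => 'a" where "tr x = (\<Oplus>t\<in>\<Gamma>. t x)"

lemma tr_closed [simp]: "x\<in>cK ==> tr x\<in>cK"
 unfolding tr_def by (intro finsum_closed) auto

lemma fixed_closed: "x\<in>fixed_field K \<Gamma> ==> x\<in>cK" by (simp add: fixed_field_def)

lemma tr_fixed: "x\<in>cK ==> tr x\<in>fixed_field K \<Gamma>"
proof -
 assume x: "x\<in>cK"
 have "t (tr x) = tr x" if t: "t\<in>\<Gamma>" for t
 proof -
  have "t (tr x) = (\<Oplus>u\<in>\<Gamma>. (t\<star>u) x)"
   unfolding tr_def using x t fin by (subst aut_finsum) (auto intro!: finsum_cong' simp: aut_comp)
  also have "... = tr x" unfolding tr_def using left_mult_bij[OF t] x by (intro finsum_bij[symmetric]) auto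
  finally show ?thesis .
 qed
 thus ?thesis using x by (simp add: fixed_field_def)
qed

lemma tr_add: "x\<in>cK ==> y\<in>cK ==> tr (x\<oplus>y) = tr x\<oplus>tr y"
 unfolding tr_def using finsum_addf[of "\<lambda>t. t x" \<Gamma> "\<lambda>t. t y"]
 by (simp add: Pi_def aut_add cong: finsum_cong)

lemma tr_mult_fixed: "c\<in>fixed_field K \<Gamma> ==> x\<in>cK ==> tr (c\<otimes>x) = c\<otimes>tr x"
proof -
 assume c: "c\<in>fixed_field K \<Gamma>" and x: "x\<in>cK"
 have "tr (c\<otimes>x) = (\<Oplus>t\<in>\<Gamma>. c\<otimes>t x)"
  unfolding tr_def using c x by (intro finsum_cong') (auto simp: aut_mult fixed_field_def)
 thus ?thesis unfolding tr_def using c x fin by (simp add: finsum_rdistr Pi_def fixed_field_def)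
qed

text \<open>Pulling out \<open>t\<close> reduces the pair \<open>t\<close>, \<open>u\<close> to the
  identity and \<open>iG t \<star> u\<close>, where \<open>separating_coordinates\<close>
  applies.\<close>

lemma coordinates:
 "\<exists>(n::nat) x y. (\<forall>i. x i\<in>cK \<and> y i\<in>cK) \<and>
  (\<forall>t\<in>\<Gamma>. \<forall>u\<in>\<Gamma>. (\<Oplus>i\<in>{..<n}. t (x i)\<otimes>u (y i)) = (if t = u then \<one> else \<zero>))"
proof -
 have "\<exists>z\<in>cK. t z ~= z" if "t\<in>\<Gamma> - {idG}" for t
  using aut_eqI[of t "idG"] that by auto
 hence ex: "\<exists>(n::nat) x y. (\<forall>i. x i\<in>cK \<and> y i\<in>cK) \<and> (\<Oplus>i\<in>{..<n}. x i\<otimes>y i) = \<one> \<and>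
   (\<forall>t\<in>\<Gamma> - {idG}. (\<Oplus>i\<in>{..<n}. x i\<otimes>t (y i)) = \<zero>)"
  using fin hom by (intro separating_coordinates) auto
 then obtain n :: nat and x y where xy0: "\<forall>i. x i\<in>cK \<and> y i\<in>cK"
  and one: "(\<Oplus>i\<in>{..<n}. x i\<otimes>y i) = \<one>"
  and zero: "\<forall>t\<in>\<Gamma> - {idG}. (\<Oplus>i\<in>{..<n}. x i\<otimes>t (y i)) = \<zero>"
  by blast
 have xy: "x i\<in>cK" "y i\<in>cK" for i using xy0 by simp_all
 have "(\<Oplus>i\<in>{..<n}. t (x i)\<otimes>u (y i)) = (if t = u then \<one> else \<zero>)" if t: "t\<in>\<Gamma>" and u: "u\<in>\<Gamma>" for t u
 proof -
  let ?r = "iG t\<star>u"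
  have r: "?r\<in>\<Gamma>" using t u by simp
  have "(\<Oplus>i\<in>{..<n}. t (x i)\<otimes>u (y i)) = (\<Oplus>i\<in>{..<n}. t (x i\<otimes>?r (y i)))"
   using t u xy by (intro finsum_cong') (auto simp: aut_mult aut_comp)
  also have "... = t (\<Oplus>i\<in>{..<n}. x i\<otimes>?r (y i))"
   using t r xy by (intro aut_finsum[symmetric]) auto
  also have "(\<Oplus>i\<in>{..<n}. x i\<otimes>?r (y i)) = (if t = u then \<one> else \<zero>)"
  proof (cases "t = u")
   case True
   hence "?r = idG" using GG.l_inv[of u] u by simp
   thus ?thesis using True one xy by simp
  next
   case False
   have "?r ~= idG"
   proof
    assume "?r = idG"
    hence "t\<star>?r = t" using t GG.r_one by simp
    thus False using False GG.m_assoc[of t "iG t" u] GG.r_inv[of t] GG.l_one[of u] t u by simp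
   qed
   thus ?thesis using False zero r by simp
  qed
  finally show ?thesis using t u by simp
 qed
 thus ?thesis using xy by blast
qed

end

context ring
begin

lemma fs_closed [simp, intro]: "(!!x. x\<in>A ==> f x\<in>carrier R) ==> (\<Oplus>x\<in>A. f x)\<in>carrier R"
 by (intro finsum_closed) auto

lemma fs_cong:
 "(!!x. x\<in>A ==> f x = g x) ==> (!!x. x\<in>A ==> g x\<in>carrier R) ==> (\<Oplus>x\<in>A. f x) = (\<Oplus>x\<in>A. g x)"
 by (intro finsum_cong') auto

lemma fs_rdistr:
 "finite A ==> a\<in>carrier R ==> (!!x. x\<in>A ==> f x\<in>carrier R) ==> a\<otimes>(\<Oplus>x\<in>A. f x) = (\<Oplus>x\<in>A. a\<otimes>f x)"
 by (intro finsum_rdistr) auto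

lemma fs_ldistr:
 "finite A ==> a\<in>carrier R ==> (!!x. x\<in>A ==> f x\<in>carrier R) ==> (\<Oplus>x\<in>A. f x)\<otimes>a = (\<Oplus>x\<in>A. f x\<otimes>a)"
 by (intro finsum_ldistr) auto

lemma fs_add:
 "(!!x. x\<in>A ==> f x\<in>carrier R) ==> (!!x. x\<in>A ==> g x\<in>carrier R) ==>
  (\<Oplus>x\<in>A. f x\<oplus>g x) = (\<Oplus>x\<in>A. f x)\<oplus>(\<Oplus>x\<in>A. g x)"
 by (intro finsum_addf) auto

lemma fs_zero: "(!!x. x\<in>A ==> f x = \<zero>) ==> (\<Oplus>x\<in>A. f x) = \<zero>"
 by (rule add.finprod_one_eqI)

lemma fs_delta:
 "finite A ==> a\<in>A ==> f a\<in>carrier R ==> (\<Oplus>x\<in>A. if a = x then f x else \<zero>) = f a"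
 "finite A ==> a\<in>A ==> f a\<in>carrier R ==> (\<Oplus>x\<in>A. if x = a then f x else \<zero>) = f a"
 using finsum_delta[of A a f] by (simp_all add: eq_commute[of a])

end

context field_auts
begin

lemma fixedD: "x\<in>fixed_field K \<Gamma> ==> t\<in>\<Gamma> ==> t x = x"
 by (simp add: fixed_field_def)

lemma fixedI: "x\<in>cK ==> (!!t. t\<in>\<Gamma> ==> t x = x) ==> x\<in>fixed_field K \<Gamma>"
 by (simp add: fixed_field_def)

lemma aut_minus: "t\<in>\<Gamma> ==> x\<in>cK ==> t (\<ominus> x) =\<ominus>t x"
 using aut_add[of t "\<ominus> x" x] minus_equality[of "t (\<ominus> x)" "t x"] by (simp add: l_neg)

lemma subfield_fixed: "subfield (fixed_field K \<Gamma>) K"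
proof (rule subfieldI')
 show "subring (fixed_field K \<Gamma>) K"
 proof (rule subringI)
  show "\<ominus> h\<in>fixed_field K \<Gamma>" if h: "h\<in>fixed_field K \<Gamma>" for h
  proof (rule fixedI)
   show "t (\<ominus> h) =\<ominus>h" if "t\<in>\<Gamma>" for t
    using aut_minus[OF that fixed_closed[OF h]] fixedD[OF h that] by simp
  qed (use fixed_closed[OF h] in simp)
  show "h\<otimes>l\<in>fixed_field K \<Gamma>" "h\<oplus>l\<in>fixed_field K \<Gamma>"
   if h: "h\<in>fixed_field K \<Gamma>" "l\<in>fixed_field K \<Gamma>" for h l
  proof -
   have *: "t h = h \<and> t l = l" if "t\<in>\<Gamma>" for t using fixedD h that by blast
   show "h\<otimes>l\<in>fixed_field K \<Gamma>" "h\<oplus>l\<in>fixed_field K \<Gamma>"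
    using fixed_closed[OF h(1)] fixed_closed[OF h(2)] aut_mult[of _ h l] aut_add[of _ h l] *
    by (metis fixedI m_closed, metis fixedI a_closed)
  qed
 qed (auto simp: fixed_field_def)
next
 fix x assume x: "x\<in>fixed_field K \<Gamma> - {\<zero>}"
 hence xc: "x\<in>cK" "x ~= \<zero>" by (auto simp: fixed_field_def)
 hence U: "x\<in>Units K" by (simp add: field_Units)
 have "t (inv x) = inv x" if s: "t\<in>\<Gamma>" for t
 proof -
  have xs: "t x = x" using x s by (intro fixedD) auto
  have i: "t (inv x)\<in>cK" using U s by simp
  have "t (inv x)\<otimes>x = \<one>" using aut_mult[OF s, of "inv x" x] xs U s xc by (simp add: Units_l_inv)
  hence "x\<otimes>t (inv x) = \<one>" using i xc by (simp add: m_comm)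
  thus ?thesis using comm_inv_char[OF xc(1) i] by simp
 qed
 thus "inv x\<in>fixed_field K \<Gamma>" using U by (simp add: fixed_field_def)
qed

definition crd :: "nat\<times>(nat => 'a)\<times>(nat => 'a)" where
 "crd = (SOME (n, x, y). (\<forall>i. x i\<in>cK \<and> y i\<in>cK) \<and>
  (\<forall>t\<in>\<Gamma>. \<forall>u\<in>\<Gamma>. (\<Oplus>i\<in>{..<n}. t (x i)\<otimes>u (y i)) = (if t = u then \<one> else \<zero>)))"

definition "idx = {..<fst crd}"
definition "xx = fst (snd crd)"
definition "yy = snd (snd crd)"

lemma crd_props:
 "(\<forall>i. xx i\<in>cK \<and> yy i\<in>cK) \<and>
  (\<forall>t\<in>\<Gamma>. \<forall>u\<in>\<Gamma>. (\<Oplus>i\<in>idx. t (xx i)\<otimes>u (yy i)) = (if t = u then \<one> else \<zero>))"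
proof -
 let ?P = "\<lambda>(n::nat, x, y). (\<forall>i. x i\<in>cK \<and> y i\<in>cK) \<and>
  (\<forall>t\<in>\<Gamma>. \<forall>u\<in>\<Gamma>. (\<Oplus>i\<in>{..<n}. t (x i)\<otimes>u (y i)) = (if t = u then \<one> else \<zero>))"
 have "\<exists>c. ?P c" using coordinates by auto
 hence "?P crd" unfolding crd_def by (rule someI_ex)
 thus ?thesis by (simp add: idx_def xx_def yy_def split_beta)
qed

lemma finite_idx [simp]: "finite idx" by (simp add: idx_def)
lemma xx_closed [simp]: "xx i\<in>cK" and yy_closed [simp]: "yy i\<in>cK"
 using crd_props by auto
lemma crd_delta: "t\<in>\<Gamma> ==> u\<in>\<Gamma> ==> (\<Oplus>i\<in>idx. t (xx i)\<otimes>u (yy i)) = (if t = u then \<one> else \<zero>)"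
 using crd_props by auto
lemma crd_delta1: "t\<in>\<Gamma> ==> (\<Oplus>i\<in>idx. xx i\<otimes>t (yy i)) = (if t = idG then \<one> else \<zero>)"
 using crd_delta[of "idG" t] by (simp add: eq_commute[of t])
lemma crd_delta2: "t\<in>\<Gamma> ==> (\<Oplus>i\<in>idx. yy i\<otimes>t (xx i)) = (if t = idG then \<one> else \<zero>)"
 using crd_delta[of t "idG"] by (simp add: m_comm)

text \<open>\<open>xx\<close> and \<open>yy\<close> are dual systems for the trace form. They play
  the part of a basis and its dual basis, except that they may be linearly dependent.\<close>

lemma dual1: assumes z: "z\<in>cK" shows "(\<Oplus>i\<in>idx. xx i\<otimes>tr (yy i\<otimes>z)) = z"
proof -
 have "(\<Oplus>i\<in>idx. xx i\<otimes>tr (yy i\<otimes>z)) = (\<Oplus>i\<in>idx. \<Oplus>t\<in>\<Gamma>. (xx i\<otimes>t (yy i))\<otimes>t z)"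
  using z fin by (intro fs_cong) (auto simp: tr_def fs_rdistr aut_mult m_assoc intro!: fs_cong)
 also have "... = (\<Oplus>t\<in>\<Gamma>. \<Oplus>i\<in>idx. (xx i\<otimes>t (yy i))\<otimes>t z)" using z fin by (intro finsum_swap) auto
 also have "... = (\<Oplus>t\<in>\<Gamma>. if t = idG then t z else \<zero>)"
  using z by (intro fs_cong) (auto simp: fs_ldistr[symmetric] crd_delta1)
 also have "... = z" using z fin by (subst fs_delta(2)) auto
 finally show ?thesis .
qed

lemma dual2: assumes z: "z\<in>cK" shows "(\<Oplus>i\<in>idx. yy i\<otimes>tr (xx i\<otimes>z)) = z"
proof -
 have "(\<Oplus>i\<in>idx. yy i\<otimes>tr (xx i\<otimes>z)) = (\<Oplus>i\<in>idx. \<Oplus>t\<in>\<Gamma>. (yy i\<otimes>t (xx i))\<otimes>t z)"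
  using z fin by (intro fs_cong) (auto simp: tr_def fs_rdistr aut_mult m_assoc intro!: fs_cong)
 also have "... = (\<Oplus>t\<in>\<Gamma>. \<Oplus>i\<in>idx. (yy i\<otimes>t (xx i))\<otimes>t z)" using z fin by (intro finsum_swap) auto
 also have "... = (\<Oplus>t\<in>\<Gamma>. if t = idG then t z else \<zero>)"
  using z by (intro fs_cong) (auto simp: fs_ldistr[symmetric] crd_delta2)
 also have "... = z" using z fin by (subst fs_delta(2)) auto
 finally show ?thesis .
qed

lemma sum_tr: "(\<Oplus>i\<in>idx. xx i\<otimes>tr (yy i)) = \<one>"
 using dual1[OF one_closed] by simp

text \<open>If all \<open>tr (yy i)\<close> vanished, \<open>sum_tr\<close> would read 0 = 1. The
  unit is no candidate, as its trace is the group order and may vanish in \<open>K\<close>.\<close>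

lemma trace_one: "\<exists>t\<in>cK. tr t = \<one>"
proof -
 have "\<exists>i\<in>idx. tr (yy i) ~= \<zero>"
 proof (rule ccontr)
  assume "\<not> ?thesis"
  hence "(\<Oplus>i\<in>idx. xx i\<otimes>tr (yy i)) = \<zero>" by (intro fs_zero) auto
  thus False using sum_tr by simp
 qed
 then obtain i where i: "i\<in>idx" "tr (yy i) ~= \<zero>" by blast
 have f: "tr (yy i)\<in>fixed_field K \<Gamma> - {\<zero>}" using tr_fixed[of "yy i"] i by simp
 note inv = subfield_m_inv[OF subfield_fixed f]
 have "tr (inv (tr (yy i))\<otimes>yy i) = \<one>" using tr_mult_fixed[of "inv (tr (yy i))" "yy i"] inv by simp
 moreover have "inv (tr (yy i))\<otimes>yy i\<in>cK" using inv(1) fixed_closed by simp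
 ultimately show ?thesis by blast
qed

definition "tt = (SOME t. t\<in>cK \<and> tr t = \<one>)"

lemma tt: "tt\<in>cK" "tr tt = \<one>"
 using someI_ex[of "\<lambda>t. t\<in>cK \<and> tr t = \<one>"] trace_one unfolding tt_def by auto

end

section \<open>Hopf algebras obtained by descent\<close>

text \<open>\<open>cl\<close> is a crossed homomorphism for the action of \<open>\<Gamma>\<close> on
  \<open>N\<close>, with section \<open>e\<close>, so \<open>N\<close> is identified with the cosets
  of a stabiliser. Greither--Pareigis subgroups, the classical structure (with trivial action) and a
  bare group of automorphisms are all instances.\<close>

locale hopf_descent = field_auts K \<Gamma> + N: group N
 for K (structure) and \<Gamma> and N :: "('n, 'z) monoid_scheme" +
 fixes act :: "('a => 'a) => 'n => 'n" and cl :: "('a => 'a) => 'n" and e :: "'n => ('a => 'a)"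
 assumes finN [simp]: "finite (carrier N)"
  and act_closed [simp]: "[|g\<in>\<Gamma>; \<eta>\<in>carrier N|] ==> act g \<eta>\<in>carrier N"
  and act_mult: "[|g\<in>\<Gamma>; \<eta>\<in>carrier N; \<zeta>\<in>carrier N|] ==> act g (\<eta>\<otimes>\<^bsub>N\<^esub> \<zeta>) = act g \<eta>\<otimes>\<^bsub>N\<^esub> act g \<zeta>"
  and act_comp: "[|g\<in>\<Gamma>; h\<in>\<Gamma>; \<eta>\<in>carrier N|] ==> act (g\<otimes>\<^bsub>GG\<^esub> h) \<eta> = act g (act h \<eta>)"
  and act_id [simp]: "\<eta>\<in>carrier N ==> act \<one>\<^bsub>GG\<^esub> \<eta> = \<eta>"
  and cl_closed [simp]: "g\<in>\<Gamma> ==> cl g\<in>carrier N"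
  and cl_mult: "[|g\<in>\<Gamma>; h\<in>\<Gamma>|] ==> cl (g\<otimes>\<^bsub>GG\<^esub> h) = cl g\<otimes>\<^bsub>N\<^esub> act g (cl h)"
  and e_closed [simp]: "\<eta>\<in>carrier N ==> e \<eta>\<in>\<Gamma>"
  and cl_e [simp]: "\<eta>\<in>carrier N ==> cl (e \<eta>) = \<eta>"
begin

abbreviation N_mult (infixl "\<cdot>" 70) where "x\<cdot>y \<equiv> x\<otimes>\<^bsub>N\<^esub> y"
abbreviation N_inv ("iN _" [81] 80) where "iN x \<equiv> inv\<^bsub>N\<^esub> x"
abbreviation "eN \<equiv> \<one>\<^bsub>N\<^esub>"

abbreviation "C \<equiv> carrier N"
abbreviation "F \<equiv> fixed_field K \<Gamma>"

definition "\<Gamma>' = {g\<in>\<Gamma>. cl g = eN}"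
definition "L = fixed_field K \<Gamma>'"

text \<open>The ring of invariants of the group algebra \<open>K[N]\<close>, its elements being
  written as equivariant functions.\<close>

definition Inv :: "('n => 'a) set" where
 "Inv = {c\<in>C \<rightarrow>\<^sub>E cK. \<forall>g\<in>\<Gamma>. \<forall>w\<in>C. c (act g w) = g (c w)}"

lemma act_inv1 [simp]: "g\<in>\<Gamma> ==> w\<in>C ==> act (iG g) (act g w) = w"
 using act_comp[of "iG g" g w] GG.l_inv[of g] by simp

lemma act_inv2 [simp]: "g\<in>\<Gamma> ==> w\<in>C ==> act g (act (iG g) w) = w"
 using act_comp[of g "iG g" w] GG.r_inv[of g] by simp

lemma act_bij: "g\<in>\<Gamma> ==> bij_betw (act g) C C"
 by (intro bij_betwI[where g="act (iG g)"]) auto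

lemma act_eq_iff: "g\<in>\<Gamma> ==> w\<in>C ==> v\<in>C ==> act g w = act g v \<longleftrightarrow> w = v"
 using act_bij[of g] by (auto simp: bij_betw_def inj_on_def)

lemma act_group_hom: "g\<in>\<Gamma> ==> group_hom N N (act g)"
 by (intro group_hom.intro N.is_group group_hom_axioms.intro homI) (auto simp: act_mult)

lemma act_one [simp]: "g\<in>\<Gamma> ==> act g eN = eN"
 using group_hom.hom_one[OF act_group_hom] .

lemma act_inv: "g\<in>\<Gamma> ==> w\<in>C ==> act g (iN w) = iN (act g w)"
 using group_hom.hom_inv[OF act_group_hom] .

lemma N_left_bij: "w\<in>C ==> bij_betw (\<lambda>v. w\<cdot>v) C C"
 by (intro bij_betwI[where g="\<lambda>v. iN w\<cdot>v"]) (auto simp: N.m_assoc[symmetric])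

lemma N_inv_bij: "bij_betw (\<lambda>w. iN w) C C"
 by (intro bij_betwI[where g="\<lambda>w. iN w"]) auto

lemma InvI: "(!!w. w\<in>C ==> c w\<in>cK) ==> (!!g w. g\<in>\<Gamma> ==> w\<in>C ==> c (act g w) = g (c w)) ==>
  restrict c C\<in>Inv"
 by (auto simp: Inv_def)

lemma Inv_closed [simp]: "c\<in>Inv ==> w\<in>C ==> c w\<in>cK"
 by (auto simp: Inv_def)

lemma Inv_act: "c\<in>Inv ==> g\<in>\<Gamma> ==> w\<in>C ==> c (act g w) = g (c w)"
 by (auto simp: Inv_def)

lemma Inv_ext: "a\<in>Inv ==> b\<in>Inv ==> (!!w. w\<in>C ==> a w = b w) ==> a = b"
 by (rule PiE_ext[of a C "\<lambda>_. cK" b]) (auto simp: Inv_def)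

definition "adds a b = (\<lambda>w\<in>C. a w\<oplus>b w)"
definition "scal s a = (\<lambda>w\<in>C. s\<otimes>a w)"
definition "conv a b = (\<lambda>w\<in>C. \<Oplus>v\<in>C. a v\<otimes>b (iN v\<cdot>w))"
definition "csum I c = (\<lambda>w\<in>C. \<Oplus>i\<in>I. c i w)"
definition "dl t v = (\<lambda>w. if w = t then v else \<zero>)"
text \<open>The trace of an element of \<open>K[N]\<close> under the simultaneous action of
  \<open>\<Gamma>\<close> on coefficients and on \<open>N\<close>. It is the main source of
  invariant elements.\<close>

definition "Tr w = (\<lambda>v\<in>C. \<Oplus>g\<in>\<Gamma>. g (w (act (iG g) v)))"

lemma adds_Inv [simp]: "a\<in>Inv ==> b\<in>Inv ==> adds a b\<in>Inv"
 unfolding adds_def by (intro InvI) (auto simp: Inv_act aut_add)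

lemma F_closed [simp]: "s\<in>F ==> s\<in>cK" by (rule fixed_closed)

lemma scal_Inv [simp]: "s\<in>F ==> a\<in>Inv ==> scal s a\<in>Inv"
 unfolding scal_def
proof (rule InvI)
 assume s: "s\<in>F" and a: "a\<in>Inv"
 show "s\<otimes>a (act g w) = g (s\<otimes>a w)" if "g\<in>\<Gamma>" "w\<in>C" for g w
  using that s a fixedD[OF s that(1)] by (simp add: Inv_act aut_mult)
qed simp

lemma csum_Inv [simp]: "finite I ==> (!!i. i\<in>I ==> c i\<in>Inv) ==> csum I c\<in>Inv"
 unfolding csum_def by (intro InvI) (auto simp: Inv_act aut_finsum intro!: fs_cong)

lemma conv_Inv [simp]:
 assumes "a\<in>Inv" "b\<in>Inv" shows "conv a b\<in>Inv"
 unfolding conv_def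
proof (intro InvI)
 fix g w assume g: "g\<in>\<Gamma>" "w\<in>C"
 have "(\<Oplus>v\<in>C. a v\<otimes>b (iN v\<cdot>act g w)) = (\<Oplus>v\<in>C. a (act g v)\<otimes>b (iN (act g v)\<cdot>act g w))"
  using g assms by (intro finsum_bij act_bij) auto
 also have "... = (\<Oplus>v\<in>C. g (a v\<otimes>b (iN v\<cdot>w)))"
  using g assms by (intro fs_cong) (simp_all add: aut_mult Inv_act flip: act_inv act_mult)
 also have "... = g (\<Oplus>v\<in>C. a v\<otimes>b (iN v\<cdot>w))"
  using g assms by (intro aut_finsum[symmetric]) auto
 finally show "(\<Oplus>v\<in>C. a v\<otimes>b (iN v\<cdot>act g w)) = g (\<Oplus>v\<in>C. a v\<otimes>b (iN v\<cdot>w))" .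
qed (use assms in auto)

lemma Tr_Inv [simp]:
 assumes w: "!!v. v\<in>C ==> w v\<in>cK" shows "Tr w\<in>Inv"
 unfolding Tr_def
proof (intro InvI)
 fix h v assume h: "h\<in>\<Gamma>" "v\<in>C"
 have "(\<Oplus>g\<in>\<Gamma>. g (w (act (iG g) (act h v)))) =
   (\<Oplus>g\<in>\<Gamma>. (h\<star>g) (w (act (iG (h\<star>g)) (act h v))))"
  using h w by (intro finsum_bij left_mult_bij) auto
 also have "... = (\<Oplus>g\<in>\<Gamma>. h (g (w (act (iG g) v))))"
  using h w by (intro fs_cong) (simp_all add: aut_comp GG.inv_mult_group act_comp)
 also have "... = h (\<Oplus>g\<in>\<Gamma>. g (w (act (iG g) v)))"
  using h w fin by (intro aut_finsum[symmetric]) auto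
 finally show "(\<Oplus>g\<in>\<Gamma>. g (w (act (iG g) (act h v)))) = h (\<Oplus>g\<in>\<Gamma>. g (w (act (iG g) v)))" .
qed (use w in auto)

lemma dl_closed [simp]: "v\<in>cK ==> dl t v w\<in>cK" by (simp add: dl_def)

lemma Tr_scal_Inv: assumes "v\<in>cK" "a\<in>Inv" shows "Tr (\<lambda>w. v\<otimes>a w) = scal (tr v) a"
proof (rule Inv_ext)
 fix w assume w: "w\<in>C"
 have "(\<Oplus>g\<in>\<Gamma>. g (v\<otimes>a (act (iG g) w))) = (\<Oplus>g\<in>\<Gamma>. g v\<otimes>a w)"
  using assms w by (intro fs_cong) (simp_all add: aut_mult Inv_act[symmetric])
 thus "Tr (\<lambda>w. v\<otimes>a w) w = scal (tr v) a w"
  using assms w fin by (simp add: Tr_def scal_def tr_def fs_ldistr)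
qed (use assms tr_fixed in auto)

lemma Tr_sum_dl: assumes w: "!!v. v\<in>C ==> w v\<in>cK" shows "Tr w = csum C (\<lambda>t. Tr (dl t (w t)))"
proof (rule Inv_ext)
 fix v assume v: "v\<in>C"
 have "(\<Oplus>t\<in>C. \<Oplus>g\<in>\<Gamma>. g (dl t (w t) (act (iG g) v))) =
   (\<Oplus>g\<in>\<Gamma>. \<Oplus>t\<in>C. g (dl t (w t) (act (iG g) v)))"
  using w v fin by (intro finsum_swap) auto
 also have "... = (\<Oplus>g\<in>\<Gamma>. g (w (act (iG g) v)))"
 proof (intro fs_cong)
  fix g assume g: "g\<in>\<Gamma>"
  have "(\<Oplus>t\<in>C. g (dl t (w t) (act (iG g) v))) = (\<Oplus>t\<in>C. if act (iG g) v = t then g (w t) else \<zero>)"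
   using g w by (intro fs_cong) (auto simp: dl_def)
  also have "... = g (w (act (iG g) v))" using g w v by (intro fs_delta(1)) auto
  finally show "(\<Oplus>t\<in>C. g (dl t (w t) (act (iG g) v))) = g (w (act (iG g) v))" .
 qed (use w v in auto)
 finally show "Tr w v = csum C (\<lambda>t. Tr (dl t (w t))) v" using v by (simp add: Tr_def csum_def)
qed (use w in auto)

text \<open>Expanding \<open>z\<close> by \<open>dual2\<close> leaves coefficients that are traces;
  these are fixed by \<open>\<Gamma>\<close> and pass through \<open>Tr\<close>. The finitely many
  elements \<open>Tr (dl v (yy i))\<close> therefore span.\<close>

lemma Tr_dl_expand:
 assumes z: "z\<in>cK" shows "Tr (dl v z) = csum idx (\<lambda>i. scal (tr (xx i\<otimes>z)) (Tr (dl v (yy i))))"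
proof (rule Inv_ext)
 fix w assume w: "w\<in>C"
 have d: "dl v z w' = (\<Oplus>i\<in>idx. tr (xx i\<otimes>z)\<otimes>dl v (yy i) w')" for w'
  using dual2[OF z] z by (simp add: dl_def m_comm fs_zero)
 have "(\<Oplus>g\<in>\<Gamma>. g (dl v z (act (iG g) w))) =
   (\<Oplus>g\<in>\<Gamma>. \<Oplus>i\<in>idx. tr (xx i\<otimes>z)\<otimes>g (dl v (yy i) (act (iG g) w)))"
 proof (intro fs_cong)
  fix g assume g: "g\<in>\<Gamma>"
  have "g (tr (xx i\<otimes>z)) = tr (xx i\<otimes>z)" for i using fixedD[OF tr_fixed g] z by simp
  thus "g (dl v z (act (iG g) w)) = (\<Oplus>i\<in>idx. tr (xx i\<otimes>z)\<otimes>g (dl v (yy i) (act (iG g) w)))"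
   unfolding d using g z by (subst aut_finsum) (auto simp: aut_mult)
 qed (use z w in auto)
 also have "... = (\<Oplus>i\<in>idx. \<Oplus>g\<in>\<Gamma>. tr (xx i\<otimes>z)\<otimes>g (dl v (yy i) (act (iG g) w)))"
  using z w fin by (intro finsum_swap) auto
 also have "... = (\<Oplus>i\<in>idx. tr (xx i\<otimes>z)\<otimes>(\<Oplus>g\<in>\<Gamma>. g (dl v (yy i) (act (iG g) w))))"
  using z w fin by (intro fs_cong fs_rdistr[symmetric]) auto
 finally show "Tr (dl v z) w = csum idx (\<lambda>i. scal (tr (xx i\<otimes>z)) (Tr (dl v (yy i)))) w"
  using w by (simp add: Tr_def csum_def scal_def)
qed (use z tr_fixed in auto)

text \<open>The delta relation of the separability system isolates one automorphism in the sum
  defining \<open>Tr\<close>, so the averaging can be undone over \<open>K\<close>.\<close>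

lemma Tr_recover:
 assumes w: "!!v. v\<in>C ==> w v\<in>cK" and s: "t\<in>\<Gamma>" "v\<in>C"
 shows "(\<Oplus>i\<in>idx. t (xx i)\<otimes>Tr (\<lambda>u. yy i\<otimes>w u) v) = t (w (act (iG t) v))"
proof -
 let ?w = "\<lambda>g. g (w (act (iG g) v))"
 have "(\<Oplus>i\<in>idx. t (xx i)\<otimes>Tr (\<lambda>u. yy i\<otimes>w u) v) = (\<Oplus>i\<in>idx. \<Oplus>g\<in>\<Gamma>. (t (xx i)\<otimes>g (yy i))\<otimes>?w g)"
  using w s fin by (intro fs_cong) (auto simp: Tr_def fs_rdistr aut_mult m_assoc intro!: fs_cong)
 also have "... = (\<Oplus>g\<in>\<Gamma>. \<Oplus>i\<in>idx. (t (xx i)\<otimes>g (yy i))\<otimes>?w g)" using w s fin by (intro finsum_swap) auto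
 also have "... = (\<Oplus>g\<in>\<Gamma>. if t = g then ?w g else \<zero>)"
  using w s by (intro fs_cong) (auto simp: fs_ldistr[symmetric] crd_delta)
 also have "... = ?w t" using w s fin by (intro fs_delta(1)) auto
 finally show ?thesis .
qed

lemma Tr_dl_recover:
 assumes "t\<in>\<Gamma>" "w\<in>C" "v\<in>C"
 shows "(\<Oplus>i\<in>idx. t (xx i)\<otimes>Tr (dl v (yy i)) w) = (if act t v = w then \<one> else \<zero>)"
proof -
 have "Tr (dl v (yy i)) = Tr (\<lambda>u. yy i\<otimes>dl v \<one> u)" for i
  by (rule arg_cong[of _ _ Tr]) (auto simp: dl_def)
 hence "(\<Oplus>i\<in>idx. t (xx i)\<otimes>Tr (dl v (yy i)) w) = t (dl v \<one> (act (iG t) w))"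
  using Tr_recover[of "dl v \<one>" t w] assms by simp
 also have "... = (if act t v = w then \<one> else \<zero>)"
  using assms by (auto simp: dl_def)
 finally show ?thesis .
qed

definition lin :: "(('n => 'a) => 'a) => bool" where
 "lin f \<longleftrightarrow> (\<forall>a\<in>Inv. f a\<in>F) \<and> (\<forall>a\<in>Inv. \<forall>b\<in>Inv. f (adds a b) = f a\<oplus>f b) \<and>
  (\<forall>s\<in>F. \<forall>a\<in>Inv. f (scal s a) = s\<otimes>f a)"

text \<open>The value at the point mass in \<open>w\<close> of the \<open>K\<close>-linear extension
  of \<open>f\<close> to all functions on \<open>N\<close>: that point mass is the combination of
  the \<open>Tr (dl w (yy i))\<close> with coefficients \<open>xx i\<close>.\<close>

definition "cf f w = (\<Oplus>i\<in>idx. xx i\<otimes>f (Tr (dl w (yy i))))"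

lemma zero_F [simp]: "\<zero>\<in>F" by (rule fixedI) simp_all
lemma one_F [simp]: "\<one>\<in>F" by (rule fixedI) simp_all
lemma lin_closed: "lin f ==> a\<in>Inv ==> f a\<in>cK" by (simp add: lin_def)

lemma lin_sums:
 assumes f: "lin f"
 shows "finite I ==> (!!i. i\<in>I ==> c i\<in>Inv) ==> f (csum I c) = (\<Oplus>i\<in>I. f (c i))"
proof (induction I rule: finite_induct)
 case empty
 have z: "csum {} c\<in>Inv" by (rule csum_Inv) auto
 have "csum {} c = scal \<zero> (csum {} c)" by (auto simp: csum_def scal_def)
 hence "f (csum {} c) = \<zero>\<otimes>f (csum {} c)" using f z by (metis lin_def zero_F)
 thus ?case using lin_closed[OF f z] by simp
next
 case (insert i I)
 have "csum (insert i I) c = adds (c i) (csum I c)"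
  using insert by (auto simp: csum_def adds_def intro!: restrict_ext)
 thus ?case using insert f by (simp add: lin_def lin_closed[OF f])
qed

lemma cf_closed: "lin f ==> cf f w\<in>cK"
 unfolding cf_def by (intro fs_closed m_closed xx_closed lin_closed Tr_Inv dl_closed yy_closed)

text \<open>A linear form on the fixed ring is the restriction of a form on \<open>K[N]\<close>. All
  later comparisons of tensors rest on this.\<close>

lemma lin_expand:
 assumes f: "lin f" and a: "a\<in>Inv"
 shows "f a = (\<Oplus>w\<in>C. a w\<otimes>cf f w)"
proof -
 have fc: "f b\<in>cK" if "b\<in>Inv" for b using lin_closed[OF f that] .
 have fs: "f (scal s b) = s\<otimes>f b" if "s\<in>F" "b\<in>Inv" for s b using f that by (simp add: lin_def)
 let ?T = "\<lambda>v i. Tr (dl v (yy i))"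
 have T: "?T v i\<in>Inv" for v i by simp
 have dl: "f (Tr (dl v z)) = (\<Oplus>i\<in>idx. tr (xx i\<otimes>z)\<otimes>f (?T v i))" if "z\<in>cK" for v z
  unfolding Tr_dl_expand[OF that] using that tr_fixed fc[OF T]
  by (subst lin_sums[OF f]) (auto simp: fs intro!: fs_cong)
 have step: "tr (yy j)\<otimes>f a = (\<Oplus>v\<in>C. \<Oplus>i\<in>idx. tr (xx i\<otimes>(yy j\<otimes>a v))\<otimes>f (?T v i))" for j
 proof -
  have "tr (yy j)\<otimes>f a = f (Tr (\<lambda>w. yy j\<otimes>a w))" using Tr_scal_Inv[of "yy j" a] a fs[OF tr_fixed] by simp
  also have "... = (\<Oplus>v\<in>C. f (Tr (dl v (yy j\<otimes>a v))))"
   using a by (subst Tr_sum_dl) (auto intro!: lin_sums[OF f])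
  also have "... = (\<Oplus>v\<in>C. \<Oplus>i\<in>idx. tr (xx i\<otimes>(yy j\<otimes>a v))\<otimes>f (?T v i))"
   using a fc[OF T] by (intro fs_cong dl) auto
  finally show ?thesis .
 qed
 \<comment> \<open>Inserting \<open>sum_tr\<close> produces the factors \<open>tr (yy j)\<close>; a
   trace times \<open>a\<close> is \<open>Tr\<close> of a function, to which \<open>step\<close>
   applies.\<close>
 have "f a = (\<Oplus>j\<in>idx. xx j\<otimes>tr (yy j))\<otimes>f a" using sum_tr fc[OF a] by simp
 also have "... = (\<Oplus>j\<in>idx. xx j\<otimes>(tr (yy j)\<otimes>f a))" using fc[OF a] by (simp add: fs_ldistr m_assoc)
 also have "... = (\<Oplus>j\<in>idx. \<Oplus>v\<in>C. \<Oplus>i\<in>idx. (xx j\<otimes>tr (yy j\<otimes>(xx i\<otimes>a v)))\<otimes>f (?T v i))"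
  unfolding step using a fc[OF T] by (intro fs_cong) (auto simp: fs_rdistr m_assoc m_lcomm intro!: fs_cong)
 also have "... = (\<Oplus>v\<in>C. \<Oplus>j\<in>idx. \<Oplus>i\<in>idx. (xx j\<otimes>tr (yy j\<otimes>(xx i\<otimes>a v)))\<otimes>f (?T v i))"
  using a fc[OF T] by (intro finsum_swap) auto
 also have "... = (\<Oplus>v\<in>C. \<Oplus>i\<in>idx. \<Oplus>j\<in>idx. (xx j\<otimes>tr (yy j\<otimes>(xx i\<otimes>a v)))\<otimes>f (?T v i))"
  using a fc[OF T] by (intro fs_cong finsum_swap) auto
 also have "... = (\<Oplus>v\<in>C. \<Oplus>i\<in>idx. (xx i\<otimes>a v)\<otimes>f (?T v i))"
  using a fc[OF T] by (intro fs_cong) (auto simp: fs_ldistr[symmetric] dual1)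
 also have "... = (\<Oplus>v\<in>C. a v\<otimes>cf f v)"
  unfolding cf_def using a fc[OF T] by (intro fs_cong) (auto simp: fs_rdistr m_assoc m_lcomm intro!: fs_cong)
 finally show ?thesis .
qed

end

section \<open>The intermediate field and its linear maps\<close>

context hopf_descent
begin

lemma cl_one [simp]: "cl idG = eN"
 using cl_mult[of "idG" "idG"] GG.l_one[of "idG"] N.r_cancel_one'[of "cl idG" "cl idG"] by simp

lemma \<Gamma>'_sub: "\<Gamma>' \<subseteq> \<Gamma>" by (auto simp: \<Gamma>'_def)

lemma cl_eq_imp:
 assumes "g\<in>\<Gamma>" "h\<in>\<Gamma>" "cl g = cl h"
 shows "iG g\<star>h\<in>\<Gamma>'"
proof -
 have "cl (iG g\<star>h) = cl (iG g\<star>g)" using assms cl_mult[of "iG g" h] cl_mult[of "iG g" g] by simp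
 also have "... = eN" using assms GG.l_inv[of g] by simp
 finally show ?thesis using assms by (simp add: \<Gamma>'_def)
qed

lemma \<Gamma>'_subgroup: "subgroup \<Gamma>' GG"
proof (rule GG.subgroupI)
 have "idG\<in>\<Gamma>'" by (simp add: \<Gamma>'_def)
 thus "\<Gamma>' ~= {}" by blast
 show "iG a\<in>\<Gamma>'" if "a\<in>\<Gamma>'" for a
  using cl_eq_imp[of a "idG"] that GG.r_one[of "iG a"] by (simp add: \<Gamma>'_def)
qed (auto simp: \<Gamma>'_def cl_mult)

sublocale G': field_auts K \<Gamma>'
proof (intro field_auts.intro field_auts_axioms.intro field_axioms)
 show "subgroup \<Gamma>' (BijGroup cK)"
  using \<Gamma>'_subgroup group.incl_subgroup[OF group_BijGroup sub, of \<Gamma>'] unfolding GG_def by blast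
 show "t\<in>ring_hom K K" if "t\<in>\<Gamma>'" for t using that \<Gamma>'_sub hom by blast
 show "finite \<Gamma>'" using finite_subset[OF \<Gamma>'_sub fin] .
qed

lemma L_closed [simp]: "x\<in>L ==> x\<in>cK" unfolding L_def by (rule G'.fixed_closed)

lemma F_sub_L: "F \<subseteq> L" using \<Gamma>'_sub unfolding L_def fixed_field_def by blast

lemma L_eq:
 assumes "g\<in>\<Gamma>" "h\<in>\<Gamma>" "cl g = cl h" "x\<in>L"
 shows "g x = h x"
proof -
 have "(iG g\<star>h) x = x"
  using G'.fixedD[of x] cl_eq_imp[OF assms(1-3)] assms(4) by (simp add: L_def)
 hence "(iG g) (h x) = x" using assms by (simp add: aut_comp)
 thus ?thesis using assms by (metis L_closed aut_closed aut_inv2)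
qed

lemma e_cl [simp]: "g\<in>\<Gamma> ==> x\<in>L ==> e (cl g) x = g x"
 by (rule L_eq) auto

lemma L_ring_ops [simp]:
 "x\<in>L ==> y\<in>L ==> x\<oplus>y\<in>L" "x\<in>L ==> y\<in>L ==> x\<otimes>y\<in>L" "\<one>\<in>L" "\<zero>\<in>L"
 using subringE[OF subfieldE(1)[OF G'.subfield_fixed[folded L_def]]] by auto

text \<open>As \<open>G'.tt\<close> has trace one over \<open>L\<close>, the map sending
  \<open>x\<close> to \<open>G'.tr (G'.tt \<otimes> x)\<close> projects \<open>K\<close> onto
  \<open>L\<close>; \<open>uu i\<close> is the image of \<open>xx i\<close>.\<close>

definition "uu i = G'.tr (G'.tt\<otimes>xx i)"

lemma uu_L [simp]: "uu i\<in>L" unfolding uu_def L_def using G'.tt by (intro G'.tr_fixed) simp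

lemma L_expand:
 assumes x: "x\<in>L" shows "x = (\<Oplus>i\<in>idx. tr (yy i\<otimes>x)\<otimes>uu i)"
proof -
 have "x = G'.tr G'.tt\<otimes>x" using G'.tt x by simp
 also have "... = G'.tr (x\<otimes>G'.tt)"
  using G'.tr_mult_fixed[of x "G'.tt"] x G'.tt(1) unfolding L_def by (simp add: m_comm G'.fixed_closed)
 also have "... = (\<Oplus>u\<in>\<Gamma>'. u (G'.tt\<otimes>x))" using x G'.tt by (simp add: G'.tr_def m_comm)
 also have "... = (\<Oplus>u\<in>\<Gamma>'. \<Oplus>i\<in>idx. tr (yy i\<otimes>x)\<otimes>u (G'.tt\<otimes>xx i))"
 proof (intro fs_cong)
  fix u assume t: "u\<in>\<Gamma>'"
  hence tG: "u\<in>\<Gamma>" using \<Gamma>'_sub by blast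
  have "G'.tt\<otimes>x = G'.tt\<otimes>(\<Oplus>i\<in>idx. xx i\<otimes>tr (yy i\<otimes>x))" using dual1 x by simp
  also have "... = (\<Oplus>i\<in>idx. tr (yy i\<otimes>x)\<otimes>(G'.tt\<otimes>xx i))"
   using x G'.tt by (subst fs_rdistr) (auto simp: m_ac intro!: fs_cong)
  finally have "u (G'.tt\<otimes>x) = (\<Oplus>i\<in>idx. u (tr (yy i\<otimes>x)\<otimes>(G'.tt\<otimes>xx i)))"
   using x G'.tt tG by (simp add: aut_finsum)
  also have "... = (\<Oplus>i\<in>idx. tr (yy i\<otimes>x)\<otimes>u (G'.tt\<otimes>xx i))"
  proof (intro fs_cong)
   fix i
   have "u (tr (yy i\<otimes>x)) = tr (yy i\<otimes>x)" using fixedD[OF tr_fixed tG] x by simp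
   thus "u (tr (yy i\<otimes>x)\<otimes>(G'.tt\<otimes>xx i)) = tr (yy i\<otimes>x)\<otimes>u (G'.tt\<otimes>xx i)"
    using aut_mult[OF tG, of "tr (yy i\<otimes>x)" "G'.tt\<otimes>xx i"] x G'.tt by simp
  qed (use x G'.tt tG in auto)
  finally show "u (G'.tt\<otimes>x) = (\<Oplus>i\<in>idx. tr (yy i\<otimes>x)\<otimes>u (G'.tt\<otimes>xx i))" .
 qed (use x G'.tt \<Gamma>'_sub in auto)
 also have "... = (\<Oplus>i\<in>idx. \<Oplus>u\<in>\<Gamma>'. tr (yy i\<otimes>x)\<otimes>u (G'.tt\<otimes>xx i))"
  using x G'.tt \<Gamma>'_sub G'.fin by (intro finsum_swap) auto
 also have "... = (\<Oplus>i\<in>idx. tr (yy i\<otimes>x)\<otimes>uu i)"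
  using x G'.tt \<Gamma>'_sub G'.fin by (intro fs_cong) (auto simp: uu_def G'.tr_def fs_rdistr)
 finally show ?thesis .
qed

definition linL :: "('a => 'a) => bool" where
 "linL f \<longleftrightarrow> (\<forall>x\<in>L. f x\<in>cK) \<and> (\<forall>x\<in>L. \<forall>y\<in>L. f (x\<oplus>y) = f x\<oplus>f y) \<and>
  (\<forall>s\<in>F. \<forall>x\<in>L. f (s\<otimes>x) = s\<otimes>f x)"

lemma linL_sum:
 assumes f: "linL f"
 shows "finite I ==> (!!i. i\<in>I ==> c i\<in>L) ==> (\<Oplus>i\<in>I. c i)\<in>L \<and> f (\<Oplus>i\<in>I. c i) = (\<Oplus>i\<in>I. f (c i))"
proof (induction I rule: finite_induct)
 case empty
 have "f (\<zero>\<otimes>\<zero>) = \<zero>\<otimes>f \<zero>" using f L_ring_ops(4) zero_F unfolding linL_def by blast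
 moreover have "f \<zero>\<in>cK" using f L_ring_ops(4) unfolding linL_def by blast
 ultimately show ?case by simp
next
 case (insert i I)
 hence IH: "(\<Oplus>i\<in>I. c i)\<in>L" "f (\<Oplus>i\<in>I. c i) = (\<Oplus>i\<in>I. f (c i))" by auto
 have c: "c i\<in>cK" "!!j. j\<in>I ==> c j\<in>cK" "f (c i)\<in>cK" "!!j. j\<in>I ==> f (c j)\<in>cK"
  using insert.prems f by (auto simp: linL_def)
 have "f (c i\<oplus>(\<Oplus>i\<in>I. c i)) = f (c i)\<oplus>f (\<Oplus>i\<in>I. c i)"
  using f insert.prems IH(1) by (simp add: linL_def)
 thus ?case using insert IH c by (simp add: Pi_def)
qed

definition "cg f t = (\<Oplus>i\<in>idx. t (yy i)\<otimes>f (uu i))"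

lemma F_L: "s\<in>F ==> s\<in>L" using F_sub_L by blast

text \<open>\<open>L_expand\<close> and linearity write \<open>f x\<close> through the traces
  \<open>tr (yy i \<otimes> x)\<close>, and a trace is a sum of automorphisms. Such coefficients are
  not unique in general, since different automorphisms may agree on \<open>L\<close>.\<close>

lemma linL_expand:
 assumes f: "linL f" and x: "x\<in>L"
 shows "f x = (\<Oplus>u\<in>\<Gamma>. u x\<otimes>cg f u)"
proof -
 have fu: "f (uu i)\<in>cK" for i using f by (simp add: linL_def)
 have t: "tr (yy i\<otimes>x)\<in>F" for i using x by (intro tr_fixed) simp
 have "f x = f (\<Oplus>i\<in>idx. tr (yy i\<otimes>x)\<otimes>uu i)" using L_expand[OF x] by simp
 also have "... = (\<Oplus>i\<in>idx. f (tr (yy i\<otimes>x)\<otimes>uu i))"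
  using linL_sum[OF f, of idx "\<lambda>i. tr (yy i\<otimes>x)\<otimes>uu i"] F_L[OF t] by simp
 also have "... = (\<Oplus>i\<in>idx. \<Oplus>u\<in>\<Gamma>. u x\<otimes>(u (yy i)\<otimes>f (uu i)))"
 proof (intro fs_cong)
  fix i
  have "f (tr (yy i\<otimes>x)\<otimes>uu i) = tr (yy i\<otimes>x)\<otimes>f (uu i)" using f t by (simp add: linL_def)
  also have "... = (\<Oplus>u\<in>\<Gamma>. u x\<otimes>(u (yy i)\<otimes>f (uu i)))"
   using fu x fin by (simp add: tr_def fs_ldistr) (auto simp: aut_mult m_ac intro!: fs_cong)
  finally show "f (tr (yy i\<otimes>x)\<otimes>uu i) = (\<Oplus>u\<in>\<Gamma>. u x\<otimes>(u (yy i)\<otimes>f (uu i)))" .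
 qed (use fu x in auto)
 also have "... = (\<Oplus>u\<in>\<Gamma>. \<Oplus>i\<in>idx. u x\<otimes>(u (yy i)\<otimes>f (uu i)))"
  using fu x fin by (intro finsum_swap) auto
 also have "... = (\<Oplus>u\<in>\<Gamma>. u x\<otimes>cg f u)"
  using fu x by (intro fs_cong) (auto simp: cg_def fs_rdistr)
 finally show ?thesis .
qed

lemma cg_closed: "linL f ==> t\<in>\<Gamma> ==> cg f t\<in>cK"
 unfolding cg_def linL_def by auto

lemma finite_extension_L: "finite_field_extension K F L"
proof -
 have sF: "subfield F K" by (rule subfield_fixed)
 have sL: "subfield L K" unfolding L_def by (rule G'.subfield_fixed)
 obtain n where n: "idx = {..<n}" by (simp add: idx_def)
 let ?Us = "map uu [0..<n]"
 have Us: "set ?Us \<subseteq> cK" by auto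
 have sp: "subalgebra F (Span F ?Us) K" using Span_is_subalgebra[OF sF Us] .
 have base: "uu i\<in>Span F ?Us" if "i\<in>idx" for i using Span_base_incl[OF sF Us] that n by auto
 have sub: "subgroup (Span F ?Us) (add_monoid K)" using sp by (simp add: subalgebra_def)
 have sum: "finite I ==> (!!i. i\<in>I ==> f i\<in>Span F ?Us) ==> (\<Oplus>i\<in>I. f i)\<in>Span F ?Us" for I and f :: "nat => 'a"
 proof (induction I rule: finite_induct)
  case empty
  thus ?case using subgroup.one_closed[OF sub] by simp
 next
  case (insert i I)
  hence "f j\<in>cK" if "j\<in>insert i I" for j
   using that subgroup.mem_carrier[OF sub] by auto
  thus ?case using insert subgroup.m_closed[OF sub] by (simp add: Pi_def)
 qed
 have "L \<subseteq> Span F ?Us"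
 proof
  fix x assume x: "x\<in>L"
  have "tr (yy i\<otimes>x)\<otimes>uu i\<in>Span F ?Us" if "i\<in>idx" for i
   using subalgebra.smult_closed[OF sp tr_fixed base[OF that]] x by simp
  hence "(\<Oplus>i\<in>idx. tr (yy i\<otimes>x)\<otimes>uu i)\<in>Span F ?Us" by (intro sum finite_idx)
  thus "x\<in>Span F ?Us" unfolding L_expand[OF x, symmetric] .
 qed
 moreover have "subalgebra F L K"
  using subringE[OF subfieldE(1)[OF sL]] F_sub_L
  by (intro subalgebra.intro subalgebra_axioms.intro add.subgroupI) (auto simp: a_inv_def)
 ultimately have "finite_dimension F L"
  using subalbegra_incl_imp_finite_dimension[OF sF Span_finite_dimension[OF sF Us]] by blast
 thus ?thesis using sF sL F_sub_L field_axioms by (simp add: finite_field_extension_def)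
qed

definition "cf2 B w v = (\<Oplus>i\<in>idx. xx i\<otimes>cf (B (Tr (dl w (yy i)))) v)"
definition "cf3 B w v u = (\<Oplus>i\<in>idx. xx i\<otimes>cf2 (B (Tr (dl w (yy i)))) v u)"

lemma bilinear_expand:
 assumes B1: "!!b. b\<in>Inv ==> lin (\<lambda>a. B a b)" and B2: "!!a. a\<in>Inv ==> lin (B a)"
  and ab: "a\<in>Inv" "b\<in>Inv"
 shows "B a b = (\<Oplus>w\<in>C. \<Oplus>v\<in>C. (a w\<otimes>b v)\<otimes>cf2 B w v)"
proof -
 let ?T = "\<lambda>w i. Tr (dl w (yy i))"
 have T: "?T w i\<in>Inv" for w i by simp
 have c: "cf (B (?T w i)) v\<in>cK" for w i v using cf_closed[OF B2[OF T]] .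
 have "B a b = (\<Oplus>w\<in>C. a w\<otimes>(\<Oplus>i\<in>idx. xx i\<otimes>B (?T w i) b))"
  using lin_expand[OF B1[OF ab(2)] ab(1)] by (simp add: cf_def)
 also have "... = (\<Oplus>w\<in>C. \<Oplus>v\<in>C. (a w\<otimes>b v)\<otimes>cf2 B w v)"
 proof (intro fs_cong)
  fix w assume w: "w\<in>C"
  have "(\<Oplus>i\<in>idx. xx i\<otimes>B (?T w i) b) = (\<Oplus>i\<in>idx. \<Oplus>v\<in>C. b v\<otimes>(xx i\<otimes>cf (B (?T w i)) v))"
   using ab c lin_expand[OF B2[OF T] ab(2)] by (intro fs_cong) (auto simp: fs_rdistr m_lcomm intro!: fs_cong)
  also have "... = (\<Oplus>v\<in>C. b v\<otimes>cf2 B w v)"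
   using ab c by (subst finsum_swap) (auto simp: cf2_def fs_rdistr intro!: fs_cong)
  finally show "a w\<otimes>(\<Oplus>i\<in>idx. xx i\<otimes>B (?T w i) b) = (\<Oplus>v\<in>C. (a w\<otimes>b v)\<otimes>cf2 B w v)"
   using ab w c by (simp add: fs_rdistr cf2_def) (auto intro!: fs_cong simp: m_assoc)
 qed (use ab c in \<open>auto simp: cf2_def\<close>)
 finally show ?thesis .
qed

lemma cf2_closed: "(!!a. a\<in>Inv ==> lin (B a)) ==> cf2 B w v\<in>cK"
 unfolding cf2_def by (intro fs_closed m_closed xx_closed cf_closed) simp

lemma trilinear_expand:
 assumes B1: "!!b c. b\<in>Inv ==> c\<in>Inv ==> lin (\<lambda>a. B a b c)"
  and B2: "!!a c. a\<in>Inv ==> c\<in>Inv ==> lin (\<lambda>b. B a b c)"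
  and B3: "!!a b. a\<in>Inv ==> b\<in>Inv ==> lin (B a b)"
  and abc: "a\<in>Inv" "b\<in>Inv" "c\<in>Inv"
 shows "B a b c = (\<Oplus>w\<in>C. \<Oplus>v\<in>C. \<Oplus>u\<in>C. (a w\<otimes>(b v\<otimes>c u))\<otimes>cf3 B w v u)"
proof -
 let ?T = "\<lambda>w i. Tr (dl w (yy i))"
 have T: "?T w i\<in>Inv" for w i by simp
 have k: "cf2 (B (?T w i)) v u\<in>cK" for w i v u using cf2_closed[of "B (?T w i)"] B3[OF T] by simp
 have "B a b c = (\<Oplus>w\<in>C. a w\<otimes>(\<Oplus>i\<in>idx. xx i\<otimes>B (?T w i) b c))"
  using lin_expand[OF B1[OF abc(2,3)] abc(1)] by (simp add: cf_def)
 also have "... = (\<Oplus>w\<in>C. \<Oplus>v\<in>C. \<Oplus>u\<in>C. (a w\<otimes>(b v\<otimes>c u))\<otimes>cf3 B w v u)"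
 proof (intro fs_cong)
  fix w assume w: "w\<in>C"
  have "(\<Oplus>i\<in>idx. xx i\<otimes>B (?T w i) b c) =
    (\<Oplus>i\<in>idx. \<Oplus>v\<in>C. \<Oplus>u\<in>C. (b v\<otimes>c u)\<otimes>(xx i\<otimes>cf2 (B (?T w i)) v u))"
   using abc k bilinear_expand[OF B2[OF T] B3[OF T] abc(2,3)]
   by (intro fs_cong) (auto simp: fs_rdistr m_lcomm intro!: fs_cong)
  also have "... = (\<Oplus>v\<in>C. \<Oplus>i\<in>idx. \<Oplus>u\<in>C. (b v\<otimes>c u)\<otimes>(xx i\<otimes>cf2 (B (?T w i)) v u))"
   using abc k by (intro finsum_swap) auto
  also have "... = (\<Oplus>v\<in>C. \<Oplus>u\<in>C. \<Oplus>i\<in>idx. (b v\<otimes>c u)\<otimes>(xx i\<otimes>cf2 (B (?T w i)) v u))"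
   using abc k by (intro fs_cong finsum_swap) auto
  also have "... = (\<Oplus>v\<in>C. \<Oplus>u\<in>C. (b v\<otimes>c u)\<otimes>cf3 B w v u)"
   using abc k by (auto simp: cf3_def fs_rdistr intro!: fs_cong)
  finally show "a w\<otimes>(\<Oplus>i\<in>idx. xx i\<otimes>B (?T w i) b c) = (\<Oplus>v\<in>C. \<Oplus>u\<in>C. (a w\<otimes>(b v\<otimes>c u))\<otimes>cf3 B w v u)"
   using abc w k by (simp add: fs_rdistr cf3_def) (auto intro!: fs_cong simp: m_assoc fs_rdistr)
 qed (use abc k in \<open>auto simp: cf3_def\<close>)
 finally show ?thesis .
qed

lemma cf3_closed: "(!!a b. a\<in>Inv ==> b\<in>Inv ==> lin (B a b)) ==> cf3 B w v u\<in>cK"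
 unfolding cf3_def by (intro fs_closed m_closed xx_closed cf2_closed) simp

lemma conv_assoc:
 assumes "a\<in>Inv" "b\<in>Inv" "c\<in>Inv"
 shows "conv (conv a b) c = conv a (conv b c)"
proof (rule Inv_ext)
 fix w assume w: "w\<in>C"
 have "conv (conv a b) c w = (\<Oplus>v\<in>C. \<Oplus>u\<in>C. a u\<otimes>(b (iN u\<cdot>v)\<otimes>c (iN v\<cdot>w)))"
  using w assms by (simp add: conv_def) (auto simp: fs_ldistr m_assoc intro!: fs_cong)
 also have "... = (\<Oplus>u\<in>C. \<Oplus>v\<in>C. a u\<otimes>(b (iN u\<cdot>v)\<otimes>c (iN v\<cdot>w)))"
  using w assms by (intro finsum_swap) auto
 also have "... = (\<Oplus>u\<in>C. a u\<otimes>conv b c (iN u\<cdot>w))"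
 proof (intro fs_cong)
  fix u assume u: "u\<in>C"
  have "(\<Oplus>v\<in>C. b (iN u\<cdot>v)\<otimes>c (iN v\<cdot>w)) =
    (\<Oplus>v\<in>C. b (iN u\<cdot>(u\<cdot>v))\<otimes>c (iN (u\<cdot>v)\<cdot>w))"
   using u w assms by (intro finsum_bij N_left_bij) auto
  also have "... = conv b c (iN u\<cdot>w)"
   using u w assms by (simp add: conv_def) (intro fs_cong, auto simp: N.inv_mult_group N.m_assoc N.inv_solve_left simp flip: N.m_assoc)
  finally show "(\<Oplus>v\<in>C. a u\<otimes>(b (iN u\<cdot>v)\<otimes>c (iN v\<cdot>w))) =
    a u\<otimes>conv b c (iN u\<cdot>w)"
   using u w assms by (simp flip: fs_rdistr)
 qed (use w assms in auto)
 also have "... = conv a (conv b c) w" using w by (simp add: conv_def[of a])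
 finally show "conv (conv a b) c w = conv a (conv b c) w" .
qed (use assms in auto)

definition "unit = (\<lambda>w\<in>C. if w = eN then \<one> else \<zero>)"

lemma unit_Inv [simp]: "unit\<in>Inv"
 unfolding unit_def
proof (rule InvI)
 fix g w assume "g\<in>\<Gamma>" "w\<in>C"
 thus "(if act g w = eN then \<one> else \<zero>) = g (if w = eN then \<one> else \<zero>)"
  using act_eq_iff[of g w "eN"] by simp
qed simp

lemma unit_conv: assumes "a\<in>Inv" shows "conv unit a = a"
proof (rule Inv_ext)
 fix w assume w: "w\<in>C"
 have "conv unit a w = (\<Oplus>v\<in>C. if v = eN then a (iN v\<cdot>w) else \<zero>)"
  using w assms by (simp add: conv_def unit_def) (intro fs_cong, auto)
 also have "... = a w" using w assms by (subst fs_delta(2)) auto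
 finally show "conv unit a w = a w" .
qed (use assms in auto)

lemma conv_unit: assumes "a\<in>Inv" shows "conv a unit = a"
proof (rule Inv_ext)
 fix w assume w: "w\<in>C"
 have eq: "iN v\<cdot>w = eN \<longleftrightarrow> v = w" if "v\<in>C" for v
  using that w N.inv_solve_left'[of "eN" v w] by auto
 have "conv a unit w = (\<Oplus>v\<in>C. if v = w then a v else \<zero>)"
  using w assms by (simp add: conv_def unit_def) (intro fs_cong, auto simp: eq)
 also have "... = a w" using w assms by (subst fs_delta(2)) auto
 finally show "conv a unit w = a w" .
qed (use assms in auto)

lemma conv_adds_left: "a\<in>Inv ==> b\<in>Inv ==> c\<in>Inv ==> conv (adds a b) c = adds (conv a c) (conv b c)"
proof (rule Inv_ext)
 fix w assume h: "w\<in>C" "a\<in>Inv" "b\<in>Inv" "c\<in>Inv"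
 let ?f = "\<lambda>a v. a v\<otimes>c (iN v\<cdot>w)"
 have "conv (adds a b) c w = (\<Oplus>v\<in>C. ?f a v\<oplus>?f b v)"
  unfolding conv_def restrict_apply'[OF h(1)] using h by (intro fs_cong) (simp_all add: adds_def l_distr)
 also have "... = (\<Oplus>v\<in>C. ?f a v)\<oplus>(\<Oplus>v\<in>C. ?f b v)" using h by (intro fs_add) auto
 finally show "conv (adds a b) c w = adds (conv a c) (conv b c) w" using h by (simp add: conv_def adds_def)
qed auto

lemma conv_adds_right: "a\<in>Inv ==> b\<in>Inv ==> c\<in>Inv ==> conv c (adds a b) = adds (conv c a) (conv c b)"
proof (rule Inv_ext)
 fix w assume h: "w\<in>C" "a\<in>Inv" "b\<in>Inv" "c\<in>Inv"
 let ?f = "\<lambda>a v. c v\<otimes>a (iN v\<cdot>w)"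
 have "conv c (adds a b) w = (\<Oplus>v\<in>C. ?f a v\<oplus>?f b v)"
  unfolding conv_def restrict_apply'[OF h(1)] using h by (intro fs_cong) (simp_all add: adds_def r_distr)
 also have "... = (\<Oplus>v\<in>C. ?f a v)\<oplus>(\<Oplus>v\<in>C. ?f b v)" using h by (intro fs_add) auto
 finally show "conv c (adds a b) w = adds (conv c a) (conv c b) w" using h by (simp add: conv_def adds_def)
qed auto

lemma conv_scal_left: "a\<in>Inv ==> b\<in>Inv ==> s\<in>F ==> conv (scal s a) b = scal s (conv a b)"
proof (rule Inv_ext)
 fix w assume "w\<in>C" "a\<in>Inv" "b\<in>Inv" "s\<in>F"
 thus "conv (scal s a) b w = scal s (conv a b) w"
  by (simp add: conv_def scal_def fs_rdistr) (auto simp: m_assoc intro!: fs_cong)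
qed auto

lemma conv_scal_right: "a\<in>Inv ==> b\<in>Inv ==> s\<in>F ==> conv a (scal s b) = scal s (conv a b)"
proof (rule Inv_ext)
 fix w assume "w\<in>C" "a\<in>Inv" "b\<in>Inv" "s\<in>F"
 thus "conv a (scal s b) w = scal s (conv a b) w"
  by (simp add: conv_def scal_def fs_rdistr) (auto simp: m_lcomm intro!: fs_cong)
qed auto

lemma sum_F: "a\<in>Inv ==> (\<Oplus>w\<in>C. a w)\<in>F"
proof (rule fixedI)
 assume a: "a\<in>Inv"
 fix t assume s: "t\<in>\<Gamma>"
 have "t (\<Oplus>w\<in>C. a w) = (\<Oplus>w\<in>C. a (act t w))" using a s by (auto simp: aut_finsum Inv_act intro!: fs_cong)
 also have "... = (\<Oplus>w\<in>C. a w)" using a s by (intro finsum_bij[symmetric] act_bij) auto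
 finally show "t (\<Oplus>w\<in>C. a w) = (\<Oplus>w\<in>C. a w)" .
qed auto

definition "mu a x = (\<Oplus>w\<in>C. a w\<otimes>e w x)"

lemma mu_K [simp]: "a\<in>Inv ==> x\<in>cK ==> mu a x\<in>cK"
 unfolding mu_def by auto

text \<open>An element of the stabiliser permutes the summands: by the cocycle law it carries
  \<open>e w x\<close> to \<open>e (act u w) x\<close>.\<close>

lemma mu_L [simp]:
 assumes "a\<in>Inv" "x\<in>L" shows "mu a x\<in>L"
 unfolding L_def
proof (rule G'.fixedI)
 fix u assume t: "u\<in>\<Gamma>'"
 hence tG: "u\<in>\<Gamma>" "cl u = eN" by (auto simp: \<Gamma>'_def)
 have "u (mu a x) = (\<Oplus>w\<in>C. a (act u w)\<otimes>e (act u w) x)"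
  unfolding mu_def
 proof (subst aut_finsum[OF tG(1)])
  show "(\<Oplus>w\<in>C. u (a w\<otimes>e w x)) = (\<Oplus>w\<in>C. a (act u w)\<otimes>e (act u w) x)"
  proof (rule fs_cong)
   fix w assume w: "w\<in>C"
   have "e (act u w) x = (u\<star>e w) x"
    using w tG assms by (intro L_eq) (auto simp: cl_mult)
   thus "u (a w\<otimes>e w x) = a (act u w)\<otimes>e (act u w) x"
    using w tG assms by (simp add: aut_mult aut_comp Inv_act)
  qed (use tG assms in auto)
 qed (use tG assms in auto)
 also have "... = mu a x" unfolding mu_def using tG assms by (intro finsum_bij[symmetric] act_bij) auto
 finally show "u (mu a x) = mu a x" .
qed (use assms in auto)

text \<open>After the substitution of \<open>v \<cdot> act (e v) w\<close> for the inner index, the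
  cocycle law splits the embedding into \<open>e v\<close> after \<open>e w\<close>, and invariance
  of \<open>b\<close> moves \<open>e v\<close> outside the sum.\<close>

lemma mu_conv:
 assumes "a\<in>Inv" "b\<in>Inv" "x\<in>L" shows "mu (conv a b) x = mu a (mu b x)"
proof -
 have "mu (conv a b) x = (\<Oplus>w\<in>C. \<Oplus>v\<in>C. a v\<otimes>(b (iN v\<cdot>w)\<otimes>e w x))"
  using assms by (simp add: mu_def conv_def) (auto simp: fs_ldistr m_assoc intro!: fs_cong)
 also have "... = (\<Oplus>v\<in>C. \<Oplus>w\<in>C. a v\<otimes>(b (iN v\<cdot>w)\<otimes>e w x))"
  using assms by (intro finsum_swap) auto
 also have "... = (\<Oplus>v\<in>C. a v\<otimes>e v (mu b x))"
 proof (rule fs_cong)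
  fix v assume v: "v\<in>C"
  have "(\<Oplus>w\<in>C. b (iN v\<cdot>w)\<otimes>e w x) = (\<Oplus>w\<in>C. b (iN v\<cdot>(v\<cdot>w))\<otimes>e (v\<cdot>w) x)"
   using v assms by (intro finsum_bij N_left_bij) auto
  also have "... = (\<Oplus>w\<in>C. b w\<otimes>e (v\<cdot>w) x)"
   using v assms by (intro fs_cong) (auto simp: N.m_assoc[symmetric])
  also have "... = (\<Oplus>w\<in>C. b (act (e v) w)\<otimes>e (v\<cdot>act (e v) w) x)"
   using v assms by (intro finsum_bij act_bij) auto
  also have "... = (\<Oplus>w\<in>C. e v (b w\<otimes>e w x))"
  proof (rule fs_cong)
   fix w assume w: "w\<in>C"
   have "e (v\<cdot>act (e v) w) x = (e v\<star>e w) x"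
    using w v assms by (intro L_eq) (auto simp: cl_mult)
   thus "b (act (e v) w)\<otimes>e (v\<cdot>act (e v) w) x = e v (b w\<otimes>e w x)"
    using w v assms by (simp add: aut_mult aut_comp Inv_act)
  qed (use v assms in auto)
  also have "... = e v (mu b x)" unfolding mu_def using v assms by (intro aut_finsum[symmetric]) auto
  finally show "(\<Oplus>w\<in>C. a v\<otimes>(b (iN v\<cdot>w)\<otimes>e w x)) = a v\<otimes>e v (mu b x)"
   using v assms by (simp flip: fs_rdistr)
 qed (use assms in auto)
 finally show ?thesis by (simp add: mu_def[of a])
qed

lemma mu_one: "a\<in>Inv ==> mu a \<one> = (\<Oplus>w\<in>C. a w)"
 unfolding mu_def by (intro fs_cong) auto

lemma mu_unit: "x\<in>L ==> mu unit x = x"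
proof -
 assume x: "x\<in>L"
 have "mu unit x = (\<Oplus>w\<in>C. if w = eN then e w x else \<zero>)"
  using x unfolding mu_def by (intro fs_cong) (auto simp: unit_def)
 also have "... = e eN x" using x by (subst fs_delta(2)) auto
 also have "... = idG x" using x by (intro L_eq) auto
 finally show ?thesis using x by simp
qed

lemma vv_L: "G'.tr (yy i)\<in>L" unfolding L_def by (intro G'.tr_fixed) simp

text \<open>Dedekind independence of the embeddings \<open>e w\<close>, in explicit form.\<close>

lemma coefficient_recover:
 assumes c: "!!w. w\<in>C ==> c w\<in>cK" and v: "v\<in>C"
 shows "(\<Oplus>i\<in>idx. e v (xx i)\<otimes>(\<Oplus>w\<in>C. c w\<otimes>e w (G'.tr (yy i)))) = c v"
proof -
 have ind: "(\<Oplus>i\<in>idx. e v (xx i)\<otimes>e w (G'.tr (yy i))) = (if w = v then \<one> else \<zero>)" if w: "w\<in>C" for w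
 proof -
  have "(\<Oplus>i\<in>idx. e v (xx i)\<otimes>e w (G'.tr (yy i))) = (\<Oplus>i\<in>idx. \<Oplus>u\<in>\<Gamma>'. e v (xx i)\<otimes>(e w\<star>u) (yy i))"
   using v w \<Gamma>'_sub G'.fin
   by (intro fs_cong) (auto simp: G'.tr_def aut_finsum fs_rdistr aut_comp subset_iff intro!: fs_cong)
  also have "... = (\<Oplus>u\<in>\<Gamma>'. \<Oplus>i\<in>idx. e v (xx i)\<otimes>(e w\<star>u) (yy i))"
   using v w \<Gamma>'_sub G'.fin by (intro finsum_swap) (auto simp: subset_iff)
  also have "... = (\<Oplus>u\<in>\<Gamma>'. if u = idG then (if w = v then \<one> else \<zero>) else \<zero>)"
  proof (rule fs_cong)
   fix u assume t: "u\<in>\<Gamma>'"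
   hence tG: "u\<in>\<Gamma>" "cl u = eN" by (auto simp: \<Gamma>'_def)
   have "e v = e w\<star>u \<longleftrightarrow> w = v \<and> u = idG"
   proof
    assume eq: "e v = e w\<star>u"
    hence "cl (e v) = cl (e w)" using tG w by (simp add: cl_mult)
    hence "v = w" using v w by simp
    thus "w = v \<and> u = idG" using eq tG w GG.r_cancel_one'[of u "e w"] GG.l_cancel_one'[of "e w" u] by simp
   qed (use w in \<open>auto simp: GG.r_one\<close>)
   thus "(\<Oplus>i\<in>idx. e v (xx i)\<otimes>(e w\<star>u) (yy i)) = (if u = idG then (if w = v then \<one> else \<zero>) else \<zero>)"
    using v w tG by (subst crd_delta) auto
  qed auto
  also have "... = (if w = v then \<one> else \<zero>)"
   using G'.fin G'.G_one_closed cl_one by (intro fs_delta(2)) (auto simp: \<Gamma>'_def)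
  finally show ?thesis .
 qed
 have vK: "G'.tr (yy i)\<in>cK" for i by simp
 have "(\<Oplus>i\<in>idx. e v (xx i)\<otimes>(\<Oplus>w\<in>C. c w\<otimes>e w (G'.tr (yy i)))) =
   (\<Oplus>i\<in>idx. \<Oplus>w\<in>C. c w\<otimes>(e v (xx i)\<otimes>e w (G'.tr (yy i))))"
  using c v by (intro fs_cong) (auto simp: fs_rdistr m_lcomm intro!: fs_cong)
 also have "... = (\<Oplus>w\<in>C. \<Oplus>i\<in>idx. c w\<otimes>(e v (xx i)\<otimes>e w (G'.tr (yy i))))"
  using c v by (intro finsum_swap) auto
 also have "... = (\<Oplus>w\<in>C. if w = v then c w else \<zero>)"
  using c v by (intro fs_cong) (auto simp: fs_rdistr[symmetric] ind)
 also have "... = c v" using c v by (intro fs_delta(2)) auto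
 finally show ?thesis .
qed

text \<open>This is the surjectivity in the Hopf Galois condition. Grouping the automorphisms of
  \<open>linL_expand\<close> by class gives an element of \<open>K[N]\<close>; it is invariant under
  the stabiliser because \<open>f\<close> takes values in \<open>L\<close>, and \<open>Tr\<close>
  brings it down to the fixed ring.\<close>

lemma endomorphism_expand:
 assumes f: "linL f" "!!x. x\<in>L ==> f x\<in>L"
 shows "\<exists>h. (\<forall>i\<in>idx. h i\<in>Inv) \<and> (\<forall>x\<in>L. f x = (\<Oplus>i\<in>idx. uu i\<otimes>mu (h i) x))"
proof -
 have cgc: "cg f u\<in>cK" if "u\<in>\<Gamma>" for u using cg_closed[OF f(1) that] .
 define w where "w = (\<lambda>v. \<Oplus>u\<in>\<Gamma>. if cl u = v then cg f u else \<zero>)"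
 have wc: "w v\<in>cK" for v unfolding w_def using cgc by auto
 have fw: "f x = (\<Oplus>v\<in>C. w v\<otimes>e v x)" if x: "x\<in>L" for x
 proof -
  have "f x = (\<Oplus>u\<in>\<Gamma>. u x\<otimes>cg f u)" by (rule linL_expand[OF f(1) x])
  also have "... = (\<Oplus>v\<in>C. \<Oplus>u\<in>\<Gamma>. if cl u = v then u x\<otimes>cg f u else \<zero>)"
   using fin x cgc by (intro finsum_group) auto
  also have "... = (\<Oplus>v\<in>C. w v\<otimes>e v x)"
  proof (rule fs_cong)
   fix v assume v: "v\<in>C"
   have "w v\<otimes>e v x = (\<Oplus>u\<in>\<Gamma>. (if cl u = v then cg f u else \<zero>)\<otimes>e v x)"
    unfolding w_def using fin x v cgc by (intro fs_ldistr) auto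
   also have "... = (\<Oplus>u\<in>\<Gamma>. if cl u = v then u x\<otimes>cg f u else \<zero>)"
    using x v cgc by (intro fs_cong) (auto simp: m_comm)
   finally show "(\<Oplus>u\<in>\<Gamma>. if cl u = v then u x\<otimes>cg f u else \<zero>) = w v\<otimes>e v x" by simp
  qed (use x wc in auto)
  finally show ?thesis .
 qed
 have w_inv: "q (w (act (iG q) v)) = w v" if t: "q\<in>\<Gamma>'" and v: "v\<in>C" for q v
 proof -
  have tG: "q\<in>\<Gamma>" "cl q = eN" using t by (auto simp: \<Gamma>'_def)
  have cg_t: "q (cg f u) = cg f (q\<star>u)" if s: "u\<in>\<Gamma>" for u
  proof -
   have "q (f (uu i)) = f (uu i)" for i using G'.fixedD[of "f (uu i)" q] f(2)[of "uu i"] t by (simp add: L_def[symmetric])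
   thus ?thesis unfolding cg_def using tG s f(2)[OF uu_L]
    by (subst aut_finsum) (auto simp: aut_mult aut_comp intro!: fs_cong)
  qed
  have "w v = (\<Oplus>u\<in>\<Gamma>. if cl (q\<star>u) = v then cg f (q\<star>u) else \<zero>)"
   unfolding w_def using tG cgc by (intro finsum_bij left_mult_bij) auto
  also have "... = (\<Oplus>u\<in>\<Gamma>. q (if cl u = act (iG q) v then cg f u else \<zero>))"
  proof (rule fs_cong)
   fix u assume s: "u\<in>\<Gamma>"
   have "cl (q\<star>u) = v \<longleftrightarrow> cl u = act (iG q) v"
    using tG s v by (auto simp: cl_mult)
   thus "(if cl (q\<star>u) = v then cg f (q\<star>u) else \<zero>) = q (if cl u = act (iG q) v then cg f u else \<zero>)"
    using cg_t[OF s] tG by simp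
  qed (use tG cgc in auto)
  also have "... = q (w (act (iG q) v))"
   unfolding w_def using tG cgc fin by (intro aut_finsum[symmetric]) auto
  finally show ?thesis by simp
 qed
 \<comment> \<open>\<open>Tr_recover\<close> regains \<open>w\<close> from \<open>h\<close> with the
   coefficients \<open>xx i\<close>; averaging against \<open>G'.tt\<close> replaces them by the
   \<open>uu i\<close>, which lie in \<open>L\<close>.\<close>
 define h where "h = (\<lambda>i. Tr (\<lambda>p. yy i\<otimes>w p))"
 have hI: "h i\<in>Inv" for i unfolding h_def using wc by (intro Tr_Inv) simp
 have wh: "(\<Oplus>i\<in>idx. uu i\<otimes>h i v) = w v" if v: "v\<in>C" for v
 proof -
  have "(\<Oplus>i\<in>idx. uu i\<otimes>h i v) = (\<Oplus>i\<in>idx. \<Oplus>q\<in>\<Gamma>'. q G'.tt\<otimes>(q (xx i)\<otimes>h i v))"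
   using v hI G'.tt \<Gamma>'_sub G'.fin
   by (intro fs_cong) (auto simp: uu_def G'.tr_def fs_ldistr G'.aut_mult m_assoc intro!: fs_cong)
  also have "... = (\<Oplus>q\<in>\<Gamma>'. \<Oplus>i\<in>idx. q G'.tt\<otimes>(q (xx i)\<otimes>h i v))"
   using v hI G'.tt G'.fin by (intro finsum_swap) auto
  also have "... = (\<Oplus>q\<in>\<Gamma>'. q G'.tt\<otimes>w v)"
  proof (rule fs_cong)
   fix q assume t: "q\<in>\<Gamma>'"
   hence tG: "q\<in>\<Gamma>" using \<Gamma>'_sub by blast
   have "(\<Oplus>i\<in>idx. q G'.tt\<otimes>(q (xx i)\<otimes>h i v)) = q G'.tt\<otimes>(\<Oplus>i\<in>idx. q (xx i)\<otimes>h i v)"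
    using v hI G'.tt t by (intro fs_rdistr[symmetric]) auto
   also have "(\<Oplus>i\<in>idx. q (xx i)\<otimes>h i v) = w v"
    unfolding h_def using Tr_recover[of w q v] wc tG v w_inv[OF t v] by simp
   finally show "(\<Oplus>i\<in>idx. q G'.tt\<otimes>(q (xx i)\<otimes>h i v)) = q G'.tt\<otimes>w v" .
  qed (use wc G'.tt in auto)
  also have "... = G'.tr G'.tt\<otimes>w v" unfolding G'.tr_def using wc G'.tt G'.fin by (intro fs_ldistr[symmetric]) auto
  finally show ?thesis using G'.tt wc by simp
 qed
 have "f x = (\<Oplus>i\<in>idx. uu i\<otimes>mu (h i) x)" if x: "x\<in>L" for x
 proof -
  have "f x = (\<Oplus>v\<in>C. (\<Oplus>i\<in>idx. uu i\<otimes>h i v)\<otimes>e v x)" unfolding fw[OF x] using wh x wc by (intro fs_cong) auto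
  also have "... = (\<Oplus>v\<in>C. \<Oplus>i\<in>idx. uu i\<otimes>(h i v\<otimes>e v x))"
   using x hI by (intro fs_cong) (auto simp: fs_ldistr m_assoc)
  also have "... = (\<Oplus>i\<in>idx. \<Oplus>v\<in>C. uu i\<otimes>(h i v\<otimes>e v x))" using x hI by (intro finsum_swap) auto
  also have "... = (\<Oplus>i\<in>idx. uu i\<otimes>mu (h i) x)" unfolding mu_def using x hI by (intro fs_cong fs_rdistr[symmetric]) auto
  finally show ?thesis .
 qed
 thus ?thesis using hI by blast
qed

end

lemma (in ring) ls_zero: "list_sum R (\<lambda>x. \<zero>) xs = \<zero>" by (induction xs) auto

section \<open>Hopf algebra axioms by comparison of coefficients\<close>

context hopf_descent
begin

lemma mu_add: "a\<in>Inv ==> x\<in>cK ==> y\<in>cK ==> mu a (x\<oplus>y) = mu a x\<oplus>mu a y"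
proof -
 assume h: "a\<in>Inv" "x\<in>cK" "y\<in>cK"
 have "mu a (x\<oplus>y) = (\<Oplus>w\<in>C. a w\<otimes>e w x\<oplus>a w\<otimes>e w y)"
  unfolding mu_def using h by (intro fs_cong) (simp_all add: aut_add r_distr)
 also have "... = mu a x\<oplus>mu a y" unfolding mu_def using h by (intro fs_add) auto
 finally show ?thesis .
qed

lemma mu_scal: "a\<in>Inv ==> s\<in>F ==> x\<in>cK ==> mu a (s\<otimes>x) = s\<otimes>mu a x"
proof -
 assume h: "a\<in>Inv" "s\<in>F" "x\<in>cK"
 have "mu a (s\<otimes>x) = (\<Oplus>w\<in>C. s\<otimes>(a w\<otimes>e w x))"
  unfolding mu_def
 proof (rule fs_cong)
  fix w assume w: "w\<in>C"
  have "e w s = s" using fixedD[OF h(2)] w by simp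
  thus "a w\<otimes>e w (s\<otimes>x) = s\<otimes>(a w\<otimes>e w x)" using h w by (simp add: aut_mult m_lcomm)
 qed (use h in auto)
 thus ?thesis unfolding mu_def using h by (simp add: fs_rdistr)
qed

text \<open>The sum of the coefficients is the action on the unit, so this is \<open>mu_conv\<close>
  at the unit.\<close>

lemma sum_conv: "a\<in>Inv ==> b\<in>Inv ==> (\<Oplus>w\<in>C. conv a b w) = (\<Oplus>w\<in>C. a w)\<otimes>(\<Oplus>w\<in>C. b w)"
 using mu_conv[of a b \<one>] mu_scal[of a "mu b \<one>" \<one>] sum_F[of b] by (simp add: mu_one m_comm)

definition "antip a = (\<lambda>w\<in>C. a (iN w))"

lemma antip_Inv [simp]: "a\<in>Inv ==> antip a\<in>Inv"
 unfolding antip_def by (intro InvI) (auto simp: Inv_act act_inv[symmetric])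

end

text \<open>Only equations on \<open>Inv\<close> are required, and the comultiplication is known
  only through its coefficients, since the records under study choose the list presenting it.
  Greither--Pareigis algebras and the classical group algebra are both covered, so each axiom is
  verified once.\<close>

locale hopf_record = hopf_descent K \<Gamma> N act cl e
 for K (structure) and \<Gamma> and N :: "('n, 'z) monoid_scheme" and act cl e +
 fixes H :: "('a, 'n => 'a) hopf" and \<mu> :: "('n => 'a) => 'a => 'a"
 assumes carrier_H [simp]: "carrier H = Inv"
  and mult_H [simp]: "[|a\<in>Inv; b\<in>Inv|] ==> a\<otimes>\<^bsub>H\<^esub> b = conv a b"
  and add_H [simp]: "[|a\<in>Inv; b\<in>Inv|] ==> a\<oplus>\<^bsub>H\<^esub> b = adds a b"
  and zero_H [simp]: "\<zero>\<^bsub>H\<^esub> = (\<lambda>\<eta>\<in>C. \<zero>)"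
  and one_H [simp]: "\<one>\<^bsub>H\<^esub> = unit"
  and smult_H [simp]: "[|s\<in>F; a\<in>Inv|] ==> s\<odot>\<^bsub>H\<^esub> a = scal s a"
  and comul_set: "a\<in>Inv ==> set (comul H a) \<subseteq> Inv\<times>Inv"
  and comul_coeff: "[|a\<in>Inv; \<eta>\<in>C; \<zeta>\<in>C|] ==>
   list_sum K (\<lambda>(x, y). x \<eta>\<otimes>y \<zeta>) (comul H a) = (if \<eta> = \<zeta> then a \<eta> else \<zero>)"
  and counit_H [simp]: "a\<in>Inv ==> counit H a = (\<Oplus>\<eta>\<in>C. a \<eta>)"
  and antipode_H [simp]: "a\<in>Inv ==> antipode H a = antip a"
  and mu_H [simp]: "[|a\<in>Inv; x\<in>L|] ==> \<mu> a x = mu a x"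
begin

abbreviation H_smult (infixl "\<bullet>" 70) where "x\<bullet>y \<equiv> x\<odot>\<^bsub>H\<^esub> y"
abbreviation H_mult (infixl "\<diamondop>" 70) where "x\<diamondop>y \<equiv> x\<otimes>\<^bsub>H\<^esub> y"
abbreviation H_add (infixl "\<boxplus>" 65) where "x\<boxplus>y \<equiv> x\<oplus>\<^bsub>H\<^esub> y"

abbreviation "RF \<equiv> K\<lparr>carrier := F\<rparr>"
abbreviation "LM \<equiv> ring_as_module (K\<lparr>carrier := L\<rparr>)"

lemma ls_RF: "list_sum RF f xs = list_sum K f xs" by (simp add: list_sum_def)

lemma linear_map_lin: "linear_map RF H (ring_as_module RF) f \<longleftrightarrow> lin f"
 by (auto simp: linear_map_def lin_def ring_as_module_def)

lemma linear_map_linL: "linear_map RF LM (ring_as_module RF) f ==> linL f"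
 unfolding linear_map_def linL_def by (auto simp: ring_as_module_def intro: F_closed)

lemma comul_mem: "a\<in>Inv ==> p\<in>set (comul H a) ==> fst p\<in>Inv \<and> snd p\<in>Inv"
 using comul_set[of a] by auto

lemma adds_apply [simp]: "w\<in>C ==> adds a b w = a w\<oplus>b w" by (simp add: adds_def)
lemma scal_apply [simp]: "w\<in>C ==> scal s a w = s\<otimes>a w" by (simp add: scal_def)

lemma comul_memD: "(x, y)\<in>set (comul H a) ==> a\<in>Inv ==> x\<in>Inv \<and> y\<in>Inv"
 using comul_set[of a] by auto

lemma unit_apply [simp]: "w\<in>C ==> unit w = (if w = eN then \<one> else \<zero>)" by (simp add: unit_def)
lemma antip_apply [simp]: "w\<in>C ==> antip a w = a (iN w)" by (simp add: antip_def)
lemma conv_apply: "w\<in>C ==> conv a b w = (\<Oplus>v\<in>C. a v\<otimes>b (iN v\<cdot>w))" by (simp add: conv_def)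

definition "coef2 ss w v = list_sum K (\<lambda>p. fst p w\<otimes>snd p v) ss"
definition "coef3 ss w v u = list_sum K (\<lambda>p. fst p w\<otimes>(fst (snd p) v\<otimes>snd (snd p) u)) ss"

lemma coef2_sum:
 assumes ss: "set ss \<subseteq> Inv\<times>Inv" and c: "!!w v. w\<in>C ==> v\<in>C ==> c w v\<in>cK"
 shows "list_sum K (\<lambda>p. \<Oplus>w\<in>C. \<Oplus>v\<in>C. fst p w\<otimes>snd p v\<otimes>c w v) ss = (\<Oplus>w\<in>C. \<Oplus>v\<in>C. coef2 ss w v\<otimes>c w v)"
proof -
 have m: "!!p. p\<in>set ss ==> fst p\<in>Inv \<and> snd p\<in>Inv" using ss by auto
 have "list_sum K (\<lambda>p. \<Oplus>w\<in>C. \<Oplus>v\<in>C. fst p w\<otimes>snd p v\<otimes>c w v) ss =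
   (\<Oplus>w\<in>C. list_sum K (\<lambda>p. \<Oplus>v\<in>C. fst p w\<otimes>snd p v\<otimes>c w v) ss)"
  using m c by (intro ls_finsum) auto
 also have "... = (\<Oplus>w\<in>C. \<Oplus>v\<in>C. list_sum K (\<lambda>p. fst p w\<otimes>snd p v\<otimes>c w v) ss)"
  using m c by (intro fs_cong ls_finsum) auto
 also have "... = (\<Oplus>w\<in>C. \<Oplus>v\<in>C. coef2 ss w v\<otimes>c w v)"
  unfolding coef2_def using m c by (intro fs_cong ls_ldistr[symmetric]) auto
 finally show ?thesis .
qed

lemma bilinear_list:
 assumes B1: "!!b. b\<in>Inv ==> lin (\<lambda>a. B a b)" and B2: "!!a. a\<in>Inv ==> lin (B a)"
  and ss: "set ss \<subseteq> Inv\<times>Inv"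
 shows "list_sum K (\<lambda>(x, y). B x y) ss = (\<Oplus>w\<in>C. \<Oplus>v\<in>C. coef2 ss w v\<otimes>cf2 B w v)"
proof -
 have k: "cf2 B w v\<in>cK" for w v using cf2_closed B2 by blast
 have "list_sum K (\<lambda>(x, y). B x y) ss =
   list_sum K (\<lambda>p. \<Oplus>w\<in>C. \<Oplus>v\<in>C. (fst p w\<otimes>snd p v)\<otimes>cf2 B w v) ss"
  using ss bilinear_expand[OF B1 B2] by (intro ls_cong) (auto simp: split_beta)
 thus ?thesis using coef2_sum[OF ss k] by simp
qed

lemma trilinear_list:
 assumes B1: "!!b c. b\<in>Inv ==> c\<in>Inv ==> lin (\<lambda>a. B a b c)"
  and B2: "!!a c. a\<in>Inv ==> c\<in>Inv ==> lin (\<lambda>b. B a b c)"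
  and B3: "!!a b. a\<in>Inv ==> b\<in>Inv ==> lin (B a b)"
  and ss: "set ss \<subseteq> Inv\<times>Inv\<times>Inv"
 shows "list_sum K (\<lambda>(x, y, z). B x y z) ss = (\<Oplus>w\<in>C. \<Oplus>v\<in>C. \<Oplus>u\<in>C. coef3 ss w v u\<otimes>cf3 B w v u)"
proof -
 have k: "cf3 B w v u\<in>cK" for w v u using cf3_closed B3 by blast
 have m: "(!!p. p\<in>set ss ==> fst p\<in>Inv \<and> fst (snd p)\<in>Inv \<and> snd (snd p)\<in>Inv)" using ss by auto
 let ?m = "\<lambda>p w v u. fst p w\<otimes>(fst (snd p) v\<otimes>snd (snd p) u)"
 have "list_sum K (\<lambda>(x, y, z). B x y z) ss =
   list_sum K (\<lambda>p. \<Oplus>w\<in>C. \<Oplus>v\<in>C. \<Oplus>u\<in>C. ?m p w v u\<otimes>cf3 B w v u) ss"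
  using m trilinear_expand[OF B1 B2 B3] by (intro ls_cong) (auto simp: split_beta)
 also have "... = (\<Oplus>w\<in>C. list_sum K (\<lambda>p. \<Oplus>v\<in>C. \<Oplus>u\<in>C. ?m p w v u\<otimes>cf3 B w v u) ss)"
  using m k by (intro ls_finsum) auto
 also have "... = (\<Oplus>w\<in>C. \<Oplus>v\<in>C. list_sum K (\<lambda>p. \<Oplus>u\<in>C. ?m p w v u\<otimes>cf3 B w v u) ss)"
  using m k by (intro fs_cong ls_finsum) auto
 also have "... = (\<Oplus>w\<in>C. \<Oplus>v\<in>C. \<Oplus>u\<in>C. list_sum K (\<lambda>p. ?m p w v u\<otimes>cf3 B w v u) ss)"
  using m k by (intro fs_cong ls_finsum) auto
 also have "... = (\<Oplus>w\<in>C. \<Oplus>v\<in>C. \<Oplus>u\<in>C. coef3 ss w v u\<otimes>cf3 B w v u)"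
  unfolding coef3_def using m k by (intro fs_cong ls_ldistr[symmetric]) auto
 finally show ?thesis .
qed

lemma coef2_closed: "set ss \<subseteq> Inv\<times>Inv ==> w\<in>C ==> v\<in>C ==> coef2 ss w v\<in>cK"
 unfolding coef2_def by (intro ls_closed) auto

lemma coef3_closed: "set ss \<subseteq> Inv\<times>Inv\<times>Inv ==> w\<in>C ==> v\<in>C ==> u\<in>C ==> coef3 ss w v u\<in>cK"
 unfolding coef3_def by (intro ls_closed) auto

text \<open>\<open>bilinear_list\<close> turns every bilinear form into a combination of
  coefficients. In substance, the tensor square of the fixed ring embeds into that of
  \<open>K[N]\<close>.\<close>

lemma tensor_eqI:
 assumes ss: "set ss \<subseteq> Inv\<times>Inv" and ts: "set ts \<subseteq> Inv\<times>Inv"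
  and eq: "!!w v. w\<in>C ==> v\<in>C ==> coef2 ss w v = coef2 ts w v"
 shows "tensor_eq RF H H ss ts"
 unfolding tensor_eq_def
proof (intro allI impI)
 fix B assume "bilinear_form RF H H B"
 hence B: "!!b. b\<in>Inv ==> lin (\<lambda>a. B a b)" "!!a. a\<in>Inv ==> lin (B a)"
  by (simp_all add: bilinear_form_def linear_map_lin)
 have k: "cf2 B w v\<in>cK" for w v using cf2_closed B(2) by blast
 show "list_sum RF (\<lambda>(x, y). B x y) ss = list_sum RF (\<lambda>(x, y). B x y) ts"
  unfolding ls_RF using bilinear_list[OF B ss] bilinear_list[OF B ts] eq k coef2_closed[OF ts]
  by (auto intro!: fs_cong)
qed

lemma tensor3_eqI:
 assumes ss: "set ss \<subseteq> Inv\<times>Inv\<times>Inv" and ts: "set ts \<subseteq> Inv\<times>Inv\<times>Inv"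
  and eq: "!!w v u. w\<in>C ==> v\<in>C ==> u\<in>C ==> coef3 ss w v u = coef3 ts w v u"
 shows "tensor3_eq RF H ss ts"
 unfolding tensor3_eq_def
proof (intro allI impI)
 fix B assume "trilinear_form RF H B"
 hence B: "!!b c. b\<in>Inv ==> c\<in>Inv ==> lin (\<lambda>a. B a b c)"
  "!!a c. a\<in>Inv ==> c\<in>Inv ==> lin (\<lambda>b. B a b c)"
  "!!a b. a\<in>Inv ==> b\<in>Inv ==> lin (B a b)"
  by (simp_all add: trilinear_form_def linear_map_lin)
 have k: "cf3 B w v u\<in>cK" for w v u using cf3_closed B(3) by blast
 show "list_sum RF (\<lambda>(x, y, z). B x y z) ss = list_sum RF (\<lambda>(x, y, z). B x y z) ts"
  unfolding ls_RF using trilinear_list[OF B ss] trilinear_list[OF B ts] eq k coef3_closed[OF ts]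
  by (auto intro!: fs_cong)
qed

lemma coef2_comul: "a\<in>Inv ==> w\<in>C ==> v\<in>C ==> coef2 (comul H a) w v = (if w = v then a w else \<zero>)"
 using comul_coeff[of a w v] by (simp add: coef2_def split_beta')

lemma zero_Inv [simp]: "(\<lambda>w\<in>C. \<zero>)\<in>Inv" by (intro InvI) auto

lemma F_ops [simp]: "s\<in>F ==> t\<in>F ==> s\<oplus>t\<in>F" "s\<in>F ==> t\<in>F ==> s\<otimes>t\<in>F" "s\<in>F ==>\<ominus>s\<in>F"
 using subringE[OF subfieldE(1)[OF subfield_fixed]] by auto

lemma abelian_group_H: "abelian_group H"
proof (rule abelian_groupI)
 fix x assume x: "x\<in>carrier H"
 have m: "\<ominus> \<one>\<in>F" by simp
 have "adds (scal (\<ominus> \<one>) x) x = (\<lambda>w\<in>C. \<zero>)"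
  using x m by (intro Inv_ext) (auto simp: l_minus l_neg)
 thus "\<exists>y\<in>carrier H. y\<boxplus>x = \<zero>\<^bsub>H\<^esub>"
  using x m by (intro bexI[of _ "scal (\<ominus> \<one>) x"]) auto
next
 fix x y z assume "x\<in>carrier H" "y\<in>carrier H" "z\<in>carrier H"
 thus "x\<boxplus>y\<boxplus>z = x\<boxplus>(y\<boxplus>z)"
  by (simp, intro Inv_ext) (auto simp:  a_assoc)
next
 fix x y assume "x\<in>carrier H" "y\<in>carrier H"
 thus "x\<boxplus>y = y\<boxplus>x"
  by (simp, intro Inv_ext) (auto simp:  a_comm)
next
 fix x assume "x\<in>carrier H"
 thus "\<zero>\<^bsub>H\<^esub>\<boxplus>x = x"
  by (simp, intro Inv_ext) auto
qed auto

lemma ring_H: "ring H"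
proof (rule ringI[OF abelian_group_H])
 show "monoid H"
  by (rule monoidI) (auto simp: conv_assoc unit_conv conv_unit)
qed (auto simp: conv_adds_left conv_adds_right)

sublocale H: ring H by (rule ring_H)

lemma field_RF: "field RF" using subfield_iff(2)[OF subfield_fixed] .

lemma module_H: "module RF H"
proof (intro module.intro module_axioms.intro)
 show "cring RF" using field_RF by (simp add: field_def domain_def)
 show "abelian_group H" by (rule abelian_group_H)
 fix a b x y assume h: "a\<in>carrier RF" "b\<in>carrier RF" "x\<in>carrier H" "y\<in>carrier H"
 show "(a\<oplus>\<^bsub>RF\<^esub> b)\<bullet>x = a\<bullet>x\<boxplus>b\<bullet>x"
  using h by (simp, intro Inv_ext) (auto simp: l_distr)
 show "a\<bullet>(x\<boxplus>y) = a\<bullet>x\<boxplus>a\<bullet>y"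
  using h by (simp, intro Inv_ext) (auto simp: r_distr)
 show "(a\<otimes>\<^bsub>RF\<^esub> b)\<bullet>x = a\<bullet>(b\<bullet>x)"
  using h by (simp, intro Inv_ext) (auto simp: m_assoc)
qed (simp_all, intro Inv_ext, auto)

lemma ls_H_apply:
 "(!!x. x\<in>set xs ==> f x\<in>Inv) ==> w\<in>C ==> list_sum H f xs w = list_sum K (\<lambda>x. f x w) xs"
proof (induction xs)
 case (Cons x xs)
 hence "list_sum H f xs\<in>Inv" using H.ls_closed[of xs f] by simp
 thus ?case using Cons by simp
qed simp

lemma ls_H_Inv: "(!!x. x\<in>set xs ==> f x\<in>Inv) ==> list_sum H f xs\<in>Inv"
 using H.ls_closed[of xs f] by simp

lemma fs_H_apply:
 "finite I ==> (!!x. x\<in>I ==> f x\<in>Inv) ==> w\<in>C ==> (\<Oplus>\<^bsub>H\<^esub>x\<in>I. f x) w = (\<Oplus>x\<in>I. f x w)"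
proof (induction I rule: finite_induct)
 case (insert x I)
 hence "(\<Oplus>\<^bsub>H\<^esub>x\<in>I. f x)\<in>Inv" using H.fs_closed[of I f] by simp
 thus ?case using insert by (simp add: Pi_def)
qed simp

lemma fs_H_Inv: "(!!x. x\<in>I ==> f x\<in>Inv) ==> (\<Oplus>\<^bsub>H\<^esub>x\<in>I. f x)\<in>Inv"
 using H.fs_closed[of I f] by simp

lemma comul_eval:
 assumes a: "a\<in>Inv" and c: "!!w v. w\<in>C ==> v\<in>C ==> c w v\<in>cK"
  and f: "!!x y. x\<in>Inv ==> y\<in>Inv ==> f (x, y) = (\<Oplus>w\<in>C. \<Oplus>v\<in>C. x w\<otimes>y v\<otimes>c w v)"
 shows "list_sum K f (comul H a) = (\<Oplus>w\<in>C. a w\<otimes>c w w)"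
proof -
 have "list_sum K f (comul H a) = list_sum K (\<lambda>p. \<Oplus>w\<in>C. \<Oplus>v\<in>C. fst p w\<otimes>snd p v\<otimes>c w v) (comul H a)"
  using comul_mem[OF a] f by (intro ls_cong) (auto simp: split_beta)
 also have "... = (\<Oplus>w\<in>C. \<Oplus>v\<in>C. coef2 (comul H a) w v\<otimes>c w v)" using coef2_sum[OF comul_set[OF a] c] .
 also have "... = (\<Oplus>w\<in>C. \<Oplus>v\<in>C. if w = v then a w\<otimes>c w v else \<zero>)"
  using a c by (intro fs_cong) (auto simp: coef2_comul)
 also have "... = (\<Oplus>w\<in>C. a w\<otimes>c w w)" using a c by (intro fs_cong fs_delta(1)) auto
 finally show ?thesis .
qed

lemma coef2_swap: "set ss \<subseteq> Inv\<times>Inv ==> w\<in>C ==> v\<in>C ==> coef2 (map (\<lambda>(a, b). (b, a)) ss) w v = coef2 ss v w"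
 unfolding coef2_def by (simp add: split_beta) (rule ls_cong, auto simp: m_comm)

lemma cocomm': "a\<in>Inv ==> tensor_eq RF H H (map (\<lambda>(a, b). (b, a)) (comul H a)) (comul H a)"
 using comul_set[of a] by (intro tensor_eqI) (auto simp: coef2_swap coef2_comul)

text \<open>An identity between contractions of the comultiplication holds as soon as it holds for the
 coefficients, where the comultiplication is diagonal.\<close>

lemma contract:
 assumes a: "a\<in>Inv" and I: "!!x y. x\<in>Inv ==> y\<in>Inv ==> f (x, y)\<in>Inv" and b: "b\<in>Inv"
  and p: "!!w r. w\<in>C ==> r\<in>C ==> p w r\<in>C" "!!w r. w\<in>C ==> r\<in>C ==> q w r\<in>C"
  and f: "!!x y w. x\<in>Inv ==> y\<in>Inv ==> w\<in>C ==> f (x, y) w = (\<Oplus>r\<in>C. x (p w r)\<otimes>y (q w r))"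
  and eq: "!!w. w\<in>C ==> (\<Oplus>r\<in>C. if p w r = q w r then a (p w r) else \<zero>) = b w"
 shows "list_sum H f (comul H a) = b"
proof (rule Inv_ext)
 note m = comul_mem[OF a]
 show "list_sum H f (comul H a)\<in>Inv" using m I by (intro ls_H_Inv) (metis prod.collapse)
 fix w assume w: "w\<in>C"
 have "list_sum H f (comul H a) w = list_sum K (\<lambda>x. f x w) (comul H a)"
  using m I w by (intro ls_H_apply) (metis prod.collapse)
 also have "... = list_sum K (\<lambda>x. \<Oplus>r\<in>C. fst x (p w r)\<otimes>snd x (q w r)) (comul H a)"
  using m f w by (intro ls_cong) (metis prod.collapse)
 also have "... = (\<Oplus>r\<in>C. coef2 (comul H a) (p w r) (q w r))"
  unfolding coef2_def using m p w by (intro ls_finsum) auto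
 also have "... = (\<Oplus>r\<in>C. if p w r = q w r then a (p w r) else \<zero>)"
  using a p w by (intro fs_cong) (auto simp: coef2_comul)
 finally show "list_sum H f (comul H a) w = b w" using eq w by simp
qed (rule b)

lemma counit_left':
 assumes a: "a\<in>Inv" shows "list_sum H (\<lambda>(x, y). counit H x\<bullet>y) (comul H a) = a"
proof (rule contract[OF a _ a, where p="\<lambda>w r. r" and q="\<lambda>w r. w"])
 show "(\<Oplus>r\<in>C. if r = w then a r else \<zero>) = a w" if "w\<in>C" for w using a that by (intro fs_delta(2)) auto
qed (use a sum_F in \<open>auto simp: fs_ldistr\<close>)

lemma counit_right':
 assumes a: "a\<in>Inv" shows "list_sum H (\<lambda>(x, y). counit H y\<bullet>x) (comul H a) = a"
proof (rule contract[OF a _ a, where p="\<lambda>w r. w" and q="\<lambda>w r. r"])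
 show "(\<Oplus>r\<in>C. if w = r then a w else \<zero>) = a w" if "w\<in>C" for w
  using fs_delta(1)[of C w "\<lambda>_. a w"] a that by auto
qed (use a sum_F in \<open>auto simp: fs_rdistr[symmetric] m_comm\<close>)

lemma sum_antip: assumes "a\<in>Inv" shows "(\<Oplus>r\<in>C. a (iN r)) = (\<Oplus>r\<in>C. a r)"
 using assms by (intro finsum_bij[symmetric] N_inv_bij) auto

lemma antipode_left':
 assumes a: "a\<in>Inv"
 shows "list_sum H (\<lambda>(x, y). antipode H x\<diamondop>y) (comul H a) = counit H a\<bullet>\<one>\<^bsub>H\<^esub>"
proof (rule contract[OF a, where p="\<lambda>w r. iN r" and q="\<lambda>w r. iN r\<cdot>w"])
 show "(\<Oplus>r\<in>C. if iN r = iN r\<cdot>w then a (iN r) else \<zero>) = (counit H a\<bullet>\<one>\<^bsub>H\<^esub>) w"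
  if w: "w\<in>C" for w
 proof (cases "w = eN")
  case True
  have "(\<Oplus>r\<in>C. if iN r = iN r\<cdot>w then a (iN r) else \<zero>) = (\<Oplus>r\<in>C. a (iN r))"
   using True a by (intro fs_cong) auto
  thus ?thesis using True a sum_antip[OF a] sum_F[OF a] by simp
 next
  case False
  hence "(\<Oplus>r\<in>C. if iN r = iN r\<cdot>w then a (iN r) else \<zero>) = \<zero>"
   using w N.r_cancel_one'[of w] N.l_cancel_one' by (intro fs_zero) (simp add: N.l_cancel_one')
  thus ?thesis using False a w sum_F[OF a] by simp
 qed
qed (use a sum_F in \<open>auto simp: conv_apply intro!: fs_cong\<close>)

lemma antipode_right':
 assumes a: "a\<in>Inv"
 shows "list_sum H (\<lambda>(x, y). x\<diamondop>antipode H y) (comul H a) = counit H a\<bullet>\<one>\<^bsub>H\<^esub>"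
proof (rule contract[OF a, where p="\<lambda>w r. r" and q="\<lambda>w r. iN (iN r\<cdot>w)"])
 show "(\<Oplus>r\<in>C. if r = iN (iN r\<cdot>w) then a r else \<zero>) = (counit H a\<bullet>\<one>\<^bsub>H\<^esub>) w"
  if w: "w\<in>C" for w
 proof (cases "w = eN")
  case True
  have "(\<Oplus>r\<in>C. if r = iN (iN r\<cdot>w) then a r else \<zero>) = (\<Oplus>r\<in>C. a r)"
   using True a by (intro fs_cong) auto
  thus ?thesis using True a sum_F[OF a] by simp
 next
  case False
  have "iN (iN r\<cdot>w) ~= r" if r: "r\<in>C" for r
  proof
   assume "iN (iN r\<cdot>w) = r"
   hence "iN w\<cdot>r = r" using w r by (simp add: N.inv_mult_group)
   hence "iN w = eN" using w r N.r_cancel_one[of r "iN w"] by simp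
   thus False using False w N.inv_eq_1_iff by blast
  qed
  hence "(\<Oplus>r\<in>C. if r = iN (iN r\<cdot>w) then a r else \<zero>) = \<zero>"
   by (intro fs_zero) (metis)
  thus ?thesis using False a w sum_F[OF a] by simp
 qed
qed (use a sum_F in \<open>auto simp: conv_apply intro!: fs_cong\<close>)

lemma coef2_append: "set ss \<subseteq> Inv\<times>Inv ==> set ts \<subseteq> Inv\<times>Inv ==> w\<in>C ==> v\<in>C ==>
  coef2 (ss @ ts) w v = coef2 ss w v\<oplus>coef2 ts w v"
 unfolding coef2_def by (intro ls_append) auto

lemma comul_add':
 assumes "x\<in>Inv" "y\<in>Inv" shows "tensor_eq RF H H (comul H (adds x y)) (comul H x @ comul H y)"
proof (rule tensor_eqI)
 show "coef2 (comul H (adds x y)) w v = coef2 (comul H x @ comul H y) w v" if "w\<in>C" "v\<in>C" for w v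
  using assms that coef2_append[OF comul_set comul_set] by (simp add: coef2_comul)
qed (use assms comul_set in auto)

lemma comul_smult':
 assumes "s\<in>F" "x\<in>Inv"
 shows "tensor_eq RF H H (comul H (scal s x)) (map (\<lambda>(a, b). (s\<bullet>a, b)) (comul H x))"
proof (rule tensor_eqI)
 note m = comul_mem[OF assms(2)]
 show "coef2 (comul H (scal s x)) w v = coef2 (map (\<lambda>(a, b). (s\<bullet>a, b)) (comul H x)) w v" if h: "w\<in>C" "v\<in>C" for w v
 proof -
  have "coef2 (map (\<lambda>(a, b). (s\<bullet>a, b)) (comul H x)) w v = list_sum K (\<lambda>p. s\<otimes>(fst p w\<otimes>snd p v)) (comul H x)"
   unfolding coef2_def ls_map using m assms h by (intro ls_cong) (auto simp: split_beta m_assoc)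
  also have "... = s\<otimes>coef2 (comul H x) w v"
   unfolding coef2_def using m assms h by (intro ls_rdistr[symmetric]) auto
  finally show ?thesis using assms h by (simp add: coef2_comul)
 qed
 show "set (map (\<lambda>(a, b). (s\<bullet>a, b)) (comul H x)) \<subseteq> Inv\<times>Inv" using m assms by auto
qed (use assms comul_set in auto)

lemma comul_one': "tensor_eq RF H H (comul H unit) [(unit, unit)]"
proof (rule tensor_eqI)
 show "coef2 (comul H unit) w v = coef2 [(unit, unit)] w v" if "w\<in>C" "v\<in>C" for w v
  using that by (auto simp: coef2_comul) (auto simp: coef2_def)
qed (use comul_set in auto)

text \<open>Diagonality of the comultiplication of \<open>x\<close> forces the two convolution
  indices to agree; that of \<open>y\<close> then forces \<open>w = v\<close>.\<close>

lemma comul_mult':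
 assumes x: "x\<in>Inv" and y: "y\<in>Inv"
 shows "tensor_eq RF H H (comul H (conv x y))
  [(a\<diamondop>c, b\<diamondop>d). (a, b) \<leftarrow> comul H x, (c, d) \<leftarrow> comul H y]"
proof (rule tensor_eqI)
 note mx = comul_mem[OF x] and my = comul_mem[OF y]
 let ?l = "[(a\<diamondop>c, b\<diamondop>d). (a, b) \<leftarrow> comul H x, (c, d) \<leftarrow> comul H y]"
 show l: "set ?l \<subseteq> Inv\<times>Inv" using mx my by (force)
 show "coef2 (comul H (conv x y)) w v = coef2 ?l w v" if h: "w\<in>C" "v\<in>C" for w v
 proof -
  let ?c = "\<lambda>r t. if iN r\<cdot>w = iN t\<cdot>v then y (iN r\<cdot>w) else \<zero>"
  let ?g = "\<lambda>p. list_sum K (\<lambda>q. conv (fst p) (fst q) w\<otimes>conv (snd p) (snd q) v) (comul H y)"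
  have "coef2 ?l w v = list_sum K (\<lambda>p. list_sum K (\<lambda>p. fst p w\<otimes>snd p v)
    (map (\<lambda>q. (fst p\<diamondop>fst q, snd p\<diamondop>snd q)) (comul H y))) (comul H x)"
   unfolding coef2_def split_beta' using mx my h by (subst ls_concat_map) (auto intro!: ls_cong)
  also have "... = list_sum K ?g (comul H x)"
   unfolding ls_map using mx my by (intro ls_cong) auto
  also have "... = (\<Oplus>r\<in>C. x r\<otimes>?c r r)"
  proof (rule comul_eval[OF x, where c="?c"])
   fix a b assume ab: "a\<in>Inv" "b\<in>Inv"
   have "?g (a, b) = list_sum K (\<lambda>q. \<Oplus>r\<in>C. \<Oplus>t\<in>C. a r\<otimes>b t\<otimes>(fst q (iN r\<cdot>w)\<otimes>snd q (iN t\<cdot>v))) (comul H y)"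
   proof (rule ls_cong)
    fix q assume "q\<in>set (comul H y)"
    hence q: "fst q\<in>Inv" "snd q\<in>Inv" using my by auto
    show "conv (fst (a, b)) (fst q) w\<otimes>conv (snd (a, b)) (snd q) v =
     (\<Oplus>r\<in>C. \<Oplus>t\<in>C. a r\<otimes>b t\<otimes>(fst q (iN r\<cdot>w)\<otimes>snd q (iN t\<cdot>v)))"
     using q ab h by (simp add: conv_def fs_ldistr) (intro fs_cong, auto simp: fs_rdistr m_ac intro!: fs_cong)
   qed
   also have "... = (\<Oplus>r\<in>C. list_sum K (\<lambda>q. \<Oplus>t\<in>C. a r\<otimes>b t\<otimes>(fst q (iN r\<cdot>w)\<otimes>snd q (iN t\<cdot>v))) (comul H y))"
    using my ab h by (intro ls_finsum) auto
   also have "... = (\<Oplus>r\<in>C. \<Oplus>t\<in>C. list_sum K (\<lambda>q. a r\<otimes>b t\<otimes>(fst q (iN r\<cdot>w)\<otimes>snd q (iN t\<cdot>v))) (comul H y))"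
    using my ab h by (intro fs_cong ls_finsum) auto
   also have "... = (\<Oplus>r\<in>C. \<Oplus>t\<in>C. a r\<otimes>b t\<otimes>coef2 (comul H y) (iN r\<cdot>w) (iN t\<cdot>v))"
    unfolding coef2_def using my ab h by (intro fs_cong ls_rdistr[symmetric]) auto
   also have "... = (\<Oplus>r\<in>C. \<Oplus>t\<in>C. a r\<otimes>b t\<otimes>?c r t)"
    using y ab h by (intro fs_cong) (auto simp: coef2_comul)
   finally show "?g (a, b) = (\<Oplus>r\<in>C. \<Oplus>t\<in>C. a r\<otimes>b t\<otimes>?c r t)" .
  qed (use y h in auto)
  also have "... = (if w = v then conv x y w else \<zero>)"
  proof (cases "w = v")
   case True thus ?thesis using h by (simp add: conv_def)
  next
   case False thus ?thesis using h x by (auto intro!: fs_zero)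
  qed
  finally show ?thesis using x y h by (simp add: coef2_comul)
 qed
qed (use x y comul_set in auto)

text \<open>Both sides have the coefficient \<open>x w\<close> where the three indices agree, and
  zero elsewhere.\<close>

lemma coassoc':
 assumes x: "x\<in>Inv"
 shows "tensor3_eq RF H
  [(a1, a2, b). (a, b) \<leftarrow> comul H x, (a1, a2) \<leftarrow> comul H a]
  [(a, b1, b2). (a, b) \<leftarrow> comul H x, (b1, b2) \<leftarrow> comul H b]"
proof (rule tensor3_eqI)
 note mx = comul_mem[OF x]
 have mm: "p\<in>set (comul H x) ==> q\<in>set (comul H (fst p)) \<union> set (comul H (snd p)) ==> fst q\<in>Inv \<and> snd q\<in>Inv" for p q
  using mx comul_mem[of "fst p" q] comul_mem[of "snd p" q] by blast
 let ?l = "[(a1, a2, b). (a, b) \<leftarrow> comul H x, (a1, a2) \<leftarrow> comul H a]"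
 let ?r = "[(a, b1, b2). (a, b) \<leftarrow> comul H x, (b1, b2) \<leftarrow> comul H b]"
 show "set ?l \<subseteq> Inv\<times>Inv\<times>Inv" "set ?r \<subseteq> Inv\<times>Inv\<times>Inv" using mx mm by (force)+
 fix w v u assume h: "w\<in>C" "v\<in>C" "u\<in>C"
 have "coef3 ?l w v u = list_sum K (\<lambda>p. list_sum K (\<lambda>p. fst p w\<otimes>(fst (snd p) v\<otimes>snd (snd p) u))
    (map (\<lambda>q. (fst q, snd q, snd p)) (comul H (fst p)))) (comul H x)"
  unfolding coef3_def split_beta' using x h by (subst ls_concat_map) (auto intro!: ls_cong dest!: comul_memD)
 also have "... = list_sum K (\<lambda>p. coef2 (comul H (fst p)) w v\<otimes>snd p u) (comul H x)"
  unfolding ls_map coef2_def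
 proof (rule ls_cong)
  fix p assume p: "p\<in>set (comul H x)"
  show "list_sum K (\<lambda>q. fst (fst q, snd q, snd p) w\<otimes>(fst (snd (fst q, snd q, snd p)) v\<otimes>snd (snd (fst q, snd q, snd p)) u))
    (comul H (fst p)) = list_sum K (\<lambda>q. fst q w\<otimes>snd q v) (comul H (fst p))\<otimes>snd p u"
   using mx[OF p] h by (subst ls_ldistr) (auto simp: m_assoc intro!: ls_cong dest!: comul_memD)
 qed
 also have "... = list_sum K (\<lambda>p. if w = v then fst p w\<otimes>snd p u else \<zero>) (comul H x)"
  using mx h by (intro ls_cong) (auto simp: coef2_comul)
 also have "... = (if w = v then coef2 (comul H x) w u else \<zero>)" by (auto simp: coef2_def ls_zero)
 also have "... = (if w = v \<and> v = u then x w else \<zero>)" using x h by (simp add: coef2_comul)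
 also have "... = (if v = u then coef2 (comul H x) w v else \<zero>)" using x h by (simp add: coef2_comul)
 also have "... = list_sum K (\<lambda>p. if v = u then fst p w\<otimes>snd p v else \<zero>) (comul H x)" by (auto simp: coef2_def ls_zero)
 also have "... = list_sum K (\<lambda>p. fst p w\<otimes>coef2 (comul H (snd p)) v u) (comul H x)"
  using mx h by (intro ls_cong) (auto simp: coef2_comul)
 also have "... = list_sum K (\<lambda>p. list_sum K (\<lambda>p. fst p w\<otimes>(fst (snd p) v\<otimes>snd (snd p) u))
    (map (\<lambda>q. (fst p, fst q, snd q)) (comul H (snd p)))) (comul H x)"
  unfolding ls_map coef2_def using mx mm h by (intro ls_cong) (auto simp: ls_rdistr)
 also have "... = coef3 ?r w v u"
  unfolding coef3_def split_beta' using x h by (subst ls_concat_map) (auto intro!: ls_cong dest!: comul_memD)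
 finally show "coef3 ?l w v u = coef3 ?r w v u" .
qed

lemma sum_adds: "a\<in>Inv ==> b\<in>Inv ==> (\<Oplus>w\<in>C. adds a b w) = (\<Oplus>w\<in>C. a w)\<oplus>(\<Oplus>w\<in>C. b w)"
 by (subst fs_add[symmetric]) (auto intro!: fs_cong simp del: finsum_addf)

lemma sum_scal: "s\<in>F ==> a\<in>Inv ==> (\<Oplus>w\<in>C. scal s a w) = s\<otimes>(\<Oplus>w\<in>C. a w)"
 by (subst fs_rdistr) (auto intro!: fs_cong)

lemma sum_unit: "(\<Oplus>w\<in>C. unit w) = \<one>"
proof -
 have "(\<Oplus>w\<in>C. unit w) = (\<Oplus>w\<in>C. if w = eN then \<one> else \<zero>)" by (intro fs_cong) auto
 also have "... = \<one>" by (rule fs_delta(2)[of C "eN" "\<lambda>_. \<one>"]) auto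
 finally show ?thesis .
qed

lemma counit_hom': "counit H\<in>ring_hom H RF"
 by (rule ring_hom_memI) (auto simp: sum_F sum_conv sum_adds sum_unit)

lemma cocommutative_hopf_algebra_H: "cocommutative_hopf_algebra RF H"
proof (intro cocommutative_hopf_algebra.intro cocommutative_hopf_algebra_axioms.intro field_RF module_H ring_H)
 show "counit H\<in>ring_hom H RF" by (rule counit_hom')
 show "linear_map RF H (ring_as_module RF) (counit H)"
  unfolding linear_map_lin lin_def by (auto simp: sum_F sum_adds sum_scal)
 show "linear_map RF H H (antipode H)"
  unfolding linear_map_def
 proof (intro conjI ballI)
  show "antipode H (x\<boxplus>y) = antipode H x\<boxplus>antipode H y" if "x\<in>carrier H" "y\<in>carrier H" for x y
   using that by (simp, intro Inv_ext) auto
  show "antipode H (c\<bullet>x) = c\<bullet>antipode H x" if "c\<in>carrier RF" "x\<in>carrier H" for c x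
   using that by (simp, intro Inv_ext) auto
 qed auto
 show "tensor3_eq RF H [(a1, a2, b). (a, b) \<leftarrow> comul H x, (a1, a2) \<leftarrow> comul H a]
   [(a, b1, b2). (a, b) \<leftarrow> comul H x, (b1, b2) \<leftarrow> comul H b]" if "x\<in>carrier H" for x
  using that by (intro coassoc') simp
qed (simp_all add: conv_scal_left conv_scal_right comul_set comul_add' comul_smult' comul_one' comul_mult'
  cocomm' counit_left' counit_right' antipode_left' antipode_right' del: counit_H antipode_H)

text \<open>\<open>finite_dimensional\<close> indexes coefficients by the elements of the spanning
  set, so the coefficients of indices with the same \<open>g i\<close> have to be added up.\<close>

lemma finite_dimensional_family:
 assumes I: "finite I" and g: "!!i. i\<in>I ==> g i\<in>Inv"
  and span: "!!x. x\<in>Inv ==> \<exists>s. (\<forall>i\<in>I. s i\<in>F) \<and> (\<forall>w\<in>C. x w = (\<Oplus>i\<in>I. s i\<otimes>g i w))"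
 shows "finite_dimensional RF H"
 unfolding finite_dimensional_def
proof (intro exI[of _ "g ` I"] conjI ballI)
 fix x assume "x\<in>carrier H"
 hence x: "x\<in>Inv" by simp
 obtain s where s: "\<forall>i\<in>I. s i\<in>F" "\<forall>w\<in>C. x w = (\<Oplus>i\<in>I. s i\<otimes>g i w)" using span[OF x] by blast
 define c where "c b = (\<Oplus>i\<in>I. if g i = b then s i else \<zero>)" for b
 have c: "c b\<in>F" for b unfolding c_def
 proof (rule fixedI)
  fix t assume t: "t\<in>\<Gamma>"
  have "t (\<Oplus>i\<in>I. if g i = b then s i else \<zero>) = (\<Oplus>i\<in>I. t (if g i = b then s i else \<zero>))"
   using I s t by (intro aut_finsum) auto
  also have "... = (\<Oplus>i\<in>I. if g i = b then s i else \<zero>)"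
   using s t fixedD[OF _ t] by (intro fs_cong) auto
  finally show "t (\<Oplus>i\<in>I. if g i = b then s i else \<zero>) = (\<Oplus>i\<in>I. if g i = b then s i else \<zero>)" .
 qed (use s in auto)
 have gI: "b\<in>Inv" if "b\<in>g ` I" for b using that g by auto
 have "x = (\<Oplus>\<^bsub>H\<^esub>b\<in>g ` I. c b\<bullet>b)"
 proof (rule Inv_ext[OF x])
  show "(\<Oplus>\<^bsub>H\<^esub>b\<in>g ` I. c b\<bullet>b)\<in>Inv" using gI c by (intro fs_H_Inv) simp
  fix w assume w: "w\<in>C"
  have "x w = (\<Oplus>b\<in>g ` I. \<Oplus>i\<in>I. if g i = b then s i\<otimes>g i w else \<zero>)"
   using I s g w by (simp add: finsum_group[of I "g ` I" g])
  also have "... = (\<Oplus>b\<in>g ` I. c b\<otimes>b w)"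
  proof (rule fs_cong)
   fix b assume b: "b\<in>g ` I"
   have "c b\<otimes>b w = (\<Oplus>i\<in>I. (if g i = b then s i else \<zero>)\<otimes>b w)"
    unfolding c_def using I s w gI[OF b] by (intro fs_ldistr) auto
   also have "... = (\<Oplus>i\<in>I. if g i = b then s i\<otimes>g i w else \<zero>)"
    using s g w gI[OF b] by (intro fs_cong) auto
   finally show "(\<Oplus>i\<in>I. if g i = b then s i\<otimes>g i w else \<zero>) = c b\<otimes>b w" by simp
  qed (use c gI w in auto)
  also have "... = (\<Oplus>\<^bsub>H\<^esub>b\<in>g ` I. c b\<bullet>b) w"
   using gI c w I by (subst fs_H_apply) (auto intro!: fs_cong)
  finally show "x w = (\<Oplus>\<^bsub>H\<^esub>b\<in>g ` I. c b\<bullet>b) w" .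
 qed
 thus "\<exists>c\<in>g ` I \<rightarrow> carrier RF. x = (\<Oplus>\<^bsub>H\<^esub>b\<in>g ` I. c b\<bullet>b)" using c by (intro bexI[of _ c]) auto
qed (use I g in auto)

text \<open>The element \<open>tt\<close> of trace one exhibits \<open>x\<close> as a value of
  \<open>Tr\<close>, which \<open>Tr_sum_dl\<close> and \<open>Tr_dl_expand\<close> then break
  up.\<close>

lemma finite_dimensional_H: "finite_dimensional RF H"
proof (rule finite_dimensional_family)
 show "finite (C\<times>idx)" by simp
 show "(\<lambda>(v, i). Tr (dl v (yy i))) p\<in>Inv" if "p\<in>C\<times>idx" for p by (simp add: split_beta)
 fix x assume x: "x\<in>Inv"
 let ?s = "\<lambda>(v, i). tr (xx i\<otimes>(tt\<otimes>x v))"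
 have T: "Tr (dl v (yy i))\<in>Inv" for v i by simp
 have "x w = (\<Oplus>p\<in>C\<times>idx. ?s p\<otimes>(\<lambda>(v, i). Tr (dl v (yy i))) p w)" if w: "w\<in>C" for w
 proof -
  have "x = scal (tr tt) x" using x tt by (intro Inv_ext) auto
  also have "... = Tr (\<lambda>w. tt\<otimes>x w)" using Tr_scal_Inv[of tt x] x tt by simp
  also have "... = csum C (\<lambda>v. Tr (dl v (tt\<otimes>x v)))" using x tt by (intro Tr_sum_dl) simp
  finally have "x w = csum C (\<lambda>v. Tr (dl v (tt\<otimes>x v))) w" by simp
  also have "... = (\<Oplus>v\<in>C. Tr (dl v (tt\<otimes>x v)) w)" using w by (simp add: csum_def)
  also have "... = (\<Oplus>v\<in>C. \<Oplus>i\<in>idx. ?s (v, i)\<otimes>Tr (dl v (yy i)) w)"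
  proof (rule fs_cong)
   fix v assume v: "v\<in>C"
   show "Tr (dl v (tt\<otimes>x v)) w = (\<Oplus>i\<in>idx. ?s (v, i)\<otimes>Tr (dl v (yy i)) w)"
    using v w x tt by (subst Tr_dl_expand) (auto simp: csum_def intro!: fs_cong Inv_closed[OF T])
  qed (use x tt w Inv_closed[OF T] in auto)
  also have "... = (\<Oplus>p\<in>C\<times>idx. ?s p\<otimes>(\<lambda>(v, i). Tr (dl v (yy i))) p w)"
   using x tt w Inv_closed[OF T] by (subst finsum_cartesian) auto
  finally show ?thesis .
 qed
 note xeq = this
 have sF: "\<forall>p\<in>C\<times>idx. ?s p\<in>F" using x tt by (auto intro!: tr_fixed)
 show "\<exists>s. (\<forall>p\<in>C\<times>idx. s p\<in>F) \<and> (\<forall>w\<in>C. x w = (\<Oplus>p\<in>C\<times>idx. s p\<otimes>(\<lambda>(v, i). Tr (dl v (yy i))) p w))"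
  by (intro exI[of _ ?s] conjI sF ballI xeq)
qed

text \<open>\<open>d xs t w\<close> applies \<open>t\<close> to the first factor and takes the
  coefficient at \<open>w\<close> of the second. Equality of the endomorphisms settles the identity
  automorphism by \<open>coefficient_recover\<close>, invariance carries it to every
  \<open>t\<close>, and each bilinear form is a combination of these numbers.\<close>

lemma injectivity:
 assumes ss: "set ss \<subseteq> L\<times>Inv" and ts: "set ts \<subseteq> L\<times>Inv"
  and eq: "!!y. y\<in>L ==> list_sum K (\<lambda>(x, h). x\<otimes>mu h y) ss = list_sum K (\<lambda>(x, h). x\<otimes>mu h y) ts"
 shows "tensor_eq RF LM H ss ts"
proof -
 define d where "d xs t w = list_sum K (\<lambda>p. t (fst p)\<otimes>snd p w) xs" for xs :: "('a\<times>('n => 'a)) list" and t w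
 have mem: "fst p\<in>L \<and> snd p\<in>Inv" if "p\<in>set xs" "set xs \<subseteq> L\<times>Inv" for p xs using that by auto
 have dc: "d xs t w\<in>cK" if "set xs \<subseteq> L\<times>Inv" "t\<in>\<Gamma>" "w\<in>C" for xs t w
  unfolding d_def using that by (intro ls_closed) auto
 have d1: "(\<Oplus>w\<in>C. d xs idG w\<otimes>e w y) = list_sum K (\<lambda>(x, h). x\<otimes>mu h y) xs" if xs: "set xs \<subseteq> L\<times>Inv" and y: "y\<in>L" for xs y
 proof -
  have m: "fst p\<in>L" "snd p\<in>Inv" if "p\<in>set xs" for p using mem[OF that xs] by auto
  have "list_sum K (\<lambda>(x, h). x\<otimes>mu h y) xs = list_sum K (\<lambda>p. \<Oplus>w\<in>C. fst p\<otimes>snd p w\<otimes>e w y) xs"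
   using m y by (intro ls_cong) (auto simp: split_beta mu_def fs_rdistr m_assoc intro!: fs_cong)
  also have "... = (\<Oplus>w\<in>C. list_sum K (\<lambda>p. fst p\<otimes>snd p w\<otimes>e w y) xs)" using m y by (intro ls_finsum) auto
  also have "... = (\<Oplus>w\<in>C. list_sum K (\<lambda>p. fst p\<otimes>snd p w) xs\<otimes>e w y)"
   using m y by (intro fs_cong ls_ldistr[symmetric]) auto
  also have "... = (\<Oplus>w\<in>C. d xs idG w\<otimes>e w y)"
   unfolding d_def using m y by (intro fs_cong arg_cong2[of _ _ _ _ "(\<otimes>)"] ls_cong) auto
  finally show ?thesis by simp
 qed
 have d2: "d ss idG w = d ts idG w" if w: "w\<in>C" for w
 proof -
  have v: "(\<Oplus>w\<in>C. d ss idG w\<otimes>e w (G'.tr (yy i))) = (\<Oplus>w\<in>C. d ts idG w\<otimes>e w (G'.tr (yy i)))" for i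
   using d1[OF ss vv_L] d1[OF ts vv_L] eq[OF vv_L] by simp
  show ?thesis
   using coefficient_recover[of "d ss idG" w] coefficient_recover[of "d ts idG" w] dc[OF ss] dc[OF ts] w
   by (simp add: v)
 qed
 have d3: "d xs t w = t (d xs idG (act (iG t) w))"
  if xs: "set xs \<subseteq> L\<times>Inv" and t: "t\<in>\<Gamma>" and w: "w\<in>C" for xs t w
 proof -
  have m: "fst p\<in>L" "snd p\<in>Inv" if "p\<in>set xs" for p using mem[OF that xs] by auto
  have "t (d xs idG (act (iG t) w)) = list_sum K (\<lambda>p. t (idG (fst p)\<otimes>snd p (act (iG t) w))) xs"
   unfolding d_def using m t w by (intro aut_ls) auto
  also have "... = d xs t w"
   unfolding d_def using m t w by (intro ls_cong) (auto simp: aut_mult Inv_act[symmetric])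
  finally show ?thesis by simp
 qed
 have d4: "d ss t w = d ts t w" if "t\<in>\<Gamma>" "w\<in>C" for t w
  using d3[OF ss that] d3[OF ts that] d2[of "act (iG t) w"] that by simp
 show ?thesis unfolding tensor_eq_def
 proof (intro allI impI)
  fix B assume "bilinear_form RF LM H B"
  hence B1: "!!x. x\<in>L ==> lin (B x)" and B2: "!!h. h\<in>Inv ==> linL (\<lambda>x. B x h)"
   by (auto simp: bilinear_form_def linear_map_lin intro: linear_map_linL) (auto simp: ring_as_module_def)
  define q where "q t w = (\<Oplus>i\<in>idx. t (yy i)\<otimes>cf (B (uu i)) w)" for t w
  have cfc: "cf (B (uu i)) w\<in>cK" for i w using cf_closed[OF B1[OF uu_L]] .
  have qc: "q t w\<in>cK" if "t\<in>\<Gamma>" for t w unfolding q_def using that cfc by auto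
  have ex: "B x h = (\<Oplus>t\<in>\<Gamma>. \<Oplus>w\<in>C. t x\<otimes>h w\<otimes>q t w)" if x: "x\<in>L" and h: "h\<in>Inv" for x h
  proof -
   have "B x h = (\<Oplus>t\<in>\<Gamma>. t x\<otimes>cg (\<lambda>x. B x h) t)" by (rule linL_expand[OF B2[OF h] x])
   also have "... = (\<Oplus>t\<in>\<Gamma>. \<Oplus>w\<in>C. t x\<otimes>h w\<otimes>q t w)"
   proof (rule fs_cong)
    fix t assume t: "t\<in>\<Gamma>"
    have "cg (\<lambda>x. B x h) t = (\<Oplus>i\<in>idx. \<Oplus>w\<in>C. h w\<otimes>(t (yy i)\<otimes>cf (B (uu i)) w))"
     unfolding cg_def using t h cfc lin_expand[OF B1[OF uu_L] h]
     by (intro fs_cong) (auto simp: fs_rdistr m_lcomm intro!: fs_cong)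
    also have "... = (\<Oplus>w\<in>C. \<Oplus>i\<in>idx. h w\<otimes>(t (yy i)\<otimes>cf (B (uu i)) w))"
     using t h cfc by (intro finsum_swap) auto
    also have "... = (\<Oplus>w\<in>C. h w\<otimes>q t w)"
     unfolding q_def using t h cfc by (intro fs_cong fs_rdistr[symmetric]) auto
    finally show "t x\<otimes>cg (\<lambda>x. B x h) t = (\<Oplus>w\<in>C. t x\<otimes>h w\<otimes>q t w)"
     using t h x qc by (simp add: fs_rdistr) (auto simp: m_assoc intro!: fs_cong)
   qed (use x h qc in auto)
   finally show ?thesis .
  qed
  have lst: "list_sum K (\<lambda>(x, h). B x h) xs = (\<Oplus>t\<in>\<Gamma>. \<Oplus>w\<in>C. d xs t w\<otimes>q t w)" if xs: "set xs \<subseteq> L\<times>Inv" for xs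
  proof -
   have m: "fst p\<in>L" "snd p\<in>Inv" if "p\<in>set xs" for p using mem[OF that xs] by auto
   have "list_sum K (\<lambda>(x, h). B x h) xs = list_sum K (\<lambda>p. \<Oplus>t\<in>\<Gamma>. \<Oplus>w\<in>C. t (fst p)\<otimes>snd p w\<otimes>q t w) xs"
    using m by (intro ls_cong) (auto simp: split_beta ex)
   also have "... = (\<Oplus>t\<in>\<Gamma>. list_sum K (\<lambda>p. \<Oplus>w\<in>C. t (fst p)\<otimes>snd p w\<otimes>q t w) xs)"
    using m qc fin by (intro ls_finsum) auto
   also have "... = (\<Oplus>t\<in>\<Gamma>. \<Oplus>w\<in>C. list_sum K (\<lambda>p. t (fst p)\<otimes>snd p w\<otimes>q t w) xs)"
    using m qc by (intro fs_cong ls_finsum) auto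
   also have "... = (\<Oplus>t\<in>\<Gamma>. \<Oplus>w\<in>C. d xs t w\<otimes>q t w)"
    unfolding d_def using m qc by (intro fs_cong ls_ldistr[symmetric]) auto
   finally show ?thesis .
  qed
  have "(\<Oplus>t\<in>\<Gamma>. \<Oplus>w\<in>C. d ss t w\<otimes>q t w) = (\<Oplus>t\<in>\<Gamma>. \<Oplus>w\<in>C. d ts t w\<otimes>q t w)"
   using d4 qc dc[OF ts] by (intro fs_cong) auto
  thus "list_sum RF (\<lambda>(x, h). B x h) ss = list_sum RF (\<lambda>(x, h). B x h) ts"
   unfolding ls_RF using lst[OF ss] lst[OF ts] by simp
 qed
qed

lemma mu_comul:
 assumes h: "h\<in>Inv" and x: "x\<in>L" and y: "y\<in>L"
 shows "mu h (x\<otimes>y) = list_sum K (\<lambda>(a, b). \<mu> a x\<otimes>\<mu> b y) (comul H h)"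
proof -
 have "list_sum K (\<lambda>(a, b). \<mu> a x\<otimes>\<mu> b y) (comul H h) = (\<Oplus>w\<in>C. h w\<otimes>(e w x\<otimes>e w y))"
 proof (rule comul_eval[OF h, where c="\<lambda>w v. e w x\<otimes>e v y"])
  fix a b assume ab: "a\<in>Inv" "b\<in>Inv"
  show "(case (a, b) of (a, b) => \<mu> a x\<otimes>\<mu> b y) = (\<Oplus>w\<in>C. \<Oplus>v\<in>C. a w\<otimes>b v\<otimes>(e w x\<otimes>e v y))"
   using ab x y by (simp add: mu_def fs_ldistr) (intro fs_cong, auto simp: fs_rdistr m_ac intro!: fs_cong)
 qed (use x y in auto)
 also have "... = mu h (x\<otimes>y)" unfolding mu_def using h x y by (intro fs_cong) (auto simp: aut_mult)
 finally show ?thesis by simp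
qed

theorem hopf_galois_H: "hopf_galois_structure K F L (H, \<mu>)"
proof -
 have lm: "linear_map RF LM LM (\<mu> h)" if h: "h\<in>Inv" for h
  using h F_L by (auto simp: linear_map_def ring_as_module_def mu_add mu_scal)
 have surj: "\<exists>ts. set ts \<subseteq> L\<times>Inv \<and> (\<forall>y\<in>L. f y = list_sum K (\<lambda>(x, h). x\<otimes>\<mu> h y) ts)" if f: "linear_map RF LM LM f" for f
 proof -
  have p: "!!x. x\<in>L ==> f x\<in>L" "linL f"
   using f L_closed by (auto simp: linear_map_def ring_as_module_def linL_def Pi_iff simp del: L_closed)
  obtain h where h: "!!i. i\<in>idx ==> h i\<in>Inv" "!!x. x\<in>L ==> f x = (\<Oplus>i\<in>idx. uu i\<otimes>mu (h i) x)"
   using endomorphism_expand[OF p(2) p(1)] by blast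
  let ?is = "[0..<fst crd]"
  have set: "set ?is = idx" by (auto simp: idx_def)
  have "f y = list_sum K (\<lambda>(x, h). x\<otimes>\<mu> h y) (map (\<lambda>i. (uu i, h i)) ?is)" if y: "y\<in>L" for y
  proof -
   have "list_sum K (\<lambda>(x, h). x\<otimes>\<mu> h y) (map (\<lambda>i. (uu i, h i)) ?is) = list_sum K (\<lambda>i. uu i\<otimes>mu (h i) y) ?is"
    unfolding ls_map using set h(1) y by (intro ls_cong) auto
   also have "... = (\<Oplus>i\<in>idx. uu i\<otimes>mu (h i) y)"
    using set h(1) y by (subst ls_distinct) auto
   finally show ?thesis using h(2)[OF y] by simp
  qed
  thus ?thesis using set h(1) by (intro exI[of _ "map (\<lambda>i. (uu i, h i)) ?is"]) auto
 qed
 have inj: "tensor_eq RF LM H ss ts" if "set ss \<subseteq> L\<times>Inv" "set ts \<subseteq> L\<times>Inv"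
  "\<forall>y\<in>L. list_sum K (\<lambda>(x, h). x\<otimes>\<mu> h y) ss = list_sum K (\<lambda>(x, h). x\<otimes>\<mu> h y) ts" for ss ts
 proof (rule injectivity[OF that(1,2)])
  fix y assume y: "y\<in>L"
  have "list_sum K (\<lambda>(x, h). x\<otimes>mu h y) us = list_sum K (\<lambda>(x, h). x\<otimes>\<mu> h y) us" if "set us \<subseteq> L\<times>Inv" for us
   using that y by (intro ls_cong) auto
  thus "list_sum K (\<lambda>(x, h). x\<otimes>mu h y) ss = list_sum K (\<lambda>(x, h). x\<otimes>mu h y) ts" using that y by auto
 qed
 show ?thesis
  unfolding hopf_galois_structure_def Let_def prod.case
 proof (intro conjI ballI allI impI)
  fix f assume "linear_map RF LM LM f"
  thus "\<exists>ts. set ts \<subseteq> L\<times>carrier H \<and> (\<forall>y\<in>L. f y = list_sum K (\<lambda>(x, h). x\<otimes>\<mu> h y) ts)" using surj by simp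
 next
  fix ss ts assume "set ss \<subseteq> L\<times>carrier H \<and> set ts \<subseteq> L\<times>carrier H \<and>
   (\<forall>y\<in>L. list_sum K (\<lambda>(x, h). x\<otimes>\<mu> h y) ss = list_sum K (\<lambda>(x, h). x\<otimes>\<mu> h y) ts)"
  thus "tensor_eq RF LM H ss ts" using inj by simp
 next
  fix h x y assume "h\<in>carrier H" "x\<in>L" "y\<in>L"
  thus "\<mu> h (x\<otimes>y) = list_sum K (\<lambda>(a, b). \<mu> a x\<otimes>\<mu> b y) (comul H h)" using mu_comul[of h x y] by simp
 next
  fix h h' x assume h: "h\<in>carrier H" "h'\<in>carrier H" "x\<in>L"
  thus "\<mu> (h\<diamondop>h') x = \<mu> h (\<mu> h' x)" by (simp add: mu_conv)
  have "mu (adds h h') x = (\<Oplus>w\<in>C. h w\<otimes>e w x\<oplus>h' w\<otimes>e w x)"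
   unfolding mu_def using h by (intro fs_cong) (auto simp: l_distr)
  also have "... = mu h x\<oplus>mu h' x" unfolding mu_def using h by (intro fs_add) auto
  finally show "\<mu> (h\<boxplus>h') x = \<mu> h x\<oplus>\<mu> h' x" using h by simp
 next
  fix c h x assume h: "c\<in>F" "h\<in>carrier H" "x\<in>L"
  have "mu (scal c h) x = (\<Oplus>w\<in>C. c\<otimes>(h w\<otimes>e w x))"
   unfolding mu_def using h by (intro fs_cong) (auto simp: m_assoc)
  also have "... = c\<otimes>mu h x" unfolding mu_def using h by (intro fs_rdistr[symmetric]) auto
  finally show "\<mu> (c\<bullet>h) x = c\<otimes>\<mu> h x" using h by simp
 next
  fix h assume h: "h\<in>carrier H"
  thus "linear_map RF LM LM (\<mu> h)" using lm by simp
  show "\<mu> h \<one> = counit H h" using h by (simp add: mu_one)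
 next
  fix x assume "x\<in>L" thus "\<mu> \<one>\<^bsub>H\<^esub> x = x" by (simp add: mu_unit)
 qed (rule finite_extension_L cocommutative_hopf_algebra_H finite_dimensional_H)+
qed

end

context hopf_descent
begin

lemma Tr_dl_apply:
 assumes "v\<in>cK" "u\<in>C" "w\<in>C"
 shows "Tr (dl u v) w = (\<Oplus>t\<in>\<Gamma>. if act t u = w then t v else \<zero>)"
proof -
 have "act (iG t) w = u \<longleftrightarrow> act t u = w" if "t\<in>\<Gamma>" for t using assms that by auto
 thus ?thesis using assms by (simp add: Tr_def) (intro fs_cong, auto simp: dl_def)
qed

text \<open>The tensor is the trace of the diagonal one, in which the point mass at \<open>r\<close>
  is tensored with itself and weighted by \<open>c r\<close>. The factor \<open>tt\<close>
  normalises the trace, and the system \<open>xx\<close>, \<open>yy\<close> ties both tensor factors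
  to the same automorphism.\<close>

lemma comul_exists:
 assumes c: "c\<in>Inv"
 shows "\<exists>ts. set ts \<subseteq> Inv\<times>Inv \<and>
  (\<forall>u\<in>C. \<forall>q\<in>C. list_sum K (\<lambda>(a, b). a u\<otimes>b q) ts = (if u = q then c u else \<zero>))"
proof -
 obtain ps where ps: "set ps = C\<times>idx" "distinct ps" using finite_distinct_list[of "C\<times>idx"] by auto
 let ?T = "\<lambda>r i. Tr (dl r (yy i))"
 let ?v = "\<lambda>r i. Tr (dl r (tt\<otimes>c r\<otimes>xx i))"
 have T: "?T r i\<in>Inv" for r i by simp
 have v: "?v r i\<in>Inv" if "r\<in>C" for r i using tt c that by simp
 note Tc = Inv_closed[OF T] and vc = Inv_closed[OF v]
 let ?ts = "map (\<lambda>p. (?v (fst p) (snd p), ?T (fst p) (snd p))) ps"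
 have "set ?ts \<subseteq> Inv\<times>Inv" using v T ps(1) by auto
 moreover have "list_sum K (\<lambda>(a, b). a u\<otimes>b q) ?ts = (if u = q then c u else \<zero>)"
  if h: "u\<in>C" "q\<in>C" for u q
 proof -
  let ?w = "\<lambda>r t. if act t r = u then t tt\<otimes>c u else \<zero>"
  let ?k = "\<lambda>t. if u = q then t tt\<otimes>c u else \<zero>"
  have "list_sum K (\<lambda>(a, b). a u\<otimes>b q) ?ts = list_sum K (\<lambda>p. ?v (fst p) (snd p) u\<otimes>?T (fst p) (snd p) q) ps"
   by simp
  also have "... = (\<Oplus>p\<in>C\<times>idx. ?v (fst p) (snd p) u\<otimes>?T (fst p) (snd p) q)"
   unfolding ps(1)[symmetric] using ps vc Tc h by (intro ls_distinct) auto
  also have "... = (\<Oplus>r\<in>C. \<Oplus>i\<in>idx. ?v r i u\<otimes>?T r i q)" using vc Tc h by (subst finsum_cartesian) auto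
  also have "... = (\<Oplus>r\<in>C. \<Oplus>i\<in>idx. \<Oplus>t\<in>\<Gamma>. ?w r t\<otimes>(t (xx i)\<otimes>?T r i q))"
  proof (intro fs_cong)
   fix r i assume r: "r\<in>C"
   have "?v r i u = (\<Oplus>t\<in>\<Gamma>. ?w r t\<otimes>t (xx i))"
    using r h tt c by (subst Tr_dl_apply) (auto simp: aut_mult Inv_act[symmetric] intro!: fs_cong)
   thus "?v r i u\<otimes>?T r i q = (\<Oplus>t\<in>\<Gamma>. ?w r t\<otimes>(t (xx i)\<otimes>?T r i q))"
    using h tt c Tc fin by (simp add: fs_ldistr) (intro fs_cong, auto simp: m_assoc)
  qed (use h tt c Tc in auto)
  also have "... = (\<Oplus>r\<in>C. \<Oplus>t\<in>\<Gamma>. \<Oplus>i\<in>idx. ?w r t\<otimes>(t (xx i)\<otimes>?T r i q))"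
   using h tt c Tc fin by (intro fs_cong finsum_swap) auto
  also have "... = (\<Oplus>r\<in>C. \<Oplus>t\<in>\<Gamma>. if act t r = u then ?k t else \<zero>)"
   using h tt c Tc by (intro fs_cong) (auto simp: fs_rdistr[symmetric] Tr_dl_recover)
  also have "... = (\<Oplus>t\<in>\<Gamma>. \<Oplus>r\<in>C. if act t r = u then ?k t else \<zero>)"
   using h tt c fin by (intro finsum_swap) auto
  also have "... = (\<Oplus>t\<in>\<Gamma>. ?k t)"
  proof (rule fs_cong)
   fix t assume t: "t\<in>\<Gamma>"
   have "(\<Oplus>r\<in>C. if act t r = u then ?k t else \<zero>) = (\<Oplus>r\<in>C. if r = act (iG t) u then ?k t else \<zero>)"
    using h t tt c by (intro fs_cong) auto
   also have "... = ?k t" using h t tt c by (intro fs_delta(2)[where f="\<lambda>_. ?k t"]) auto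
   finally show "(\<Oplus>r\<in>C. if act t r = u then ?k t else \<zero>) = ?k t" .
  qed (use h tt c in auto)
  also have "... = (if u = q then tr tt\<otimes>c u else \<zero>)"
   using fs_ldistr[of \<Gamma> "c u" "\<lambda>t. t tt"] h tt(1) c fin by (auto simp: tr_def fs_zero)
  finally show ?thesis using tt c h by simp
 qed
 ultimately show ?thesis by blast
qed

end

section \<open>Greither--Pareigis structures\<close>

locale gp_setting = field_auts K \<Gamma>
 for K (structure) and \<Gamma> +
 fixes X :: "'x set" and x0 :: 'x and A :: "('a => 'a) => 'x => 'x" and NN :: "('x => 'x) set"
 assumes A_Bij: "g\<in>\<Gamma> ==> A g\<in>Bij X"
  and A_mult: "[|g\<in>\<Gamma>; h\<in>\<Gamma>; x\<in>X|] ==> A (g\<otimes>\<^bsub>GG\<^esub> h) x = A g (A h x)"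
  and x0: "x0\<in>X"
  and transitive: "x\<in>X ==> \<exists>g\<in>\<Gamma>. A g x0 = x"
  and gp: "gp_subgroup GG X A NN"
begin

lemma reg: "regular_subgroup X NN" using gp by (simp add: gp_subgroup_def)
lemma NN_Bij: "w\<in>NN ==> w\<in>Bij X" using regular_subgroup_Bij[OF reg] .
lemma NN_sub: "subgroup NN (BijGroup X)" using reg by (simp add: regular_subgroup_def)

lemma regular_unique: "w\<in>NN ==> v\<in>NN ==> x\<in>X ==> w x = v x ==> w = v"
proof -
 assume h: "w\<in>NN" "v\<in>NN" "x\<in>X" "w x = v x"
 have "\<exists>!t. t\<in>NN \<and> t x = v x" using reg h Bij_closed[OF NN_Bij[OF h(2)] h(3)] by (simp add: regular_subgroup_def)
 thus ?thesis using h by blast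
qed

lemma regular_ex: "x\<in>X ==> y\<in>X ==> \<exists>w\<in>NN. w x = y"
proof -
 assume "x\<in>X" "y\<in>X"
 hence "\<exists>!t. t\<in>NN \<and> t x = y" using reg by (simp add: regular_subgroup_def)
 thus ?thesis by blast
qed

lemma A_closed: "g\<in>\<Gamma> ==> x\<in>X ==> A g x\<in>X" using Bij_closed[OF A_Bij] .

text \<open>The element carrying the point of \<open>g\<close> back to the base point, hence the
  inverse of the one reaching it. This matches the inverse in \<open>gp_action\<close> and makes
  \<open>cls\<close> a crossed homomorphism; \<open>rep\<close> repeats the choice made in
  \<open>gp_action\<close>.\<close>

definition "cls g = (SOME w. w\<in>NN \<and> w (A g x0) = x0)"
definition "rep w = (SOME g. g\<in>\<Gamma> \<and> A g x0 = (inv\<^bsub>BijGroup X\<^esub> w) x0)"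

lemma cls: "g\<in>\<Gamma> ==> cls g\<in>NN \<and> cls g (A g x0) = x0"
proof -
 assume g: "g\<in>\<Gamma>"
 obtain w where "w\<in>NN" "w (A g x0) = x0" using regular_ex[OF A_closed[OF g x0] x0] ..
 thus ?thesis unfolding cls_def by (intro someI[of "\<lambda>w. w\<in>NN \<and> w (A g x0) = x0"] conjI)
qed

lemma cls_eqI: "g\<in>\<Gamma> ==> w\<in>NN ==> w (A g x0) = x0 ==> cls g = w"
 using cls regular_unique A_closed x0 by metis

lemma rep: "w\<in>NN ==> rep w\<in>\<Gamma> \<and> A (rep w) x0 = (inv\<^bsub>BijGroup X\<^esub> w) x0"
proof -
 assume w: "w\<in>NN"
 obtain g where "g\<in>\<Gamma>" "A g x0 = (inv\<^bsub>BijGroup X\<^esub> w) x0" using transitive[OF BijGroup_inv_apply(1)[OF NN_Bij[OF w] x0]] ..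
 thus ?thesis unfolding rep_def by (intro someI[of "\<lambda>g. g\<in>\<Gamma> \<and> A g x0 = (inv\<^bsub>BijGroup X\<^esub> w) x0"] conjI)
qed

lemma A_one: "x\<in>X ==> A idG x = x"
proof -
 assume x: "x\<in>X"
 have "A idG (A idG x) = A idG x" using A_mult[of "idG" "idG" x] x GG.l_one[of "idG"] by simp
 moreover have "inj_on (A idG) X" using A_Bij[of "idG"] by (simp add: Bij_def bij_betw_def)
 ultimately show ?thesis using x A_closed[of "idG" x] by (simp add: inj_on_eq_iff)
qed

lemma conj_ext:
 assumes "g\<in>\<Gamma>" "w\<in>Bij X" "v\<in>Bij X" "!!x. x\<in>X ==> w (A g x) = v (A g x)"
 shows "w = v"
proof (rule Bij_ext[OF assms(2,3)])
 fix y assume "y\<in>X"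
 moreover have "A g ` X = X" using A_Bij[OF assms(1)] by (simp add: Bij_def bij_betw_def)
 ultimately obtain x where "x\<in>X" "A g x = y" by (metis imageE)
 thus "w y = v y" using assms(4) by blast
qed

lemma finite_NN: "finite NN"
proof -
 have "X \<subseteq> (\<lambda>g. A g x0) ` \<Gamma>" using transitive by (auto simp: image_iff)
 hence "finite X" using finite_subset[OF _ finite_imageI[OF fin]] by blast
 moreover have "inj_on (\<lambda>w. w x0) NN" using regular_unique x0 by (auto intro: inj_onI)
 moreover have "(\<lambda>w. w x0) ` NN \<subseteq> X" using Bij_closed[OF NN_Bij x0] by auto
 ultimately show ?thesis using inj_on_finite by blast
qed

lemma conj_NN: "g\<in>\<Gamma> ==> w\<in>NN ==> perm_conj X (A g) w\<in>NN"
 using gp by (simp add: gp_subgroup_def)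

lemma conj_app: "g\<in>\<Gamma> ==> w\<in>NN ==> x\<in>X ==> perm_conj X (A g) w (A g x) = A g (w x)"
 using perm_conj_apply[OF A_Bij NN_Bij] .

lemma mult_app: "w\<in>NN ==> v\<in>NN ==> x\<in>X ==> (w\<otimes>\<^bsub>BijGroup X\<^esub> v) x = w (v x)"
 using BijGroup_mult_apply[OF NN_Bij NN_Bij] .

lemma mult_NN: "w\<in>NN ==> v\<in>NN ==> w\<otimes>\<^bsub>BijGroup X\<^esub> v\<in>NN" using subgroup.m_closed[OF NN_sub] .

lemma NN_closed: "w\<in>NN ==> x\<in>X ==> w x\<in>X" using Bij_closed[OF NN_Bij] .

sublocale D: hopf_descent K \<Gamma> "perm_subgroup X NN" "\<lambda>g. perm_conj X (A g)" cls rep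
proof (intro hopf_descent.intro hopf_descent_axioms.intro field_auts_axioms group_perm_subgroup[OF reg])
 fix g h w v
 show "finite (carrier (perm_subgroup X NN))" using finite_NN by simp
 show "perm_conj X (A g) w\<in>carrier (perm_subgroup X NN)" if "g\<in>\<Gamma>" "w\<in>carrier (perm_subgroup X NN)"
  using that conj_NN by simp
 show "perm_conj X (A g) (w\<otimes>\<^bsub>perm_subgroup X NN\<^esub> v) = perm_conj X (A g) w\<otimes>\<^bsub>perm_subgroup X NN\<^esub> perm_conj X (A g) v"
  if h: "g\<in>\<Gamma>" "w\<in>carrier (perm_subgroup X NN)" "v\<in>carrier (perm_subgroup X NN)"
  using h by (intro conj_ext[OF h(1)] NN_Bij) (auto simp: conj_NN mult_NN mult_app conj_app A_closed NN_closed)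
 show "perm_conj X (A (g\<star>h)) w = perm_conj X (A g) (perm_conj X (A h) w)"
  if h: "g\<in>\<Gamma>" "h\<in>\<Gamma>" "w\<in>carrier (perm_subgroup X NN)"
 proof (rule conj_ext[of "g\<star>h"])
  show "perm_conj X (A (g\<star>h)) w (A (g\<star>h) x) = perm_conj X (A g) (perm_conj X (A h) w) (A (g\<star>h) x)" if x: "x\<in>X" for x
   using h x by (simp add: conj_app) (simp add: A_mult conj_app conj_NN A_closed NN_closed)
 qed (use h in \<open>auto intro!: NN_Bij conj_NN\<close>)
 show "perm_conj X (A idG) w = w" if h: "w\<in>carrier (perm_subgroup X NN)"
  using h conj_app[of "idG" w] by (intro Bij_ext[of _ X] NN_Bij) (auto simp: conj_NN A_one NN_closed)
 show "cls g\<in>carrier (perm_subgroup X NN)" if "g\<in>\<Gamma>" using cls that by simp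
 show "cls (g\<star>h) = cls g\<otimes>\<^bsub>perm_subgroup X NN\<^esub> perm_conj X (A g) (cls h)" if "g\<in>\<Gamma>" "h\<in>\<Gamma>"
  using that cls x0 by (intro cls_eqI) (auto simp: mult_NN conj_NN mult_app A_mult A_closed conj_app)
 show "rep w\<in>\<Gamma>" if "w\<in>carrier (perm_subgroup X NN)" using rep that by simp
 show "cls (rep w) = w" if "w\<in>carrier (perm_subgroup X NN)"
  using rep that BijGroup_inv_apply(2)[OF NN_Bij x0] by (intro cls_eqI) auto
qed

lemma gp_carrier: "carrier (gp_hopf_algebra K GG X A NN) = D.Inv"
 by (simp add: gp_hopf_algebra_def D.Inv_def Let_def)

text \<open>The comultiplication of \<open>gp_hopf_algebra\<close> is a choice;
  \<open>comul_exists\<close> shows that there is something to choose, so the choice has the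
  prescribed coefficients.\<close>

lemma gp_record: "hopf_record K \<Gamma> (perm_subgroup X NN) (\<lambda>g. perm_conj X (A g)) cls rep
  (gp_hopf_algebra K GG X A NN) (gp_action K GG X A x0 NN)"
proof (intro hopf_record.intro hopf_record_axioms.intro D.hopf_descent_axioms)
 show "carrier (gp_hopf_algebra K GG X A NN) = D.Inv" by (rule gp_carrier)
 fix a assume a: "a\<in>D.Inv"
 let ?P = "\<lambda>ts. set ts \<subseteq> D.Inv\<times>D.Inv \<and> (\<forall>w\<in>NN. \<forall>v\<in>NN. list_sum K (\<lambda>(x, y). x w\<otimes>y v) ts
       = (if w = v then a w else \<zero>))"
 have "comul (gp_hopf_algebra K GG X A NN) a = (SOME ts. ?P ts)"
  by (simp add: gp_hopf_algebra_def D.Inv_def Let_def)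
 moreover have "\<exists>ts. ?P ts" using D.comul_exists[OF a] by simp
 hence "?P (SOME ts. ?P ts)" by (rule someI_ex)
 ultimately have P: "?P (comul (gp_hopf_algebra K GG X A NN) a)" by simp
 thus "set (comul (gp_hopf_algebra K GG X A NN) a) \<subseteq> D.Inv\<times>D.Inv" by simp
 show "list_sum K (\<lambda>(x, y). x w\<otimes>y v) (comul (gp_hopf_algebra K GG X A NN) a) = (if w = v then a w else \<zero>)"
  if "w\<in>carrier (perm_subgroup X NN)" "v\<in>carrier (perm_subgroup X NN)" for w v using P that by simp
qed (simp_all add: gp_hopf_algebra_def group_hopf_algebra_def group_element_def Let_def D.conv_def D.adds_def D.scal_def
  D.unit_def D.antip_def gp_action_def D.mu_def rep_def)

lemma stabiliser: "D.\<Gamma>' = {g\<in>\<Gamma>. A g x0 = x0}"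
proof -
 have "cls g = \<one>\<^bsub>perm_subgroup X NN\<^esub> \<longleftrightarrow> A g x0 = x0" if g: "g\<in>\<Gamma>" for g
 proof -
  have one: "\<one>\<^bsub>BijGroup X\<^esub>\<in>NN" "\<one>\<^bsub>BijGroup X\<^esub> y = y" if "y\<in>X" for y
   using subgroup.one_closed[OF NN_sub] that by (auto simp: BijGroup_def)
  show ?thesis
  proof
   assume "cls g = \<one>\<^bsub>perm_subgroup X NN\<^esub>"
   thus "A g x0 = x0" using cls[OF g] one(2)[OF A_closed[OF g x0]] by simp
  next
   assume "A g x0 = x0"
   thus "cls g = \<one>\<^bsub>perm_subgroup X NN\<^esub>" using one[OF x0] g by (intro cls_eqI) auto
  qed
 qed
 thus ?thesis by (auto simp: D.\<Gamma>'_def)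
qed

theorem gp_hopf_galois:
 "hopf_galois_structure K (fixed_field K \<Gamma>) (fixed_field K {g\<in>\<Gamma>. A g x0 = x0})
  (gp_hopf_algebra K GG X A NN, gp_action K GG X A x0 NN)"
 using hopf_record.hopf_galois_H[OF gp_record] unfolding D.L_def stabiliser .

end

section \<open>Galois groups acting by translations\<close>

lemma galois_group_eq: "(BijGroup (carrier K))\<lparr>carrier := carrier (galois_group K k)\<rparr> = galois_group K k"
 by (simp add: galois_group_def)

lemma galois_field_auts:
 fixes K (structure)
 assumes K: "field K" and k: "k \<subseteq> carrier K" and fin: "finite (carrier (galois_group K k))"
 shows "field_auts K (carrier (galois_group K k))"
proof -
 interpret field K by (rule K)
 let ?B = "BijGroup (carrier K)"
 interpret B: group ?B by (rule group_BijGroup)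
 have "subgroup (carrier (galois_group K k)) ?B"
 proof (rule B.subgroupI)
  show "carrier (galois_group K k) \<subseteq> carrier ?B" by (auto simp: galois_group_def carrier_BijGroup)
  have "\<one>\<^bsub>?B\<^esub>\<in>Bij (carrier K)" using B.one_closed by (simp add: carrier_BijGroup)
  hence "\<one>\<^bsub>?B\<^esub>\<in>carrier (galois_group K k)"
   using k by (auto simp: galois_group_def BijGroup_def intro!: ring_hom_memI)
  thus "carrier (galois_group K k) ~= {}" by blast
 next
  fix u assume "u\<in>carrier (galois_group K k)"
  hence s: "u\<in>Bij (carrier K)" "u\<in>ring_hom K K" "!!x. x\<in>k ==> u x = x" by (auto simp: galois_group_def)
  let ?i = "inv\<^bsub>?B\<^esub> u"
  note i = BijGroup_inv_apply[OF s(1)]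
  have iB: "?i\<in>Bij (carrier K)" using B.inv_closed[of u] s(1) by (simp add: carrier_BijGroup)
  have "?i\<in>ring_hom K K"
  proof (rule ring_hom_memI)
   show "?i (x\<otimes>y) = ?i x\<otimes>?i y" if "x\<in>carrier K" "y\<in>carrier K" for x y
    using that i ring_hom_mult[OF s(2), of "?i x" "?i y"] by (metis m_closed)
   show "?i (x\<oplus>y) = ?i x\<oplus>?i y" if "x\<in>carrier K" "y\<in>carrier K" for x y
    using that i ring_hom_add[OF s(2), of "?i x" "?i y"] by (metis a_closed)
   show "?i \<one> = \<one>" using i(3)[OF one_closed] ring_hom_one[OF s(2)] by simp
  qed (use i in auto)
  moreover have "?i x = x" if "x\<in>k" for x using i(3)[of x] that k s(3)[OF that] by auto
  ultimately show "?i\<in>carrier (galois_group K k)" using iB by (simp add: galois_group_def)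
 next
  fix u v assume "u\<in>carrier (galois_group K k)" "v\<in>carrier (galois_group K k)"
  hence s: "u\<in>Bij (carrier K)" "u\<in>ring_hom K K" "!!x. x\<in>k ==> u x = x"
   and t: "v\<in>Bij (carrier K)" "v\<in>ring_hom K K" "!!x. x\<in>k ==> v x = x" by (auto simp: galois_group_def)
  let ?m = "u\<otimes>\<^bsub>?B\<^esub> v"
  have mB: "?m\<in>Bij (carrier K)" using B.m_closed[of u v] s(1) t(1) by (simp add: carrier_BijGroup)
  note m = BijGroup_mult_apply[OF s(1) t(1)]
  have "?m\<in>ring_hom K K"
   using m ring_hom_closed[OF s(2)] ring_hom_closed[OF t(2)] ring_hom_mult[OF s(2)] ring_hom_mult[OF t(2)]
    ring_hom_add[OF s(2)] ring_hom_add[OF t(2)] ring_hom_one[OF s(2)] ring_hom_one[OF t(2)]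
   by (intro ring_hom_memI) auto
  moreover have "?m x = x" if "x\<in>k" for x using m[of x] that k s(3)[OF that] t(3)[OF that] by auto
  ultimately show "?m\<in>carrier (galois_group K k)" using mB by (simp add: galois_group_def)
 qed
 moreover have "u\<in>ring_hom K K" if "u\<in>carrier (galois_group K k)" for u
  using that by (simp add: galois_group_def)
 ultimately show ?thesis using fin by (intro field_auts.intro field_auts_axioms.intro field_axioms) auto
qed

context group
begin

lemma lcosets_closed: "subgroup G' G ==> g\<in>cG ==> C\<in>lcosets G' ==> g <# C\<in>lcosets G'"
 by (auto simp: LCOSETS_def lcos_m_assoc subgroup.subset intro!: bexI[of _ "g\<otimes>_"])

lemma lcos_mult: "subgroup G' G ==> g\<in>cG ==> h\<in>cG ==> C\<in>lcosets G' ==>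
  g <# (h <# C) = (g\<otimes>h) <# C"
 using subgroup.lcosets_carrier[OF _ is_group, of G' C] by (intro lcos_m_assoc) auto

lemma coset_translation_Bij:
 assumes "subgroup G' G" "g\<in>cG"
 shows "coset_translation G G' g\<in>Bij (lcosets G')"
proof -
 have one: "\<one> <# C = C" if "C\<in>lcosets G'" for C
  using subgroup.lcosets_carrier[OF assms(1) is_group that] by (rule lcos_mult_one)
 have "bij_betw (\<lambda>C. g <# C) (lcosets G') (lcosets G')"
  using assms lcosets_closed[OF assms(1)] lcos_mult[OF assms(1)] one
  by (intro bij_betwI[where g="\<lambda>C. inv g <# C"]) auto
 thus ?thesis by (simp add: coset_translation_def Bij_def)
qed

lemma mult_Bij: "f\<in>Bij X ==> g\<in>Bij X ==> f\<otimes>\<^bsub>BijGroup X\<^esub> g\<in>Bij X"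
 using monoid.m_closed[OF group.is_monoid[OF group_BijGroup], of f X g] by (simp add: carrier_BijGroup)

end

text \<open>Finiteness of the Galois group is an assumption here; in the theorem it follows from the
  isomorphism with a finite group.\<close>

locale galois_setting =
 fixes K (structure) and k :: "'a set"
 assumes gal: "galois_extension K k" and finG: "finite (carrier (galois_group K k))"
begin

abbreviation "G \<equiv> galois_group K k"

lemma K_field: "field K" and k_sub: "k \<subseteq> carrier K" and fixG: "fixed_field K (carrier G) = k"
 using gal subfieldE(3)[of k K] by (auto simp: galois_extension_def finite_field_extension_def)

sublocale field_auts K "carrier G" by (rule galois_field_auts[OF K_field k_sub finG])

abbreviation "cG \<equiv> carrier G"

lemma GG_G [simp]: "GG = G" by (simp add: GG_def galois_group_eq)

lemma group_G: "group G" using GG.is_group by simp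

sublocale G: group G by (rule group_G)

lemma gp_setting_regular:
 assumes N: "gp_subgroup G cG (left_translation G) N"
 shows "gp_setting K cG cG \<one>\<^bsub>G\<^esub> (left_translation G) N"
proof (intro gp_setting.intro gp_setting_axioms.intro field_auts_axioms)
 show "left_translation G g\<in>Bij cG" if "g\<in>cG" for g using left_translation_Bij[OF group_G that] .
 show "\<exists>g\<in>cG. left_translation G g \<one>\<^bsub>G\<^esub> = x" if "x\<in>cG" for x
  using that by (intro bexI[of _ x]) (simp_all add: left_translation_def)
qed (use N in \<open>simp_all add: left_translation_def G.m_assoc\<close>)

lemma fixed_trivial: "fixed_field K {g\<in>cG. g = \<one>\<^bsub>G\<^esub>} = cK"
 using aut_id by (auto simp: fixed_field_def)

lemma gp_structure_hopf_galois:
 assumes N: "gp_subgroup G cG (left_translation G) N"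
 shows "hopf_galois_structure K k cK (gp_structure K k N)"
proof -
 have "{g\<in>cG. left_translation G g \<one>\<^bsub>G\<^esub> = \<one>\<^bsub>G\<^esub>} = {g\<in>cG. g = \<one>\<^bsub>G\<^esub>}"
  by (auto simp: left_translation_def)
 thus ?thesis
  using gp_setting.gp_hopf_galois[OF gp_setting_regular[OF N]] fixG fixed_trivial
  by (simp add: gp_structure_def Let_def)
qed

lemma coset_self: "subgroup G' G ==> G'\<in>lcosets\<^bsub>G\<^esub> G'"
 using G.lcos_mult_one[of G'] by (auto simp: LCOSETS_def subgroup.subset intro!: bexI[of _ "\<one>\<^bsub>G\<^esub>"])

lemma coset_translation_base:
 assumes "subgroup G' G" "g\<in>cG"
 shows "coset_translation G G' g G' = G' \<longleftrightarrow> g\<in>G'"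
proof
 assume "coset_translation G G' g G' = G'"
 thus "g\<in>G'" using coset_self[OF assms(1)] G.lcos_self[OF assms(2,1)] assms by (simp add: coset_translation_def)
next
 assume "g\<in>G'"
 hence "g <#\<^bsub>G\<^esub> G' = \<one>\<^bsub>G\<^esub> <#\<^bsub>G\<^esub> G'"
  using assms G.l_repr_independence[of g "\<one>\<^bsub>G\<^esub>" G'] G.lcos_mult_one[of G'] by (simp add: subgroup.subset)
 thus "coset_translation G G' g G' = G'"
  using G.lcos_mult_one[of G'] coset_self[OF assms(1)] assms(1) by (simp add: coset_translation_def subgroup.subset)
qed

lemma gp_setting_coset:
 assumes G': "subgroup G' G" and N: "gp_subgroup G (lcosets\<^bsub>G\<^esub> G') (coset_translation G G') N"
 shows "gp_setting K cG (lcosets\<^bsub>G\<^esub> G') G' (coset_translation G G') N"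
proof (intro gp_setting.intro gp_setting_axioms.intro field_auts_axioms)
 show "coset_translation G G' g\<in>Bij (lcosets\<^bsub>G\<^esub> G')" if "g\<in>cG" for g using G.coset_translation_Bij[OF G' that] .
 show "coset_translation G G' (g\<otimes>\<^bsub>GG\<^esub> h) C = coset_translation G G' g (coset_translation G G' h C)"
  if "g\<in>cG" "h\<in>cG" "C\<in>lcosets\<^bsub>G\<^esub> G'" for g h C
  using that G.lcosets_closed[OF G'] G.lcos_mult[OF G'] by (simp add: coset_translation_def)
 show "\<exists>g\<in>cG. coset_translation G G' g G' = C" if "C\<in>lcosets\<^bsub>G\<^esub> G'" for C
  using that coset_self[OF G'] by (auto simp: LCOSETS_def coset_translation_def)
qed (use N coset_self[OF G'] in simp_all)

lemma gp_coset_structure_hopf_galois: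
 assumes G': "subgroup G' G" and N: "gp_subgroup G (lcosets\<^bsub>G\<^esub> G') (coset_translation G G') N"
 shows "hopf_galois_structure K k (fixed_field K G') (gp_coset_structure K k G' N)"
proof -
 have "{g\<in>cG. coset_translation G G' g G' = G'} = G'"
  using coset_translation_base[OF G'] subgroup.subset[OF G'] by auto
 thus ?thesis
  using gp_setting.gp_hopf_galois[OF gp_setting_coset[OF G' N]] fixG
  by (simp add: gp_coset_structure_def Let_def)
qed

text \<open>Named identity maps: with the bare abstractions the simplification rules of the interpreted locale
 would loop.\<close>

definition triv_act :: "('a => 'a) => ('a => 'a) => 'a => 'a" where "triv_act g w = w"
definition triv_cl :: "('a => 'a) => 'a => 'a" where "triv_cl g = g"

sublocale C: hopf_descent K "cG" G triv_act triv_cl triv_cl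
 by (intro hopf_descent.intro hopf_descent_axioms.intro field_auts_axioms group_G)
  (simp_all add: finG triv_act_def triv_cl_def)

lemma finsum_subfield: "finite A ==> (!!x. x\<in>A ==> f x\<in>k) ==> finsum (K\<lparr>carrier := k\<rparr>) f A = finsum K f A"
proof (induction A rule: finite_induct)
 case (insert x A)
 interpret R: field "K\<lparr>carrier := k\<rparr>" using subfield_fixed subfield_iff(2) fixG by simp
 have "f y\<in>cK" if "y\<in>insert x A" for y using insert.prems[OF that] k_sub by blast
 moreover have "f y\<in>carrier (K\<lparr>carrier := k\<rparr>)" if "y\<in>insert x A" for y using insert.prems[OF that] by simp
 ultimately show ?case using insert by (simp add: Pi_def)
next
 case empty
 interpret R: field "K\<lparr>carrier := k\<rparr>" using subfield_fixed subfield_iff(2) fixG by simp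
 show ?case by simp
qed

text \<open>For the trivial action, equivariance says that all values are fixed by the Galois
  group.\<close>

lemma Inv_classical: "C.Inv = cG \<rightarrow>\<^sub>E k"
proof (intro subset_antisym subsetI)
 fix c assume c: "c\<in>C.Inv"
 have "c w\<in>k" if w: "w\<in>cG" for w
 proof -
  have "c w\<in>fixed_field K cG"
  proof (rule fixedI)
   show "c w\<in>cK" using C.Inv_closed[OF c w] .
   show "g (c w) = c w" if "g\<in>cG" for g using C.Inv_act[OF c that w] by (simp add: triv_act_def)
  qed
  thus ?thesis unfolding fixG .
 qed
 moreover have cE: "c\<in>cG \<rightarrow>\<^sub>E cK" using conjunct1[OF CollectD[OF c[unfolded C.Inv_def]]] .
 ultimately show "c\<in>cG \<rightarrow>\<^sub>E k" using PiE_arb[OF cE] by (intro PiE_I)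
next
 fix c assume c: "c\<in>cG \<rightarrow>\<^sub>E k"
 have ck: "c w\<in>k" if "w\<in>cG" for w using c that by (rule PiE_mem)
 have "restrict c cG\<in>C.Inv"
 proof (rule C.InvI)
  show "c w\<in>cK" if "w\<in>cG" for w using subsetD[OF k_sub ck[OF that]] .
  show "c (triv_act g w) = g (c w)" if g: "g\<in>cG" and w: "w\<in>cG" for g w
   using fixedD[of "c w" g] ck[OF w] g unfolding fixG by (simp add: triv_act_def)
 qed
 thus "c\<in>C.Inv" using c by (simp add: PiE_restrict)
qed

lemma classical_record:
 "hopf_record K cG G triv_act triv_cl triv_cl
  (fst (classical_structure K k)) (snd (classical_structure K k))"
proof (intro hopf_record.intro hopf_record_axioms.intro C.hopf_descent_axioms)
 let ?H = "fst (classical_structure K k)"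
 let ?R = "K\<lparr>carrier := k\<rparr>"
 note defs = classical_structure_def group_hopf_algebra_def
 have Ik: "a w\<in>k" if "a\<in>C.Inv" "w\<in>cG" for a w using that by (auto simp: Inv_classical)
 have kops: "x\<otimes>y\<in>k" if "x\<in>k" "y\<in>k" for x y
  using subringE(6)[OF subfieldE(1)[OF subfield_fixed]] that fixG by simp
 have k1: "\<one>\<in>k" "\<zero>\<in>k" using subringE(2,3)[OF subfieldE(1)[OF subfield_fixed]] fixG by auto
 show "carrier ?H = C.Inv" by (simp add: defs Inv_classical)
 have gs: "set (SOME gs. set gs = cG \<and> distinct gs) = cG \<and> distinct (SOME gs. set gs = cG \<and> distinct gs)"
  using finite_distinct_list[OF finG] by (rule someI_ex)
 fix a assume a: "a\<in>C.Inv"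
 have el: "group_element ?R G g\<in>C.Inv" for g using k1 by (auto simp: group_element_def Inv_classical)
 have sc: "(\<lambda>x\<in>cG. a g\<otimes>group_element ?R G g x)\<in>C.Inv" if "g\<in>cG" for g
  using Ik[OF a that] el[of g] kops by (auto simp: Inv_classical)
 have cm: "comul ?H a = map (\<lambda>g. (\<lambda>x\<in>cG. a g\<otimes>group_element ?R G g x, group_element ?R G g))
   (SOME gs. set gs = cG \<and> distinct gs)" by (simp add: defs)
 show "set (comul ?H a) \<subseteq> C.Inv\<times>C.Inv" unfolding cm using gs el sc by auto
 fix w v assume h: "w\<in>cG" "v\<in>cG"
 have ac: "a g\<in>cK" if "g\<in>cG" for g using a that by simp
 have "list_sum K (\<lambda>(x, y). x w\<otimes>y v) (comul ?H a) =
   list_sum K (\<lambda>g. if g = w then (if w = v then a w else \<zero>) else \<zero>) (SOME gs. set gs = cG \<and> distinct gs)"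
  unfolding cm ls_map using gs h ac by (intro ls_cong) (auto simp: group_element_def)
 also have "... = (\<Oplus>g\<in>cG. if g = w then (if w = v then a w else \<zero>) else \<zero>)"
  using gs h ac ls_distinct[of "SOME gs. set gs = cG \<and> distinct gs" "\<lambda>g. if g = w then (if w = v then a w else \<zero>) else \<zero>"] by simp
 also have "... = (if w = v then a w else \<zero>)"
  using h ac by (intro fs_delta(2)[where f="\<lambda>_. if w = v then a w else \<zero>"] finG) auto
 finally show "list_sum K (\<lambda>(x, y). x w\<otimes>y v) (comul ?H a) = (if w = v then a w else \<zero>)" .
next
 let ?H = "fst (classical_structure K k)"
 note defs = classical_structure_def group_hopf_algebra_def
 have Ik: "a w\<in>k" if "a\<in>C.Inv" "w\<in>cG" for a w using that by (auto simp: Inv_classical)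
 have kops: "x\<otimes>y\<in>k" if "x\<in>k" "y\<in>k" for x y
  using subringE(6)[OF subfieldE(1)[OF subfield_fixed]] that fixG by simp
 show "\<one>\<^bsub>?H\<^esub> = C.unit" by (auto simp: defs group_element_def C.unit_def intro!: restrict_ext)
 fix a assume a: "a\<in>C.Inv"
 show "counit ?H a = (\<Oplus>w\<in>cG. a w)" using Ik[OF a] by (simp add: defs finsum_subfield[OF finG])
 fix b assume b: "b\<in>C.Inv"
 show "a\<otimes>\<^bsub>?H\<^esub> b = C.conv a b"
  using Ik[OF a] Ik[OF b] kops by (simp add: defs C.conv_def finsum_subfield[OF finG] cong: restrict_cong)
qed (simp_all add: classical_structure_def group_hopf_algebra_def group_element_def C.adds_def C.scal_def
  C.unit_def C.antip_def C.mu_def triv_cl_def)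

lemma classical_hopf_galois: "hopf_galois_structure K k cK (classical_structure K k)"
proof -
 have "C.L = cK" unfolding C.L_def C.\<Gamma>'_def triv_cl_def using fixed_trivial by simp
 thus ?thesis using hopf_record.hopf_galois_H[OF classical_record] fixG by simp
qed

end

section \<open>Isomorphisms of Hopf Galois structures\<close>

lemma list_sum_map: "list_sum A f (map g xs) = list_sum A (\<lambda>x. f (g x)) xs"
 by (simp add: list_sum_def foldr_map comp_def)

lemma hopf_galois_isomorphic_refl: "hopf_galois_isomorphic K k L (H, \<mu>) (H, \<mu>)"
 unfolding hopf_galois_isomorphic_def Let_def prod.case
 by (rule exI[of _ "\<lambda>h. h"]) (simp add: bij_betw_def linear_map_def ring_hom_def tensor_eq_def map_prod_def list_sum_map split_beta)

lemma linear_map_comp: "linear_map R M N f ==> linear_map R N P g ==> linear_map R M P (\<lambda>x. g (f x))"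
 unfolding linear_map_def by (auto simp: Pi_iff)

lemma bilinear_form_comp:
 assumes B: "bilinear_form R N N B" and f: "linear_map R M N f"
 shows "bilinear_form R M M (\<lambda>x y. B (f x) (f y))"
proof -
 have c: "f x\<in>carrier N" if "x\<in>carrier M" for x using f that by (auto simp: linear_map_def)
 have "linear_map R M (ring_as_module R) (\<lambda>y. B (f x) (f y))" if "x\<in>carrier M" for x
  using B c[OF that] by (intro linear_map_comp[OF f]) (simp add: bilinear_form_def)
 moreover have "linear_map R M (ring_as_module R) (\<lambda>x. B (f x) (f y))" if "y\<in>carrier M" for y
  using B c[OF that] by (intro linear_map_comp[OF f, where g="\<lambda>x. B x (f y)"]) (simp add: bilinear_form_def)
 ultimately show ?thesis by (simp add: bilinear_form_def)
qed

lemma hopf_galois_isomorphic_trans: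
 assumes "hopf_galois_isomorphic K k L (H1, \<mu>1) (H2, \<mu>2)" "hopf_galois_isomorphic K k L (H2, \<mu>2) (H3, \<mu>3)"
 shows "hopf_galois_isomorphic K k L (H1, \<mu>1) (H3, \<mu>3)"
proof -
 let ?R = "K\<lparr>carrier := k\<rparr>"
 obtain f where f: "bij_betw f (carrier H1) (carrier H2)" "linear_map ?R H1 H2 f" "f\<in>ring_hom H1 H2"
   "!!h. h\<in>carrier H1 ==> tensor_eq ?R H2 H2 (map (map_prod f f) (comul H1 h)) (comul H2 (f h))"
   "!!h. h\<in>carrier H1 ==> counit H2 (f h) = counit H1 h"
   "!!h x. h\<in>carrier H1 ==> x\<in>L ==> \<mu>2 (f h) x = \<mu>1 h x"
  using assms(1) unfolding hopf_galois_isomorphic_def Let_def prod.case by blast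
 obtain g where g: "bij_betw g (carrier H2) (carrier H3)" "linear_map ?R H2 H3 g" "g\<in>ring_hom H2 H3"
   "!!h. h\<in>carrier H2 ==> tensor_eq ?R H3 H3 (map (map_prod g g) (comul H2 h)) (comul H3 (g h))"
   "!!h. h\<in>carrier H2 ==> counit H3 (g h) = counit H2 h"
   "!!h x. h\<in>carrier H2 ==> x\<in>L ==> \<mu>3 (g h) x = \<mu>2 h x"
  using assms(2) unfolding hopf_galois_isomorphic_def Let_def prod.case by blast
 have fc: "f h\<in>carrier H2" if "h\<in>carrier H1" for h using f(1) that by (auto simp: bij_betw_def)
 have "tensor_eq ?R H3 H3 (map (map_prod (g \<circ> f) (g \<circ> f)) (comul H1 h)) (comul H3 ((g \<circ> f) h))"
  if h: "h\<in>carrier H1" for h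
  unfolding tensor_eq_def
 proof (intro allI impI)
  fix B assume B: "bilinear_form ?R H3 H3 B"
  have "list_sum ?R (\<lambda>(x, y). B x y) (map (map_prod (g \<circ> f) (g \<circ> f)) (comul H1 h)) =
    list_sum ?R (\<lambda>(x, y). B (g x) (g y)) (map (map_prod f f) (comul H1 h))"
   by (simp add: list_sum_map case_prod_unfold)
  also have "... = list_sum ?R (\<lambda>(x, y). B (g x) (g y)) (comul H2 (f h))"
   using f(4)[OF h] bilinear_form_comp[OF B g(2)] unfolding tensor_eq_def by blast
  also have "... = list_sum ?R (\<lambda>(x, y). B x y) (map (map_prod g g) (comul H2 (f h)))"
   by (simp add: list_sum_map case_prod_unfold)
  also have "... = list_sum ?R (\<lambda>(x, y). B x y) (comul H3 ((g \<circ> f) h))"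
   using g(4)[OF fc[OF h]] B unfolding tensor_eq_def by simp
  finally show "list_sum ?R (\<lambda>(x, y). B x y) (map (map_prod (g \<circ> f) (g \<circ> f)) (comul H1 h)) =
   list_sum ?R (\<lambda>(x, y). B x y) (comul H3 ((g \<circ> f) h))" .
 qed
 moreover have "linear_map ?R H1 H3 (g \<circ> f)" using linear_map_comp[OF f(2) g(2)] by (simp add: comp_def)
 moreover have "g \<circ> f\<in>ring_hom H1 H3" by (rule ring_hom_trans[OF f(3) g(3)])
 ultimately show ?thesis
  unfolding hopf_galois_isomorphic_def Let_def prod.case
  using bij_betw_trans[OF f(1) g(1)] f(5,6) g(5,6) fc by (intro exI[of _ "g \<circ> f"]) auto
qed

text \<open>An equivariant isomorphism of the groups that respects the chosen automorphisms
  transports functions by composition. For the comultiplications it suffices to compare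
  coefficients, although the two lists may differ.\<close>

lemma hopf_record_isomorphic:
 assumes "hopf_record K \<Gamma> N act cl e H \<mu>" "hopf_record K \<Gamma> M act' cl' e' H' \<mu>'"
  and t: "t\<in>iso M N"
  and eqv: "!!g w. g\<in>\<Gamma> ==> w\<in>carrier M ==> t (act' g w) = act g (t w)"
  and rep: "!!w x. w\<in>carrier M ==> x\<in>carrier K ==> e' w x = e (t w) x"
  and L: "hopf_descent.L K \<Gamma> N cl = L" "hopf_descent.L K \<Gamma> M cl' = L"
 shows "hopf_galois_isomorphic K (fixed_field K \<Gamma>) L (H, \<mu>) (H', \<mu>')"
proof -
 interpret A: hopf_record K \<Gamma> N act cl e H \<mu> by fact
 interpret B: hopf_record K \<Gamma> M act' cl' e' H' \<mu>' by fact
 define f where "f a = (\<lambda>w\<in>carrier M. a (t w))" for a :: "'c => 'a"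
 have tc [simp]: "t w\<in>carrier N" if "w\<in>carrier M" for w using t that by (auto simp: iso_def hom_def)
 have tb: "bij_betw t (carrier M) (carrier N)" using t by (simp add: iso_def)
 have tm: "t (w\<otimes>\<^bsub>M\<^esub> v) = t w\<otimes>\<^bsub>N\<^esub> t v" if "w\<in>carrier M" "v\<in>carrier M" for w v
  using t that by (auto simp: iso_def hom_def)
 interpret t: group_hom M N t using t by unfold_locales (simp add: iso_def)
 have fI [simp]: "f a\<in>B.Inv" if "a\<in>A.Inv" for a
  unfolding f_def using that by (intro B.InvI) (auto simp: eqv A.Inv_act)
 have fa [simp]: "f a w = a (t w)" if "w\<in>carrier M" for a w using that by (simp add: f_def)
 have injt: "t w = t v \<longleftrightarrow> w = v" if "w\<in>carrier M" "v\<in>carrier M" for w v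
  using tb that by (auto simp: bij_betw_def inj_on_def)
 let ?i = "inv_into (carrier M) t"
 have i1: "?i (t w) = w" if "w\<in>carrier M" for w using tb that by (simp add: bij_betw_def)
 have i2: "?i v\<in>carrier M" "t (?i v) = v" if "v\<in>carrier N" for v
  using tb that by (auto simp: bij_betw_def inv_into_into f_inv_into_f)
 have bij: "bij_betw f A.Inv B.Inv"
 proof (rule bij_betwI[where g="\<lambda>b. \<lambda>v\<in>carrier N. b (?i v)"])
  have iact: "?i (act g v) = act' g (?i v)" if "g\<in>\<Gamma>" "v\<in>carrier N" for g v
   using i1[of "act' g (?i v)"] that i2 eqv by simp
  have gI: "(\<lambda>v\<in>carrier N. b (?i v))\<in>A.Inv" if "b\<in>B.Inv" for b
   using that i2 by (intro A.InvI) (auto simp: iact B.Inv_act)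
  thus "(\<lambda>b. \<lambda>v\<in>carrier N. b (?i v))\<in>B.Inv \<rightarrow> A.Inv" by blast
  show "(\<lambda>v\<in>carrier N. f a (?i v)) = a" if "a\<in>A.Inv" for a
   using that gI[OF fI[OF that]] i2 by (intro A.Inv_ext) auto
  show "f (\<lambda>v\<in>carrier N. b (?i v)) = b" if "b\<in>B.Inv" for b
   using that gI[OF that] i1 by (intro B.Inv_ext) auto
 qed auto
 have add: "f (A.adds a b) = B.adds (f a) (f b)" if "a\<in>A.Inv" "b\<in>A.Inv" for a b
  using that by (intro B.Inv_ext) auto
 have scal: "f (A.scal s a) = B.scal s (f a)" if "s\<in>fixed_field K \<Gamma>" "a\<in>A.Inv" for s a
  using that by (intro B.Inv_ext) auto
 have lin: "linear_map (K\<lparr>carrier := fixed_field K \<Gamma>\<rparr>) H H' f"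
  unfolding linear_map_def using add scal by auto
 have conv: "f (A.conv a b) = B.conv (f a) (f b)" if ab: "a\<in>A.Inv" "b\<in>A.Inv" for a b
 proof (rule B.Inv_ext)
  fix w assume w: "w\<in>carrier M"
  have "f (A.conv a b) w = finsum K (\<lambda>v. a v\<otimes>\<^bsub>K\<^esub> b (inv\<^bsub>N\<^esub> v\<otimes>\<^bsub>N\<^esub> t w)) (carrier N)"
   using w by (simp add: A.conv_apply)
  also have "... = finsum K (\<lambda>v. a (t v)\<otimes>\<^bsub>K\<^esub> b (inv\<^bsub>N\<^esub> (t v)\<otimes>\<^bsub>N\<^esub> t w)) (carrier M)"
   using ab w by (intro A.finsum_bij[OF tb]) auto
  also have "... = B.conv (f a) (f b) w"
   unfolding B.conv_apply[OF w] using ab w by (intro A.fs_cong) (auto simp: tm)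
  finally show "f (A.conv a b) w = B.conv (f a) (f b) w" .
 qed (use ab in auto)
 have one: "f A.unit = B.unit"
 proof (rule B.Inv_ext)
  show "f A.unit w = B.unit w" if "w\<in>carrier M" for w
   using that injt[of w "\<one>\<^bsub>M\<^esub>"] by simp
 qed auto
 have hom: "f\<in>ring_hom H H'"
  by (rule ring_hom_memI) (auto simp: add conv one)
 have cnt: "counit H' (f h) = counit H h" if h: "h\<in>A.Inv" for h
 proof -
  have "finsum K h (carrier N) = finsum K (\<lambda>w. h (t w)) (carrier M)" using h by (intro A.finsum_bij[OF tb]) auto
  also have "... = finsum K (f h) (carrier M)" using h by (intro A.fs_cong) auto
  finally show ?thesis using h by simp
 qed
 have mu: "\<mu>' (f h) x = \<mu> h x" if h: "h\<in>A.Inv" and x: "x\<in>L" for h x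
 proof -
  have xA: "x\<in>A.L" "x\<in>B.L" using x L by simp_all
  hence xK: "x\<in>carrier K" by simp
  have "A.mu h x = finsum K (\<lambda>w. h (t w)\<otimes>\<^bsub>K\<^esub> e (t w) x) (carrier M)"
   unfolding A.mu_def using h xK by (intro A.finsum_bij[OF tb]) auto
  also have "... = B.mu (f h) x" unfolding B.mu_def using h xK rep by (intro A.fs_cong) auto
  finally show ?thesis using h xA by simp
 qed
 have com: "tensor_eq (K\<lparr>carrier := fixed_field K \<Gamma>\<rparr>) H' H' (map (map_prod f f) (comul H h)) (comul H' (f h))"
  if h: "h\<in>A.Inv" for h
 proof (rule B.tensor_eqI)
  show "set (map (map_prod f f) (comul H h)) \<subseteq> B.Inv\<times>B.Inv" using A.comul_mem[OF h] by auto
  show "set (comul H' (f h)) \<subseteq> B.Inv\<times>B.Inv" using h by (intro B.comul_set) simp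
  fix w v assume e: "w\<in>carrier M" "v\<in>carrier M"
  have "B.coef2 (map (map_prod f f) (comul H h)) w v = A.coef2 (comul H h) (t w) (t v)"
   using e by (simp add: B.coef2_def A.coef2_def)
  also have "... = B.coef2 (comul H' (f h)) w v"
   using e h by (simp add: A.coef2_comul B.coef2_comul injt)
  finally show "B.coef2 (map (map_prod f f) (comul H h)) w v = B.coef2 (comul H' (f h)) w v" .
 qed
 show ?thesis
  unfolding hopf_galois_isomorphic_def Let_def prod.case
  using bij lin hom com cnt mu by (intro exI[of _ f]) simp
qed

section \<open>Right translations and the classical structure\<close>

context galois_setting
begin

definition rho :: "('a => 'a) => ('a => 'a) => ('a => 'a)" where
 "rho g = (\<lambda>x\<in>cG. x\<otimes>\<^bsub>G\<^esub> inv\<^bsub>G\<^esub> g)"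

lemma rho_Bij: "g\<in>cG ==> rho g\<in>Bij cG"
proof -
 assume g: "g\<in>cG"
 have "bij_betw (\<lambda>x. x\<otimes>\<^bsub>G\<^esub> inv\<^bsub>G\<^esub> g) cG cG"
  using g by (intro bij_betwI[where g="\<lambda>x. x\<otimes>\<^bsub>G\<^esub> g"]) (auto simp: G.m_assoc)
 thus ?thesis by (simp add: rho_def Bij_def)
qed

lemma rho_mult: "g\<in>cG ==> h\<in>cG ==> rho (g\<otimes>\<^bsub>G\<^esub> h) = rho g\<otimes>\<^bsub>BijGroup cG\<^esub> rho h"
proof -
 assume h: "g\<in>cG" "h\<in>cG"
 have m: "rho g\<otimes>\<^bsub>BijGroup cG\<^esub> rho h\<in>Bij cG"
  using monoid.m_closed[OF group.is_monoid[OF group_BijGroup], of "rho g" "cG" "rho h"] rho_Bij h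
  by (simp add: carrier_BijGroup)
 show ?thesis
 proof (rule Bij_ext[OF rho_Bij m])
  show "rho (g\<otimes>\<^bsub>G\<^esub> h) x = (rho g\<otimes>\<^bsub>BijGroup cG\<^esub> rho h) x" if x: "x\<in>cG" for x
   unfolding BijGroup_mult_apply[OF rho_Bij[OF h(1)] rho_Bij[OF h(2)] x]
   using h x by (simp add: rho_def G.inv_mult_group G.m_assoc)
 qed (use h in simp)
qed

lemma rho_hom: "group_hom G (BijGroup cG) rho"
 by (intro group_hom.intro group_hom_axioms.intro homI group_G group_BijGroup)
  (auto simp: rho_mult carrier_BijGroup rho_Bij)

lemma rho_inj: "g\<in>cG ==> h\<in>cG ==> rho g = rho h ==> g = h"
proof -
 assume h: "g\<in>cG" "h\<in>cG" "rho g = rho h"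
 hence "rho g \<one>\<^bsub>G\<^esub> = rho h \<one>\<^bsub>G\<^esub>" by simp
 hence "inv\<^bsub>G\<^esub> g = inv\<^bsub>G\<^esub> h" using h by (simp add: rho_def)
 thus ?thesis using h by (metis G.inv_inv)
qed

lemma rho_iso: "rho\<in>iso G (perm_subgroup cG (rho ` cG))"
 using rho_inj by (intro isoI homI) (auto simp: rho_mult bij_betw_def inj_on_def)

text \<open>Left and right translations commute. So the Galois group acts trivially on the right
  translations, and the fixed ring is the group algebra over \<open>k\<close>.\<close>

lemma rho_conj:
 assumes g: "g\<in>cG" and h: "h\<in>cG"
 shows "perm_conj cG (left_translation G g) (rho h) = rho h"
proof (rule Bij_ext[OF perm_conj_Bij[OF left_translation_Bij[OF group_G g] rho_Bij[OF h]] rho_Bij[OF h]])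
 fix x assume x: "x\<in>cG"
 have "perm_conj cG (left_translation G g) (rho h) (left_translation G g (inv\<^bsub>G\<^esub> g\<otimes>\<^bsub>G\<^esub> x)) =
   left_translation G g (rho h (inv\<^bsub>G\<^esub> g\<otimes>\<^bsub>G\<^esub> x))"
  using x g by (intro perm_conj_apply left_translation_Bij group_G rho_Bij h) auto
 thus "perm_conj cG (left_translation G g) (rho h) x = rho h x"
  using x g h by (simp add: left_translation_def rho_def G.m_assoc[symmetric])
qed

lemma rho_gp: "gp_subgroup G cG (left_translation G) (rho ` cG)"
 unfolding gp_subgroup_def regular_subgroup_def
proof (intro conjI ballI)
 show "subgroup (rho ` cG) (BijGroup cG)"
  using group_hom.img_is_subgroup[OF rho_hom] .
 fix x y assume xy: "x\<in>cG" "y\<in>cG"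
 show "\<exists>!w. w\<in>rho ` cG \<and> w x = y"
 proof (rule ex1I[of _ "rho (inv\<^bsub>G\<^esub> y\<otimes>\<^bsub>G\<^esub> x)"])
  show "rho (inv\<^bsub>G\<^esub> y\<otimes>\<^bsub>G\<^esub> x)\<in>rho ` cG \<and> rho (inv\<^bsub>G\<^esub> y\<otimes>\<^bsub>G\<^esub> x) x = y"
   using xy by (intro conjI imageI) (simp_all add: rho_def G.inv_mult_group G.m_assoc[symmetric])
  fix w assume "w\<in>rho ` cG \<and> w x = y"
  then obtain g where g: "g\<in>cG" "w = rho g" "x\<otimes>\<^bsub>G\<^esub> inv\<^bsub>G\<^esub> g = y" using xy by (auto simp: rho_def)
  thus "w = rho (inv\<^bsub>G\<^esub> y\<otimes>\<^bsub>G\<^esub> x)" using xy by (simp add: G.inv_mult_group G.m_assoc flip: g(3))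
 qed
next
 fix g w assume "g\<in>cG" "w\<in>rho ` cG"
 thus "perm_conj cG (left_translation G g) w\<in>rho ` cG" using rho_conj by auto
qed

lemma classical_isomorphic_rho:
 "hopf_galois_isomorphic K k cK (classical_structure K k) (gp_structure K k (rho ` cG))"
proof -
 interpret P: gp_setting K "cG" "cG" "\<one>\<^bsub>G\<^esub>" "left_translation G" "rho ` cG"
  by (rule gp_setting_regular[OF rho_gp])
 let ?N = "perm_subgroup cG (rho ` cG)"
 let ?i = "inv_into cG rho"
 have inj: "inj_on rho cG" using rho_inj by (auto simp: inj_on_def)
 have i: "?i (rho g) = g" if "g\<in>cG" for g using that inj by simp
 have "hopf_galois_isomorphic K (fixed_field K cG) cK
  (fst (classical_structure K k), snd (classical_structure K k))
  (gp_hopf_algebra K GG cG (left_translation G) (rho ` cG),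
   gp_action K GG cG (left_translation G) \<one>\<^bsub>G\<^esub> (rho ` cG))"
 proof (rule hopf_record_isomorphic[OF classical_record P.gp_record])
  show "?i\<in>iso ?N G" using G.iso_set_sym[OF rho_iso] by simp
  fix g w assume h: "g\<in>cG" "w\<in>carrier ?N"
  then obtain a where a: "a\<in>cG" "w = rho a" by auto
  show "?i (perm_conj cG (left_translation G g) w) = triv_act g (?i w)"
   using h a by (simp add: rho_conj triv_act_def)
 next
  fix w x assume h: "w\<in>carrier ?N" "x\<in>cK"
  then obtain a where a: "a\<in>cG" "w = rho a" by auto
  \<comment> \<open>The inverse in \<open>gp_action\<close> cancels the one in \<open>rho\<close>,
    so that \<open>rho a\<close> acts on \<open>K\<close> through \<open>a\<close> itself.\<close>
  have inv1: "(inv\<^bsub>BijGroup cG\<^esub> (rho a)) \<one>\<^bsub>G\<^esub> = a"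
   using BijGroup_inv_apply(3)[OF rho_Bij[OF a(1)] a(1)] a(1) by (simp add: rho_def)
  have "P.rep w\<in>cG" "left_translation G (P.rep w) \<one>\<^bsub>G\<^esub> = a"
   using P.rep[of w] h(1) inv1 a(2) by simp_all
  hence "P.rep w = a" by (simp add: left_translation_def)
  thus "P.rep w x = triv_cl (?i w) x" using a i by (simp add: triv_cl_def)
 next
  show "C.L = cK" unfolding C.L_def C.\<Gamma>'_def triv_cl_def using fixed_trivial by simp
  show "P.D.L = cK"
   unfolding P.D.L_def P.stabiliser fixed_trivial[symmetric]
   by (rule arg_cong[of _ _ "fixed_field K"]) (auto simp: left_translation_def)
 qed
 thus ?thesis using fixG by (simp add: gp_structure_def Let_def)
qed

end

section \<open>Uniqueness for quadratic extensions\<close>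

context module
begin

abbreviation M_smult (infixl "\<bullet>" 70) where "x\<bullet>y \<equiv> x\<odot>\<^bsub>M\<^esub> y"
abbreviation M_add (infixl "\<boxplus>" 65) where "x\<boxplus>y \<equiv> x\<oplus>\<^bsub>M\<^esub> y"

definition subspace_of :: "'c set => bool" where
 "subspace_of U \<longleftrightarrow> U \<subseteq> carrier M \<and> \<zero>\<^bsub>M\<^esub>\<in>U \<and> (\<forall>x\<in>U. \<forall>y\<in>U. x\<boxplus>y\<in>U) \<and>
  (\<forall>r\<in>carrier R. \<forall>x\<in>U. r\<bullet>x\<in>U)"

definition add_line :: "'c set => 'c => 'c set" where
 "add_line U b = {u\<boxplus>s\<bullet>b | u s. u\<in>U \<and> s\<in>carrier R}"

lemma add_lineI: "u\<in>U ==> s\<in>carrier R ==> x = u\<boxplus>s\<bullet>b ==> x\<in>add_line U b"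
 by (auto simp: add_line_def)

lemma subspace_add_line:
 assumes U: "subspace_of U" and b: "b\<in>carrier M"
 shows "subspace_of (add_line U b)"
proof -
 have Uc: "u\<in>carrier M" if "u\<in>U" for u using U that by (auto simp: subspace_of_def)
 have a: "x\<boxplus>y\<in>add_line U b" if xy: "x\<in>add_line U b" "y\<in>add_line U b" for x y
 proof -
  obtain u s v t where h: "x = u\<boxplus>s\<bullet>b" "u\<in>U" "s\<in>carrier R"
    "y = v\<boxplus>t\<bullet>b" "v\<in>U" "t\<in>carrier R"
   using xy unfolding add_line_def mem_Collect_eq by blast
  show ?thesis
  proof (rule add_lineI)
   show "x\<boxplus>y = (u\<boxplus>v)\<boxplus>(s\<oplus>t)\<bullet>b"
    using h b Uc by (simp add: smult_l_distr M.a_ac)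
  qed (use h U in \<open>auto simp: subspace_of_def\<close>)
 qed
 have s: "r\<bullet>x\<in>add_line U b" if r: "r\<in>carrier R" and x: "x\<in>add_line U b" for r x
 proof -
  obtain u s where h: "x = u\<boxplus>s\<bullet>b" "u\<in>U" "s\<in>carrier R"
   using x by (auto simp: add_line_def)
  show ?thesis
  proof (rule add_lineI)
   show "r\<bullet>x = r\<bullet>u\<boxplus>(r\<otimes>s)\<bullet>b"
    using h b Uc r by (simp add: smult_r_distr smult_assoc1)
  qed (use h U r in \<open>auto simp: subspace_of_def\<close>)
 qed
 have z: "\<zero>\<^bsub>M\<^esub>\<in>add_line U b"
  using U b by (intro add_lineI[of "\<zero>\<^bsub>M\<^esub>" _ \<zero>]) (auto simp: subspace_of_def)
 show ?thesis
  using a s z Uc b by (auto simp: subspace_of_def add_line_def)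
qed

lemma add_line_sub: "subspace_of U ==> b\<in>carrier M ==> u\<in>U ==> u\<in>add_line U b"
 by (rule add_lineI[of u U \<zero>]) (auto simp: subspace_of_def)

lemma add_line_self: "subspace_of U ==> b\<in>carrier M ==> b\<in>add_line U b"
 by (rule add_lineI[of "\<zero>\<^bsub>M\<^esub>" U \<one>]) (auto simp: subspace_of_def)

text \<open>\<open>U\<close> grows by a generator only when that generator is not yet reached from
  \<open>U\<close> and \<open>h\<close>; then \<open>h\<close> stays outside. In the end
  \<open>U\<close> is a complement of the line through \<open>h\<close>.\<close>

lemma complement_exists:
 assumes F: "field R" and h: "h\<in>carrier M" "h ~= \<zero>\<^bsub>M\<^esub>"
 shows "finite B ==> B \<subseteq> carrier M ==> \<exists>U. subspace_of U \<and> h \<notin> U \<and> B \<subseteq> add_line U h"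
proof (induction B rule: finite_induct)
 case empty
 have "subspace_of {\<zero>\<^bsub>M\<^esub>}" by (simp add: subspace_of_def)
 thus ?case using h by blast
next
 case (insert b B)
 interpret field R by (rule F)
 obtain U where U: "subspace_of U" "h \<notin> U" and UB: "B \<subseteq> add_line U h" using insert by auto
 have b: "b\<in>carrier M" using insert.prems by simp
 have Uc: "u\<in>carrier M" if "u\<in>U" for u using U that by (auto simp: subspace_of_def)
 show ?case
 proof (cases "b\<in>add_line U h")
  case True thus ?thesis using U UB by blast
 next
  case False
  have "h \<notin> add_line U b"
  proof
   assume "h\<in>add_line U b"
   then obtain u s where us: "h = u\<boxplus>s\<bullet>b" "u\<in>U" "s\<in>carrier R" by (auto simp: add_line_def)
   show False
   proof (cases "s = \<zero>")
    case True thus False using us U(2) b Uc by simp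
   next
    case s0: False
    hence S: "s\<in>Units R" using us by (simp add: field_Units)
    \<comment> \<open>If \<open>h\<close> were reached with the nonzero coefficient
      \<open>s\<close>, solving for \<open>b\<close> would put it into
      \<open>add_line U h\<close>.\<close>
    have "inv s\<bullet>h = inv s\<bullet>u\<boxplus>b"
     using us S b Uc by (simp add: smult_r_distr smult_assoc1[symmetric] Units_l_inv)
    hence "b = (\<ominus> (inv s))\<bullet>u\<boxplus>inv s\<bullet>h"
     using us(2,3) S b Uc by (simp add: smult_l_minus M.r_neg1)
    moreover have "(\<ominus> (inv s))\<bullet>u\<in>U" using U us S by (auto simp: subspace_of_def)
    ultimately have "b\<in>add_line U h" using S by (intro add_lineI) auto
    thus False using False by blast
   qed
  qed
  moreover have "B \<subseteq> add_line (add_line U b) h"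
  proof
   fix x assume "x\<in>B"
   then obtain u r where ur: "x = u\<boxplus>r\<bullet>h" "u\<in>U" "r\<in>carrier R" using UB by (auto simp: add_line_def)
   show "x\<in>add_line (add_line U b) h" by (rule add_lineI[OF add_line_sub[OF U(1) b ur(2)] ur(3) ur(1)])
  qed
  moreover have "b\<in>add_line (add_line U b) h"
   using add_line_sub[OF subspace_add_line[OF U(1) b] h(1) add_line_self[OF U(1) b]] .
  ultimately show ?thesis using subspace_add_line[OF U(1) b] by (intro exI[of _ "add_line U b"]) simp
 qed
qed

lemma subspace_finsum:
 assumes U: "subspace_of U"
 shows "finite B ==> (!!b. b\<in>B ==> f b\<in>U) ==> (\<Oplus>\<^bsub>M\<^esub>b\<in>B. f b)\<in>U"
proof (induction B rule: finite_induct)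
 case (insert b B)
 have "f x\<in>carrier M" if "x\<in>insert b B" for x using insert.prems[OF that] U by (auto simp: subspace_of_def)
 thus ?case using insert U by (simp add: Pi_def subspace_of_def)
qed (use U in \<open>simp add: subspace_of_def\<close>)

text \<open>\<open>g\<close> reads off the coefficient of \<open>h\<close> along a complement. Since
  equality of tensors is defined by forms, such a form is what turns it into equality of
  elements.\<close>

lemma separating_functional:
 assumes F: "field R" and fd: "finite_dimensional R M" and h: "h\<in>carrier M" "h ~= \<zero>\<^bsub>M\<^esub>"
 shows "\<exists>g. linear_map R M (ring_as_module R) g \<and> g h = \<one>"
proof -
 interpret field R by (rule F)
 obtain B where B: "finite B" "B \<subseteq> carrier M"
   "!!x. x\<in>carrier M ==> \<exists>c\<in>B \<rightarrow> carrier R. x = (\<Oplus>\<^bsub>M\<^esub>b\<in>B. c b\<bullet>b)"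
  using fd by (auto simp: finite_dimensional_def)
 obtain U where U: "subspace_of U" "h \<notin> U" "B \<subseteq> add_line U h" using complement_exists[OF F h B(1,2)] by blast
 have Uc: "u\<in>carrier M" if "u\<in>U" for u using U that by (auto simp: subspace_of_def)
 have Ua: "u\<boxplus>v\<in>U" if "u\<in>U" "v\<in>U" for u v using U that by (auto simp: subspace_of_def)
 have Us: "r\<bullet>u\<in>U" if "u\<in>U" "r\<in>carrier R" for u r using U that by (auto simp: subspace_of_def)
 have W: "subspace_of (add_line U h)" using subspace_add_line[OF U(1) h(1)] .
 have all: "x\<in>add_line U h" if x: "x\<in>carrier M" for x
 proof -
  obtain c where c: "c\<in>B \<rightarrow> carrier R" "x = (\<Oplus>\<^bsub>M\<^esub>b\<in>B. c b\<bullet>b)" using B(3)[OF x] by blast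
  have "c b\<bullet>b\<in>add_line U h" if "b\<in>B" for b
  proof -
   have "c b\<in>carrier R" "b\<in>add_line U h" using U(3) c(1) that by auto
   moreover have "\<forall>r\<in>carrier R. \<forall>x\<in>add_line U h. r\<bullet>x\<in>add_line U h" using W unfolding subspace_of_def by simp
   ultimately show ?thesis by simp
  qed
  thus ?thesis unfolding c(2) by (intro subspace_finsum[OF W B(1)])
 qed
 define P where "P x r \<longleftrightarrow> r\<in>carrier R \<and> (\<exists>u\<in>U. x = u\<boxplus>r\<bullet>h)" for x r
 have uniq: "r = s" if rs: "P x r" "P x s" for x r s
 proof (rule ccontr)
  assume ne: "r ~= s"
  obtain u v where uv: "u\<in>U" "v\<in>U" "u\<boxplus>r\<bullet>h = v\<boxplus>s\<bullet>h" "r\<in>carrier R" "s\<in>carrier R"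
   using rs by (auto simp: P_def)
  let ?d = "r\<ominus>s"
  have d: "?d\<in>Units R" using ne uv by (simp add: field_Units)
  have "?d\<bullet>h = r\<bullet>h\<boxplus>\<ominus>\<^bsub>M\<^esub> (s\<bullet>h)"
   using uv h by (simp add: a_minus_def smult_l_distr smult_l_minus)
  also have "... = (\<ominus>\<^bsub>M\<^esub> u\<boxplus>(u\<boxplus>r\<bullet>h))\<boxplus>\<ominus>\<^bsub>M\<^esub> (s\<bullet>h)"
   using uv(1,2,4,5) h Uc by (simp add: M.r_neg1)
  also have "... =\<ominus>\<^bsub>M\<^esub> u\<boxplus>v"
   unfolding uv(3) using uv h Uc by (simp add: M.a_assoc M.r_neg)
  also have "... = (\<ominus> \<one>)\<bullet>u\<boxplus>v" using uv Uc by (simp add: smult_l_minus)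
  finally have dU: "?d\<bullet>h\<in>U" using Ua[OF Us[OF uv(1)] uv(2), of "\<ominus> \<one>"] by simp
  have "inv ?d\<bullet>(?d\<bullet>h)\<in>U" by (rule Us[OF dU Units_inv_closed[OF d]])
  moreover have "inv ?d\<bullet>(?d\<bullet>h) = (inv ?d\<otimes>?d)\<bullet>h"
   using d h(1) by (intro smult_assoc1[symmetric]) auto
  ultimately show False using d h(1) U(2) by (simp add: Units_l_inv)
 qed
 define g where "g x = (THE r. P x r)" for x
 have gP: "P x (g x)" if "x\<in>carrier M" for x
 proof -
  have "\<exists>r. P x r" using all[OF that] by (auto simp: P_def add_line_def)
  thus ?thesis unfolding g_def using uniq by (metis theI)
 qed
 have g_eq: "g x = r" if "x\<in>carrier M" "P x r" for x r using uniq[OF gP[OF that(1)] that(2)] .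
 have "linear_map R M (ring_as_module R) g"
  unfolding linear_map_def
 proof (intro conjI ballI)
  show "g\<in>carrier M \<rightarrow> carrier (ring_as_module R)" using gP by (auto simp: P_def ring_as_module_def)
  fix x y assume xy: "x\<in>carrier M" "y\<in>carrier M"
  obtain u v where uv: "u\<in>U" "x = u\<boxplus>g x\<bullet>h" "g x\<in>carrier R" "v\<in>U" "y = v\<boxplus>g y\<bullet>h" "g y\<in>carrier R"
   using gP[OF xy(1)] gP[OF xy(2)] by (auto simp: P_def)
  have "x\<boxplus>y = (u\<boxplus>g x\<bullet>h)\<boxplus>(v\<boxplus>g y\<bullet>h)" using uv(2,5) by simp
  also have "... = (u\<boxplus>v)\<boxplus>(g x\<oplus>g y)\<bullet>h"
   using uv(1,3,4,6) h Uc by (simp add: smult_l_distr M.a_ac)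
  finally have "P (x\<boxplus>y) (g x\<oplus>g y)" unfolding P_def using uv(3,6) Ua[OF uv(1,4)] by (intro conjI bexI) auto
  hence "g (x\<boxplus>y) = g x\<oplus>g y" by (rule g_eq[OF M.a_closed[OF xy]])
  thus "g (x\<boxplus>y) = g x\<oplus>\<^bsub>ring_as_module R\<^esub> g y" by (simp add: ring_as_module_def)
 next
  fix c x assume c: "c\<in>carrier R" and x: "x\<in>carrier M"
  obtain u where u: "u\<in>U" "x = u\<boxplus>g x\<bullet>h" "g x\<in>carrier R" using gP[OF x] by (auto simp: P_def)
  have "c\<bullet>x = c\<bullet>(u\<boxplus>g x\<bullet>h)" using u(2) by simp
  also have "... = c\<bullet>u\<boxplus>(c\<otimes>g x)\<bullet>h"
   using u(1,3) c h Uc by (simp add: smult_r_distr smult_assoc1)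
  finally have "P (c\<bullet>x) (c\<otimes>g x)" unfolding P_def using u(3) c Us[OF u(1) c] by (intro conjI bexI) auto
  hence "g (c\<bullet>x) = c\<otimes>g x" by (rule g_eq[OF smult_closed[OF c x]])
  thus "g (c\<bullet>x) = c\<odot>\<^bsub>ring_as_module R\<^esub> g x" by (simp add: ring_as_module_def)
 qed
 moreover have "g h = \<one>"
  using h U(1) by (intro g_eq) (auto simp: P_def subspace_of_def intro!: bexI[of _ "\<zero>\<^bsub>M\<^esub>"])
 ultimately show ?thesis by blast
qed

end

section \<open>Coefficients of an arbitrary Hopf Galois structure\<close>

lemma (in hopf_descent) coeff_unique:
 assumes c: "!!w. w\<in>C ==> c w\<in>carrier K" and d: "!!w. w\<in>C ==> d w\<in>carrier K"
  and eq: "!!x. x\<in>L ==> (\<Oplus>w\<in>C. c w\<otimes>e w x) = (\<Oplus>w\<in>C. d w\<otimes>e w x)" and v: "v\<in>C"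
 shows "c v = d v"
 using coefficient_recover[of c, OF c v] coefficient_recover[of d, OF d v] unfolding eq[OF vv_L] by (rule trans[OF sym])

text \<open>The trace form is nondegenerate, as the dual systems show.\<close>

lemma (in field_auts) trace_determines:
 assumes "x\<in>carrier K" "y\<in>carrier K" "!!z. z\<in>carrier K ==> tr (z\<otimes>x) = tr (z\<otimes>y)"
 shows "x = y"
proof -
 have "x = (\<Oplus>i\<in>idx. xx i\<otimes>tr (yy i\<otimes>x))" using dual1[OF assms(1)] by (rule sym)
 also have "... = (\<Oplus>i\<in>idx. xx i\<otimes>tr (yy i\<otimes>y))" by (simp only: assms(3)[OF yy_closed])
 also have "... = y" by (rule dual1[OF assms(2)])
 finally show ?thesis .
qed

lemma (in galois_setting) one_apply [simp]: "x\<in>carrier K ==> \<one>\<^bsub>G\<^esub> x = x"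
 using aut_id by simp

locale hopf_galois_on = galois_setting K k for K (structure) and k +
 fixes H :: "('a, 'h) hopf" and \<mu> :: "'h => 'a => 'a"
 assumes S: "hopf_galois_structure K k (carrier K) (H, \<mu>)"
begin

abbreviation "cH \<equiv> carrier H"

abbreviation "RK \<equiv> K\<lparr>carrier := k\<rparr>"
abbreviation "LK \<equiv> ring_as_module K"

lemma K_eq: "K\<lparr>carrier := cK\<rparr> = K" by simp

lemma hopf: "cocommutative_hopf_algebra RK H"
 and fd: "finite_dimensional RK H"
 and mu_lin: "h\<in>cH ==> linear_map RK LK LK (\<mu> h)"
 and mu_H_add: "h\<in>cH ==> h'\<in>cH ==> x\<in>cK ==> \<mu> (h\<oplus>\<^bsub>H\<^esub> h') x = \<mu> h x\<oplus>\<mu> h' x"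
 and mu_H_smult: "c\<in>k ==> h\<in>cH ==> x\<in>cK ==> \<mu> (c\<odot>\<^bsub>H\<^esub> h) x = c\<otimes>\<mu> h x"
 and mu_H_one: "x\<in>cK ==> \<mu> \<one>\<^bsub>H\<^esub> x = x"
 and mu_H_mult: "h\<in>cH ==> h'\<in>cH ==> x\<in>cK ==> \<mu> (h\<otimes>\<^bsub>H\<^esub> h') x = \<mu> h (\<mu> h' x)"
 and mu_counit: "h\<in>cH ==> \<mu> h \<one> = counit H h"
 and mu_prod: "h\<in>cH ==> x\<in>cK ==> y\<in>cK ==>
   \<mu> h (x\<otimes>y) = list_sum K (\<lambda>(a, b). \<mu> a x\<otimes>\<mu> b y) (comul H h)"
 and mu_surj: "linear_map RK LK LK f ==>
   \<exists>ts. set ts \<subseteq> cK\<times>cH \<and> (\<forall>y\<in>cK. f y = list_sum K (\<lambda>(x, h). x\<otimes>\<mu> h y) ts)"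
 and mu_inj: "set ss \<subseteq> cK\<times>cH ==> set ts \<subseteq> cK\<times>cH ==>
   (!!y. y\<in>cK ==> list_sum K (\<lambda>(x, h). x\<otimes>\<mu> h y) ss = list_sum K (\<lambda>(x, h). x\<otimes>\<mu> h y) ts) ==>
   tensor_eq RK LK H ss ts"
 using S unfolding hopf_galois_structure_def Let_def prod.case K_eq by simp_all

sublocale HR: ring H using hopf by (rule cocommutative_hopf_algebra.axioms(3))
sublocale HM: module RK H using hopf by (rule cocommutative_hopf_algebra.axioms(2))

lemma comul_mem: "h\<in>cH ==> p\<in>set (comul H h) ==> fst p\<in>cH \<and> snd p\<in>cH"
 using cocommutative_hopf_algebra.comul_closed[OF hopf] by fastforce

lemma mu_closed [simp]: "h\<in>cH ==> x\<in>cK ==> \<mu> h x\<in>cK"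
 using mu_lin[of h] by (auto simp: linear_map_def ring_as_module_def)

lemma k_closed: "c\<in>k ==> c\<in>cK" using k_sub by blast

lemma C_L: "C.L = cK"
 unfolding C.L_def C.\<Gamma>'_def triv_cl_def using fixed_trivial by simp

lemma mu_linL: "h\<in>cH ==> C.linL (\<mu> h)"
 using mu_lin[of h] unfolding C.linL_def C_L fixG linear_map_def by (simp add: ring_as_module_def)

text \<open>The coefficients of \<open>\<mu> h\<close> as a combination of automorphisms. A priori
  they lie in \<open>K\<close>; the structure is classical as soon as they lie in
  \<open>k\<close>.\<close>

definition "cc h t = C.cg (\<mu> h) t"

lemma cc_closed [simp]: "h\<in>cH ==> t\<in>cG ==> cc h t\<in>cK"
 unfolding cc_def by (intro C.cg_closed mu_linL)

lemma mu_expand: "h\<in>cH ==> x\<in>cK ==> \<mu> h x = (\<Oplus>t\<in>cG. cc h t\<otimes>t x)"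
proof -
 assume h: "h\<in>cH" "x\<in>cK"
 have "\<mu> h x = (\<Oplus>t\<in>cG. t x\<otimes>cc h t)"
  unfolding cc_def using C.linL_expand[OF mu_linL[OF h(1)], of x] h C_L by simp
 also have "... = (\<Oplus>t\<in>cG. cc h t\<otimes>t x)" using h by (intro fs_cong) (auto simp: m_comm)
 finally show ?thesis .
qed

lemma coeffs_unique:
 assumes "!!t. t\<in>cG ==> c t\<in>cK" "!!t. t\<in>cG ==> d t\<in>cK"
  "!!x. x\<in>cK ==> (\<Oplus>t\<in>cG. c t\<otimes>t x) = (\<Oplus>t\<in>cG. d t\<otimes>t x)" "r\<in>cG"
 shows "c r = d r"
 using C.coeff_unique[of c d r] assms unfolding C_L triv_cl_def by blast

lemma cc_add: "h\<in>cH ==> h'\<in>cH ==> t\<in>cG ==> cc (h\<oplus>\<^bsub>H\<^esub> h') t = cc h t\<oplus>cc h' t"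
proof (rule coeffs_unique[where c="cc (h\<oplus>\<^bsub>H\<^esub> h')" and d="\<lambda>t. cc h t\<oplus>cc h' t"])
 fix x assume h: "h\<in>cH" "h'\<in>cH" "x\<in>cK"
 have "(\<Oplus>t\<in>cG. (cc h t\<oplus>cc h' t)\<otimes>t x) = (\<Oplus>t\<in>cG. cc h t\<otimes>t x\<oplus>cc h' t\<otimes>t x)"
  using h by (intro fs_cong) (auto simp: l_distr)
 also have "... = \<mu> h x\<oplus>\<mu> h' x" using h by (subst fs_add) (auto simp: mu_expand)
 finally show "(\<Oplus>t\<in>cG. cc (h\<oplus>\<^bsub>H\<^esub> h') t\<otimes>t x) = (\<Oplus>t\<in>cG. (cc h t\<oplus>cc h' t)\<otimes>t x)"
  using h mu_H_add[of h h' x] mu_expand[of "h\<oplus>\<^bsub>H\<^esub> h'" x] by simp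
qed auto

lemma cc_smult: "c\<in>k ==> h\<in>cH ==> t\<in>cG ==> cc (c\<odot>\<^bsub>H\<^esub> h) t = c\<otimes>cc h t"
proof (rule coeffs_unique[where c="cc (c\<odot>\<^bsub>H\<^esub> h)" and d="\<lambda>t. c\<otimes>cc h t"])
 fix x assume h: "c\<in>k" "h\<in>cH" "x\<in>cK"
 have "(\<Oplus>t\<in>cG. (c\<otimes>cc h t)\<otimes>t x) = (\<Oplus>t\<in>cG. c\<otimes>(cc h t\<otimes>t x))"
  using h k_closed by (intro fs_cong) (auto simp: m_assoc)
 also have "... = c\<otimes>\<mu> h x" using h k_closed by (simp add: mu_expand fs_rdistr finG)
 finally show "(\<Oplus>t\<in>cG. cc (c\<odot>\<^bsub>H\<^esub> h) t\<otimes>t x) = (\<Oplus>t\<in>cG. (c\<otimes>cc h t)\<otimes>t x)"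
  using h mu_H_smult[of c h x] mu_expand[of "c\<odot>\<^bsub>H\<^esub> h" x] HM.smult_closed[of c h] by simp
qed (use k_closed HM.smult_closed[of c h] in auto)

lemma cc_sum: "h\<in>cH ==> (\<Oplus>t\<in>cG. cc h t) = counit H h"
proof -
 assume h: "h\<in>cH"
 have "(\<Oplus>t\<in>cG. cc h t) = (\<Oplus>t\<in>cG. cc h t\<otimes>t \<one>)" using h by (intro fs_cong) auto
 thus ?thesis using mu_expand[OF h one_closed] mu_counit[OF h] by simp
qed

lemma counit_k: "h\<in>cH ==> counit H h\<in>k"
 using ring_hom_closed[OF cocommutative_hopf_algebra.counit_hom[OF hopf], of h] by simp

text \<open>\<open>\<mu> h (x \<otimes> y)\<close> is expanded once through automorphisms, which are
  multiplicative, and once through the comultiplication. Independence of automorphisms, first in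
  \<open>x\<close> and then in \<open>y\<close>, equates the coefficients.\<close>

lemma cc_comul:
 assumes h: "h\<in>cH" and t: "t\<in>cG" and r: "r\<in>cG"
 shows "list_sum K (\<lambda>p. cc (fst p) t\<otimes>cc (snd p) r) (comul H h) = (if t = r then cc h t else \<zero>)"
proof -
 note m = comul_mem[OF h]
 define c where "c t r = list_sum K (\<lambda>p. cc (fst p) t\<otimes>cc (snd p) r) (comul H h)" for t r
 have cK: "c t r\<in>cK" if "t\<in>cG" "r\<in>cG" for t r
  unfolding c_def using m that by (intro ls_closed) auto
 have 1: "cc h t\<otimes>t y = (\<Oplus>r\<in>cG. c t r\<otimes>r y)" if y: "y\<in>cK" and t: "t\<in>cG" for t y
 proof (rule coeffs_unique[where c="\<lambda>t. cc h t\<otimes>t y" and d="\<lambda>t. \<Oplus>r\<in>cG. c t r\<otimes>r y"])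
  fix x assume x: "x\<in>cK"
  have "(\<Oplus>t\<in>cG. cc h t\<otimes>t y\<otimes>t x) = \<mu> h (x\<otimes>y)"
   unfolding mu_expand[OF h m_closed[OF x y]] using h x y by (intro fs_cong) (auto simp: aut_mult m_ac)
  also have "... = list_sum K (\<lambda>p. \<mu> (fst p) x\<otimes>\<mu> (snd p) y) (comul H h)"
   using mu_prod[OF h x y] by (simp add: case_prod_unfold)
  also have "... = list_sum K (\<lambda>p. \<Oplus>t\<in>cG. \<Oplus>r\<in>cG. (cc (fst p) t\<otimes>cc (snd p) r)\<otimes>(r y\<otimes>t x)) (comul H h)"
  proof (rule ls_cong)
   fix p assume "p\<in>set (comul H h)"
   hence p: "fst p\<in>cH" "snd p\<in>cH" using m by auto
   have "\<mu> (fst p) x\<otimes>\<mu> (snd p) y = (\<Oplus>t\<in>cG. (cc (fst p) t\<otimes>t x)\<otimes>\<mu> (snd p) y)"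
    unfolding mu_expand[OF p(1) x] using p x y by (intro fs_ldistr finG) auto
   also have "... = (\<Oplus>t\<in>cG. \<Oplus>r\<in>cG. (cc (fst p) t\<otimes>t x)\<otimes>(cc (snd p) r\<otimes>r y))"
    unfolding mu_expand[OF p(2) y] using p x y by (intro fs_cong fs_rdistr finG) auto
   also have "... = (\<Oplus>t\<in>cG. \<Oplus>r\<in>cG. (cc (fst p) t\<otimes>cc (snd p) r)\<otimes>(r y\<otimes>t x))"
    using p x y by (intro fs_cong) (auto simp: m_ac)
   finally show "\<mu> (fst p) x\<otimes>\<mu> (snd p) y =
    (\<Oplus>t\<in>cG. \<Oplus>r\<in>cG. (cc (fst p) t\<otimes>cc (snd p) r)\<otimes>(r y\<otimes>t x))" .
  qed
  also have "... = (\<Oplus>t\<in>cG. list_sum K (\<lambda>p. \<Oplus>r\<in>cG. (cc (fst p) t\<otimes>cc (snd p) r)\<otimes>(r y\<otimes>t x)) (comul H h))"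
   using m x y by (intro ls_finsum finG) auto
  also have "... = (\<Oplus>t\<in>cG. \<Oplus>r\<in>cG. list_sum K (\<lambda>p. (cc (fst p) t\<otimes>cc (snd p) r)\<otimes>(r y\<otimes>t x)) (comul H h))"
   using m x y by (intro fs_cong ls_finsum finG) auto
  also have "... = (\<Oplus>t\<in>cG. \<Oplus>r\<in>cG. c t r\<otimes>(r y\<otimes>t x))"
   unfolding c_def using m x y by (intro fs_cong ls_ldistr[symmetric]) auto
  also have "... = (\<Oplus>t\<in>cG. (\<Oplus>r\<in>cG. c t r\<otimes>r y)\<otimes>t x)"
   using cK x y by (intro fs_cong) (auto simp: fs_ldistr finG m_assoc intro!: fs_cong)
  finally show "(\<Oplus>t\<in>cG. cc h t\<otimes>t y\<otimes>t x) = (\<Oplus>t\<in>cG. (\<Oplus>r\<in>cG. c t r\<otimes>r y)\<otimes>t x)" .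
 qed (use h y t cK in auto)
 have "c t r = (if t = r then cc h t else \<zero>)"
 proof (rule coeffs_unique[where c="c t" and d="\<lambda>r. if t = r then cc h t else \<zero>"])
  fix y assume y: "y\<in>cK"
  have "(\<Oplus>r\<in>cG. (if t = r then cc h t else \<zero>)\<otimes>r y) = (\<Oplus>r\<in>cG. if t = r then cc h t\<otimes>r y else \<zero>)"
   using h y t by (intro fs_cong) auto
  also have "... = cc h t\<otimes>t y" using h y t by (intro fs_delta(1) finG) auto
  finally show "(\<Oplus>r\<in>cG. c t r\<otimes>r y) = (\<Oplus>r\<in>cG. (if t = r then cc h t else \<zero>)\<otimes>r y)"
   using 1[OF y t] by simp
 qed (use h t r cK in auto)
 thus ?thesis by (simp add: c_def)
qed

lemma linear_map_K: "linear_map RK LK (ring_as_module RK) f \<longleftrightarrow> (\<forall>x\<in>cK. f x\<in>k) \<and>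
  (\<forall>x\<in>cK. \<forall>y\<in>cK. f (x\<oplus>y) = f x\<oplus>f y) \<and> (\<forall>c\<in>k. \<forall>x\<in>cK. f (c\<otimes>x) = c\<otimes>f x)"
 by (auto simp: linear_map_def ring_as_module_def)

lemma one_F_k: "\<one>\<in>k" and zero_F_k: "\<zero>\<in>k" using C.one_F C.zero_F unfolding fixG by auto

lemma k_mult: "x\<in>k ==> y\<in>k ==> x\<otimes>y\<in>k"
 using subringE(6)[OF subfieldE(1)[OF subfield_fixed]] unfolding fixG by blast

lemma tr_k: "x\<in>cK ==> tr x\<in>k" using tr_fixed unfolding fixG .

lemma tr_smult: "c\<in>k ==> x\<in>cK ==> tr (c\<otimes>x) = c\<otimes>tr x"
 using tr_mult_fixed unfolding fixG .

text \<open>\<open>tensor_eq\<close> tests against forms with values in \<open>k\<close>; the trace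
  supplies them on the factor \<open>K\<close>.\<close>

lemma trace_bilinear:
 assumes z: "z\<in>cK" and g: "linear_map RK H (ring_as_module RK) g"
 shows "bilinear_form RK LK H (\<lambda>x h. tr (z\<otimes>x)\<otimes>g h)"
proof -
 have g': "g h\<in>k" "g (h\<oplus>\<^bsub>H\<^esub> h') = g h\<oplus>g h'" "c\<in>k ==> g (c\<odot>\<^bsub>H\<^esub> h) = c\<otimes>g h"
  if "h\<in>cH" "h'\<in>cH" for h h' c
  using g that by (auto simp: linear_map_def ring_as_module_def)
 note kc = k_closed[OF tr_k] k_closed[OF g'(1)]
 have 1: "linear_map RK LK (ring_as_module RK) (\<lambda>x. tr (z\<otimes>x)\<otimes>g h)" if h: "h\<in>cH" for h
  unfolding linear_map_K
 proof (intro conjI ballI)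
  fix x y assume xy: "x\<in>cK" "y\<in>cK"
  show "tr (z\<otimes>x)\<otimes>g h\<in>k" using z xy h by (intro k_mult tr_k g') auto
  show "tr (z\<otimes>(x\<oplus>y))\<otimes>g h = tr (z\<otimes>x)\<otimes>g h\<oplus>tr (z\<otimes>y)\<otimes>g h"
   using z xy k_closed[OF g'(1)[OF h h]] by (simp add: r_distr tr_add l_distr)
 next
  fix c x assume c: "c\<in>k" "x\<in>cK"
  have "z\<otimes>(c\<otimes>x) = c\<otimes>(z\<otimes>x)" using c z k_closed by (simp add: m_lcomm)
  thus "tr (z\<otimes>(c\<otimes>x))\<otimes>g h = c\<otimes>(tr (z\<otimes>x)\<otimes>g h)"
   using c z k_closed[OF g'(1)[OF h h]] k_closed[OF c(1)] by (simp add: tr_smult m_assoc)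
 qed
 have 2: "linear_map RK H (ring_as_module RK) (\<lambda>h. tr (z\<otimes>x)\<otimes>g h)" if x: "x\<in>cK" for x
  unfolding linear_map_def
 proof (intro conjI ballI)
  show "(\<lambda>h. tr (z\<otimes>x)\<otimes>g h)\<in>cH \<rightarrow> carrier (ring_as_module RK)"
   using z x g'(1) by (auto simp: ring_as_module_def intro!: k_mult tr_k)
  fix h h' assume h: "h\<in>cH" "h'\<in>cH"
  show "tr (z\<otimes>x)\<otimes>g (h\<oplus>\<^bsub>H\<^esub> h') = (tr (z\<otimes>x)\<otimes>g h)\<oplus>\<^bsub>ring_as_module RK\<^esub> (tr (z\<otimes>x)\<otimes>g h')"
   using z x h g'(2)[OF h] k_closed[OF g'(1)[OF h]] k_closed[OF g'(1)[OF h(2,1)]]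
   by (simp add: ring_as_module_def r_distr)
 next
  fix c h assume c: "c\<in>carrier RK" and h: "h\<in>cH"
  thus "tr (z\<otimes>x)\<otimes>g (c\<odot>\<^bsub>H\<^esub> h) = c\<odot>\<^bsub>ring_as_module RK\<^esub> (tr (z\<otimes>x)\<otimes>g h)"
   using z x g'(3)[OF h h] k_closed[OF g'(1)[OF h h]] k_closed[of c] by (simp add: ring_as_module_def m_lcomm)
 qed
 show ?thesis unfolding bilinear_form_def using 1 2 by (auto simp: ring_as_module_def)
qed

lemma mu_functional:
 assumes w: "w\<in>cK" and y: "y\<in>cK"
 shows "linear_map RK H (ring_as_module RK) (\<lambda>h. tr (w\<otimes>\<mu> h y))"
 unfolding linear_map_def
proof (intro conjI ballI)
 show "(\<lambda>h. tr (w\<otimes>\<mu> h y))\<in>cH \<rightarrow> carrier (ring_as_module RK)"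
  using w y by (auto simp: ring_as_module_def intro!: tr_k)
 show "tr (w\<otimes>\<mu> (h\<oplus>\<^bsub>H\<^esub> h') y) = tr (w\<otimes>\<mu> h y)\<oplus>\<^bsub>ring_as_module RK\<^esub> tr (w\<otimes>\<mu> h' y)"
  if "h\<in>cH" "h'\<in>cH" for h h'
  using that w y by (simp add: ring_as_module_def mu_H_add r_distr tr_add)
 fix c h assume c: "c\<in>carrier RK" and h: "h\<in>cH"
 hence "w\<otimes>\<mu> (c\<odot>\<^bsub>H\<^esub> h) y = c\<otimes>(w\<otimes>\<mu> h y)" using w y k_closed[of c] by (simp add: mu_H_smult m_lcomm)
 thus "tr (w\<otimes>\<mu> (c\<odot>\<^bsub>H\<^esub> h) y) = c\<odot>\<^bsub>ring_as_module RK\<^esub> tr (w\<otimes>\<mu> h y)"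
  using c h w y by (simp add: ring_as_module_def tr_smult)
qed

lemma tensor_eq_single:
 assumes "tensor_eq RK LK H [(x, h)] [(y, h')]" "bilinear_form RK LK H B" "B x h\<in>cK" "B y h'\<in>cK"
 shows "B x h = B y h'"
 using assms unfolding tensor_eq_def by (auto simp: list_sum_def)

text \<open>After subtraction of its counit, \<open>h\<close> acts as \<open>?b h\<close> times the
  difference of \<open>v\<close> and the identity, so over \<open>K\<close> all these operators are
  proportional. Injectivity of the Hopf Galois map forces the ratios into \<open>k\<close>. The
  comultiplication then equates \<open>?b h0\<close> with its square times some \<open>Q\<close> in
  \<open>k\<close>, so \<open>?b h0\<close> is the inverse of \<open>Q\<close>.\<close>

lemma quadratic_coeffs:
 assumes G2: "cG = {\<one>\<^bsub>G\<^esub>, v}" and t1: "v ~= \<one>\<^bsub>G\<^esub>" and h: "h\<in>cH" and u: "u\<in>cG"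
 shows "cc h u\<in>k"
proof -
 have t: "v\<in>cG" using G2 by simp
 let ?b = "\<lambda>h. cc h v"
 have bK: "?b h\<in>cK" if "h\<in>cH" for h using that t by simp
 have k1: "\<one>\<in>k" using one_F_k by simp
 have pair: "(\<Oplus>u\<in>cG. f u) = f \<one>\<^bsub>G\<^esub>\<oplus>f v"
  if "f \<one>\<^bsub>G\<^esub>\<in>cK" "f v\<in>cK" for f
  unfolding G2 using that t1 by (simp add: Pi_def)
 have eps: "counit H h = cc h \<one>\<^bsub>G\<^esub>\<oplus>?b h" if h: "h\<in>cH" for h
  using cc_sum[OF h] pair[of "cc h"] h t by simp
 have mu2: "\<mu> h x = cc h \<one>\<^bsub>G\<^esub>\<otimes>x\<oplus>?b h\<otimes>v x" if h: "h\<in>cH" and x: "x\<in>cK" for h x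
  using mu_expand[OF h x] pair[of "\<lambda>u. cc h u\<otimes>u x"] h x t aut_id[OF x] by simp
 have all: "?b h\<in>k" if h: "h\<in>cH" for h
 proof (cases "\<exists>h0\<in>cH. ?b h0 ~= \<zero>")
  case False
  hence "?b h = \<zero>" using h by blast
  thus ?thesis using zero_F_k by simp
 next
  case True
  then obtain h0 where h0: "h0\<in>cH" "?b h0 ~= \<zero>" by blast
  have b0U: "?b h0\<in>Units K" using h0 bK by (simp add: field_Units)
  have multiple: "\<exists>s\<in>k. ?b h = s\<otimes>?b h0" if h: "h\<in>cH" for h
  proof -
   define aug where "aug h = h\<oplus>\<^bsub>H\<^esub> (\<ominus> counit H h)\<odot>\<^bsub>H\<^esub> \<one>\<^bsub>H\<^esub>" for h
   have ck: "\<ominus> counit H h\<in>k" if "h\<in>cH" for h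
    using counit_k[OF that] subringE(5)[OF subfieldE(1)[OF subfield_fixed]] unfolding fixG by blast
   have augH: "aug h\<in>cH" if "h\<in>cH" for h
    unfolding aug_def using that ck[OF that] HM.smult_closed[of "\<ominus> counit H h" "\<one>\<^bsub>H\<^esub>"] by simp
   have mu_aug: "\<mu> (aug h) x = ?b h\<otimes>(v x\<ominus>x)" if h: "h\<in>cH" and x: "x\<in>cK" for h x
   proof -
    have "\<mu> (aug h) x = \<mu> h x\<oplus>(\<ominus> counit H h)\<otimes>x"
     unfolding aug_def using h x ck[OF h] HM.smult_closed[of "\<ominus> counit H h" "\<one>\<^bsub>H\<^esub>"]
     by (simp add: mu_H_add mu_H_smult mu_H_one)
    also have "... = (cc h \<one>\<^bsub>G\<^esub>\<otimes>x\<oplus>?b h\<otimes>v x)\<oplus>(\<ominus> (cc h \<one>\<^bsub>G\<^esub>\<oplus>?b h))\<otimes>x"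
     using mu2[OF h x] eps[OF h] by simp
    also have "... = ?b h\<otimes>(v x\<ominus>x)"
    proof -
     have "cc h \<one>\<^bsub>G\<^esub>\<in>cK" "?b h\<in>cK" "v x\<in>cK" using h x t by auto
     thus ?thesis using x by algebra
    qed
    finally show ?thesis .
   qed
   \<comment> \<open>Both tensors act as the product of \<open>?b h0\<close> and \<open>?b h\<close>
     times the difference of \<open>v\<close> and the identity.\<close>
   have te: "tensor_eq RK LK H [(?b h0, aug h)] [(?b h, aug h0)]"
   proof (rule mu_inj)
    show "list_sum K (\<lambda>(x, h). x\<otimes>\<mu> h y) [(?b h0, aug h)] = list_sum K (\<lambda>(x, h). x\<otimes>\<mu> h y) [(?b h, aug h0)]"
     if y: "y\<in>cK" for y
     using y h h0 bK t by (simp add: mu_aug m_lcomm)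
   qed (use augH h h0 bK in auto)
   have tre: "tr (z\<otimes>?b h0)\<otimes>tr (w\<otimes>(?b h\<otimes>(v y\<ominus>y))) = tr (z\<otimes>?b h)\<otimes>tr (w\<otimes>(?b h0\<otimes>(v y\<ominus>y)))"
    if zwy: "z\<in>cK" "w\<in>cK" "y\<in>cK" for z w y
    using tensor_eq_single[OF te trace_bilinear[OF zwy(1) mu_functional[OF zwy(2,3)]]] zwy h h0 bK t augH
    by (simp add: mu_aug)
   obtain y where y: "y\<in>cK" "v y ~= y"
    using aut_eqI[OF t G.one_closed] t1 one_apply by metis
   define d where "d = v y\<ominus>y"
   have dU: "?b h0\<otimes>d\<in>Units K"
    using y t h0 bK[OF h0(1)] b0U by (intro Units_m_closed) (auto simp: d_def field_Units)
   have dK: "d\<in>cK" using y t by (simp add: d_def)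
   \<comment> \<open>Chosen so that \<open>w\<close> times \<open>?b h0 \<otimes> d\<close> has
     trace one; then \<open>tre\<close> exhibits the ratio of \<open>?b h\<close> and
     \<open>?b h0\<close> as the trace \<open>s\<close>.\<close>
   define w where "w = tt\<otimes>inv (?b h0\<otimes>d)"
   have wK: "w\<in>cK" using tt dU by (simp add: w_def)
   have w1: "w\<otimes>(?b h0\<otimes>d) = tt"
    unfolding w_def m_assoc[OF tt(1) Units_inv_closed[OF dU] Units_closed[OF dU]] Units_l_inv[OF dU] using tt by simp
   define s where "s = tr (w\<otimes>(?b h\<otimes>d))"
   have sk: "s\<in>k" unfolding s_def using wK dK bK[OF h] by (intro tr_k) simp
   have "?b h = s\<otimes>?b h0"
   proof (rule trace_determines)
    fix z assume z: "z\<in>cK"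
    have "tr (z\<otimes>?b h) = tr (z\<otimes>?b h0)\<otimes>s"
     using tre[OF z wK y(1)] z bK[OF h] tt unfolding d_def[symmetric] w1 s_def by simp
    also have "... = tr (s\<otimes>(z\<otimes>?b h0))"
     using z h0 bK k_closed[OF sk] by (simp add: tr_smult[OF sk] m_comm)
    also have "s\<otimes>(z\<otimes>?b h0) = z\<otimes>(s\<otimes>?b h0)" using z h0 bK k_closed[OF sk] by (simp add: m_lcomm)
    finally show "tr (z\<otimes>?b h) = tr (z\<otimes>(s\<otimes>?b h0))" .
   qed (use bK h h0 k_closed[OF sk] in auto)
   thus ?thesis using sk by blast
  qed
  hence "\<forall>h\<in>cH. \<exists>s. s\<in>k \<and> ?b h = s\<otimes>?b h0" by blast
  then obtain s where s: "!!h. h\<in>cH ==> s h\<in>k" "!!h. h\<in>cH ==> ?b h = s h\<otimes>?b h0"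
   using bchoice[of "cH" "\<lambda>h s. s\<in>k \<and> ?b h = s\<otimes>?b h0"] by blast
  note m = comul_mem[OF h0(1)]
  define Q where "Q = list_sum K (\<lambda>p. s (fst p)\<otimes>s (snd p)) (comul H h0)"
  have sK: "s h\<in>cK" if "h\<in>cH" for h using s(1)[OF that] k_closed by blast
  have QK: "Q\<in>cK" unfolding Q_def using m sK by (intro ls_closed) auto
  have "Q\<in>k"
  proof -
   have lk: "list_sum K f xs\<in>k" if "!!x. x\<in>set xs ==> f x\<in>k" for f and xs :: "('h\<times>'h) list"
    using that subringE(7)[OF subfieldE(1)[OF subfield_fixed]] zero_F_k unfolding fixG by (induction xs) auto
   show ?thesis unfolding Q_def by (intro lk k_mult s(1)) (use m in auto)
  qed
  have "?b h0 = list_sum K (\<lambda>p. ?b (fst p)\<otimes>?b (snd p)) (comul H h0)" using cc_comul[OF h0(1) t t] by simp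
  also have "... = list_sum K (\<lambda>p. (s (fst p)\<otimes>s (snd p))\<otimes>(?b h0\<otimes>?b h0)) (comul H h0)"
  proof (rule ls_cong)
   fix p assume p: "p\<in>set (comul H h0)"
   show "?b (fst p)\<otimes>?b (snd p) = (s (fst p)\<otimes>s (snd p))\<otimes>(?b h0\<otimes>?b h0)"
    using s(2)[of "fst p"] s(2)[of "snd p"] m[OF p] sK[of "fst p"] sK[of "snd p"] bK[OF h0(1)] by (simp add: m_ac)
  qed
  also have "... = Q\<otimes>(?b h0\<otimes>?b h0)"
   unfolding Q_def using m sK bK[OF h0(1)] by (intro ls_ldistr[symmetric]) auto
  finally have e: "?b h0 = (Q\<otimes>?b h0)\<otimes>?b h0" using QK bK[OF h0(1)] by (simp add: m_assoc)
  hence "?b h0\<otimes>inv (?b h0) = ((Q\<otimes>?b h0)\<otimes>?b h0)\<otimes>inv (?b h0)" by simp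
  hence "Q\<otimes>?b h0 = \<one>" using QK bK[OF h0(1)] b0U by (simp add: m_assoc Units_r_inv)
  moreover have "Q ~= \<zero>" using calculation bK[OF h0(1)] by auto
  ultimately have "?b h0 = inv Q" using comm_inv_char[OF QK bK[OF h0(1)]] by simp
  hence "?b h0\<in>k"
   using subfield_m_inv(1)[OF subfield_fixed, of Q] \<open>Q\<in>k\<close> \<open>Q ~= \<zero>\<close> unfolding fixG by simp
  thus ?thesis using s(1)[OF h] s(2)[OF h] k_mult by simp
 qed
 have "cc h \<one>\<^bsub>G\<^esub> = counit H h\<ominus>?b h"
  using eps[OF h] h bK[OF h] by (simp add: a_minus_def a_assoc r_neg)
 moreover have "counit H h\<ominus>?b h\<in>k"
  using counit_k[OF h] all[OF h] subringE(5,7)[OF subfieldE(1)[OF subfield_fixed]] unfolding fixG a_minus_def by blast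
 ultimately show ?thesis using all[OF h] u G2 by auto
qed

definition "ph h = (\<lambda>t\<in>cG. cc h t)"

lemma ph_apply [simp]: "t\<in>cG ==> ph h t = cc h t" by (simp add: ph_def)

text \<open>With all coefficients in \<open>k\<close>, taking coefficients is a map into the group
  algebra over \<open>k\<close>. Its surjectivity and injectivity come from the two halves of the
  Hopf Galois condition.\<close>

lemma classical_isomorphic:
 assumes ck: "!!h t. h\<in>cH ==> t\<in>cG ==> cc h t\<in>k"
 shows "hopf_galois_isomorphic K k cK (H, \<mu>) (classical_structure K k)"
proof -
 let ?H = "fst (classical_structure K k)"
 interpret CR: hopf_record K "cG" G triv_act triv_cl triv_cl ?H "snd (classical_structure K k)"
  by (rule classical_record)
 have phI [simp]: "ph h\<in>C.Inv" if "h\<in>cH" for h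
  unfolding Inv_classical ph_def using ck[OF that] by auto
 have mu_ph: "C.mu (ph h) x = \<mu> h x" if "h\<in>cH" "x\<in>cK" for h x
  unfolding C.mu_def mu_expand[OF that] using that by (intro fs_cong) (auto simp: triv_cl_def)
 have Inv_eq: "a = b" if ab: "a\<in>C.Inv" "b\<in>C.Inv" and eq: "!!x. x\<in>cK ==> C.mu a x = C.mu b x" for a b
 proof (rule C.Inv_ext[OF ab])
  show "a t = b t" if "t\<in>cG" for t
   using eq ab that by (intro coeffs_unique[of a b]) (auto simp: C.mu_def triv_cl_def)
 qed
 have add: "ph (h\<oplus>\<^bsub>H\<^esub> h') = C.adds (ph h) (ph h')" if "h\<in>cH" "h'\<in>cH" for h h'
  using that by (intro C.Inv_ext) (auto simp: cc_add)
 have smult: "ph (c\<odot>\<^bsub>H\<^esub> h) = C.scal c (ph h)" if "c\<in>k" "h\<in>cH" for c h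
  using that fixG HM.smult_closed[of c h] by (intro C.Inv_ext) (auto simp: cc_smult)
 have mult: "ph (h\<otimes>\<^bsub>H\<^esub> h') = C.conv (ph h) (ph h')" if "h\<in>cH" "h'\<in>cH" for h h'
  using that by (intro Inv_eq) (simp_all add: mu_ph mu_H_mult C.mu_conv C_L)
 have one: "ph \<one>\<^bsub>H\<^esub> = C.unit"
  by (intro Inv_eq) (simp_all add: mu_ph mu_H_one C.mu_unit C_L)
 have lin: "linear_map RK H ?H ph"
  unfolding linear_map_def using add smult fixG by auto
 have hom: "ph\<in>ring_hom H ?H"
  by (rule ring_hom_memI) (auto simp: add mult one)
 have cnt: "counit ?H (ph h) = counit H h" if h: "h\<in>cH" for h
 proof -
  have "(\<Oplus>t\<in>cG. ph h t) = (\<Oplus>t\<in>cG. cc h t)" using h by (intro fs_cong) auto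
  thus ?thesis using h by (simp add: cc_sum)
 qed
 have com: "tensor_eq RK ?H ?H (map (map_prod ph ph) (comul H h)) (comul ?H (ph h))" if h: "h\<in>cH" for h
 proof -
  note m = comul_mem[OF h]
  have "tensor_eq CR.RF ?H ?H (map (map_prod ph ph) (comul H h)) (comul ?H (ph h))"
  proof (rule CR.tensor_eqI)
   show "set (map (map_prod ph ph) (comul H h)) \<subseteq> C.Inv\<times>C.Inv" using m by auto
   show "set (comul ?H (ph h)) \<subseteq> C.Inv\<times>C.Inv" using h by (intro CR.comul_set) simp
   fix w v assume e: "w\<in>cG" "v\<in>cG"
   have "CR.coef2 (map (map_prod ph ph) (comul H h)) w v = list_sum K (\<lambda>p. cc (fst p) w\<otimes>cc (snd p) v) (comul H h)"
    using e by (simp add: CR.coef2_def)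
   also have "... = CR.coef2 (comul ?H (ph h)) w v"
    using e h by (simp add: cc_comul CR.coef2_comul)
   finally show "CR.coef2 (map (map_prod ph ph) (comul H h)) w v = CR.coef2 (comul ?H (ph h)) w v" .
  qed
  thus ?thesis by (simp add: fixG)
 qed
 have surj: "\<exists>h\<in>cH. ph h = b" if b: "b\<in>C.Inv" for b
 proof -
  have bk: "b t\<in>k" if "t\<in>cG" for t using b that by (auto simp: Inv_classical)
  have "linear_map RK LK LK (C.mu b)"
   unfolding linear_map_def using b k_closed
   by (auto simp: ring_as_module_def C.mu_add C.mu_scal[unfolded fixG])
  then obtain ts where ts: "set ts \<subseteq> cK\<times>cH"
    "!!y. y\<in>cK ==> C.mu b y = list_sum K (\<lambda>(x, h). x\<otimes>\<mu> h y) ts" using mu_surj by blast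
  have m: "fst p\<in>cK" "snd p\<in>cH" if "p\<in>set ts" for p using ts(1) that by auto
  have bs: "b t = list_sum K (\<lambda>p. fst p\<otimes>cc (snd p) t) ts" if t: "t\<in>cG" for t
  proof (rule coeffs_unique[where d="\<lambda>t. list_sum K (\<lambda>p. fst p\<otimes>cc (snd p) t) ts"])
   fix y assume y: "y\<in>cK"
   have "list_sum K (\<lambda>(x, h). x\<otimes>\<mu> h y) ts = list_sum K (\<lambda>p. \<Oplus>t\<in>cG. (fst p\<otimes>cc (snd p) t)\<otimes>t y) ts"
   proof (rule ls_cong)
    fix p assume p: "p\<in>set ts"
    show "(case p of (x, h) => x\<otimes>\<mu> h y) = (\<Oplus>t\<in>cG. (fst p\<otimes>cc (snd p) t)\<otimes>t y)"
     using m[OF p] y by (simp add: case_prod_unfold mu_expand fs_rdistr finG) (auto simp: m_assoc intro!: fs_cong)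
   qed
   also have "... = (\<Oplus>t\<in>cG. list_sum K (\<lambda>p. (fst p\<otimes>cc (snd p) t)\<otimes>t y) ts)"
    using m y by (intro ls_finsum finG) auto
   also have "... = (\<Oplus>t\<in>cG. list_sum K (\<lambda>p. fst p\<otimes>cc (snd p) t) ts\<otimes>t y)"
    using m y by (intro fs_cong ls_ldistr[symmetric]) auto
   finally show "(\<Oplus>t\<in>cG. b t\<otimes>t y) = (\<Oplus>t\<in>cG. list_sum K (\<lambda>p. fst p\<otimes>cc (snd p) t) ts\<otimes>t y)"
    using ts(2)[OF y] by (simp add: C.mu_def triv_cl_def)
  qed (use t b m in \<open>auto intro!: ls_closed\<close>)
  \<comment> \<open>An operator from the group algebra is a combination of the
    \<open>\<mu> h\<close> with coefficients in \<open>K\<close>. The map sending \<open>x\<close>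
    to \<open>tr (tt \<otimes> x)\<close> brings these into \<open>k\<close>, and it leaves the
    values \<open>b t\<close> unchanged since they already lie there.\<close>
  have ind: "list_sum H (\<lambda>p. tr (tt\<otimes>fst p)\<odot>\<^bsub>H\<^esub> snd p) us\<in>cH \<and>
    (\<forall>t\<in>cG. cc (list_sum H (\<lambda>p. tr (tt\<otimes>fst p)\<odot>\<^bsub>H\<^esub> snd p) us) t = tr (tt\<otimes>list_sum K (\<lambda>p. fst p\<otimes>cc (snd p) t) us))"
   if "\<forall>p\<in>set us. fst p\<in>cK \<and> snd p\<in>cH" for us
   using that
  proof (induction us)
   case Nil
   have "cc \<zero>\<^bsub>H\<^esub> t = \<zero>" if "t\<in>cG" for t
    using cc_smult[OF zero_F_k HR.zero_closed that] that HM.smult_l_null[of "\<zero>\<^bsub>H\<^esub>"] by simp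
   moreover have "tr (tt\<otimes>\<zero>) = \<zero>" using tr_smult[OF zero_F_k tt(1)] tt by simp
   ultimately show ?case by simp
  next
   case (Cons p us)
   let ?l = "list_sum H (\<lambda>p. tr (tt\<otimes>fst p)\<odot>\<^bsub>H\<^esub> snd p) us"
   have p: "fst p\<in>cK" "snd p\<in>cH" and l: "?l\<in>cH" using Cons by auto
   have tk: "tr (tt\<otimes>fst p)\<in>k" using p tt by (intro tr_k) simp
   have sH: "tr (tt\<otimes>fst p)\<odot>\<^bsub>H\<^esub> snd p\<in>cH" using HM.smult_closed[of "tr (tt\<otimes>fst p)" "snd p"] tk p by simp
   have "cc (tr (tt\<otimes>fst p)\<odot>\<^bsub>H\<^esub> snd p\<oplus>\<^bsub>H\<^esub> ?l) t =
     tr (tt\<otimes>list_sum K (\<lambda>p. fst p\<otimes>cc (snd p) t) (p # us))" if t: "t\<in>cG" for t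
   proof -
    have lc: "list_sum K (\<lambda>p. fst p\<otimes>cc (snd p) t) us\<in>cK" using Cons.prems t by (intro ls_closed) auto
    have "cc (snd p) t\<otimes>tr (tt\<otimes>fst p) = tr (tt\<otimes>(fst p\<otimes>cc (snd p) t))"
     using tr_smult[OF ck[OF p(2) t], of "tt\<otimes>fst p"] p tt t by (simp add: m_ac)
    hence "tr (tt\<otimes>fst p)\<otimes>cc (snd p) t = tr (tt\<otimes>(fst p\<otimes>cc (snd p) t))"
     using p tt t by (simp add: m_comm)
    thus ?thesis
     using p tt t sH l lc Cons by (simp add: cc_add cc_smult[OF tk] r_distr tr_add)
   qed
   thus ?case using sH l by simp
  qed
  let ?h = "list_sum H (\<lambda>p. tr (tt\<otimes>fst p)\<odot>\<^bsub>H\<^esub> snd p) ts"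
  have h: "?h\<in>cH" "!!t. t\<in>cG ==> cc ?h t = tr (tt\<otimes>b t)" using ind[of ts] m bs by auto
  have "ph ?h = b"
  proof (rule C.Inv_ext)
   fix t assume t: "t\<in>cG"
   have "tr (tt\<otimes>b t) = b t" using tr_smult[OF bk[OF t] tt(1)] tt k_closed[OF bk[OF t]] by (simp add: m_comm)
   thus "ph ?h t = b t" using h t by simp
  qed (use h b in auto)
  thus ?thesis using h by blast
 qed
 have inj: "h = h'" if h: "h\<in>cH" "h'\<in>cH" and eq: "ph h = ph h'" for h h'
 proof (rule ccontr)
  assume ne: "h ~= h'"
  let ?d = "h\<ominus>\<^bsub>H\<^esub> h'"
  have d: "?d\<in>cH" "?d ~= \<zero>\<^bsub>H\<^esub>" using h ne by auto
  have hd: "h = ?d\<oplus>\<^bsub>H\<^esub> h'" using h by (simp add: HR.minus_eq HR.a_assoc HR.l_neg)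
  have "field RK" using hopf by (rule cocommutative_hopf_algebra.axioms(1))
  then obtain g where g: "linear_map RK H (ring_as_module RK) g" "g ?d = \<one>"
   using HM.separating_functional[OF _ fd d] by auto
  have gk: "g x\<in>cK" if "x\<in>cH" for x
   using g(1) that k_closed by (auto simp: linear_map_def ring_as_module_def)
  \<comment> \<open>Elements with equal coefficients act equally, so \<open>mu_inj\<close> equates
    the tensors; the form \<open>g\<close>, with value one on the difference, contradicts
    this.\<close>
  have te: "tensor_eq RK LK H [(\<one>, h)] [(\<one>, h')]"
  proof (rule mu_inj)
   show "list_sum K (\<lambda>(x, h). x\<otimes>\<mu> h y) [(\<one>, h)] = list_sum K (\<lambda>(x, h). x\<otimes>\<mu> h y) [(\<one>, h')]"
    if y: "y\<in>cK" for y using mu_ph[OF h(1) y] mu_ph[OF h(2) y] eq by simp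
  qed (use h in auto)
  have "tr (tt\<otimes>\<one>)\<otimes>g h = tr (tt\<otimes>\<one>)\<otimes>g h'"
   using tensor_eq_single[OF te trace_bilinear[OF tt(1) g(1)]] gk h tt by simp
  hence "g h = g h'" using tt gk h by simp
  moreover have "g (?d\<oplus>\<^bsub>H\<^esub> h') = g ?d\<oplus>g h'" using g(1) d h by (simp add: linear_map_def ring_as_module_def)
  ultimately have "g h' = \<one>\<oplus>g h'" using hd g(2) by simp
  hence "\<one> = \<zero>" using gk[OF h(2)] add.r_cancel_one'[of "g h'" \<one>] by simp
  thus False by simp
 qed
 have "b\<in>ph ` cH" if "b\<in>C.Inv" for b using surj[OF that] by (metis image_eqI)
 hence "bij_betw ph cH (carrier ?H)"
  unfolding bij_betw_def inj_on_def using inj phI by auto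
 hence "hopf_galois_isomorphic K k cK (H, \<mu>) (?H, snd (classical_structure K k))"
  unfolding hopf_galois_isomorphic_def Let_def prod.case
  using lin hom com cnt mu_ph by (intro exI[of _ ph]) (auto simp: C_L)
 thus ?thesis by simp
qed

end

section \<open>Normal complements and induced structures\<close>

locale group_complement = group G for G (structure) +
 fixes G' M :: "'a set"
 assumes nc: "normal_complement G G' M"
begin

lemma sG: "subgroup G' G" and nM: "M \<lhd> G" and int: "M \<inter> G' = {\<one>}" and prod: "M <#> G' = cG"
 using nc by (auto simp: normal_complement_def)

lemma sM: "subgroup M G" using nM by (rule normal_imp_subgroup)

lemma M_closed [simp]: "m\<in>M ==> m\<in>cG" using subgroup.mem_carrier[OF sM] .
lemma G'_closed [simp]: "y\<in>G' ==> y\<in>cG" using subgroup.mem_carrier[OF sG] .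
lemma M_ops [simp]: "m\<in>M ==> n\<in>M ==> m\<otimes>n\<in>M" "m\<in>M ==> inv m\<in>M" "\<one>\<in>M"
 using subgroup.m_closed[OF sM] subgroup.m_inv_closed[OF sM] subgroup.one_closed[OF sM] by auto
lemma G'_ops [simp]: "x\<in>G' ==> y\<in>G' ==> x\<otimes>y\<in>G'" "y\<in>G' ==> inv y\<in>G'" "\<one>\<in>G'"
 using subgroup.m_closed[OF sG] subgroup.m_inv_closed[OF sG] subgroup.one_closed[OF sG] by auto
lemma M_conj [simp]: "g\<in>cG ==> m\<in>M ==> g\<otimes>m\<otimes>inv g\<in>M"
 using normal_invE(2)[OF nM] .

lemma decompose: "g\<in>cG ==> \<exists>h\<in>M. \<exists>y\<in>G'. g = h\<otimes>y"
 using prod unfolding set_mult_def by blast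

lemma decompose_unique:
 assumes "h\<in>M" "h'\<in>M" "y\<in>G'" "y'\<in>G'" "h\<otimes>y = h'\<otimes>y'"
 shows "h = h' \<and> y = y'"
proof -
 have "inv h'\<otimes>h = inv h'\<otimes>(h\<otimes>y)\<otimes>inv y" using assms(1-4) by (simp add: m_assoc)
 also have "... = inv h'\<otimes>(h'\<otimes>y')\<otimes>inv y" by (simp only: assms(5))
 also have "... = y'\<otimes>inv y" using assms(1-4) by (simp add: m_assoc[symmetric])
 finally have e: "inv h'\<otimes>h = y'\<otimes>inv y" .
 have "inv h'\<otimes>h\<in>M \<inter> G'" using assms by (intro IntI) (simp, simp add: e)
 hence "inv h'\<otimes>h = \<one>" unfolding int by simp
 hence hh: "h = h'" using assms inv_solve_left'[of "\<one>" h' h] by simp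
 thus ?thesis using assms(5) assms by simp
qed

lemma lcos_G': "h\<in>cG ==> y\<in>G' ==> (h\<otimes>y) <# G' = h <# G'"
 using l_repr_independence[of "h\<otimes>y" h G'] sG by (auto simp: l_coset_def)

lemma lcos_memb: "h\<in>M ==> x\<in>M ==> x\<in>h <# G' ==> x = h"
 using decompose_unique[of x h \<one>] by (auto simp: l_coset_def)

lemma lcos_inj: "h\<in>M ==> x\<in>M ==> x <# G' = h <# G' ==> x = h"
 using lcos_memb[of h x] lcos_self[OF _ sG, of x] by simp

lemma lcosets_cases: "C\<in>lcosets G' ==> \<exists>h\<in>M. C = h <# G'"
proof -
 assume "C\<in>lcosets G'"
 then obtain g where g: "g\<in>cG" "C = g <# G'" by (auto simp: LCOSETS_def)
 obtain h y where hy: "h\<in>M" "y\<in>G'" "g = h\<otimes>y" using decompose[OF g(1)] by blast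
 hence "C = h <# G'" using g(2) lcos_G' by simp
 thus ?thesis using hy(1) by blast
qed

lemma lcos_mem [simp]: "g\<in>cG ==> g <# G'\<in>lcosets G'" by (auto simp: LCOSETS_def)

definition "mrep C = (THE h. h\<in>M \<and> h\<in>C)"

lemma mrep [simp]: "h\<in>M ==> mrep (h <# G') = h"
 unfolding mrep_def using lcos_memb lcos_self[OF _ sG, of h] by (intro the_equality) auto

text \<open>Right translation by the inverse of \<open>m\<close>, in the coordinate that labels each
  coset by its representative in \<open>M\<close>.\<close>

definition "eta m = (\<lambda>C\<in>lcosets G'. (mrep C\<otimes>inv m) <# G')"

lemma eta_apply [simp]: "h\<in>M ==> eta m (h <# G') = (h\<otimes>inv m) <# G'"
 by (simp add: eta_def)

lemma Bij_cosetI: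
 assumes "f\<in>extensional (lcosets G')" "!!h. h\<in>M ==> f (h <# G') = p h <# G'" "!!h. h\<in>M ==> p h\<in>M"
  "!!h. h\<in>M ==> q h\<in>M" "!!h. h\<in>M ==> p (q h) = h" "!!h. h\<in>M ==> q (p h) = h"
 shows "f\<in>Bij (lcosets G')"
proof -
 have "bij_betw f (lcosets G') (lcosets G')"
 proof (rule bij_betwI[where g="\<lambda>C. q (mrep C) <# G'"])
  show "f\<in>lcosets G' \<rightarrow> lcosets G'" using lcosets_cases assms(2,3) by fastforce
  show "(\<lambda>C. q (mrep C) <# G')\<in>lcosets G' \<rightarrow> lcosets G'" using lcosets_cases assms(4) by fastforce
  show "q (mrep (f C)) <# G' = C" if "C\<in>lcosets G'" for C using lcosets_cases[OF that] assms by auto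
  show "f (q (mrep C) <# G') = C" if "C\<in>lcosets G'" for C using lcosets_cases[OF that] assms by auto
 qed
 thus ?thesis using assms(1) by (simp add: Bij_def)
qed

lemma eta_Bij: "m\<in>M ==> eta m\<in>Bij (lcosets G')"
 by (rule Bij_cosetI[where p="\<lambda>h. h\<otimes>inv m" and q="\<lambda>h. h\<otimes>m"]) (auto simp: eta_def m_assoc)

lemma eq_on_cosets:
 assumes "f\<in>Bij (lcosets G')" "g\<in>Bij (lcosets G')" "!!h. h\<in>M ==> f (h <# G') = g (h <# G')"
 shows "f = g"
 using lcosets_cases assms(3) by (intro Bij_ext[OF assms(1,2)]) metis

lemma eta_mult: "m\<in>M ==> n\<in>M ==> eta (m\<otimes>n) = eta m\<otimes>\<^bsub>BijGroup (lcosets G')\<^esub> eta n"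
 by (intro eq_on_cosets eta_Bij mult_Bij)
  (simp_all add: BijGroup_mult_apply[OF eta_Bij eta_Bij] inv_mult_group m_assoc)

lemma eta_subgroup: "subgroup (eta ` M) (BijGroup (lcosets G'))"
proof -
 interpret MM: group "G\<lparr>carrier := M\<rparr>" by (rule subgroup.subgroup_is_group[OF sM is_group])
 have "group_hom (G\<lparr>carrier := M\<rparr>) (BijGroup (lcosets G')) eta"
  by (intro group_hom.intro group_hom_axioms.intro homI MM.is_group group_BijGroup)
   (auto simp: carrier_BijGroup eta_Bij eta_mult)
 thus ?thesis using group_hom.img_is_subgroup by fastforce
qed

lemma translation_apply:
 "n\<in>M ==> w\<in>G' ==> h\<in>M ==> coset_translation G G' (n\<otimes>w) (h <# G') = (n\<otimes>(w\<otimes>h\<otimes>inv w)) <# G'"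
proof -
 assume h: "n\<in>M" "w\<in>G'" "h\<in>M"
 have "coset_translation G G' (n\<otimes>w) (h <# G') = (n\<otimes>w\<otimes>h) <# G'"
  using h by (simp add: coset_translation_def lcos_m_assoc subgroup.subset[OF sG])
 also have "n\<otimes>w\<otimes>h = (n\<otimes>(w\<otimes>h\<otimes>inv w))\<otimes>w" using h by (simp add: m_assoc)
 also have "... <# G' = (n\<otimes>(w\<otimes>h\<otimes>inv w)) <# G'" using h by (intro lcos_G') auto
 finally show ?thesis .
qed

lemma translation_apply_M: "n\<in>M ==> h\<in>M ==> coset_translation G G' n (h <# G') = (n\<otimes>h) <# G'"
 using translation_apply[of n \<one> h] by simp

text \<open>A permutation commuting with all left translations by \<open>M\<close> is determined by
  the image of the base coset; the right translations of \<open>M\<close> already realise every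
  possible image.\<close>

lemma almost_classical_eq: "almost_classical_subgroup G G' M = eta ` M"
proof (intro subset_antisym subsetI)
 fix f assume f: "f\<in>almost_classical_subgroup G G' M"
 hence fB: "f\<in>Bij (lcosets G')"
  and fc: "!!m. m\<in>M ==> f\<otimes>\<^bsub>BijGroup (lcosets G')\<^esub> coset_translation G G' m = coset_translation G G' m\<otimes>\<^bsub>BijGroup (lcosets G')\<^esub> f"
  by (auto simp: almost_classical_subgroup_def)
 obtain c where c: "c\<in>M" "f (\<one> <# G') = c <# G'"
  using lcosets_cases[OF Bij_closed[OF fB lcos_mem[OF one_closed]]] by blast
 have "f = eta (inv c)"
 proof (rule eq_on_cosets[OF fB eta_Bij])
  fix h assume h: "h\<in>M"
  have tB: "coset_translation G G' h\<in>Bij (lcosets G')" using h by (intro coset_translation_Bij sG) simp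
  have "f (h <# G') = f (coset_translation G G' h (\<one> <# G'))" using h translation_apply_M[of h \<one>] by simp
  also have "... = coset_translation G G' h (f (\<one> <# G'))"
   using fun_cong[OF fc[OF h], of "\<one> <# G'"] by (simp add: BijGroup_mult_apply[OF fB tB] BijGroup_mult_apply[OF tB fB])
  also have "... = eta (inv c) (h <# G')" using h c by (simp add: translation_apply_M)
  finally show "f (h <# G') = eta (inv c) (h <# G')" .
 qed (use c in simp)
 thus "f\<in>eta ` M" using c by auto
next
 fix f assume "f\<in>eta ` M"
 then obtain m where m: "m\<in>M" "f = eta m" by blast
 have "f\<otimes>\<^bsub>BijGroup (lcosets G')\<^esub> coset_translation G G' n = coset_translation G G' n\<otimes>\<^bsub>BijGroup (lcosets G')\<^esub> f"
  if n: "n\<in>M" for n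
 proof -
  have tB: "coset_translation G G' n\<in>Bij (lcosets G')" using n by (intro coset_translation_Bij sG) simp
  show ?thesis unfolding m(2)
   using m n eta_Bij[OF m(1)] tB
   by (intro eq_on_cosets mult_Bij)
    (simp_all add: BijGroup_mult_apply[OF eta_Bij[OF m(1)] tB] BijGroup_mult_apply[OF tB eta_Bij[OF m(1)]] translation_apply_M m_assoc)
 qed
 thus "f\<in>almost_classical_subgroup G G' M"
  using m eta_Bij by (auto simp: almost_classical_subgroup_def)
qed

text \<open>Left translation by \<open>M\<close> centralises \<open>eta m\<close>, while the part
  \<open>w\<close> of \<open>g\<close> in \<open>G'\<close> acts on \<open>M\<close> by conjugation;
  so \<open>eta m\<close> goes to \<open>eta (w \<otimes> m \<otimes> inv w)\<close>.\<close>

lemma almost_classical_gp: "gp_subgroup G (lcosets G') (coset_translation G G') (eta ` M)"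
 unfolding gp_subgroup_def regular_subgroup_def
proof (intro conjI ballI eta_subgroup)
 fix C D assume "C\<in>lcosets G'" "D\<in>lcosets G'"
 then obtain h n where hn: "h\<in>M" "C = h <# G'" "n\<in>M" "D = n <# G'" using lcosets_cases by metis
 show "\<exists>!f. f\<in>eta ` M \<and> f C = D"
 proof (rule ex1I[of _ "eta (inv n\<otimes>h)"])
  show "eta (inv n\<otimes>h)\<in>eta ` M \<and> eta (inv n\<otimes>h) C = D"
   using hn by (intro conjI imageI) (simp_all add: inv_mult_group m_assoc[symmetric])
  fix f assume "f\<in>eta ` M \<and> f C = D"
  then obtain m where m: "m\<in>M" "f = eta m" "(h\<otimes>inv m) <# G' = n <# G'" using hn by auto
  hence "h\<otimes>inv m = n" using hn by (intro lcos_inj) auto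
  hence "inv n\<otimes>h = m" using m hn by (simp add: inv_mult_group m_assoc flip: \<open>h\<otimes>inv m = n\<close>)
  thus "f = eta (inv n\<otimes>h)" using m by simp
 qed
next
 fix g f assume g: "g\<in>cG" and "f\<in>eta ` M"
 then obtain m where m: "m\<in>M" "f = eta m" by blast
 obtain n w where nw: "n\<in>M" "w\<in>G'" "g = n\<otimes>w" using decompose[OF g] by blast
 have tB: "coset_translation G G' g\<in>Bij (lcosets G')" using g by (intro coset_translation_Bij sG)
 have "perm_conj (lcosets G') (coset_translation G G' g) (eta m) = eta (w\<otimes>m\<otimes>inv w)"
 proof (rule eq_on_cosets[OF perm_conj_Bij[OF tB eta_Bij[OF m(1)]] eta_Bij])
  fix x assume x: "x\<in>M"
  \<comment> \<open>Left translation by \<open>g\<close> moves the coset of \<open>h\<close> to that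
    of \<open>x\<close>.\<close>
  define h where "h = inv w\<otimes>(inv n\<otimes>x)\<otimes>w"
  have h: "h\<in>M" using M_conj[of "inv w" "inv n\<otimes>x"] x nw by (simp add: h_def)
  have xh: "n\<otimes>(w\<otimes>h\<otimes>inv w) = x" using x nw by (simp add: h_def m_assoc[symmetric]) (simp add: m_assoc)
  have "perm_conj (lcosets G') (coset_translation G G' g) (eta m) (coset_translation G G' g (h <# G')) =
    coset_translation G G' g (eta m (h <# G'))"
   using h by (intro perm_conj_apply tB eta_Bij m(1)) auto
  hence "perm_conj (lcosets G') (coset_translation G G' g) (eta m) (x <# G') = (n\<otimes>(w\<otimes>(h\<otimes>inv m)\<otimes>inv w)) <# G'"
   using h m nw xh by (simp add: translation_apply)
  also have "n\<otimes>(w\<otimes>(h\<otimes>inv m)\<otimes>inv w) = x\<otimes>inv (w\<otimes>m\<otimes>inv w)"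
   unfolding xh[symmetric] using h m nw by (simp add: inv_mult_group m_assoc[symmetric]) (simp add: m_assoc)
  finally show "perm_conj (lcosets G') (coset_translation G G' g) (eta m) (x <# G') = eta (w\<otimes>m\<otimes>inv w) (x <# G')"
   using x by simp
 qed (use m nw in simp)
 thus "perm_conj (lcosets G') (coset_translation G G' g) f\<in>eta ` M" using m nw by simp
qed

definition "mp g = (THE h. h\<in>M \<and> (\<exists>y\<in>G'. g = h\<otimes>y))"
definition "yp g = inv (mp g)\<otimes>g"

lemma mp_mult [simp]: "h\<in>M ==> y\<in>G' ==> mp (h\<otimes>y) = h"
 unfolding mp_def using decompose_unique by (intro the_equality) blast+

lemma yp_mult [simp]: "h\<in>M ==> y\<in>G' ==> yp (h\<otimes>y) = y"
 unfolding yp_def by (simp add: m_assoc[symmetric])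

text \<open>Right translation by the inverses of \<open>m\<close> on \<open>M\<close> and of
  \<open>z\<close> on \<open>G'\<close>, factor by factor. In general this is not a right
  translation of \<open>G\<close>.\<close>

definition "iot m z = (\<lambda>g\<in>cG. (mp g\<otimes>inv m)\<otimes>(yp g\<otimes>inv z))"

lemma iot_apply: "h\<in>M ==> y\<in>G' ==> iot m z (h\<otimes>y) = (h\<otimes>inv m)\<otimes>(y\<otimes>inv z)"
 by (simp add: iot_def)

lemma iot_Bij: assumes "m\<in>M" "z\<in>G'" shows "iot m z\<in>Bij cG"
proof -
 have "bij_betw (iot m z) cG cG"
 proof (rule bij_betwI[where g="iot (inv m) (inv z)"])
  show "iot m z\<in>cG \<rightarrow> cG" "iot (inv m) (inv z)\<in>cG \<rightarrow> cG"
   using decompose assms by (fastforce simp: iot_apply)+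
  show "iot (inv m) (inv z) (iot m z g) = g" if "g\<in>cG" for g
   using decompose[OF that] assms by (auto simp: iot_apply; simp add: m_assoc)
  show "iot m z (iot (inv m) (inv z) g) = g" if "g\<in>cG" for g
   using decompose[OF that] assms by (auto simp: iot_apply; simp add: m_assoc)
 qed
 thus ?thesis by (simp add: Bij_def iot_def)
qed

lemma eq_on_products:
 assumes "f\<in>Bij cG" "g\<in>Bij cG" "!!h y. h\<in>M ==> y\<in>G' ==> f (h\<otimes>y) = g (h\<otimes>y)"
 shows "f = g"
 using decompose assms(3) by (intro Bij_ext[OF assms(1,2)]) metis

lemma iot_mult:
 "m\<in>M ==> n\<in>M ==> z\<in>G' ==> w\<in>G' ==>
  iot (m\<otimes>n) (z\<otimes>w) = iot m z\<otimes>\<^bsub>BijGroup cG\<^esub> iot n w"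
 by (intro eq_on_products iot_Bij mult_Bij)
  (simp_all add: BijGroup_mult_apply[OF iot_Bij iot_Bij] iot_apply, simp add: inv_mult_group m_assoc)

lemma iot_inj: "m\<in>M ==> n\<in>M ==> z\<in>G' ==> w\<in>G' ==> iot m z = iot n w ==> m = n \<and> z = w"
proof -
 assume h: "m\<in>M" "n\<in>M" "z\<in>G'" "w\<in>G'" "iot m z = iot n w"
 have "inv m\<otimes>inv z = inv n\<otimes>inv w" using h iot_apply[of \<one> \<one> m z] iot_apply[of \<one> \<one> n w] by simp
 hence "inv m = inv n \<and> inv z = inv w" using h by (intro decompose_unique) auto
 thus ?thesis using h by (metis M_closed G'_closed inv_inv)
qed

abbreviation "Ind \<equiv> (\<lambda>(m, z). iot m z) ` (M\<times>G')"

lemma iot_hom: "group_hom (G\<lparr>carrier := M\<rparr> \<times>\<times> G\<lparr>carrier := G'\<rparr>) (BijGroup cG) (\<lambda>(m, z). iot m z)"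
proof -
 have "group (G\<lparr>carrier := M\<rparr> \<times>\<times> G\<lparr>carrier := G'\<rparr>)"
  by (intro DirProd_group subgroup.subgroup_is_group[OF sM is_group] subgroup.subgroup_is_group[OF sG is_group])
 thus ?thesis
  by (intro group_hom.intro group_hom_axioms.intro homI group_BijGroup) (auto simp: carrier_BijGroup iot_Bij iot_mult)
qed

lemma Ind_subgroup: "subgroup Ind (BijGroup cG)"
 using group_hom.img_is_subgroup[OF iot_hom] by simp

lemma IndI: "m\<in>M ==> z\<in>G' ==> iot m z\<in>Ind" by auto

text \<open>Left translation by \<open>n \<otimes> w\<close> acts on the factor \<open>M\<close> as
  in the almost classical case and on \<open>G'\<close> as left translation by \<open>w\<close>,
  which commutes with right translations. Hence only \<open>m\<close> changes, to its conjugate by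
  \<open>w\<close>.\<close>

lemma Ind_gp: "gp_subgroup G cG (left_translation G) Ind"
 unfolding gp_subgroup_def regular_subgroup_def
proof (intro conjI ballI Ind_subgroup)
 fix a b assume "a\<in>cG" "b\<in>cG"
 then obtain h y n w where hn: "h\<in>M" "y\<in>G'" "a = h\<otimes>y" "n\<in>M" "w\<in>G'" "b = n\<otimes>w" using decompose by metis
 show "\<exists>!f. f\<in>Ind \<and> f a = b"
 proof (rule ex1I[of _ "iot (inv n\<otimes>h) (inv w\<otimes>y)"])
  show "iot (inv n\<otimes>h) (inv w\<otimes>y)\<in>Ind \<and> iot (inv n\<otimes>h) (inv w\<otimes>y) a = b"
   using hn by (intro conjI IndI) (auto simp: iot_apply inv_mult_group m_assoc[symmetric])
  fix f assume "f\<in>Ind \<and> f a = b"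
  then obtain m z where m: "m\<in>M" "z\<in>G'" "f = iot m z" "(h\<otimes>inv m)\<otimes>(y\<otimes>inv z) = n\<otimes>w" using hn by (auto simp: iot_apply)
  hence nw: "h\<otimes>inv m = n" "y\<otimes>inv z = w" using hn decompose_unique[of "h\<otimes>inv m" n "y\<otimes>inv z" w] by auto
  have "inv n\<otimes>h = m" "inv w\<otimes>y = z" using m hn by (simp_all add: inv_mult_group m_assoc flip: nw)
  thus "f = iot (inv n\<otimes>h) (inv w\<otimes>y)" using m by simp
 qed
next
 fix g f assume g: "g\<in>cG" and "f\<in>Ind"
 then obtain m z where m: "m\<in>M" "z\<in>G'" "f = iot m z" by auto
 obtain n w where nw: "n\<in>M" "w\<in>G'" "g = n\<otimes>w" using decompose[OF g] by blast
 have tB: "left_translation G g\<in>Bij cG" using left_translation_Bij[OF is_group g] .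
 have lt: "left_translation G g (h\<otimes>y) = (n\<otimes>(w\<otimes>h\<otimes>inv w))\<otimes>(w\<otimes>y)" if "h\<in>M" "y\<in>G'" for h y
  using that nw by (simp add: left_translation_def m_assoc[symmetric]) (simp add: m_assoc)
 have "perm_conj cG (left_translation G g) (iot m z) = iot (w\<otimes>m\<otimes>inv w) z"
 proof (rule eq_on_products[OF perm_conj_Bij[OF tB iot_Bij[OF m(1,2)]] iot_Bij])
  fix x v assume x: "x\<in>M" "v\<in>G'"
  define h where "h = inv w\<otimes>(inv n\<otimes>x)\<otimes>w"
  have h: "h\<in>M" using M_conj[of "inv w" "inv n\<otimes>x"] x nw by (simp add: h_def)
  have xh: "n\<otimes>(w\<otimes>h\<otimes>inv w) = x" using x nw by (simp add: h_def m_assoc[symmetric]) (simp add: m_assoc)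
  have vh: "w\<otimes>(inv w\<otimes>v) = v" using x nw by (simp add: m_assoc[symmetric])
  have "perm_conj cG (left_translation G g) (iot m z) (left_translation G g (h\<otimes>(inv w\<otimes>v))) =
    left_translation G g (iot m z (h\<otimes>(inv w\<otimes>v)))"
   using h x nw by (intro perm_conj_apply tB iot_Bij m(1,2)) auto
  hence "perm_conj cG (left_translation G g) (iot m z) (x\<otimes>v) =
    (n\<otimes>(w\<otimes>(h\<otimes>inv m)\<otimes>inv w))\<otimes>(w\<otimes>(inv w\<otimes>v\<otimes>inv z))"
   using h m(1,2) nw(1,2) x by (simp add: lt iot_apply xh vh)
  also have "n\<otimes>(w\<otimes>(h\<otimes>inv m)\<otimes>inv w) = x\<otimes>inv (w\<otimes>m\<otimes>inv w)"
   unfolding xh[symmetric] using h m nw by (simp add: inv_mult_group m_assoc[symmetric]) (simp add: m_assoc)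
  also have "w\<otimes>(inv w\<otimes>v\<otimes>inv z) = v\<otimes>inv z" using x nw m by (simp add: m_assoc[symmetric])
  finally show "perm_conj cG (left_translation G g) (iot m z) (x\<otimes>v) = iot (w\<otimes>m\<otimes>inv w) z (x\<otimes>v)"
   using x by (simp add: iot_apply)
 qed (use m nw in simp_all)
 thus "perm_conj cG (left_translation G g) f\<in>Ind" using m nw by auto
qed

lemma coset_pair_apply: "h\<in>M ==> coset_pair G M (h <# G', y) = h\<otimes>y"
 using mrep by (simp add: coset_pair_def mrep_def)

lemma inv_coset_pair:
 assumes "h\<in>M" "y\<in>G'"
 shows "inv_into ((lcosets G')\<times>G') (coset_pair G M) (h\<otimes>y) = (h <# G', y)"
proof -
 have "inj_on (coset_pair G M) ((lcosets G')\<times>G')"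
 proof (rule inj_onI, clarify)
  fix C y D z assume a: "C\<in>lcosets G'" "y\<in>G'" "D\<in>lcosets G'" "z\<in>G'" "coset_pair G M (C, y) = coset_pair G M (D, z)"
  obtain h n where hn: "h\<in>M" "C = h <# G'" "n\<in>M" "D = n <# G'" using lcosets_cases a by metis
  hence "h\<otimes>y = n\<otimes>z" using a(5) by (simp add: coset_pair_apply)
  thus "C = D \<and> y = z" using decompose_unique hn a(2,4) by blast
 qed
 hence "inv_into ((lcosets G')\<times>G') (coset_pair G M) (coset_pair G M (h <# G', y)) = (h <# G', y)"
  using assms by (intro inv_into_f_f) auto
 thus ?thesis using assms by (simp add: coset_pair_apply)
qed

lemma induced_eq:
 assumes N2: "N2 = (\<lambda>z. \<lambda>y\<in>G'. y\<otimes>inv z) ` G'"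
 shows "induced_subgroup G M G' (eta ` M) N2 = Ind"
proof -
 have *: "(\<lambda>g\<in>cG. coset_pair G M (map_prod (eta m) (\<lambda>y\<in>G'. y\<otimes>inv z) (inv_into ((lcosets G')\<times>G') (coset_pair G M) g)))
   = iot m z" if mz: "m\<in>M" "z\<in>G'" for m z
 proof
  fix g
  show "(\<lambda>g\<in>cG. coset_pair G M (map_prod (eta m) (\<lambda>y\<in>G'. y\<otimes>inv z) (inv_into ((lcosets G')\<times>G') (coset_pair G M) g))) g = iot m z g"
  proof (cases "g\<in>cG")
   case True
   then obtain h y where hy: "h\<in>M" "y\<in>G'" "g = h\<otimes>y" using decompose by blast
   thus ?thesis using mz by (simp add: inv_coset_pair coset_pair_apply iot_apply)
  qed (simp add: iot_def)
 qed
 show ?thesis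
 proof (intro subset_antisym subsetI)
  fix f assume "f\<in>induced_subgroup G M G' (eta ` M) N2"
  then obtain m z where mz: "m\<in>M" "z\<in>G'" "f = (\<lambda>g\<in>cG. coset_pair G M (map_prod (eta m) (\<lambda>y\<in>G'. y\<otimes>inv z) (inv_into ((lcosets G')\<times>G') (coset_pair G M) g)))"
   unfolding induced_subgroup_def N2 by blast
  thus "f\<in>Ind" unfolding mz(3) *[OF mz(1,2)] by (intro IndI)
 next
  fix f assume "f\<in>Ind"
  then obtain m z where mz: "m\<in>M" "z\<in>G'" "f = iot m z" by auto
  thus "f\<in>induced_subgroup G M G' (eta ` M) N2"
   unfolding induced_subgroup_def N2 mz(3) *[OF mz(1,2), symmetric] by blast
 qed
qed

text \<open>\<open>iot\<close> multiplies factor by factor, so the induced group is a direct product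
  although \<open>G\<close> itself need only be a semidirect product of \<open>M\<close> and
  \<open>G'\<close>.\<close>

lemma Ind_type:
 assumes fin: "finite cG" and G': "G' = {\<one>, u}" and t: "u ~= \<one>" "u\<otimes>u = \<one>" and p: "p\<in>iso H (G\<lparr>carrier := M\<rparr>)" and H: "group H"
 shows "perm_subgroup cG Ind \<cong> H \<times>\<times> integer_mod_group 2"
proof -
 let ?N = "perm_subgroup cG Ind"
 let ?MM = "(\<lambda>m. iot m \<one>) ` M"
 have N: "group ?N" using subgroup.subgroup_is_group[OF Ind_subgroup group_BijGroup] .
 have tG: "u\<in>G'" using G' by simp
 have finM: "finite M" using finite_subset[OF subgroup.subset[OF sM] fin] .
 have inj: "inj_on (\<lambda>m. iot m \<one>) M"
 proof (rule inj_onI)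
  show "m = n" if "m\<in>M" "n\<in>M" "iot m \<one> = iot n \<one>" for m n using iot_inj[of m n \<one> \<one>] that by simp
 qed
 have cM: "card ?MM = card M" by (rule card_image[OF inj])
 have "inj_on (\<lambda>(m, z). iot m z) (M\<times>G')" using iot_inj by (auto intro!: inj_onI)
 hence "card Ind = card (M\<times>G')" by (rule card_image)
 moreover have "card G' = 2" using G' t(1) by simp
 ultimately have cN: "order ?N = 2 * card ?MM" by (simp add: order_def cM card_cartesian_product)
 have im: "iot m z\<otimes>\<^bsub>?N\<^esub> iot n w = iot (m\<otimes>n) (z\<otimes>w)" if "m\<in>M" "n\<in>M" "z\<in>G'" "w\<in>G'" for m n z w
  using that by (simp add: iot_mult)
 have one: "\<one>\<^bsub>?N\<^esub> = iot \<one> \<one>"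
 proof -
  have "iot \<one> \<one>\<otimes>\<^bsub>?N\<^esub> iot \<one> \<one> = iot \<one> \<one>" using im[of \<one> \<one> \<one> \<one>] by simp
  thus ?thesis using group.r_cancel_one'[OF N, of "iot \<one> \<one>" "iot \<one> \<one>"] IndI[of \<one> \<one>] by simp
 qed
 have sMM: "subgroup ?MM ?N"
 proof (rule group.subgroupI[OF N])
  show "?MM \<subseteq> carrier ?N" using IndI by auto
  show "?MM ~= {}" using M_ops(3) by blast
  show "a\<otimes>\<^bsub>?N\<^esub> b\<in>?MM" if ab: "a\<in>?MM" "b\<in>?MM" for a b
  proof -
   obtain m n where "m\<in>M" "n\<in>M" "a = iot m \<one>" "b = iot n \<one>" using ab by blast
   thus ?thesis using im[of m n \<one> \<one>] by auto
  qed
  show "inv\<^bsub>?N\<^esub> a\<in>?MM" if a: "a\<in>?MM" for a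
  proof -
   obtain m where m: "m\<in>M" "a = iot m \<one>" using a by blast
   have "iot (inv m) \<one>\<otimes>\<^bsub>?N\<^esub> a = \<one>\<^bsub>?N\<^esub>" using m im[of "inv m" m \<one> \<one>] one by simp
   hence "inv\<^bsub>?N\<^esub> a = iot (inv m) \<one>" using group.inv_equality[OF N, of "iot (inv m) \<one>" a] m IndI by simp
   thus ?thesis using m by auto
  qed
 qed
 have "(\<lambda>m. iot m \<one>)\<in>iso (G\<lparr>carrier := M\<rparr>) (?N\<lparr>carrier := ?MM\<rparr>)"
  using inj im[of _ _ \<one> \<one>] by (intro isoI homI) (auto simp: bij_betw_def)
 hence iso: "(\<lambda>m. iot m \<one>) \<circ> p\<in>iso H (?N\<lparr>carrier := ?MM\<rparr>)" by (rule iso_set_trans[OF p])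
 have "H \<times>\<times> integer_mod_group 2 \<cong> ?N"
 proof (rule iso_alt5_times_C2[OF N H sMM iso cN, where c="iot \<one> u"])
  have "M ~= {}" using M_ops(3) by blast
  thus "0 < card ?MM" using finM by (simp add: cM card_gt_0_iff)
  show "iot \<one> u\<in>carrier ?N" using IndI[OF M_ops(3) tG] by simp
  show "iot \<one> u \<notin> ?MM" using iot_inj[of \<one> _ u \<one>] t(1) tG by auto
  show "iot \<one> u\<otimes>\<^bsub>?N\<^esub> iot \<one> u = \<one>\<^bsub>?N\<^esub>" using im[of \<one> \<one> u u] t tG one by simp
  show "iot \<one> u\<otimes>\<^bsub>?N\<^esub> a = a\<otimes>\<^bsub>?N\<^esub> iot \<one> u" if a: "a\<in>?MM" for a
  proof -
   obtain m where "m\<in>M" "a = iot m \<one>" using a by blast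
   thus ?thesis using im[of \<one> m u \<one>] im[of m \<one> \<one> u] tG by simp
  qed
 qed
 thus ?thesis by (intro group.iso_sym[OF DirProd_group[OF H group_integer_mod_group]])
qed

end

section \<open>Artin's theorem on fixed fields\<close>

context field_auts
begin

lemma trivial_descent: "hopf_descent K \<Gamma> GG (\<lambda>g w. w) (\<lambda>g. g) (\<lambda>g. g)"
 by (intro hopf_descent.intro hopf_descent_axioms.intro field_auts_axioms GG.is_group) (simp_all add: fin)

lemma trivial_L: "hopf_descent.L K \<Gamma> GG (\<lambda>g. g) = cK"
 unfolding hopf_descent.L_def[OF trivial_descent] hopf_descent.\<Gamma>'_def[OF trivial_descent]
 by (auto simp: fixed_field_def)

text \<open>An automorphism \<open>u\<close> over the fixed field is a combination of elements of
  \<open>\<Gamma>\<close> with coefficients \<open>c v\<close>. Multiplicativity of \<open>u\<close>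
  and independence give \<open>u y \<otimes> c v = v y \<otimes> c v\<close> for all
  \<open>y\<close>, so \<open>u\<close> equals any \<open>v\<close> with nonzero
  coefficient.\<close>

lemma galois_group_fixed: "carrier (galois_group K (fixed_field K \<Gamma>)) = \<Gamma>"
proof (intro subset_antisym subsetI)
 fix u assume "u\<in>carrier (galois_group K (fixed_field K \<Gamma>))"
 hence s: "u\<in>Bij cK" "u\<in>ring_hom K K" "!!x. x\<in>fixed_field K \<Gamma> ==> u x = x"
  by (auto simp: galois_group_def)
 note sc = ring_hom_closed[OF s(2)]
 have lin: "hopf_descent.linL K \<Gamma> GG (\<lambda>g. g) u"
  unfolding hopf_descent.linL_def[OF trivial_descent] trivial_L
  using sc ring_hom_add[OF s(2)] ring_hom_mult[OF s(2)] s(3) fixed_closed by auto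
 define c where "c = hopf_descent.cg K \<Gamma> GG (\<lambda>g. g) u"
 have c: "c v\<in>cK" if "v\<in>\<Gamma>" for v unfolding c_def by (rule hopf_descent.cg_closed[OF trivial_descent lin that])
 have ex: "u x = (\<Oplus>v\<in>\<Gamma>. v x\<otimes>c v)" if "x\<in>cK" for x
  using hopf_descent.linL_expand[OF trivial_descent lin, of x] that unfolding c_def trivial_L by simp
 have eq: "u y\<otimes>c v = v y\<otimes>c v" if y: "y\<in>cK" and v: "v\<in>\<Gamma>" for y v
 proof (rule hopf_descent.coeff_unique[OF trivial_descent, where c="\<lambda>v. u y\<otimes>c v" and d="\<lambda>v. v y\<otimes>c v"])
  fix x assume "x\<in>hopf_descent.L K \<Gamma> GG (\<lambda>g. g)"
  hence x: "x\<in>cK" unfolding trivial_L .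
  have "(\<Oplus>v\<in>\<Gamma>. u y\<otimes>c v\<otimes>v x) = u y\<otimes>u x"
   unfolding ex[OF x] using c sc[OF y] x fin by (subst fs_rdistr) (auto simp: m_ac intro!: fs_cong)
  also have "... = (\<Oplus>v\<in>\<Gamma>. v y\<otimes>c v\<otimes>v x)"
   unfolding ring_hom_mult[OF s(2) y x, symmetric] ex[OF m_closed[OF y x]]
   using c x y by (intro fs_cong) (auto simp: aut_mult m_ac)
  finally show "(\<Oplus>v\<in>carrier GG. u y\<otimes>c v\<otimes>v x) = (\<Oplus>v\<in>carrier GG. v y\<otimes>c v\<otimes>v x)" by simp
 qed (use c sc y v in auto)
 have "\<exists>v\<in>\<Gamma>. c v ~= \<zero>"
 proof (rule ccontr)
  assume "\<not> ?thesis"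
  hence "u \<one> = \<zero>" unfolding ex[OF one_closed] by (intro fs_zero) auto
  thus False using ring_hom_one[OF s(2)] by simp
 qed
 then obtain v where t: "v\<in>\<Gamma>" "c v ~= \<zero>" by blast
 have "u y = v y" if "y\<in>cK" for y
  using eq[OF that t(1)] c[OF t(1)] t sc[OF that] that by (simp add: m_rcancel)
 thus "u\<in>\<Gamma>" using Bij_ext[OF s(1) G_Bij[OF t(1)]] t(1) by simp
qed (use G_Bij hom fixedD in \<open>auto simp: galois_group_def\<close>)

lemma galois_extension_fixed: "galois_extension K (fixed_field K \<Gamma>)"
proof -
 have "finite_field_extension K (fixed_field K \<Gamma>) cK"
  using hopf_descent.finite_extension_L[OF trivial_descent] unfolding trivial_L .
 thus ?thesis by (simp add: galois_extension_def galois_group_fixed)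
qed

end

lemma (in galois_setting) quadratic_unique:
 assumes "carrier G = {\<one>\<^bsub>G\<^esub>, t}" "t ~= \<one>\<^bsub>G\<^esub>" "hopf_galois_structure K k (carrier K) S"
 shows "hopf_galois_isomorphic K k (carrier K) S (gp_structure K k (rho ` carrier G))"
proof -
 obtain H \<mu> where S: "S = (H, \<mu>)" by (cases S)
 interpret U: hopf_galois_on K k H \<mu> using assms(3) unfolding S by unfold_locales
 have "hopf_galois_isomorphic K k (carrier K) (H, \<mu>) (classical_structure K k)"
  using U.classical_isomorphic U.quadratic_coeffs[OF assms(1,2)] by blast
 thus ?thesis
  using classical_isomorphic_rho hopf_galois_isomorphic_trans[of K k "carrier K" H \<mu>
   "fst (classical_structure K k)" "snd (classical_structure K k)"
   "fst (gp_structure K k (rho ` carrier G))" "snd (gp_structure K k (rho ` carrier G))"]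
  unfolding S by simp
qed

context galois_setting
begin

lemma has_type_gp:
 assumes "gp_subgroup G cG (left_translation G) N" "perm_subgroup cG N \<cong> T"
 shows "has_type K k (gp_structure K k N) T"
proof -
 have "hopf_galois_isomorphic K k cK (gp_structure K k N) (gp_structure K k N)"
  using hopf_galois_isomorphic_refl[of K k "cK" "fst (gp_structure K k N)" "snd (gp_structure K k N)"] by simp
 thus ?thesis using assms unfolding has_type_def Let_def by blast
qed

lemma has_type_classical:
 assumes "G \<cong> T" shows "has_type K k (classical_structure K k) T"
proof -
 have "perm_subgroup cG (rho ` cG) \<cong> T"
  using iso_trans[OF G.iso_sym[OF is_isoI[OF rho_iso]] assms]
   group.iso_sym[OF group_G is_isoI[OF rho_iso]] iso_trans assms by blast
 thus ?thesis using rho_gp classical_isomorphic_rho unfolding has_type_def Let_def by blast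
qed

lemma rho_type: "G \<cong> T ==> perm_subgroup cG (rho ` cG) \<cong> T"
 using group.iso_sym[OF group_G is_isoI[OF rho_iso]] iso_trans by blast

lemma type_occurs_gp:
 assumes "gp_subgroup G cG (left_translation G) N" "perm_subgroup cG N \<cong> T"
 shows "type_occurs K k T"
 unfolding type_occurs_def using gp_structure_hopf_galois[OF assms(1)] has_type_gp[OF assms] by blast

lemma type_occursD:
 assumes "type_occurs K k T"
 shows "\<exists>N. gp_subgroup G cG (left_translation G) N \<and> perm_subgroup cG N \<cong> T"
 using assms unfolding type_occurs_def has_type_def Let_def by blast

end

section \<open>Extensions with the symmetric group of degree five\<close>

locale sym5_setting = galois_setting K k for K (structure) and k +
 fixes \<phi> :: "('a => 'a) => nat => nat" and \<tau> :: "'a => 'a" and a b :: nat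
 assumes phi: "\<phi>\<in>iso G (sym_group 5)"
  and tau: "\<tau>\<in>carrier G" "a\<in>{1..5}" "b\<in>{1..5}" "a ~= b" "\<phi> \<tau> = transpose a b"
begin

sublocale phi: group_hom G "sym_group 5" \<phi>
 using phi by (intro group_hom.intro group_hom_axioms.intro group_G sym_group_is_group) (simp add: iso_def)

lemma phi_inj: "g\<in>cG ==> h\<in>cG ==> \<phi> g = \<phi> h \<longleftrightarrow> g = h"
 using phi by (auto simp: iso_def bij_betw_def inj_on_def)

lemma phi_one: "\<phi> \<one>\<^bsub>G\<^esub> = id" using phi.hom_one by (simp add: sym_group_one)

lemma tau2: "\<tau>\<otimes>\<^bsub>G\<^esub> \<tau> = \<one>\<^bsub>G\<^esub>"
 using phi_inj[of "\<tau>\<otimes>\<^bsub>G\<^esub> \<tau>" "\<one>\<^bsub>G\<^esub>"] tau by (simp add: sym_group_mult sym_group_one)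

lemma tau1: "\<tau> ~= \<one>\<^bsub>G\<^esub>"
proof
 assume "\<tau> = \<one>\<^bsub>G\<^esub>"
 hence "transpose a b a = a" using tau(5) phi_one by simp
 thus False using tau(4) by simp
qed

abbreviation "T2 \<equiv> {\<one>\<^bsub>G\<^esub>, \<tau>}"

lemma T2_subgroup: "subgroup T2 G"
proof (rule G.subgroupI)
 have "inv\<^bsub>G\<^esub> \<tau> = \<tau>" using G.inv_equality[OF tau2 tau(1) tau(1)] .
 thus "inv\<^bsub>G\<^esub> x\<in>T2" if "x\<in>T2" for x using that by auto
qed (use tau tau2 in auto)

lemma generate_tau: "generate G {\<tau>} = T2"
proof (intro subset_antisym)
 show "generate G {\<tau>} \<subseteq> T2" by (rule G.generate_subgroup_incl[OF _ T2_subgroup]) simp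
 show "T2 \<subseteq> generate G {\<tau>}" using generate.one[of G "{\<tau>}"] generate.incl[of \<tau> "{\<tau>}" G] by simp
qed

definition "FF = fixed_field K T2"

sublocale T: field_auts K T2
proof (intro field_auts.intro field_auts_axioms.intro K_field)
 show "subgroup T2 (BijGroup cK)"
  using group.incl_subgroup[OF group_BijGroup sub, of T2] T2_subgroup unfolding galois_group_eq by blast
 show "\<sigma>\<in>ring_hom K K" if "\<sigma>\<in>T2" for \<sigma> using that tau(1) hom by auto
qed simp

text \<open>By Artin's theorem no automorphism outside the group of order two fixes its fixed
  field.\<close>

lemma gal_FF: "galois_group K FF = G\<lparr>carrier := T2\<rparr>"
proof -
 have "carrier (galois_group K FF) = T2" unfolding FF_def by (rule T.galois_group_fixed)
 thus ?thesis unfolding galois_group_def by simp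
qed

sublocale Q: galois_setting K FF
proof
 show "galois_extension K FF" unfolding FF_def by (rule T.galois_extension_fixed)
 show "finite (carrier (galois_group K FF))" by (simp add: gal_FF)
qed

definition "MM = {g\<in>cG. \<phi> g\<in>carrier (alt_group 5)}"

lemma phi_closed: "g\<in>cG ==> \<phi> g permutes {1..5}"
 using phi.hom_closed by (simp add: sym_group_carrier)

text \<open>Parity decides: an odd element becomes even after multiplication by
  \<open>\<tau>\<close>, and \<open>\<tau>\<close> itself is odd.\<close>

lemma complement: "normal_complement G T2 MM"
 unfolding normal_complement_def
proof (intro conjI T2_subgroup)
 have "group_hom (sym_group 5) sign_img sign"
  using sign_is_hom by (intro group_hom.intro group_hom_axioms.intro sym_group_is_group sign_img_is_group)
 hence s: "group_hom G sign_img (sign \<circ> \<phi>)"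
  using Group.hom_compose[OF phi.homh] by (intro group_hom.intro group_hom_axioms.intro group_G) (auto simp: group_hom_def group_hom_axioms_def)
 have "MM = kernel G sign_img (sign \<circ> \<phi>)"
  unfolding MM_def alt_group_is_sign_kernel using phi.hom_closed by (auto simp: kernel_def)
 thus "MM \<lhd> G" using group_hom.normal_kernel[OF s] by simp
 have tM: "\<tau> \<notin> MM" using tau by (simp add: MM_def alt_group_carrier evenperm_swap)
 have oM: "\<one>\<^bsub>G\<^esub>\<in>MM" by (simp add: MM_def sym_group_one alt_group_carrier permutes_id)
 show "MM \<inter> T2 = {\<one>\<^bsub>G\<^esub>}" using tM oM by auto
 show "MM <#>\<^bsub>G\<^esub> T2 = cG"
 proof (intro subset_antisym subsetI)
  fix g assume "g\<in>MM <#>\<^bsub>G\<^esub> T2"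
  thus "g\<in>cG" using tau(1) by (auto simp: set_mult_def MM_def)
 next
  fix g assume g: "g\<in>cG"
  have "\<exists>h\<in>MM. \<exists>y\<in>T2. g = h\<otimes>\<^bsub>G\<^esub> y"
  proof (cases "g\<in>MM")
   case True
   thus ?thesis using g by (intro bexI[of _ g] bexI[of _ "\<one>\<^bsub>G\<^esub>"]) auto
  next
   case False
   have p: "permutation (\<phi> g)" "permutation (transpose a b)"
    using phi_closed[OF g] permutation_permutes by (auto simp: permutation_swap_id)
   have "\<not> evenperm (\<phi> g)" using False g phi_closed[OF g] by (simp add: MM_def alt_group_carrier)
   hence "evenperm (\<phi> (g\<otimes>\<^bsub>G\<^esub> \<tau>))"
    using g tau p by (simp add: sym_group_mult evenperm_comp evenperm_swap)
   hence "g\<otimes>\<^bsub>G\<^esub> \<tau>\<in>MM" using g tau(1) phi_closed[of "g\<otimes>\<^bsub>G\<^esub> \<tau>"] by (simp add: MM_def alt_group_carrier)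
   moreover have "g = (g\<otimes>\<^bsub>G\<^esub> \<tau>)\<otimes>\<^bsub>G\<^esub> \<tau>" using g tau(1) tau2 by (simp add: G.m_assoc)
   ultimately show ?thesis by (intro bexI[of _ "g\<otimes>\<^bsub>G\<^esub> \<tau>"] bexI[of _ \<tau>]) auto
  qed
  thus "g\<in>MM <#>\<^bsub>G\<^esub> T2" unfolding set_mult_def by blast
 qed
qed

lemma MM_iso: "\<exists>\<psi>. \<psi>\<in>iso (alt_group 5) (G\<lparr>carrier := MM\<rparr>)"
proof -
 have "\<phi> ` MM = carrier (alt_group 5)"
 proof (intro subset_antisym subsetI)
  fix p assume p: "p\<in>carrier (alt_group 5)"
  hence ps: "p\<in>carrier (sym_group 5)" by (simp add: alt_group_carrier sym_group_carrier)
  have im: "\<phi> ` cG = carrier (sym_group 5)" using phi by (simp add: iso_def bij_betw_def)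
  have "p\<in>\<phi> ` cG" unfolding im by (rule ps)
  then obtain g where g: "g\<in>cG" "p = \<phi> g" by (rule imageE)
  hence "g\<in>MM" using p by (simp add: MM_def)
  thus "p\<in>\<phi> ` MM" unfolding g(2) by (rule imageI)
 qed (auto simp: MM_def)
 hence "\<phi>\<in>iso (G\<lparr>carrier := MM\<rparr>) (alt_group 5)"
  by (intro isoI homI) (auto simp: bij_betw_def inj_on_def phi_inj sym_group_mult alt_group_mult MM_def)
 thus ?thesis
  using group.iso_set_sym[OF subgroup.subgroup_is_group[OF normal_imp_subgroup[OF conjunct1[OF conjunct2[OF complement[unfolded normal_complement_def]]]] group_G]] by blast
qed

sublocale X: group_complement G T2 MM
 by (intro group_complement.intro group_complement_axioms.intro group_G complement)

lemma rho_FF: "Q.rho ` carrier (galois_group K FF) = (\<lambda>z. \<lambda>y\<in>T2. y\<otimes>\<^bsub>G\<^esub> inv\<^bsub>G\<^esub> z) ` T2"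
proof -
 have "Q.rho z = (\<lambda>y\<in>T2. y\<otimes>\<^bsub>G\<^esub> inv\<^bsub>G\<^esub> z)" if "z\<in>T2" for z
  unfolding Q.rho_def gal_FF using G.m_inv_consistent[OF T2_subgroup that] by simp
 thus ?thesis unfolding gal_FF by (simp add: image_def)
qed

abbreviation "N1 \<equiv> almost_classical_subgroup G T2 MM"
abbreviation "N2 \<equiv> Q.rho ` carrier (galois_group K FF)"

lemma N1_gp: "gp_subgroup G (lcosets\<^bsub>G\<^esub> T2) (coset_translation G T2) N1"
 unfolding X.almost_classical_eq by (rule X.almost_classical_gp)

lemma induced_Ind: "induced_subgroup G MM T2 N1 N2 = X.Ind"
 unfolding X.almost_classical_eq by (rule X.induced_eq[OF rho_FF])

lemma induced_gp: "gp_subgroup G cG (left_translation G) (induced_subgroup G MM T2 N1 N2)"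
 unfolding induced_Ind by (rule X.Ind_gp)

lemma induced_type: "perm_subgroup cG (induced_subgroup G MM T2 N1 N2) \<cong> alt_group 5 \<times>\<times> integer_mod_group 2"
proof -
 obtain \<psi> where "\<psi>\<in>iso (alt_group 5) (G\<lparr>carrier := MM\<rparr>)" using MM_iso by blast
 from X.Ind_type[OF finG refl tau1 tau2 this alt_group_is_group] show ?thesis unfolding induced_Ind .
qed

lemma N1_hopf_galois: "hopf_galois_structure K k FF (gp_coset_structure K k T2 N1)"
 unfolding FF_def by (rule gp_coset_structure_hopf_galois[OF T2_subgroup N1_gp])

lemma N2_unique:
 "hopf_galois_structure K FF cK S ==> hopf_galois_isomorphic K FF cK S (gp_structure K FF N2)"
 using Q.quadratic_unique[of \<tau> S] tau1 by (simp add: gal_FF)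

end

lemma sym5_finite:
 assumes "G \<cong> sym_group 5" shows "finite (carrier G)"
proof -
 have "finite (carrier (sym_group 5))" by (simp add: sym_group_def finite_permutations)
 thus ?thesis using assms bij_betw_finite by (auto simp: is_iso_def iso_def)
qed

lemma sym5_induced_structure:
 fixes K :: "('a, 'm) ring_scheme" and k :: "'a set"
 assumes galois: "galois_extension K k" and \<phi>: "\<phi>\<in>iso (galois_group K k) (sym_group 5)"
  and \<tau>: "\<tau>\<in>carrier (galois_group K k)"
  and ab: "a\<in>{1..5}" "b\<in>{1..5}" "a ~= b" "\<phi> \<tau> = transpose a b"
  and G: "G = galois_group K k" and F: "F = fixed_field K (generate G {\<tau>})" and G': "G' = carrier (galois_group K F)"
 shows "\<exists>M N1 N2.
       normal_complement G G' M \<and>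
       N1 = almost_classical_subgroup G G' M \<and>
       gp_subgroup G (lcosets\<^bsub>G\<^esub> G') (coset_translation G G') N1 \<and>
       hopf_galois_structure K k F (gp_coset_structure K k G' N1) \<and>
       gp_subgroup (galois_group K F) G' (left_translation (galois_group K F)) N2 \<and>
       hopf_galois_structure K F (carrier K) (gp_structure K F N2) \<and>
       (\<forall>S :: ('a, 'h) hopf\<times>('h => 'a => 'a).
        hopf_galois_structure K F (carrier K) S \<longrightarrow>
        hopf_galois_isomorphic K F (carrier K) S (gp_structure K F N2)) \<and>
       gp_subgroup G (carrier G) (left_translation G) (induced_subgroup G M G' N1 N2) \<and>
       hopf_galois_structure K k (carrier K)
        (gp_structure K k (induced_subgroup G M G' N1 N2)) \<and>
       has_type K k (gp_structure K k (induced_subgroup G M G' N1 N2))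
        (alt_group 5 \<times>\<times> integer_mod_group 2)"
proof -
 interpret Z: sym5_setting K k \<phi> \<tau> a b
  by (intro sym5_setting.intro galois_setting.intro galois sym5_finite is_isoI[OF \<phi>] sym5_setting_axioms.intro \<phi> \<tau> ab)
 have F': "F = Z.FF" unfolding F G Z.FF_def Z.generate_tau ..
 have c: "carrier (galois_group K Z.FF) = Z.T2" by (simp add: Z.gal_FF)
 have G'': "G' = Z.T2" unfolding G' F' c ..
 have g2: "gp_subgroup (galois_group K Z.FF) Z.T2 (left_translation (galois_group K Z.FF)) Z.N2"
  using Z.Q.rho_gp unfolding c .
 show ?thesis unfolding G'' F' G
  by (rule exI[of _ Z.MM], rule exI[of _ Z.N1], rule exI[of _ Z.N2], intro conjI allI impI)
   (assumption | rule Z.complement refl Z.N1_gp Z.N1_hopf_galois g2 Z.Q.gp_structure_hopf_galois[OF Z.Q.rho_gp] Z.N2_unique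
    Z.induced_gp Z.gp_structure_hopf_galois[OF Z.induced_gp] Z.has_type_gp[OF Z.induced_gp Z.induced_type])+
qed

text \<open>Any transposition serves for the existence of the type; here it is the one of 1 and 2,
  pulled back along an isomorphism.\<close>

lemma sym5_type_occurs:
 fixes K :: "('a, 'm) ring_scheme" and T :: "('t, 'n) monoid_scheme"
 assumes gs: "galois_setting K k" and S5: "galois_group K k \<cong> sym_group 5"
  and T: "alt_group 5 \<times>\<times> integer_mod_group 2 \<cong> T"
 shows "type_occurs K k T"
proof -
 let ?G = "galois_group K k"
 obtain \<phi> where \<phi>: "\<phi>\<in>iso ?G (sym_group 5)" using S5 by (auto simp: is_iso_def)
 have "transpose 1 2\<in>carrier (sym_group 5)" by (auto simp: sym_group_carrier intro!: permutes_swap_id)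
 moreover have "\<phi> ` carrier ?G = carrier (sym_group 5)" using \<phi> by (simp add: iso_def bij_betw_def)
 ultimately have "transpose 1 2\<in>\<phi> ` carrier ?G" by simp
 then obtain \<tau> where \<tau>: "\<tau>\<in>carrier ?G" "\<phi> \<tau> = transpose 1 2" by auto
 interpret Z: sym5_setting K k \<phi> \<tau> 1 2
  by (intro sym5_setting.intro gs sym5_setting_axioms.intro \<phi> \<tau>) auto
 have "perm_subgroup (carrier ?G) (induced_subgroup ?G Z.MM Z.T2 Z.N1 Z.N2) \<cong> T"
  using Z.induced_type T by (rule iso_trans)
 thus ?thesis by (rule Z.type_occurs_gp[OF Z.induced_gp])
qed

theorem proposition5:
  fixes K :: "('a, 'm) ring_scheme" and k :: "'a set"
  assumes galois: "galois_extension K k"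
  shows
    "(galois_group K k \<cong> alt_group 5 \<longrightarrow>
        (\<forall>T :: 't monoid. group T \<longrightarrow> (type_occurs K k T \<longleftrightarrow> T \<cong> alt_group 5)) \<and>
        hopf_galois_structure K k (carrier K) (classical_structure K k) \<and>
        has_type K k (classical_structure K k) (alt_group 5))
     \<and>
     (galois_group K k \<cong> sym_group 5 \<longrightarrow>
        (\<forall>T :: 't monoid. group T \<longrightarrow>
           (type_occurs K k T \<longleftrightarrow>
              T \<cong> sym_group 5 \<or> T \<cong> alt_group 5 \<times>\<times> integer_mod_group 2)) \<and>
        hopf_galois_structure K k (carrier K) (classical_structure K k) \<and>
        has_type K k (classical_structure K k) (sym_group 5) \<and>
        (\<forall>\<phi> \<in> iso (galois_group K k) (sym_group 5). \<forall>\<tau> \<in> carrier (galois_group K k). \<forall>G F G'.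
           (\<exists>a\<in>{1..5}. \<exists>b\<in>{1..5}. a \<noteq> b \<and> \<phi> \<tau> = Transposition.transpose a b) \<and>
           G = galois_group K k \<and>
           F = fixed_field K (generate G {\<tau>}) \<and>
           G' = carrier (galois_group K F) \<longrightarrow>
           (\<exists>M N1 N2.
              normal_complement G G' M \<and>
              N1 = almost_classical_subgroup G G' M \<and>
              gp_subgroup G (lcosets\<^bsub>G\<^esub> G') (coset_translation G G') N1 \<and>
              hopf_galois_structure K k F (gp_coset_structure K k G' N1) \<and>
              gp_subgroup (galois_group K F) G' (left_translation (galois_group K F)) N2 \<and>
              hopf_galois_structure K F (carrier K) (gp_structure K F N2) \<and>
              (\<forall>S :: ('a, 'h) hopf \<times> ('h \<Rightarrow> 'a \<Rightarrow> 'a).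
                 hopf_galois_structure K F (carrier K) S \<longrightarrow>
                 hopf_galois_isomorphic K F (carrier K) S (gp_structure K F N2)) \<and>
              gp_subgroup G (carrier G) (left_translation G) (induced_subgroup G M G' N1 N2) \<and>
              hopf_galois_structure K k (carrier K)
                (gp_structure K k (induced_subgroup G M G' N1 N2)) \<and>
              has_type K k (gp_structure K k (induced_subgroup G M G' N1 N2))
                (alt_group 5 \<times>\<times> integer_mod_group 2))))"
proof (intro conjI impI)
 let ?G = "galois_group K k"
 assume A5: "?G \<cong> alt_group 5"
 have fin: "finite (carrier ?G)"
 proof -
  have "card (carrier (alt_group 5)) = 60" using alt5_order by (simp add: order_def)
  hence "finite (carrier (alt_group 5))" by (intro card_ge_0_finite) simp
  thus ?thesis using A5 bij_betw_finite by (auto simp: is_iso_def iso_def)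
 qed
 interpret galois_setting K k by (intro galois_setting.intro galois fin)
 show "hopf_galois_structure K k (carrier K) (classical_structure K k)" by (rule classical_hopf_galois)
 show "has_type K k (classical_structure K k) (alt_group 5)" by (rule has_type_classical[OF A5])
 show "\<forall>T :: 't monoid. group T \<longrightarrow> (type_occurs K k T \<longleftrightarrow> T \<cong> alt_group 5)"
 proof (intro allI impI iffI)
  fix T :: "'t monoid" assume T: "group T"
  {
   assume "type_occurs K k T"
   then obtain N where N: "gp_subgroup ?G (carrier ?G) (left_translation ?G) N" "perm_subgroup (carrier ?G) N \<cong> T"
    using type_occursD by blast
   have "group (perm_subgroup (carrier ?G) N)" using N(1) group_perm_subgroup by (auto simp: gp_subgroup_def)
   hence "T \<cong> perm_subgroup (carrier ?G) N" using N(2) by (rule group.iso_sym)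
   thus "T \<cong> alt_group 5" using gp_subgroup_alt5[OF group_G A5 N(1)] by (rule iso_trans)
  next
   assume "T \<cong> alt_group 5"
   hence "?G \<cong> T" using iso_trans[OF A5 group.iso_sym[OF T]] by blast
   \<comment> \<open>The right translations realise every group isomorphic to the Galois
     group.\<close>
   thus "type_occurs K k T" by (rule type_occurs_gp[OF rho_gp rho_type])
  }
 qed
next
 let ?G = "galois_group K k"
 assume S5: "?G \<cong> sym_group 5"
 interpret galois_setting K k by (intro galois_setting.intro galois sym5_finite[OF S5])
 show "hopf_galois_structure K k (carrier K) (classical_structure K k)" by (rule classical_hopf_galois)
 show "has_type K k (classical_structure K k) (sym_group 5)" by (rule has_type_classical[OF S5])
 show "\<forall>T :: 't monoid. group T \<longrightarrow>
   (type_occurs K k T \<longleftrightarrow> T \<cong> sym_group 5 \<or> T \<cong> alt_group 5 \<times>\<times> integer_mod_group 2)"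
 proof (intro allI impI iffI)
  fix T :: "'t monoid" assume T: "group T"
  {
   assume "type_occurs K k T"
   then obtain N where N: "gp_subgroup ?G (carrier ?G) (left_translation ?G) N" "perm_subgroup (carrier ?G) N \<cong> T"
    using type_occursD by blast
   have "group (perm_subgroup (carrier ?G) N)" using N(1) group_perm_subgroup by (auto simp: gp_subgroup_def)
   hence "T \<cong> perm_subgroup (carrier ?G) N" using N(2) by (rule group.iso_sym)
   note TN = this
   from gp_subgroup_sym5[OF group_G S5 N(1)] show "T \<cong> sym_group 5 \<or> T \<cong> alt_group 5 \<times>\<times> integer_mod_group 2"
   proof
    assume "perm_subgroup (carrier ?G) N \<cong> sym_group 5"
    thus ?thesis by (intro disjI1 iso_trans[OF TN])
   next
    assume "perm_subgroup (carrier ?G) N \<cong> alt_group 5 \<times>\<times> integer_mod_group 2"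
    thus ?thesis by (intro disjI2 iso_trans[OF TN])
   qed
  next
   assume "T \<cong> sym_group 5 \<or> T \<cong> alt_group 5 \<times>\<times> integer_mod_group 2"
   thus "type_occurs K k T"
   proof
    assume "T \<cong> sym_group 5"
    hence "?G \<cong> T" using iso_trans[OF S5 group.iso_sym[OF T]] by blast
    thus ?thesis by (rule type_occurs_gp[OF rho_gp rho_type])
   next
    assume T': "T \<cong> alt_group 5 \<times>\<times> integer_mod_group 2"
    show ?thesis by (rule sym5_type_occurs[OF galois_setting_axioms S5 group.iso_sym[OF T T']])
   qed
  }
 qed
qed (intro ballI allI impI, elim conjE bexE, rule sym5_induced_structure[OF galois])

end
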